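(* Let $\mathsf{T}_x(y)$ be a binary predicate added to the language of $\mathsf{PA}$, and let $\mathsf{CT}^{\ast}$ be the sentence in the expanded language that says that for all $x$ the axioms of $\mathsf{CT}^-$ hold for $\mathsf{T}_x$. Then the theory $$\mathsf{PA}+\mathsf{CT}^{\ast}+\text{"}\forall x\ \mathsf{T}_x\text{ is disjunctively correct for disjunctions whose number of disjuncts is at most }x\text{"}$$ is conservative over $\mathsf{PA}$; i.e., every $\mathcal{L}_{\mathsf{PA}}$-sentence provable in this theory is provable in $\mathsf{PA}$.
   Context: $\mathsf{PA}$ is Peano Arithmetic in the language $\mathcal{L}_{\mathsf{PA}}=\{+,\cdot,\mathrm{S},0\}$; its induction scheme is only for $\mathcal{L}_{\mathsf{PA}}$-formulae (no induction for formulae mentioning the new predicate). Syntax (built from atomic formulae $s=t$ with $\neg,\vee,\exists$) is arithmetized in $\mathsf{PA}$ in a standard way. $s^{\circ}$ is the value of the closed term $s$; $\underline{x}$ is the numeral for $x$; $\varphi[\underline{x}/v]$ is the result of substituting $\underline{x}$ for $v$ in $\varphi$. $\mathsf{CT}^-$ is the finite list of axioms for a unary predicate $\mathsf{T}$ (with $s,t$ ranging over codes of closed $\mathcal{L}_{\mathsf{PA}}$-terms and $\sigma$'s over codes of $\mathcal{L}_{\mathsf{PA}}$-sentences): (0) $\mathsf{T}(x)\to x$ is an $\mathcal{L}_{\mathsf{PA}}$-sentence; (1) $\mathsf{T}(s=t)\leftrightarrow s^{\circ}=t^{\circ}$; (2) $\mathsf{T}(\neg\sigma)\leftrightarrow\neg\mathsf{T}(\sigma)$;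 (3) $\mathsf{T}(\sigma_1\vee\sigma_2)\leftrightarrow(\mathsf{T}(\sigma_1)\vee\mathsf{T}(\sigma_2))$; (4) for every formula $\varphi(v)$ with at most the one free variable $v$: $\mathsf{T}(\exists v\,\varphi)\leftrightarrow\exists x\,\mathsf{T}(\varphi[\underline{x}/v])$. A truth predicate $\mathsf{T}$ is disjunctively correct for disjunctions whose number of disjuncts is at most $x$ if for all $m\leq x$, every coded family $\{\varphi_i:i<m\}$ of $\mathcal{L}_{\mathsf{PA}}$-sentences, and every sentence $\delta$ that is the disjunction $\bigvee_{i<m}\varphi_i$ (with any grouping of the disjuncts): $\mathsf{T}(\delta)$ iff $\mathsf{T}(\varphi_i)$ for some $i<m$. *)

theory Defs
  imports Main
begin

section \<open>Formulas over the language of arithmetic with a binary predicate\<close>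

datatype tm =
    Var nat
  | Zero
  | Succ tm
  | Add tm tm (infixl "\<oplus>" 85)
  | Mul tm tm (infixl "\<otimes>" 90)

text \<open>\<open>Tr x y\<close> is the atomic formula \<open>T\<^sub>x(y)\<close>.\<close>

datatype fm =
    Eq tm tm (infix "\<doteq>" 75)
  | Tr tm tm
  | Neg fm ("\<^bold>\<not> _" [70] 70)
  | Or fm fm (infixr "\<^bold>\<or>" 60)
  | Ex nat fm

abbreviation And :: "fm \<Rightarrow> fm \<Rightarrow> fm" (infixr "\<^bold>\<and>" 65)
  where "A \<^bold>\<and> B \<equiv> Neg (Or (Neg A) (Neg B))"
abbreviation Imp :: "fm \<Rightarrow> fm \<Rightarrow> fm" (infixr "\<^bold>\<longrightarrow>" 55)
  where "A \<^bold>\<longrightarrow> B \<equiv> Or (Neg A) B"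
abbreviation Iff :: "fm \<Rightarrow> fm \<Rightarrow> fm" (infix "\<^bold>\<longleftrightarrow>" 53)
  where "A \<^bold>\<longleftrightarrow> B \<equiv> (A \<^bold>\<longrightarrow> B) \<^bold>\<and> (B \<^bold>\<longrightarrow> A)"
abbreviation All :: "nat \<Rightarrow> fm \<Rightarrow> fm"
  where "All v A \<equiv> Neg (Ex v (Neg A))"

primrec tvars :: "tm \<Rightarrow> nat set" where
  "tvars (Var v) = {v}"
| "tvars Zero = {}"
| "tvars (Succ t) = tvars t"
| "tvars (s \<oplus> t) = tvars s \<union> tvars t"
| "tvars (s \<otimes> t) = tvars s \<union> tvars t"

primrec fv :: "fm \<Rightarrow> nat set" where
  "fv (s \<doteq> t) = tvars s \<union> tvars t"
| "fv (Tr s t) = tvars s \<union> tvars t"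
| "fv (\<^bold>\<not> A) = fv A"
| "fv (A \<^bold>\<or> B) = fv A \<union> fv B"
| "fv (Ex v A) = fv A - {v}"

text \<open>The formulas that do not mention the additional predicate.\<close>

primrec arithmetical :: "fm \<Rightarrow> bool" where
  "arithmetical (s \<doteq> t) = True"
| "arithmetical (Tr s t) = False"
| "arithmetical (\<^bold>\<not> A) = arithmetical A"
| "arithmetical (A \<^bold>\<or> B) = (arithmetical A \<and> arithmetical B)"
| "arithmetical (Ex v A) = arithmetical A"

definition L_PA :: "fm set" where "L_PA = {A. arithmetical A}"
definition L_PAT :: "fm set" where "L_PAT = UNIV"

primrec tsubst :: "nat \<Rightarrow> tm \<Rightarrow> tm \<Rightarrow> tm" where
  "tsubst v r (Var u) = (if u = v then r else Var u)"
| "tsubst v r Zero = Zero"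
| "tsubst v r (Succ t) = Succ (tsubst v r t)"
| "tsubst v r (s \<oplus> t) = tsubst v r s \<oplus> tsubst v r t"
| "tsubst v r (s \<otimes> t) = tsubst v r s \<otimes> tsubst v r t"

text \<open>Replacement of the free occurrences of \<open>v\<close> by \<open>r\<close>, without renaming of bound variables.\<close>

primrec subst :: "nat \<Rightarrow> tm \<Rightarrow> fm \<Rightarrow> fm" where
  "subst v r (s \<doteq> t) = (tsubst v r s \<doteq> tsubst v r t)"
| "subst v r (Tr s t) = Tr (tsubst v r s) (tsubst v r t)"
| "subst v r (\<^bold>\<not> A) = \<^bold>\<not> subst v r A"
| "subst v r (A \<^bold>\<or> B) = subst v r A \<^bold>\<or> subst v r B"
| "subst v r (Ex u A) = Ex u (if u = v then A else subst v r A)"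

primrec free_for :: "tm \<Rightarrow> nat \<Rightarrow> fm \<Rightarrow> bool" where
  "free_for r v (s \<doteq> t) = True"
| "free_for r v (Tr s t) = True"
| "free_for r v (\<^bold>\<not> A) = free_for r v A"
| "free_for r v (A \<^bold>\<or> B) = (free_for r v A \<and> free_for r v B)"
| "free_for r v (Ex u A) = (v \<notin> fv (Ex u A) \<or> (u \<notin> tvars r \<and> free_for r v A))"


section \<open>Provability\<close>

text \<open>Shoenfield's calculus for first-order logic with equality, whose primitives are
  \<open>\<not>\<close>, \<open>\<or>\<close>, \<open>\<exists>\<close>. It proves the universal closure of whatever it proves, so a formula with
  free variables may serve as an axiom.\<close>

inductive_set logical_axioms :: "fm set" where
  propositional: "\<^bold>\<not> A \<^bold>\<or> A \<in> logical_axioms"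
| substitution: "free_for t v A \<Longrightarrow> subst v t A \<^bold>\<longrightarrow> Ex v A \<in> logical_axioms"
| identity: "t \<doteq> t \<in> logical_axioms"
| eq_Succ: "s \<doteq> t \<^bold>\<longrightarrow> Succ s \<doteq> Succ t \<in> logical_axioms"
| eq_Add: "s \<doteq> t \<^bold>\<longrightarrow> s' \<doteq> t' \<^bold>\<longrightarrow> s \<oplus> s' \<doteq> t \<oplus> t' \<in> logical_axioms"
| eq_Mul: "s \<doteq> t \<^bold>\<longrightarrow> s' \<doteq> t' \<^bold>\<longrightarrow> s \<otimes> s' \<doteq> t \<otimes> t' \<in> logical_axioms"
| eq_Eq: "s \<doteq> t \<^bold>\<longrightarrow> s' \<doteq> t' \<^bold>\<longrightarrow> s \<doteq> s' \<^bold>\<longrightarrow> t \<doteq> t' \<in> logical_axioms"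
| eq_Tr: "s \<doteq> t \<^bold>\<longrightarrow> s' \<doteq> t' \<^bold>\<longrightarrow> Tr s s' \<^bold>\<longrightarrow> Tr t t' \<in> logical_axioms"

text \<open>\<open>provable L \<Gamma> A\<close>: there is a proof of \<open>A\<close> from \<open>\<Gamma>\<close> all of whose lines belong to \<open>L\<close>.\<close>

inductive provable :: "fm set \<Rightarrow> fm set \<Rightarrow> fm \<Rightarrow> bool" for L \<Gamma> where
  logical: "A \<in> logical_axioms \<Longrightarrow> A \<in> L \<Longrightarrow> provable L \<Gamma> A"
| nonlogical: "A \<in> \<Gamma> \<Longrightarrow> A \<in> L \<Longrightarrow> provable L \<Gamma> A"
| expansion: "provable L \<Gamma> A \<Longrightarrow> B \<^bold>\<or> A \<in> L \<Longrightarrow> provable L \<Gamma> (B \<^bold>\<or> A)"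
| contraction: "provable L \<Gamma> (A \<^bold>\<or> A) \<Longrightarrow> A \<in> L \<Longrightarrow> provable L \<Gamma> A"
| associativity: "provable L \<Gamma> (A \<^bold>\<or> (B \<^bold>\<or> C)) \<Longrightarrow> (A \<^bold>\<or> B) \<^bold>\<or> C \<in> L
    \<Longrightarrow> provable L \<Gamma> ((A \<^bold>\<or> B) \<^bold>\<or> C)"
| cut: "provable L \<Gamma> (A \<^bold>\<or> B) \<Longrightarrow> provable L \<Gamma> (\<^bold>\<not> A \<^bold>\<or> C) \<Longrightarrow> B \<^bold>\<or> C \<in> L
    \<Longrightarrow> provable L \<Gamma> (B \<^bold>\<or> C)"
| ex_introduction: "provable L \<Gamma> (A \<^bold>\<longrightarrow> B) \<Longrightarrow> v \<notin> fv B \<Longrightarrow> Ex v A \<^bold>\<longrightarrow> B \<in> L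
    \<Longrightarrow> provable L \<Gamma> (Ex v A \<^bold>\<longrightarrow> B)"


section \<open>Peano Arithmetic\<close>

definition induction_axiom :: "nat \<Rightarrow> fm \<Rightarrow> fm" where
  "induction_axiom v A =
     subst v Zero A \<^bold>\<and> All v (A \<^bold>\<longrightarrow> subst v (Succ (Var v)) A) \<^bold>\<longrightarrow> All v A"

inductive_set PA :: "fm set" where
  Succ_nonzero: "\<^bold>\<not> Succ (Var 0) \<doteq> Zero \<in> PA"
| Succ_inject: "Succ (Var 0) \<doteq> Succ (Var 1) \<^bold>\<longrightarrow> Var 0 \<doteq> Var 1 \<in> PA"
| Add_Zero: "Var 0 \<oplus> Zero \<doteq> Var 0 \<in> PA"
| Add_Succ: "Var 0 \<oplus> Succ (Var 1) \<doteq> Succ (Var 0 \<oplus> Var 1) \<in> PA"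
| Mul_Zero: "Var 0 \<otimes> Zero \<doteq> Zero \<in> PA"
| Mul_Succ: "Var 0 \<otimes> Succ (Var 1) \<doteq> Var 0 \<otimes> Var 1 \<oplus> Var 0 \<in> PA"
| induction: "A \<in> L_PA \<Longrightarrow> induction_axiom v A \<in> PA"


section \<open>Writing object-language formulas\<close>

text \<open>Object-language quantifiers in higher-order abstract syntax. The bound variable exceeds
  every free variable of the body: \<open>F Zero\<close> shows all free variables other than the bound one, as
  the functions \<open>F\<close> used below only place their argument into a formula. An inner quantifier
  chooses its variable after the outer one has been put in, so there is no capture.\<close>

definition exq :: "(tm \<Rightarrow> fm) \<Rightarrow> fm" (binder "\<^bold>\<exists>" 10) where
  "exq F = (let v = Suc (Max (insert 0 (fv (F Zero)))) in Ex v (F (Var v)))"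

definition allq :: "(tm \<Rightarrow> fm) \<Rightarrow> fm" (binder "\<^bold>\<forall>" 10) where
  "allq F = (\<^bold>\<not> (\<^bold>\<exists>x. \<^bold>\<not> F x))"

definition le :: "tm \<Rightarrow> tm \<Rightarrow> fm" (infix "\<preceq>" 75) where
  "s \<preceq> t = (\<^bold>\<exists>z. s \<oplus> z \<doteq> t)"

definition lt :: "tm \<Rightarrow> tm \<Rightarrow> fm" (infix "\<prec>" 75) where
  "s \<prec> t = Succ s \<preceq> t"

primrec numeral_tm :: "nat \<Rightarrow> tm" where
  "numeral_tm 0 = Zero"
| "numeral_tm (Suc n) = Succ (numeral_tm n)"

text \<open>Goedel's beta function: \<open>beta a b i y\<close> says that \<open>y\<close> is the remainder of \<open>a\<close> modulo
  \<open>1 + (i + 1) b\<close>. The pair \<open>a\<close>, \<open>b\<close> codes the sequence \<open>i \<mapsto> y\<close>.\<close>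

definition beta :: "tm \<Rightarrow> tm \<Rightarrow> tm \<Rightarrow> tm \<Rightarrow> fm" where
  "beta a b i y =
     ((\<^bold>\<exists>q. q \<otimes> Succ (Succ i \<otimes> b) \<oplus> y \<doteq> a) \<^bold>\<and> y \<prec> Succ (Succ i \<otimes> b))"

text \<open>Pairing by the term \<open>(x + y)\<^sup>2 + x\<close>, which is injective but not onto.\<close>

definition pr :: "tm \<Rightarrow> tm \<Rightarrow> tm" where
  "pr s t = (s \<oplus> t) \<otimes> (s \<oplus> t) \<oplus> s"

text \<open>Arithmetized inductive definitions: \<open>x\<close> is the last entry of a coded sequence, each entry
  \<open>y\<close> of which satisfies \<open>R P y\<close> with \<open>P\<close> the property of being an earlier entry. With \<open>P\<close>
  occurring only positively in \<open>R P y\<close>, this is the least predicate closed under the clauses \<open>R\<close>.\<close>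

definition generated :: "((tm \<Rightarrow> fm) \<Rightarrow> tm \<Rightarrow> fm) \<Rightarrow> tm \<Rightarrow> fm" where
  "generated R x = (\<^bold>\<exists>a. \<^bold>\<exists>b. \<^bold>\<exists>n.
     (\<^bold>\<forall>i. i \<preceq> n \<^bold>\<longrightarrow>
        (\<^bold>\<exists>y. beta a b i y \<^bold>\<and> R (\<lambda>z. \<^bold>\<exists>j. j \<prec> i \<^bold>\<and> beta a b j z) y)) \<^bold>\<and>
     beta a b n x)"


section \<open>Arithmetized syntax of the language of arithmetic\<close>

text \<open>The codes of terms and formulas. The variable with index \<open>v\<close> is represented by \<open>v\<close> itself in
  \<open>exC v p\<close>, the code of the existential quantification over that variable.\<close>

definition varC :: "tm \<Rightarrow> tm" where "varC v = pr (numeral_tm 0) v"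
definition zeroC :: tm where "zeroC = pr (numeral_tm 1) Zero"
definition succC :: "tm \<Rightarrow> tm" where "succC s = pr (numeral_tm 2) s"
definition addC :: "tm \<Rightarrow> tm \<Rightarrow> tm" where "addC s t = pr (numeral_tm 3) (pr s t)"
definition mulC :: "tm \<Rightarrow> tm \<Rightarrow> tm" where "mulC s t = pr (numeral_tm 4) (pr s t)"
definition eqC :: "tm \<Rightarrow> tm \<Rightarrow> tm" where "eqC s t = pr (numeral_tm 5) (pr s t)"
definition negC :: "tm \<Rightarrow> tm" where "negC p = pr (numeral_tm 6) p"
definition orC :: "tm \<Rightarrow> tm \<Rightarrow> tm" where "orC p q = pr (numeral_tm 7) (pr p q)"
definition exC :: "tm \<Rightarrow> tm \<Rightarrow> tm" where "exC v p = pr (numeral_tm 8) (pr v p)"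

definition closed_tm_clauses :: "(tm \<Rightarrow> fm) \<Rightarrow> tm \<Rightarrow> fm" where
  "closed_tm_clauses P y =
     (y \<doteq> zeroC
      \<^bold>\<or> (\<^bold>\<exists>s. P s \<^bold>\<and> y \<doteq> succC s)
      \<^bold>\<or> (\<^bold>\<exists>s. \<^bold>\<exists>t. P s \<^bold>\<and> P t \<^bold>\<and> (y \<doteq> addC s t \<^bold>\<or> y \<doteq> mulC s t)))"

definition is_closed_term :: "tm \<Rightarrow> fm" where
  "is_closed_term = generated closed_tm_clauses"

definition is_term :: "tm \<Rightarrow> fm" where
  "is_term = generated (\<lambda>P y. (\<^bold>\<exists>v. y \<doteq> varC v) \<^bold>\<or> closed_tm_clauses P y)"

text \<open>\<open>x\<close> is a term in which the variable \<open>v\<close> does not occur.\<close>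

definition is_term_without :: "tm \<Rightarrow> tm \<Rightarrow> fm" where
  "is_term_without v =
     generated (\<lambda>P y. (\<^bold>\<exists>u. \<^bold>\<not> u \<doteq> v \<^bold>\<and> y \<doteq> varC u) \<^bold>\<or> closed_tm_clauses P y)"

definition is_formula :: "tm \<Rightarrow> fm" where
  "is_formula = generated (\<lambda>P y.
     (\<^bold>\<exists>s. \<^bold>\<exists>t. is_term s \<^bold>\<and> is_term t \<^bold>\<and> y \<doteq> eqC s t)
     \<^bold>\<or> (\<^bold>\<exists>p. P p \<^bold>\<and> y \<doteq> negC p)
     \<^bold>\<or> (\<^bold>\<exists>p. \<^bold>\<exists>q. P p \<^bold>\<and> P q \<^bold>\<and> y \<doteq> orC p q)
     \<^bold>\<or> (\<^bold>\<exists>u. \<^bold>\<exists>p. P p \<^bold>\<and> y \<doteq> exC u p))"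

text \<open>\<open>x\<close> is a formula in which the variable \<open>v\<close> does not occur free.\<close>

definition is_formula_without :: "tm \<Rightarrow> tm \<Rightarrow> fm" where
  "is_formula_without v = generated (\<lambda>P y.
     (\<^bold>\<exists>s. \<^bold>\<exists>t. is_term_without v s \<^bold>\<and> is_term_without v t \<^bold>\<and> y \<doteq> eqC s t)
     \<^bold>\<or> (\<^bold>\<exists>p. P p \<^bold>\<and> y \<doteq> negC p)
     \<^bold>\<or> (\<^bold>\<exists>p. \<^bold>\<exists>q. P p \<^bold>\<and> P q \<^bold>\<and> y \<doteq> orC p q)
     \<^bold>\<or> (\<^bold>\<exists>u. \<^bold>\<exists>p. P p \<^bold>\<and> y \<doteq> exC u p)
     \<^bold>\<or> (\<^bold>\<exists>p. is_formula p \<^bold>\<and> y \<doteq> exC v p))"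

definition is_sentence :: "tm \<Rightarrow> fm" where
  "is_sentence x = (is_formula x \<^bold>\<and> (\<^bold>\<forall>v. is_formula_without v x))"

text \<open>\<open>x\<close> is a formula with at most the free variable \<open>v\<close>.\<close>

definition is_formula_in :: "tm \<Rightarrow> tm \<Rightarrow> fm" where
  "is_formula_in v x =
     (is_formula x \<^bold>\<and> (\<^bold>\<forall>u. \<^bold>\<not> u \<doteq> v \<^bold>\<longrightarrow> is_formula_without u x))"

text \<open>\<open>y\<close> is the value of the closed term \<open>t\<close>.\<close>

definition is_value :: "tm \<Rightarrow> tm \<Rightarrow> fm" where
  "is_value t y = generated (\<lambda>P w.
     w \<doteq> pr zeroC Zero
     \<^bold>\<or> (\<^bold>\<exists>s. \<^bold>\<exists>m. P (pr s m) \<^bold>\<and> w \<doteq> pr (succC s) (Succ m))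
     \<^bold>\<or> (\<^bold>\<exists>s. \<^bold>\<exists>m. \<^bold>\<exists>s'. \<^bold>\<exists>m'. P (pr s m) \<^bold>\<and> P (pr s' m') \<^bold>\<and>
           (w \<doteq> pr (addC s s') (m \<oplus> m') \<^bold>\<or> w \<doteq> pr (mulC s s') (m \<otimes> m'))))
     (pr t y)"

text \<open>\<open>c\<close> is the numeral for \<open>x\<close>.\<close>

definition is_numeral :: "tm \<Rightarrow> tm \<Rightarrow> fm" where
  "is_numeral x c = generated (\<lambda>P w.
     w \<doteq> pr Zero zeroC \<^bold>\<or> (\<^bold>\<exists>m. \<^bold>\<exists>d. P (pr m d) \<^bold>\<and> w \<doteq> pr (Succ m) (succC d)))
     (pr x c)"

text \<open>\<open>t'\<close> results from the term \<open>t\<close> by replacing the variable \<open>v\<close> by the term \<open>c\<close>.\<close>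

definition is_term_subst :: "tm \<Rightarrow> tm \<Rightarrow> tm \<Rightarrow> tm \<Rightarrow> fm" where
  "is_term_subst v c t t' = generated (\<lambda>P w.
     w \<doteq> pr (varC v) c
     \<^bold>\<or> (\<^bold>\<exists>u. \<^bold>\<not> u \<doteq> v \<^bold>\<and> w \<doteq> pr (varC u) (varC u))
     \<^bold>\<or> w \<doteq> pr zeroC zeroC
     \<^bold>\<or> (\<^bold>\<exists>s. \<^bold>\<exists>s'. P (pr s s') \<^bold>\<and> w \<doteq> pr (succC s) (succC s'))
     \<^bold>\<or> (\<^bold>\<exists>r. \<^bold>\<exists>r'. \<^bold>\<exists>s. \<^bold>\<exists>s'. P (pr r r') \<^bold>\<and> P (pr s s') \<^bold>\<and>
           (w \<doteq> pr (addC r s) (addC r' s') \<^bold>\<or> w \<doteq> pr (mulC r s) (mulC r' s'))))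
     (pr t t')"

text \<open>\<open>p'\<close> results from the formula \<open>p\<close> by replacing the free occurrences of the variable \<open>v\<close> by
  the closed term \<open>c\<close>.\<close>

definition is_subst :: "tm \<Rightarrow> tm \<Rightarrow> tm \<Rightarrow> tm \<Rightarrow> fm" where
  "is_subst v c p p' = generated (\<lambda>P w.
     (\<^bold>\<exists>s. \<^bold>\<exists>s'. \<^bold>\<exists>t. \<^bold>\<exists>t'. is_term_subst v c s s' \<^bold>\<and> is_term_subst v c t t' \<^bold>\<and>
        w \<doteq> pr (eqC s t) (eqC s' t'))
     \<^bold>\<or> (\<^bold>\<exists>q. \<^bold>\<exists>q'. P (pr q q') \<^bold>\<and> w \<doteq> pr (negC q) (negC q'))
     \<^bold>\<or> (\<^bold>\<exists>q. \<^bold>\<exists>q'. \<^bold>\<exists>r. \<^bold>\<exists>r'. P (pr q q') \<^bold>\<and> P (pr r r') \<^bold>\<and>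
           w \<doteq> pr (orC q r) (orC q' r'))
     \<^bold>\<or> (\<^bold>\<exists>u. \<^bold>\<exists>q. \<^bold>\<exists>q'. \<^bold>\<not> u \<doteq> v \<^bold>\<and> P (pr q q') \<^bold>\<and> w \<doteq> pr (exC u q) (exC u q'))
     \<^bold>\<or> (\<^bold>\<exists>q. is_formula q \<^bold>\<and> w \<doteq> pr (exC v q) (exC v q)))
     (pr p p')"

text \<open>\<open>d\<close> is a disjunction, bracketed in any way, of the entries \<open>0, \<dots>, m - 1\<close> of the sequence
  coded by \<open>a\<close>, \<open>b\<close>. The generated triples \<open>(i, j, d)\<close> say this of the entries \<open>i, \<dots>, j - 1\<close>.
  There is no such \<open>d\<close> if \<open>m = 0\<close>.\<close>

definition is_disjunction :: "tm \<Rightarrow> tm \<Rightarrow> tm \<Rightarrow> tm \<Rightarrow> fm" where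
  "is_disjunction a b m d = generated (\<lambda>P w.
     (\<^bold>\<exists>i. \<^bold>\<exists>e. beta a b i e \<^bold>\<and> w \<doteq> pr i (pr (Succ i) e))
     \<^bold>\<or> (\<^bold>\<exists>i. \<^bold>\<exists>j. \<^bold>\<exists>k. \<^bold>\<exists>e. \<^bold>\<exists>e'. P (pr i (pr j e)) \<^bold>\<and> P (pr j (pr k e')) \<^bold>\<and>
           w \<doteq> pr i (pr k (orC e e'))))
     (pr Zero (pr m d))"


section \<open>The truth axioms\<close>

definition CT_minus :: "tm \<Rightarrow> fm" where
  "CT_minus x =
     ((\<^bold>\<forall>y. Tr x y \<^bold>\<longrightarrow> is_sentence y)
      \<^bold>\<and> (\<^bold>\<forall>s. \<^bold>\<forall>t. is_closed_term s \<^bold>\<and> is_closed_term t \<^bold>\<longrightarrow>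
            (Tr x (eqC s t) \<^bold>\<longleftrightarrow> (\<^bold>\<exists>y. is_value s y \<^bold>\<and> is_value t y)))
      \<^bold>\<and> (\<^bold>\<forall>p. is_sentence p \<^bold>\<longrightarrow> (Tr x (negC p) \<^bold>\<longleftrightarrow> \<^bold>\<not> Tr x p))
      \<^bold>\<and> (\<^bold>\<forall>p. \<^bold>\<forall>q. is_sentence p \<^bold>\<and> is_sentence q \<^bold>\<longrightarrow>
            (Tr x (orC p q) \<^bold>\<longleftrightarrow> Tr x p \<^bold>\<or> Tr x q))
      \<^bold>\<and> (\<^bold>\<forall>v. \<^bold>\<forall>p. is_formula_in v p \<^bold>\<longrightarrow>
            (Tr x (exC v p) \<^bold>\<longleftrightarrow>
              (\<^bold>\<exists>y. \<^bold>\<exists>c. \<^bold>\<exists>q. is_numeral y c \<^bold>\<and> is_subst v c p q \<^bold>\<and> Tr x q))))"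

definition CT_star :: fm where
  "CT_star = (\<^bold>\<forall>x. CT_minus x)"

definition disjunctively_correct :: "tm \<Rightarrow> tm \<Rightarrow> fm" where
  "disjunctively_correct x m =
     (\<^bold>\<forall>a. \<^bold>\<forall>b. \<^bold>\<forall>d.
        (\<^bold>\<forall>i. i \<prec> m \<^bold>\<longrightarrow> (\<^bold>\<exists>p. beta a b i p \<^bold>\<and> is_sentence p)) \<^bold>\<and>
        is_sentence d \<^bold>\<and> is_disjunction a b m d \<^bold>\<longrightarrow>
        (Tr x d \<^bold>\<longleftrightarrow> (\<^bold>\<exists>i. \<^bold>\<exists>p. i \<prec> m \<^bold>\<and> beta a b i p \<^bold>\<and> Tr x p)))"

definition DC_star :: fm where
  "DC_star = (\<^bold>\<forall>x. \<^bold>\<forall>m. m \<preceq> x \<^bold>\<longrightarrow> disjunctively_correct x m)"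

end

theory Submission
  imports Defs "HOL-Library.Countable_Set" "HOL-Library.Nat_Bijection"
begin


text \<open>If \<open>A\<close> is not provable in PA, it fails in a model \<open>K\<close> of PA. Working in \<open>K\<close> with definable
  predicates, for which induction is available, we build an extension \<open>N\<close> of \<open>K\<close> that is elementary for
  finitely many given formulas and carries a truth predicate. The elements of \<open>N\<close> are given by names, and
  truth is made compositional for one logical skeleton after the other, as in the proof of Enayat
  and Visser that \<open>CT\<^sup>-\<close> is conservative. Since \<open>N\<close> and its truth predicate are definable in \<open>K\<close>,
  induction in \<open>K\<close> shows that truth is disjunctively correct for disjunctions whose length is
  in \<open>K\<close>. An ultraproduct of such pairs is an elementary embedding of an ultrapower \<open>Ks\<close> of \<open>K\<close> into a
  model \<open>Ns\<close> with a truth predicate that is disjunctively correct for lengths in the image of \<open>Ks\<close>.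
  Both models are \<open>\<aleph>\<^sub>1\<close>-saturated. Hence there is a countable elementary submodel \<open>M\<close> of \<open>Ks\<close> such
  that for each \<open>c\<close> in \<open>M\<close> some elementary embedding of \<open>M\<close> into \<open>Ns\<close> that sends \<open>c\<close> to its given image
  pulls the truth predicate back to one that is disjunctively correct up to \<open>c\<close>. With these
  truth predicates \<open>M\<close> is a model of the theory, and \<open>A\<close> fails in it.\<close>

section \<open>Structures and satisfaction\<close>

text \<open>Disjunctive correctness for all lengths at once is not conservative over PA, so in
  general no single truth predicate can serve every bound; all bounds have to be served on one and
  the same model. A definable truth predicate supplies the missing induction, but by Tarski it
  cannot live on a definable extension of \<open>K\<close> that is elementary for all formulas, as
  it would define truth in \<open>K\<close>. Hence the restriction to finitely many formulas, which
  the ultraproduct lifts. A second restriction stays: an induction in \<open>K\<close> reaches only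
  lengths in \<open>K\<close>, whereas the truth predicate belongs to the larger model. Pulling it
  back along the canonical map would lose witnesses, since a true existential sentence may have its
  true instances outside the image. So the embedding of \<open>M\<close> is built by back and forth,
  and beyond the bound \<open>c\<close> nothing is prescribed: the other elements may move so as to
  meet the witnesses. The embeddings for different bounds need not be compatible, because the axioms
  relate no two of the predicates to each other.\<close>

text \<open>Equality is interpreted by a congruence, so that no quotients have to be formed.\<close>

record 'a str =
  zer :: 'a
  suc :: "'a \<Rightarrow> 'a"
  plu :: "'a \<Rightarrow> 'a \<Rightarrow> 'a"
  tim :: "'a \<Rightarrow> 'a \<Rightarrow> 'a"
  equ :: "'a \<Rightarrow> 'a \<Rightarrow> bool"

definition congS :: "'a str \<Rightarrow> bool" where
  "congS I \<longleftrightarrow> (\<forall>x. equ I x x) \<and> (\<forall>x y. equ I x y \<longrightarrow> equ I y x)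
    \<and> (\<forall>x y z. equ I x y \<longrightarrow> equ I y z \<longrightarrow> equ I x z)
    \<and> (\<forall>x y. equ I x y \<longrightarrow> equ I (suc I x) (suc I y))
    \<and> (\<forall>x y x' y'. equ I x y \<longrightarrow> equ I x' y' \<longrightarrow> equ I (plu I x x') (plu I y y'))
    \<and> (\<forall>x y x' y'. equ I x y \<longrightarrow> equ I x' y' \<longrightarrow> equ I (tim I x x') (tim I y y'))"

definition congT :: "'a str \<Rightarrow> ('a \<Rightarrow> 'a \<Rightarrow> bool) \<Rightarrow> bool" where
  "congT I T \<longleftrightarrow> (\<forall>x y x' y'. equ I x y \<longrightarrow> equ I x' y' \<longrightarrow> T x x' \<longrightarrow> T y y')"

primrec tval :: "'a str \<Rightarrow> (nat \<Rightarrow> 'a) \<Rightarrow> tm \<Rightarrow> 'a" where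
  "tval I e (Var v) = e v"
| "tval I e Zero = zer I"
| "tval I e (Succ t) = suc I (tval I e t)"
| "tval I e (s \<oplus> t) = plu I (tval I e s) (tval I e t)"
| "tval I e (s \<otimes> t) = tim I (tval I e s) (tval I e t)"

primrec sat :: "'a str \<Rightarrow> ('a \<Rightarrow> 'a \<Rightarrow> bool) \<Rightarrow> (nat \<Rightarrow> 'a) \<Rightarrow> fm \<Rightarrow> bool" where
  "sat I T e (s \<doteq> t) \<longleftrightarrow> equ I (tval I e s) (tval I e t)"
| "sat I T e (Tr s t) \<longleftrightarrow> T (tval I e s) (tval I e t)"
| "sat I T e (\<^bold>\<not> A) \<longleftrightarrow> \<not> sat I T e A"
| "sat I T e (A \<^bold>\<or> B) \<longleftrightarrow> sat I T e A \<or> sat I T e B"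
| "sat I T e (Ex v A) \<longleftrightarrow> (\<exists>x. sat I T (e(v := x)) A)"

text \<open>On arithmetical formulas the interpretation of the predicate does not matter
  (\<open>sat_arith\<close>), so the empty relation stands for any other.\<close>

abbreviation sata :: "'a str \<Rightarrow> (nat \<Rightarrow> 'a) \<Rightarrow> fm \<Rightarrow> bool" where
  "sata I \<equiv> sat I (\<lambda>_ _. False)"

lemma finite_tvars [simp]: "finite (tvars t)"
  by (induction t) auto

lemma finite_fv [simp]: "finite (fv A)"
  by (induction A) auto

lemma tval_cong: "(\<And>v. v \<in> tvars t \<Longrightarrow> e v = e' v) \<Longrightarrow> tval I e t = tval I e' t"
  by (induction t) auto

lemma tval_upd [simp]: "v \<notin> tvars t \<Longrightarrow> tval I (e(v := x)) t = tval I e t"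
  by (rule tval_cong) auto

lemma sat_cong: "(\<And>v. v \<in> fv A \<Longrightarrow> e v = e' v) \<Longrightarrow> sat I T e A = sat I T e' A"
proof (induction A arbitrary: e e')
  case (Eq s t)
  then have "tval I e s = tval I e' s" "tval I e t = tval I e' t" by (auto intro!: tval_cong)
  then show ?case by simp
next
  case (Tr s t)
  then have "tval I e s = tval I e' s" "tval I e t = tval I e' t" by (auto intro!: tval_cong)
  then show ?case by simp
next
  case (Neg A)
  then show ?case by (metis fv.simps(3) sat.simps(3))
next
  case (Or A B)
  then show ?case by (metis UnI1 UnI2 fv.simps(4) sat.simps(4))
next
  case (Ex v A)
  have "sat I T (e(v := x)) A = sat I T (e'(v := x)) A" for x
    by (rule Ex.IH) (use Ex.prems in auto)
  then show ?case by simp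
qed

lemma sat_upd [simp]: "v \<notin> fv A \<Longrightarrow> sat I T (e(v := x)) A = sat I T e A"
  by (rule sat_cong) auto

lemma sat_arith: "arithmetical A \<Longrightarrow> sat I T e A = sat I T' e A"
  by (induction A arbitrary: e) auto

lemma tval_tsubst: "tval I e (tsubst v r t) = tval I (e(v := tval I e r)) t"
  by (induction t) auto

lemma tsubst_idle: "v \<notin> tvars t \<Longrightarrow> tsubst v r t = t"
  by (induction t) auto

lemma subst_idle: "v \<notin> fv A \<Longrightarrow> subst v r A = A"
  by (induction A) (auto simp: tsubst_idle)

lemma sat_subst: "free_for r v A \<Longrightarrow> sat I T e (subst v r A) = sat I T (e(v := tval I e r)) A"
proof (induction A arbitrary: e)
  case (Ex u A)
  show ?case
  proof (cases "v \<in> fv (Ex u A)")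
    \<comment> \<open>\<open>free_for\<close> permits capture here, harmlessly: without free
      occurrences of \<open>v\<close> neither side depends on it.\<close>
    case False
    show ?thesis unfolding subst_idle[OF False] sat_upd[OF False] ..
  next
    case True
    then have *: "u \<noteq> v" "u \<notin> tvars r" "free_for r v A" using Ex.prems by auto
    have "sat I T (e(u := x)) (subst v r A) = sat I T (e(v := tval I e r, u := x)) A" for x
      unfolding Ex.IH[OF *(3)] tval_upd[OF *(2)] fun_upd_twist[OF *(1)] ..
    then have "sat I T e (Ex u (subst v r A)) = sat I T (e(v := tval I e r)) (Ex u A)"
      unfolding sat.simps by blast
    moreover have "subst v r (Ex u A) = Ex u (subst v r A)" using *(1) by simp
    ultimately show ?thesis by (simp only:)
  qed
qed (auto simp: tval_tsubst)

section \<open>Congruences and the soundness of the calculus\<close>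

lemma congSD:
  assumes "congS I"
  shows "\<forall>x. equ I x x" "\<forall>x y. equ I x y \<longrightarrow> equ I y x"
    "\<forall>x y z. equ I x y \<longrightarrow> equ I y z \<longrightarrow> equ I x z"
    "\<forall>x y. equ I x y \<longrightarrow> equ I (suc I x) (suc I y)"
    "\<forall>x y x' y'. equ I x y \<longrightarrow> equ I x' y' \<longrightarrow> equ I (plu I x x') (plu I y y')"
    "\<forall>x y x' y'. equ I x y \<longrightarrow> equ I x' y' \<longrightarrow> equ I (tim I x x') (tim I y y')"
  using assms unfolding congS_def by - (elim conjE, assumption)+

lemma equ_refl: "congS I \<Longrightarrow> equ I x x"
  by (drule congSD(1)) blast

lemma equ_sym: "congS I \<Longrightarrow> equ I x y \<Longrightarrow> equ I y x"
  by (drule congSD(2)) blast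

lemma equ_trans: "congS I \<Longrightarrow> equ I x y \<Longrightarrow> equ I y z \<Longrightarrow> equ I x z"
  by (drule congSD(3)) blast

lemma equ_suc: "congS I \<Longrightarrow> equ I x y \<Longrightarrow> equ I (suc I x) (suc I y)"
  by (drule congSD(4)) blast

lemma equ_plu: "congS I \<Longrightarrow> equ I x y \<Longrightarrow> equ I x' y' \<Longrightarrow> equ I (plu I x x') (plu I y y')"
  by (drule congSD(5)) blast

lemma equ_tim: "congS I \<Longrightarrow> equ I x y \<Longrightarrow> equ I x' y' \<Longrightarrow> equ I (tim I x x') (tim I y y')"
  by (drule congSD(6)) blast

lemma congTD: "congT I T \<Longrightarrow> equ I x y \<Longrightarrow> equ I x' y' \<Longrightarrow> T x x' \<Longrightarrow> T y y'"
  unfolding congT_def by blast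

lemma tval_equ:
  assumes "congS I" "\<And>v. equ I (e v) (e' v)" shows "equ I (tval I e t) (tval I e' t)"
  by (induction t) (simp_all add: assms(2) equ_refl[OF assms(1)] equ_suc[OF assms(1)]
      equ_plu[OF assms(1)] equ_tim[OF assms(1)])

lemma sat_equ:
  assumes "congS I" "congT I T" "\<And>v. equ I (e v) (e' v)"
  shows "sat I T e A = sat I T e' A"
  using assms(3)
proof (induction A arbitrary: e e')
  case (Eq s t)
  have *: "equ I (tval I e s) (tval I e' s)" "equ I (tval I e t) (tval I e' t)"
    by (rule tval_equ[OF assms(1)], rule Eq)+
  show ?case unfolding sat.simps
    using equ_trans[OF assms(1)] equ_sym[OF assms(1)] * by blast
next
  case (Tr s t)
  have *: "equ I (tval I e s) (tval I e' s)" "equ I (tval I e t) (tval I e' t)"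
    by (rule tval_equ[OF assms(1)], rule Tr)+
  show ?case unfolding sat.simps
    using congTD[OF assms(2) *] congTD[OF assms(2) *[THEN equ_sym[OF assms(1)]]] by blast
next
  case (Ex v A)
  have "sat I T (e(v := x)) A = sat I T (e'(v := x)) A" for x
    by (rule Ex.IH) (use Ex.prems equ_refl[OF assms(1)] in auto)
  then show ?case by simp
next
  case (Neg A)
  show ?case unfolding sat.simps using Neg.IH[OF Neg.prems] by simp
next
  case (Or A B)
  show ?case unfolding sat.simps using Or.IH(1)[OF Or.prems] Or.IH(2)[OF Or.prems] by simp
qed

text \<open>Truth of the axioms is required under all assignments because
  \<open>ex_introduction\<close> uses its premise at changed values of \<open>v\<close>. This also
  gives axioms with free variables their universal reading.\<close>

lemma soundness:
  assumes "provable L \<Gamma> A" "congS I" "congT I T" "\<And>B e. B \<in> \<Gamma> \<Longrightarrow> sat I T e B"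
  shows "sat I T e A"
  using assms(1)
proof (induction arbitrary: e)
  case (logical A)
  from this(1) show ?case
  proof cases
    case (substitution t v A)
    have "sat I T e (subst v t A) \<Longrightarrow> sat I T (e(v := tval I e t)) A"
      using sat_subst[OF substitution(2)] by blast
    then show ?thesis unfolding substitution(1) sat.simps by blast
  next
    case (eq_Succ s t)
    then show ?thesis using equ_suc[OF assms(2)]
      unfolding eq_Succ(1) sat.simps tval.simps by blast
  next
    case (eq_Add s t s' t')
    then show ?thesis using equ_plu[OF assms(2)]
      unfolding eq_Add(1) sat.simps tval.simps by blast
  next
    case (eq_Mul s t s' t')
    then show ?thesis using equ_tim[OF assms(2)]
      unfolding eq_Mul(1) sat.simps tval.simps by blast
  next
    case (eq_Eq s t s' t')
    then show ?thesis using equ_trans[OF assms(2)] equ_sym[OF assms(2)]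
      unfolding eq_Eq(1) sat.simps tval.simps by blast
  next
    case (eq_Tr s t s' t')
    then show ?thesis using congTD[OF assms(3)]
      unfolding eq_Tr(1) sat.simps tval.simps by blast
  qed (simp_all add: equ_refl[OF assms(2)])
next
  case (nonlogical A)
  then show ?case by (intro assms(4))
next
  case (expansion A B)
  then show ?case unfolding sat.simps by blast
next
  case (contraction A)
  then show ?case unfolding sat.simps by blast
next
  case (associativity A B C)
  then show ?case unfolding sat.simps by blast
next
  case (cut A B C)
  then show ?case unfolding sat.simps by blast
next
  case (ex_introduction A B v)
  have "sat I T e B" if "sat I T (e(v := x)) A" for x
    using ex_introduction.IH[of "e(v := x)"] that
    unfolding sat.simps sat_upd[OF ex_introduction.hyps(2)] by blast
  then show ?case unfolding sat.simps by blast
qed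

section \<open>Renaming of variables\<close>

primrec rnt :: "(nat \<Rightarrow> nat) \<Rightarrow> tm \<Rightarrow> tm" where
  "rnt r (Var v) = Var (r v)"
| "rnt r Zero = Zero"
| "rnt r (Succ t) = Succ (rnt r t)"
| "rnt r (s \<oplus> t) = rnt r s \<oplus> rnt r t"
| "rnt r (s \<otimes> t) = rnt r s \<otimes> rnt r t"

text \<open>Bound variables are renamed along with the free ones. So an injective \<open>r\<close>
  causes no capture and its effect is a mere rearrangement of the assignment.\<close>

primrec rn :: "(nat \<Rightarrow> nat) \<Rightarrow> fm \<Rightarrow> fm" where
  "rn r (s \<doteq> t) = (rnt r s \<doteq> rnt r t)"
| "rn r (Tr s t) = Tr (rnt r s) (rnt r t)"
| "rn r (\<^bold>\<not> A) = \<^bold>\<not> rn r A"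
| "rn r (A \<^bold>\<or> B) = rn r A \<^bold>\<or> rn r B"
| "rn r (Ex v A) = Ex (r v) (rn r A)"

lemma tval_rnt [simp]: "tval I e (rnt r t) = tval I (e \<circ> r) t"
  by (induction t) auto

lemma sat_rn: "inj r \<Longrightarrow> sat I T e (rn r A) = sat I T (e \<circ> r) A"
proof (induction A arbitrary: e)
  case (Ex v A)
  have *: "(e(r v := x)) \<circ> r = (e \<circ> r)(v := x)" for x
    using Ex.prems by (auto simp: fun_eq_iff inj_def)
  show ?case unfolding rn.simps sat.simps Ex.IH[OF Ex.prems] * ..
qed (simp_all only: rn.simps sat.simps tval_rnt)

lemma arithmetical_rn [simp]: "arithmetical (rn r A) = arithmetical A"
  by (induction A) auto

instance tm :: countable by countable_datatype
instance fm :: countable by countable_datatype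


section \<open>Completeness for arithmetical formulas\<close>

subsection \<open>Derived rules\<close>

abbreviation pv :: "fm \<Rightarrow> bool" where "pv \<equiv> provable L_PA PA"

lemma L_PA_iff: "A \<in> L_PA \<longleftrightarrow> arithmetical A"
  by (simp add: L_PA_def)

lemma pv_arith: "pv A \<Longrightarrow> arithmetical A"
  by (induction rule: provable.induct) (auto simp: L_PA_iff)

lemma pv_em: "arithmetical A \<Longrightarrow> pv (\<^bold>\<not> A \<^bold>\<or> A)"
  by (intro provable.logical logical_axioms.propositional) (simp add: L_PA_iff)

lemma pv_comm: "pv (A \<^bold>\<or> B) \<Longrightarrow> pv (B \<^bold>\<or> A)"
  using pv_arith[of "A \<^bold>\<or> B"]
  by (auto simp: L_PA_iff intro: pv_em provable.cut[of _ _ A B A])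

lemma pv_assoc: "pv (A \<^bold>\<or> (B \<^bold>\<or> C)) \<Longrightarrow> pv ((A \<^bold>\<or> B) \<^bold>\<or> C)"
  using pv_arith[of "A \<^bold>\<or> (B \<^bold>\<or> C)"] by (auto simp: L_PA_iff intro: provable.associativity)

text \<open>The calculus associates in one direction only. The other direction comes from rotating
  the disjuncts: C, (A, B) becomes (C, A), B, then B, (C, A), then (B, C), A.\<close>

lemma pv_assoc': "pv ((A \<^bold>\<or> B) \<^bold>\<or> C) \<Longrightarrow> pv (A \<^bold>\<or> (B \<^bold>\<or> C))"
  by (rule pv_comm, rule pv_assoc, rule pv_comm, rule pv_assoc, rule pv_comm)

lemma pv_exp: "pv A \<Longrightarrow> arithmetical B \<Longrightarrow> pv (B \<^bold>\<or> A)"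
  using pv_arith[of A] by (auto simp: L_PA_iff intro: provable.expansion)

lemma pv_contr: "pv (A \<^bold>\<or> A) \<Longrightarrow> pv A"
  using pv_arith[of "A \<^bold>\<or> A"] by (auto simp: L_PA_iff intro: provable.contraction[of _ _ A])

lemma pv_cut: "pv (A \<^bold>\<or> B) \<Longrightarrow> pv (\<^bold>\<not> A \<^bold>\<or> C) \<Longrightarrow> pv (B \<^bold>\<or> C)"
  using pv_arith[of "A \<^bold>\<or> B"] pv_arith[of "\<^bold>\<not> A \<^bold>\<or> C"]
  by (auto simp: L_PA_iff intro: provable.cut[of _ _ A B C])

lemma pv_weak: "pv (A \<^bold>\<or> N) \<Longrightarrow> arithmetical B \<Longrightarrow> pv (A \<^bold>\<or> (B \<^bold>\<or> N))"
  by (rule pv_comm, rule pv_assoc, rule pv_exp, rule pv_comm)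

lemma pv_weak': "pv (A \<^bold>\<or> N) \<Longrightarrow> arithmetical B \<Longrightarrow> pv (A \<^bold>\<or> (N \<^bold>\<or> B))"
  by (rule pv_assoc', rule pv_comm, rule pv_exp)

lemma pv_absorb: "pv ((B \<^bold>\<or> N) \<^bold>\<or> N) \<Longrightarrow> pv (B \<^bold>\<or> N)"
  using pv_weak[of "B \<^bold>\<or> N" N B] pv_arith[of "(B \<^bold>\<or> N) \<^bold>\<or> N"] pv_contr[of "B \<^bold>\<or> N"] by auto

lemma pv_mp: "pv A \<Longrightarrow> pv (A \<^bold>\<longrightarrow> B) \<Longrightarrow> pv B"
  using pv_arith[of "A \<^bold>\<longrightarrow> B"] pv_cut[of A B B] pv_exp[of A B] pv_comm[of B A] pv_contr[of B]
  by auto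

lemma pv_trans: "pv (A \<^bold>\<longrightarrow> B) \<Longrightarrow> pv (B \<^bold>\<longrightarrow> C) \<Longrightarrow> pv (A \<^bold>\<longrightarrow> C)"
  by (rule pv_cut[of B], rule pv_comm)

lemma pv_notnot: assumes "pv A" shows "pv (\<^bold>\<not> \<^bold>\<not> A)"
proof -
  have "pv (\<^bold>\<not> A \<^bold>\<or> \<^bold>\<not> \<^bold>\<not> A)"
    using pv_arith[OF assms] by (intro pv_comm[OF pv_em]) simp
  then show ?thesis using assms pv_mp by blast
qed

lemma pv_exI: "pv (A \<^bold>\<longrightarrow> B) \<Longrightarrow> v \<notin> fv B \<Longrightarrow> pv (Ex v A \<^bold>\<longrightarrow> B)"
  using pv_arith[of "A \<^bold>\<longrightarrow> B"] by (auto simp: L_PA_iff intro: provable.ex_introduction)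

lemma pv_gen: assumes "pv A" shows "pv (All v A)"
proof -
  have a: "arithmetical (All v A)" using pv_arith[OF assms] by simp
  have "pv (\<^bold>\<not> \<^bold>\<not> A \<^bold>\<or> All v A)" by (rule pv_comm, rule pv_exp[OF pv_notnot[OF assms] a])
  \<comment> \<open>As \<open>All v A\<close> is itself the negation of \<open>Ex v (Neg A)\<close>,
    this implication is the disjunction of \<open>All v A\<close> with itself.\<close>
  then have "pv (Ex v (\<^bold>\<not> A) \<^bold>\<longrightarrow> All v A)" by (rule pv_exI) simp
  then show ?thesis by (rule pv_contr)
qed

lemma arithmetical_subst [simp]: "arithmetical (subst v t A) = arithmetical A"
  by (induction A) auto

lemma pv_inst: "free_for t v A \<Longrightarrow> arithmetical A \<Longrightarrow> pv (subst v t A \<^bold>\<longrightarrow> Ex v A)"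
  by (intro provable.logical logical_axioms.substitution) (auto simp: L_PA_iff)

section \<open>Bound variables and their renaming\<close>

primrec bvs :: "fm \<Rightarrow> nat set" where
  "bvs (s \<doteq> t) = {}"
| "bvs (Tr s t) = {}"
| "bvs (\<^bold>\<not> A) = bvs A"
| "bvs (A \<^bold>\<or> B) = bvs A \<union> bvs B"
| "bvs (Ex v A) = insert v (bvs A)"

lemma finite_bvs [simp]: "finite (bvs A)"
  by (induction A) auto

lemma free_for_bvs: "tvars t \<inter> bvs A = {} \<Longrightarrow> free_for t v A"
  by (induction A) auto

lemma tsubst_back: "c \<notin> tvars t \<Longrightarrow> tsubst c (Var v) (tsubst v (Var c) t) = t"
  by (induction t) auto

lemma subst_back:
  assumes "c \<notin> fv A" "c \<notin> bvs A"
  shows "free_for (Var v) c (subst v (Var c) A) \<and> subst c (Var v) (subst v (Var c) A) = A"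
  using assms
proof (induction A)
  case (Ex u A)
  then have u: "u \<noteq> c" by auto
  show ?case
  proof (cases "u = v")
    case True
    then show ?thesis using Ex.prems u subst_idle[of c "Ex u A"] by auto
  next
    case False
    then show ?thesis using Ex u by (cases "c \<in> fv A") auto
  qed
qed (auto simp: tsubst_back)

lemma fv_tsubst: "tvars (tsubst v t s) \<subseteq> (tvars s - {v}) \<union> tvars t"
  by (induction s) auto

lemma fv_subst: "fv (subst v t A) \<subseteq> (fv A - {v}) \<union> tvars t"
proof (induction A)
  case (Eq s r)
  then show ?case using fv_tsubst[of v t s] fv_tsubst[of v t r] by auto
next
  case (Tr s r)
  then show ?case using fv_tsubst[of v t s] fv_tsubst[of v t r] by auto
qed (auto split: if_splits)

text \<open>Constants are just variables. Once the formula is bound by the constant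
  \<open>c\<close>, \<open>pv_exI\<close> can be applied to \<open>c\<close>.\<close>

lemma pv_rename_ex:
  assumes "c \<notin> fv A" "c \<notin> bvs A" "c \<noteq> v" "arithmetical A"
  shows "pv (Ex v A \<^bold>\<longrightarrow> Ex c (subst v (Var c) A))"
proof (rule pv_exI)
  show "pv (A \<^bold>\<longrightarrow> Ex c (subst v (Var c) A))"
    using pv_inst[of "Var v" c "subst v (Var c) A"] subst_back[OF assms(1,2), of v] assms(4) by simp
  show "v \<notin> fv (Ex c (subst v (Var c) A))"
    using fv_subst[of v "Var c" A] assms(3) by auto
qed

subsection \<open>The Henkin construction\<close>

text \<open>Free variables outside \<open>B\<close> serve as constants, whereas all bound variables are taken from
  \<open>B\<close>: so no substitution of a constant can lead to capture. A finite set of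
  assumptions is recorded by the disjunction \<open>N\<close> of its negations.\<close>

primrec msub :: "(nat \<Rightarrow> nat) \<Rightarrow> fm \<Rightarrow> fm" where
  "msub r (s \<doteq> t) = (rnt r s \<doteq> rnt r t)"
| "msub r (Tr s t) = Tr (rnt r s) (rnt r t)"
| "msub r (\<^bold>\<not> A) = \<^bold>\<not> msub r A"
| "msub r (A \<^bold>\<or> B) = msub r A \<^bold>\<or> msub r B"
| "msub r (Ex v A) = Ex v (msub (r(v := v)) A)"

lemma bvs_msub [simp]: "bvs (msub r A) = bvs A"
  by (induction A arbitrary: r) auto

lemma bvs_subst [simp]: "bvs (subst v t A) = bvs A"
  by (induction A) auto

lemma arithmetical_msub [simp]: "arithmetical (msub r A) = arithmetical A"
  by (induction A arbitrary: r) auto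

lemma tsubst_rnt:
  "\<forall>u\<in>tvars t. u \<noteq> v \<longrightarrow> r u \<noteq> v \<Longrightarrow> tsubst v (Var c) (rnt (r(v := v)) t) = rnt (r(v := c)) t"
  by (induction t) auto

lemma subst_msub:
  "\<forall>u\<in>fv A. u \<noteq> v \<longrightarrow> r u \<noteq> v \<Longrightarrow> subst v (Var c) (msub (r(v := v)) A) = msub (r(v := c)) A"
proof (induction A arbitrary: r)
  case (Ex w A)
  show ?case
  proof (cases "w = v")
    case True
    show ?thesis unfolding True msub.simps fun_upd_upd by simp
  next
    case False
    have "subst v (Var c) (msub ((r(w := w))(v := v)) A) = msub ((r(w := w))(v := c)) A"
      by (rule Ex.IH) (use Ex.prems False in auto)
    then show ?thesis
      unfolding msub.simps fun_upd_twist[OF False] by (simp only: subst.simps False if_False)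
  qed
qed (auto simp: tsubst_rnt)

lemma rnt_idle: "(\<And>v. v \<in> tvars t \<Longrightarrow> r v = v) \<Longrightarrow> rnt r t = t"
  by (induction t) auto

lemma msub_idle: "(\<And>v. v \<in> fv A \<Longrightarrow> r v = v) \<Longrightarrow> msub r A = A"
proof (induction A arbitrary: r)
  case (Ex v A)
  have "msub (r(v := v)) A = A" by (rule Ex.IH) (use Ex.prems in auto)
  then show ?case by simp
qed (auto simp: rnt_idle)

locale henkin =
  fixes A0 :: fm and cv :: "nat \<Rightarrow> nat" and B :: "nat set"
  assumes unprovable: "\<not> pv A0" and arith0: "arithmetical A0"
    and inj_cv: "inj cv" and B_def: "B = - range cv"
begin

definition good :: "fm \<Rightarrow> bool" where "good A \<longleftrightarrow> arithmetical A \<and> bvs A \<subseteq> B"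

lemma fresh: "finite S \<Longrightarrow> \<exists>k. cv k \<notin> S"
  using inj_cv by (metis finite_subset image_subset_iff infinite_UNIV_nat range_inj_infinite subsetI)

definition fresh_const :: "fm \<Rightarrow> nat" where
  "fresh_const A = cv (SOME k. cv k \<notin> fv A \<union> bvs A)"

lemma fresh_const: "fresh_const A \<notin> fv A" "fresh_const A \<notin> bvs A" "fresh_const A \<in> range cv"
  using someI_ex[OF fresh[of "fv A \<union> bvs A"]] by (auto simp: fresh_const_def)

text \<open>A proof of the disjunction of \<open>Neg F\<close> and \<open>N\<close> refutes
  \<open>F\<close> from the assumptions recorded by \<open>N\<close>. In that case the negation of
  \<open>F\<close> is assumed, which enters the disjunction doubly negated. Otherwise
  \<open>F\<close> is assumed, and an existential \<open>F\<close> brings along an instance at a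
  constant that is new to it and to \<open>N\<close>.\<close>

definition extend :: "fm \<Rightarrow> fm \<Rightarrow> fm" where
  "extend F N = (if \<not> good F then N
     else if pv (\<^bold>\<not> F \<^bold>\<or> N) then \<^bold>\<not> \<^bold>\<not> F \<^bold>\<or> N
     else (case F of
         Ex v A \<Rightarrow> \<^bold>\<not> subst v (Var (fresh_const (F \<^bold>\<or> N))) A \<^bold>\<or> (\<^bold>\<not> F \<^bold>\<or> N)
       | _ \<Rightarrow> \<^bold>\<not> F \<^bold>\<or> N))"

lemma extend_arith: "arithmetical N \<Longrightarrow> arithmetical (extend F N)"
  by (cases F) (auto simp: extend_def good_def)

lemma extend_unprovable:
  assumes "\<not> pv N" "arithmetical N" shows "\<not> pv (extend F N)"
proof (cases "good F \<and> \<not> pv (\<^bold>\<not> F \<^bold>\<or> N) \<and> (\<exists>v A. F = Ex v A)")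
  case True
  then obtain v A where F: "F = Ex v A" "good F" "\<not> pv (\<^bold>\<not> F \<^bold>\<or> N)" by blast
  define c where "c = fresh_const (F \<^bold>\<or> N)"
  note c = fresh_const[of "F \<^bold>\<or> N", folded c_def]
  have cB: "c \<notin> B" using c(3) B_def by auto
  have vc: "c \<noteq> v" "c \<notin> fv A" "c \<notin> bvs A" "c \<notin> fv (\<^bold>\<not> F \<^bold>\<or> N)" using c F by auto
  have ar: "arithmetical A" using F by (auto simp: good_def)
  \<comment> \<open>As \<open>c\<close> is new, a refutation that uses the instance at
    \<open>c\<close> turns into one that uses the existential formula alone.\<close>
  have "pv (\<^bold>\<not> F \<^bold>\<or> N)" if "pv (subst v (Var c) A \<^bold>\<longrightarrow> (\<^bold>\<not> F \<^bold>\<or> N))"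
  proof -
    have "pv (Ex c (subst v (Var c) A) \<^bold>\<longrightarrow> (\<^bold>\<not> F \<^bold>\<or> N))"
      by (rule pv_exI[OF that]) (use vc in auto)
    then have "pv (F \<^bold>\<longrightarrow> (\<^bold>\<not> F \<^bold>\<or> N))"
      using pv_trans[OF pv_rename_ex[OF vc(2,3,1) ar]] F(1) by blast
    then have "pv ((\<^bold>\<not> F \<^bold>\<or> \<^bold>\<not> F) \<^bold>\<or> N)" by (rule pv_assoc)
    then have "pv (N \<^bold>\<or> (\<^bold>\<not> F \<^bold>\<or> \<^bold>\<not> F))" by (rule pv_comm)
    then have "pv ((N \<^bold>\<or> \<^bold>\<not> F) \<^bold>\<or> \<^bold>\<not> F)" by (rule pv_assoc)
    then have "pv (N \<^bold>\<or> \<^bold>\<not> F)" by (rule pv_absorb)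
    then show ?thesis by (rule pv_comm)
  qed
  then show ?thesis using F by (auto simp: extend_def c_def)
next
  case False
  show ?thesis
  proof
    assume p: "pv (extend F N)"
    have "pv N"
    proof (cases "good F \<and> pv (\<^bold>\<not> F \<^bold>\<or> N)")
      case True
      then have "pv (N \<^bold>\<or> N)" using p pv_cut[of "\<^bold>\<not> F" N N] by (simp add: extend_def)
      then show ?thesis by (rule pv_contr)
    next
      case F2: False
      have "good F" by (rule ccontr) (use p assms in \<open>simp add: extend_def\<close>)
      moreover from this have "\<not> pv (\<^bold>\<not> F \<^bold>\<or> N)" using F2 by blast
      ultimately have "good F" "\<not> pv (\<^bold>\<not> F \<^bold>\<or> N)" by blast+
      then show ?thesis using p False by (cases F) (auto simp: extend_def)
    qed
    then show False using assms by blast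
  qed
qed

text \<open>Starting with \<open>A0\<close> amounts to assuming that \<open>A0\<close> is
  false.\<close>

primrec ctx :: "nat \<Rightarrow> fm" where
  "ctx 0 = A0"
| "ctx (Suc n) = extend (from_nat n) (ctx n)"

lemma ctx_arith: "arithmetical (ctx n)"
  by (induction n) (auto simp: arith0 extend_arith)

lemma ctx_unprovable: "\<not> pv (ctx n)"
  by (induction n) (auto simp: unprovable extend_unprovable ctx_arith)

definition T :: "fm set" where "T = {A. \<exists>n. pv (A \<^bold>\<or> ctx n)}"

lemma extend_weak: "pv (A \<^bold>\<or> N) \<Longrightarrow> pv (A \<^bold>\<or> extend F N)"
  by (cases F) (auto simp: extend_def good_def intro!: pv_weak)

lemma ctx_mono: "n \<le> m \<Longrightarrow> pv (A \<^bold>\<or> ctx n) \<Longrightarrow> pv (A \<^bold>\<or> ctx m)"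
  by (induction m rule: dec_induct) (auto intro: extend_weak)

lemma T_common: assumes "A \<in> T" "C \<in> T" obtains n where "pv (A \<^bold>\<or> ctx n)" "pv (C \<^bold>\<or> ctx n)"
proof -
  obtain n m where "pv (A \<^bold>\<or> ctx n)" "pv (C \<^bold>\<or> ctx m)" using assms by (auto simp: T_def)
  then have "pv (A \<^bold>\<or> ctx (max n m))" "pv (C \<^bold>\<or> ctx (max n m))"
    using ctx_mono by (meson max.cobounded1 max.cobounded2)+
  then show ?thesis using that by blast
qed

lemma T_pv: "pv A \<Longrightarrow> A \<in> T"
  unfolding T_def by (blast intro: pv_comm[OF pv_exp[OF _ ctx_arith]])

lemma T_mp: assumes "A \<in> T" "(A \<^bold>\<longrightarrow> C) \<in> T" shows "C \<in> T"
proof -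
  obtain n where n: "pv (A \<^bold>\<or> ctx n)" "pv ((A \<^bold>\<longrightarrow> C) \<^bold>\<or> ctx n)" by (rule T_common[OF assms])
  have "pv (ctx n \<^bold>\<or> (C \<^bold>\<or> ctx n))" using pv_cut[OF n(1) pv_assoc'[OF n(2)]] .
  then have "pv (C \<^bold>\<or> ctx n)" by (rule pv_absorb[OF pv_comm])
  then show ?thesis by (auto simp: T_def)
qed

lemma T_cons: "\<not> (A \<in> T \<and> \<^bold>\<not> A \<in> T)"
proof
  assume "A \<in> T \<and> \<^bold>\<not> A \<in> T"
  then obtain n where "pv (A \<^bold>\<or> ctx n)" "pv (\<^bold>\<not> A \<^bold>\<or> ctx n)" using T_common by blast
  then have "pv (ctx n)" by (rule pv_contr[OF pv_cut])
  then show False using ctx_unprovable by blast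
qed

lemma T_complete: assumes "good A" shows "A \<in> T \<or> \<^bold>\<not> A \<in> T"
proof -
  define n where "n = to_nat A"
  have c: "ctx (Suc n) = extend A (ctx n)" by (simp add: n_def)
  have ar: "arithmetical A" using assms by (simp add: good_def)
  have em: "pv (A \<^bold>\<or> \<^bold>\<not> A)" by (rule pv_comm, rule pv_em[OF ar])
  have em': "pv (\<^bold>\<not> A \<^bold>\<or> \<^bold>\<not> \<^bold>\<not> A)" by (rule pv_comm, rule pv_em) (simp add: ar)
  have w: "pv (A \<^bold>\<or> (\<^bold>\<not> A \<^bold>\<or> ctx n))" "pv (\<^bold>\<not> A \<^bold>\<or> (\<^bold>\<not> \<^bold>\<not> A \<^bold>\<or> ctx n))"
    using pv_weak'[OF em ctx_arith] pv_weak'[OF em' ctx_arith] by blast+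
  have "pv (A \<^bold>\<or> ctx (Suc n)) \<or> pv (\<^bold>\<not> A \<^bold>\<or> ctx (Suc n))"
    unfolding c using assms w ar by (cases A) (auto simp: extend_def intro!: pv_weak)
  then show ?thesis unfolding T_def by blast
qed

lemma T_neg: "good A \<Longrightarrow> \<^bold>\<not> A \<in> T \<longleftrightarrow> A \<notin> T"
  using T_complete T_cons by blast

lemma T_or: assumes "good (A \<^bold>\<or> C)" shows "(A \<^bold>\<or> C) \<in> T \<longleftrightarrow> A \<in> T \<or> C \<in> T"
proof
  assume d: "(A \<^bold>\<or> C) \<in> T"
  have "C \<in> T" if na: "\<^bold>\<not> A \<in> T"
  proof -
    obtain n where n: "pv (\<^bold>\<not> A \<^bold>\<or> ctx n)" "pv ((A \<^bold>\<or> C) \<^bold>\<or> ctx n)" by (rule T_common[OF na d])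
    have "pv ((C \<^bold>\<or> ctx n) \<^bold>\<or> ctx n)" using pv_cut[OF pv_assoc'[OF n(2)] n(1)] .
    then have "pv (C \<^bold>\<or> ctx n)" by (rule pv_absorb)
    then show ?thesis by (auto simp: T_def)
  qed
  then show "A \<in> T \<or> C \<in> T" using T_complete[of A] assms by (auto simp: good_def)
next
  have ar: "arithmetical A" "arithmetical C" using assms by (auto simp: good_def)
  assume "A \<in> T \<or> C \<in> T"
  then show "(A \<^bold>\<or> C) \<in> T"
  proof
    assume "A \<in> T"
    then obtain n where "pv (A \<^bold>\<or> ctx n)" by (auto simp: T_def)
    then have "pv ((A \<^bold>\<or> C) \<^bold>\<or> ctx n)" using ar(2) by (rule pv_comm[OF pv_weak'[OF pv_comm]])
    then show ?thesis by (auto simp: T_def)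
  next
    assume "C \<in> T"
    then obtain n where "pv (C \<^bold>\<or> ctx n)" by (auto simp: T_def)
    then have "pv ((A \<^bold>\<or> C) \<^bold>\<or> ctx n)" using ar(1) by (rule pv_comm[OF pv_weak[OF pv_comm]])
    then show ?thesis by (auto simp: T_def)
  qed
qed

lemma T_ex: assumes "good (Ex v A)" "Ex v A \<in> T" shows "\<exists>k. subst v (Var (cv k)) A \<in> T"
proof -
  let ?F = "Ex v A"
  define n where "n = to_nat ?F"
  have c: "ctx (Suc n) = extend ?F (ctx n)" by (simp add: n_def)
  define d where "d = fresh_const (?F \<^bold>\<or> ctx n)"
  have ar: "arithmetical A" using assms by (simp add: good_def)
  have np: "\<not> pv (\<^bold>\<not> ?F \<^bold>\<or> ctx n)"
    using assms(2) T_cons[of ?F] by (auto simp: T_def)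
  have e: "ctx (Suc n) = \<^bold>\<not> subst v (Var d) A \<^bold>\<or> (\<^bold>\<not> ?F \<^bold>\<or> ctx n)"
    unfolding c using np assms(1) by (simp add: extend_def d_def)
  have "pv (subst v (Var d) A \<^bold>\<or> \<^bold>\<not> subst v (Var d) A)"
    by (rule pv_comm, rule pv_em) (simp add: ar)
  then have "pv (subst v (Var d) A \<^bold>\<or> ctx (Suc n))"
    unfolding e by (rule pv_weak') (use ctx_arith ar in auto)
  then have "subst v (Var d) A \<in> T" by (auto simp: T_def simp del: ctx.simps)
  then show ?thesis using fresh_const(3)[of "?F \<^bold>\<or> ctx n", folded d_def] by auto
qed

lemma T_ex_iff:
  assumes "good (Ex v A)" shows "Ex v A \<in> T \<longleftrightarrow> (\<exists>k. subst v (Var (cv k)) A \<in> T)"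
proof
  assume "\<exists>k. subst v (Var (cv k)) A \<in> T"
  then obtain k where k: "subst v (Var (cv k)) A \<in> T" by blast
  have "bvs A \<subseteq> B" using assms by (simp add: good_def)
  then have "free_for (Var (cv k)) v A" by (intro free_for_bvs) (auto simp: B_def)
  then have "(subst v (Var (cv k)) A \<^bold>\<longrightarrow> Ex v A) \<in> T"
    using assms by (intro T_pv pv_inst) (auto simp: good_def)
  then show "Ex v A \<in> T" using T_mp k by blast
qed (use T_ex assms in blast)

lemma T_logical: "A \<in> logical_axioms \<Longrightarrow> arithmetical A \<Longrightarrow> A \<in> T"
  by (intro T_pv provable.logical) (auto simp: L_PA_iff)

lemma T_refl: "t \<doteq> t \<in> T"
  by (rule T_logical[OF logical_axioms.identity]) simp

lemma T_eqeq: "s \<doteq> t \<in> T \<Longrightarrow> s' \<doteq> t' \<in> T \<Longrightarrow> s \<doteq> s' \<in> T \<Longrightarrow> t \<doteq> t' \<in> T"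
  by (rule T_mp, assumption, rule T_mp, assumption, rule T_mp, assumption,
      rule T_logical[OF logical_axioms.eq_Eq]) simp

lemma T_sym: "s \<doteq> t \<in> T \<Longrightarrow> t \<doteq> s \<in> T"
  using T_eqeq[of s t s s] T_refl by blast

lemma T_trans: "s \<doteq> t \<in> T \<Longrightarrow> t \<doteq> r \<in> T \<Longrightarrow> s \<doteq> r \<in> T"
  using T_eqeq[of s s t r] T_refl by blast

lemma T_suc: "s \<doteq> t \<in> T \<Longrightarrow> Succ s \<doteq> Succ t \<in> T"
  by (rule T_mp, assumption, rule T_logical[OF logical_axioms.eq_Succ]) simp

lemma T_add: "s \<doteq> t \<in> T \<Longrightarrow> s' \<doteq> t' \<in> T \<Longrightarrow> s \<oplus> s' \<doteq> t \<oplus> t' \<in> T"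
  by (rule T_mp, assumption, rule T_mp, assumption, rule T_logical[OF logical_axioms.eq_Add]) simp

lemma T_mul: "s \<doteq> t \<in> T \<Longrightarrow> s' \<doteq> t' \<in> T \<Longrightarrow> s \<otimes> s' \<doteq> t \<otimes> t' \<in> T"
  by (rule T_mp, assumption, rule T_mp, assumption, rule T_logical[OF logical_axioms.eq_Mul]) simp

text \<open>\<open>Ex v (Var v \<doteq> t)\<close> follows from an identity, and its Henkin witness
  is a constant equal to \<open>t\<close>. Therefore the constants alone can form the carrier of the
  term model.\<close>

lemma T_term: assumes "infinite B" shows "\<exists>k. Var (cv k) \<doteq> t \<in> T"
proof -
  obtain v where v: "v \<in> B" "v \<notin> tvars t" using assms by (metis finite_subset finite_tvars subsetI)
  let ?A = "Var v \<doteq> t"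
  have "pv (subst v t ?A \<^bold>\<longrightarrow> Ex v ?A)" by (rule pv_inst) auto
  then have "(t \<doteq> t \<^bold>\<longrightarrow> Ex v ?A) \<in> T" using v by (intro T_pv) (simp add: tsubst_idle)
  then have "Ex v ?A \<in> T" using T_mp T_refl by blast
  then obtain k where "subst v (Var (cv k)) ?A \<in> T" using T_ex[of v ?A] v by (auto simp: good_def)
  then show ?thesis using v by (auto simp: tsubst_idle)
qed

definition cn :: "tm \<Rightarrow> nat" where "cn t = (SOME k. Var (cv k) \<doteq> t \<in> T)"

definition I :: "nat str" where
  "I = \<lparr>zer = cn Zero, suc = \<lambda>x. cn (Succ (Var (cv x))),
     plu = \<lambda>x y. cn (Var (cv x) \<oplus> Var (cv y)), tim = \<lambda>x y. cn (Var (cv x) \<otimes> Var (cv y)),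
     equ = \<lambda>x y. Var (cv x) \<doteq> Var (cv y) \<in> T\<rparr>"

context assumes infB: "infinite B"
begin

lemma cn: "Var (cv (cn t)) \<doteq> t \<in> T"
  unfolding cn_def using someI_ex[OF T_term[OF infB]] .

lemma cn_cong: "s \<doteq> t \<in> T \<Longrightarrow> Var (cv (cn s)) \<doteq> Var (cv (cn t)) \<in> T"
  using cn T_trans T_sym by blast

lemma congS_I: "congS I"
  unfolding congS_def I_def
  by (auto intro: T_refl T_sym T_trans cn_cong T_suc T_add T_mul)

lemma tval_I: "Var (cv (tval I e t)) \<doteq> rnt (cv \<circ> e) t \<in> T"
proof (induction t)
  case (Var v)
  then show ?case by (simp add: T_refl)
next
  case Zero
  then show ?case using cn by (simp add: I_def)
next
  case (Succ t)
  have "tval I e (Succ t) = cn (Succ (Var (cv (tval I e t))))" by (simp add: I_def)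
  then show ?case using T_trans[OF cn T_suc[OF Succ]] by simp
next
  case (Add s t)
  have "tval I e (s \<oplus> t) = cn (Var (cv (tval I e s)) \<oplus> Var (cv (tval I e t)))" by (simp add: I_def)
  then show ?case using T_trans[OF cn T_add[OF Add]] by simp
next
  case (Mul s t)
  have "tval I e (s \<otimes> t) = cn (Var (cv (tval I e s)) \<otimes> Var (cv (tval I e t)))" by (simp add: I_def)
  then show ?case using T_trans[OF cn T_mul[OF Mul]] by simp
qed

lemma truth: "good A \<Longrightarrow> sata I e A \<longleftrightarrow> msub (cv \<circ> e) A \<in> T"
proof (induction A arbitrary: e)
  case (Eq s t)
  have "equ I x y \<longleftrightarrow> Var (cv x) \<doteq> Var (cv y) \<in> T" for x y by (simp add: I_def)
  then show ?case using tval_I[of e s] tval_I[of e t] T_sym T_trans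
    unfolding sat.simps msub.simps by meson
next
  case (Tr s t)
  then show ?case by (simp add: good_def)
next
  case (Neg A)
  then have g: "good A" by (simp add: good_def)
  then have "good (msub (cv \<circ> e) A)" by (simp add: good_def)
  then show ?case unfolding sat.simps msub.simps Neg.IH[OF g] by (simp only: T_neg not_not)
next
  case (Or A C)
  then have g: "good A" "good C" by (auto simp: good_def)
  then have "good (msub (cv \<circ> e) A \<^bold>\<or> msub (cv \<circ> e) C)" by (simp add: good_def)
  then show ?case unfolding sat.simps msub.simps Or.IH(1)[OF g(1)] Or.IH(2)[OF g(2)]
    by (simp only: T_or)
next
  case (Ex v A)
  then have g: "good A" "v \<in> B" by (auto simp: good_def)
  have "good (Ex v (msub ((cv \<circ> e)(v := v)) A))" using g by (auto simp: good_def)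
  note * = T_ex_iff[OF this]
  have "subst v (Var (cv k)) (msub ((cv \<circ> e)(v := v)) A) = msub ((cv \<circ> e)(v := cv k)) A" for k
    by (rule subst_msub) (use g(2) in \<open>auto simp: B_def\<close>)
  moreover have "(cv \<circ> e)(v := cv k) = cv \<circ> e(v := k)" for k by auto
  ultimately show ?case unfolding sat.simps msub.simps * Ex.IH[OF g(1)] by (simp only:)
qed

text \<open>That \<open>A\<close> belongs to \<open>T\<close> says nothing about the instances of
  \<open>A\<close> to which \<open>truth\<close> refers, since the free variables in
  \<open>B\<close> are not constants. They are bound one after the other by \<open>pv_gen\<close>,
  and the quantifiers so obtained are instantiated semantically.\<close>

lemma provable_true: assumes "pv A" "good A" "fv A \<subseteq> B" shows "sata I e A"
proof -
  have "\<forall>A. pv A \<longrightarrow> good A \<longrightarrow> fv A \<subseteq> S \<longrightarrow> S \<subseteq> B \<longrightarrow> (\<forall>e. sata I e A)" if "finite S" for S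
    using that
  proof (induction S)
    case empty
    show ?case
    proof clarify
      fix A e assume A: "pv A" "good A" "fv A \<subseteq> {}"
      have "msub (cv \<circ> e) A = A" by (rule msub_idle) (use A in auto)
      then show "sata I e A" using truth[OF A(2)] T_pv[OF A(1)] by simp
    qed
  next
    case (insert v S)
    show ?case
    proof (intro allI impI)
      fix A e assume A: "pv A" "good A" "fv A \<subseteq> insert v S" "insert v S \<subseteq> B"
      have "good (All v A)" "fv (All v A) \<subseteq> S" "S \<subseteq> B" using A by (auto simp: good_def)
      then have "sata I e (All v A)" using insert.IH pv_gen[OF A(1)] by blast
      then have "sata I (e(v := e v)) A" unfolding sat.simps by blast
      then show "sata I e A" by simp
    qed
  qed
  then show ?thesis using assms finite_fv by blast
qed

end

end

lemma free_for_self: "tvars t \<subseteq> {v} \<Longrightarrow> free_for t v A"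
  by (induction A) auto

lemma sat_induction_axiom:
  "sat I T e (induction_axiom v A) \<longleftrightarrow>
    (sat I T (e(v := zer I)) A \<longrightarrow> (\<forall>x. sat I T (e(v := x)) A \<longrightarrow> sat I T (e(v := suc I x)) A)
      \<longrightarrow> (\<forall>x. sat I T (e(v := x)) A))"
proof -
  have z: "sat I T e' (subst v Zero A) = sat I T (e'(v := zer I)) A" for e'
    using sat_subst[OF free_for_self[of Zero v A]] by simp
  have s: "sat I T e' (subst v (Succ (Var v)) A) = sat I T (e'(v := suc I (e' v))) A" for e'
    using sat_subst[OF free_for_self[of "Succ (Var v)" v A]] by simp
  show ?thesis unfolding induction_axiom_def sat.simps z s fun_upd_upd fun_upd_same by blast
qed

theorem completeness:
  assumes "arithmetical A" "fv A = {}" "\<not> pv A"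
  shows "\<exists>I :: nat str. congS I \<and> (\<forall>C\<in>PA. \<forall>e. sata I e C) \<and> (\<forall>e. \<not> sata I e A)"
proof -
  define b where "b = Suc (Max (insert 0 (bvs A)))"
  \<comment> \<open>The constants are odd numbers above \<open>2 * b\<close>. All even numbers
    remain for \<open>B\<close>, which is therefore infinite, and so does everything below
    \<open>2 * b\<close>: in particular the bound variables of \<open>A\<close> and the variables 0
    and 1 of the axioms of PA.\<close>
  define cv where "cv k = 2 * (k + b) + 1" for k
  have bA: "u < b" if "u \<in> bvs A" for u
    using that by (simp add: b_def less_Suc_eq_le)
  interpret henkin A cv "- range cv"
    by unfold_locales (use assms in \<open>auto simp: cv_def inj_def\<close>)
  have ev: "2 * n \<in> - range cv" for n unfolding cv_def by auto presburger
  have sm: "n < 2 * b \<Longrightarrow> n \<in> - range cv" for n unfolding cv_def by auto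
  have inf: "infinite (- range cv)"
  proof
    assume "finite (- range cv)"
    moreover have "range (\<lambda>n::nat. 2 * n) \<subseteq> - range cv" by (rule image_subsetI) (rule ev)
    ultimately have "finite (range (\<lambda>n::nat. 2 * n))" by (rule rev_finite_subset)
    then show False using finite_imageD[of "\<lambda>n::nat. 2 * n" UNIV] by (auto simp: inj_def)
  qed
  have b0: "0 < b" by (simp add: b_def)
  \<comment> \<open>Some variables of \<open>C\<close> may serve as constants. Doubling all of them
    yields an induction axiom whose variables lie in \<open>B\<close>, and the assignment
    \<open>e'\<close> undoes the doubling.\<close>
  have ind: "sata I e (induction_axiom v C)" if C: "arithmetical C" for C v e
  proof -
    define r where "r = (\<lambda>n::nat. 2 * n)"
    have inj: "inj r" by (auto simp: r_def inj_def)
    define e' where "e' n = e (n div 2)" for n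
    have e': "e'(r v := x) \<circ> r = e(v := x)" for x
      by (auto simp: e'_def r_def fun_eq_iff)
    have bv: "bvs (rn r C) \<subseteq> range r" by (induction C) auto
    have tv: "tvars (rnt r t) \<subseteq> range r" for t by (induction t) auto
    then have fvr: "fv (rn r C) \<subseteq> range r" by (induction C) auto
    have rB: "range r \<subseteq> - range cv" using ev by (auto simp: r_def)
    let ?D = "induction_axiom (r v) (rn r C)"
    have fs: "fv (subst (r v) t (rn r C)) \<subseteq> range r" if "tvars t \<subseteq> range r" for t
      using fv_subst[of "r v" t "rn r C"] that fvr by auto
    have "?D \<in> PA" using C by (intro PA.induction) (simp add: L_PA_iff)
    then have "pv ?D" by (rule provable.nonlogical)
        (use C in \<open>simp add: L_PA_iff induction_axiom_def\<close>)
    moreover have "good ?D"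
      using C bv rB by (auto simp: good_def induction_axiom_def)
    moreover have "fv ?D \<subseteq> range r"
      using fs[of Zero] fs[of "Succ (Var (r v))"] fvr
      unfolding induction_axiom_def fv.simps tvars.simps by blast
    then have "fv ?D \<subseteq> - range cv" using rB by (rule subset_trans)
    ultimately have "sata I e' ?D" using provable_true inf by blast
    then show ?thesis unfolding sat_induction_axiom sat_rn[OF inj] e' .
  qed
  have "sata I e C" if "C \<in> PA" for C e
  proof -
    have 01: "{0, Suc 0} \<subseteq> - range cv" using sm b0 by auto
    from that have "(\<exists>D v. arithmetical D \<and> C = induction_axiom v D)
        \<or> arithmetical C \<and> bvs C = {} \<and> fv C \<subseteq> {0, Suc 0}"
      by cases (auto simp: L_PA_iff)
    then show ?thesis
    proof
      assume C: "arithmetical C \<and> bvs C = {} \<and> fv C \<subseteq> {0, Suc 0}"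
      then have "pv C" using that by (auto intro: provable.nonlogical simp: L_PA_iff)
      then show ?thesis by (rule provable_true[OF inf])
          (use C subset_trans[OF _ 01, of "fv C"] in \<open>simp_all add: good_def\<close>)
    qed (use ind in blast)
  qed
  moreover have "\<not> sata I e A" for e
  proof -
    have "u \<in> - range cv" if "u \<in> bvs A" for u
      using bA[OF that] by (intro sm) linarith
    then have "bvs A \<subseteq> - range cv" by (rule subsetI)
    then have g: "good A" using assms(1) by (simp add: good_def)
    have "\<^bold>\<not> A \<in> T" using pv_em[OF assms(1)] unfolding T_def by (auto intro!: exI[of _ 0])
    then have "A \<notin> T" using T_cons by blast
    moreover have "msub (cv \<circ> e) A = A" by (rule msub_idle) (use assms in auto)
    ultimately show ?thesis using truth[OF inf g] by simp
  qed
  ultimately show ?thesis using congS_I[OF inf] by blast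
qed


section \<open>A model of Peano arithmetic\<close>

text \<open>A single model of PA, in which a counterexample to the theorem fails if there is one. As
  it is a type, its elements can be given the usual arithmetical type classes.\<close>

definition bad :: "fm \<Rightarrow> bool" where
  "bad A \<longleftrightarrow> A \<in> L_PA \<and> fv A = {} \<and> provable L_PAT (PA \<union> {CT_star, DC_star}) A \<and> \<not> pv A"

definition bad_fm :: fm where "bad_fm = (SOME A. bad A)"

definition model_of_bad :: "nat str \<Rightarrow> bool" where
  "model_of_bad I \<longleftrightarrow> congS I \<and> (\<forall>C\<in>PA. \<forall>e. sata I e C)
     \<and> ((\<exists>A. bad A) \<longrightarrow> (\<forall>e. \<not> sata I e bad_fm))"

lemma ex_model_of_bad: "\<exists>I. model_of_bad I"
proof (cases "\<exists>A. bad A")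
  case True
  then have "bad bad_fm" unfolding bad_fm_def by (rule someI_ex)
  then have "\<exists>I :: nat str. congS I \<and> (\<forall>C\<in>PA. \<forall>e. sata I e C) \<and> (\<forall>e. \<not> sata I e bad_fm)"
    by (intro completeness) (auto simp: bad_def L_PA_iff)
  then show ?thesis unfolding model_of_bad_def by blast
next
  \<comment> \<open>Without a counterexample the standard model serves, as the carrier type has to
    exist in either case.\<close>
  case False
  define I where "I = \<lparr>zer = 0, suc = Suc, plu = (+), tim = (*), equ = (=)\<rparr>"
  have ind: "sata I e (induction_axiom v C)" for v C e
  proof -
    have "sata I (e(v := x)) C" if "sata I (e(v := 0)) C"
      "\<forall>x. sata I (e(v := x)) C \<longrightarrow> sata I (e(v := Suc x)) C" for x
      using that by (induction x) blast+
    moreover have "zer I = 0" "suc I = Suc" by (simp_all add: I_def)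
    ultimately show ?thesis unfolding sat_induction_axiom by (simp only:) blast
  qed
  have "sata I e C" if "C \<in> PA" for C e
    using that by cases (use ind in \<open>auto simp: I_def\<close>)
  moreover have "congS I" by (simp add: congS_def I_def)
  ultimately show ?thesis using False unfolding model_of_bad_def by blast
qed

definition KI :: "nat str" where "KI = (SOME I. model_of_bad I)"

lemma model_of_bad_KI: "model_of_bad KI"
  unfolding KI_def by (rule someI_ex[OF ex_model_of_bad])

lemma congS_KI: "congS KI" using model_of_bad_KI by (simp add: model_of_bad_def)

\<comment> \<open>The classes of ordered semirings speak of actual equality, hence the quotient in
  this one place.\<close>
quotient_type kk = nat / "equ KI"
  by (rule equivpI) (auto intro!: reflpI sympI transpI intro: equ_refl[OF congS_KI]
      equ_sym[OF congS_KI] equ_trans[OF congS_KI])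

instantiation kk :: "{zero, one, plus, times, minus, ord}"
begin

lift_definition zero_kk :: kk is "zer KI" .
lift_definition one_kk :: kk is "suc KI (zer KI)" .
lift_definition plus_kk :: "kk \<Rightarrow> kk \<Rightarrow> kk" is "plu KI" by (rule equ_plu[OF congS_KI])
lift_definition times_kk :: "kk \<Rightarrow> kk \<Rightarrow> kk" is "tim KI" by (rule equ_tim[OF congS_KI])

definition less_eq_kk :: "kk \<Rightarrow> kk \<Rightarrow> bool" where "less_eq_kk x y \<longleftrightarrow> (\<exists>z. y = x + z)"
definition less_kk :: "kk \<Rightarrow> kk \<Rightarrow> bool" where "less_kk x y \<longleftrightarrow> x \<le> y \<and> x \<noteq> y"
definition minus_kk :: "kk \<Rightarrow> kk \<Rightarrow> kk" where
  "minus_kk x y = (if y \<le> x then SOME z. x = y + z else 0)"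

instance ..

end

lift_definition sucK :: "kk \<Rightarrow> kk" is "suc KI" by (rule equ_suc[OF congS_KI])

definition K :: "kk str" where
  "K = \<lparr>zer = 0, suc = sucK, plu = (+), tim = (*), equ = (=)\<rparr>"

lemma K_sel [simp]: "zer K = 0" "suc K = sucK" "plu K = (+)" "tim K = (*)" "equ K = (=)"
  by (simp_all add: K_def)

lemma congS_K: "congS K"
  by (simp add: congS_def)

lemma tval_K: "tval K (abs_kk \<circ> e) t = abs_kk (tval KI e t)"
  by (induction t) (simp_all add: zero_kk_def sucK.abs_eq plus_kk.abs_eq times_kk.abs_eq)

lemma abs_kk_ex: "\<exists>n. x = abs_kk n"
  by (metis Quotient_abs_rep Quotient_kk)

lemma sat_K: "arithmetical A \<Longrightarrow> sata K (abs_kk \<circ> e) A = sata KI e A"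
proof (induction A arbitrary: e)
  case (Ex v A)
  have "(abs_kk \<circ> e)(v := abs_kk n) = abs_kk \<circ> e(v := n)" for n by auto
  then have *: "(\<exists>x. sata K ((abs_kk \<circ> e)(v := x)) A) = (\<exists>n. sata K (abs_kk \<circ> e(v := n)) A)"
    by (metis abs_kk_ex)
  have ar: "arithmetical A" using Ex.prems by simp
  show ?case unfolding sat.simps * Ex.IH[OF ar] ..
next
  case (Eq s t)
  show ?case unfolding sat.simps tval_K by (simp add: kk.abs_eq_iff)
next
  case (Or A B)
  then show ?case by (simp only: sat.simps arithmetical.simps)
next
  case (Neg A)
  then show ?case by (simp only: sat.simps arithmetical.simps not_not)
qed simp

lemma env_abs: "\<exists>e'. e = abs_kk \<circ> e'"
  using abs_kk_ex by (metis (full_types) comp_apply ext choice)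

lemma PA_arith: "C \<in> PA \<Longrightarrow> arithmetical C"
  by (cases rule: PA.cases) (auto simp: L_PA_iff induction_axiom_def)

lemma PA_K: "C \<in> PA \<Longrightarrow> sata K e C"
  using env_abs[of e] sat_K[OF PA_arith, of C] model_of_bad_KI by (auto simp: model_of_bad_def)

lemma bad_K: assumes "bad A" shows "bad bad_fm" "\<not> sata K e bad_fm"
proof -
  show b: "bad bad_fm" unfolding bad_fm_def using assms by (rule someI)
  then have ar: "arithmetical bad_fm" by (simp add: bad_def L_PA_iff)
  obtain e' where e': "e = abs_kk \<circ> e'" using env_abs by blast
  show "\<not> sata K e bad_fm" unfolding e' sat_K[OF ar]
    using model_of_bad_KI assms unfolding model_of_bad_def by blast
qed

lemma fm_induct:
  assumes "arithmetical A" "sata K (e(v := 0)) A"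
    "\<And>x. sata K (e(v := x)) A \<Longrightarrow> sata K (e(v := sucK x)) A"
  shows "sata K (e(v := x)) A"
proof -
  have "sata K e (induction_axiom v A)"
    using assms(1) by (intro PA_K PA.induction) (simp add: L_PA_iff)
  then show ?thesis using assms(2,3) unfolding sat_induction_axiom K_sel by blast
qed

section \<open>The ordered semiring of the model\<close>

lemma sucK_nonzero: "sucK x \<noteq> 0"
  using PA_K[OF PA.Succ_nonzero, of "\<lambda>_. x"] by simp
lemma sucK_inj: "sucK x = sucK y \<Longrightarrow> x = y"
  using PA_K[OF PA.Succ_inject, of "\<lambda>n. if n = 0 then x else y"] by simp
lemma add_0K: "x + 0 = (x :: kk)"
  using PA_K[OF PA.Add_Zero, of "\<lambda>_. x"] by simp
lemma add_sucK: "x + sucK y = sucK (x + y)"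
  using PA_K[OF PA.Add_Succ, of "\<lambda>n. if n = 0 then x else y"] by simp
lemma mul_0K: "x * 0 = (0 :: kk)"
  using PA_K[OF PA.Mul_Zero, of "\<lambda>_. x"] by simp
lemma mul_sucK: "x * sucK y = x * y + x"
  using PA_K[OF PA.Mul_Succ, of "\<lambda>n. if n = 0 then x else y"] by simp

lemma sucK_eq: "sucK x = x + 1"
proof -
  have "1 = sucK 0" by (simp add: one_kk_def sucK.abs_eq zero_kk_def)
  then show ?thesis using add_sucK[of x 0] by (simp add: add_0K)
qed

text \<open>At this point an instance of induction has to be given by an explicit formula. For the
  semiring laws an equation of terms is enough.\<close>

lemma Kind_eq:
  assumes "tval K (e(v := 0)) s = tval K (e(v := 0)) t"
    "\<And>x. tval K (e(v := x)) s = tval K (e(v := x)) t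
      \<Longrightarrow> tval K (e(v := sucK x)) s = tval K (e(v := sucK x)) t"
  shows "tval K (e(v := x)) s = tval K (e(v := x)) t"
  using fm_induct[of "s \<doteq> t" e v x] assms by simp

lemma add_0K': "0 + x = (x :: kk)"
  using Kind_eq[of "\<lambda>_. 0" 0 "Zero \<oplus> Var 0" "Var 0" x] by (simp add: add_0K add_sucK)

lemma add_sucK': "sucK x + y = sucK (x + y)"
  using Kind_eq[of "\<lambda>_. x" 0 "Succ (Var 1) \<oplus> Var 0" "Succ (Var 1 \<oplus> Var 0)" y]
  by (simp add: add_0K add_sucK)

lemma add_commK: "x + y = y + (x :: kk)"
  using Kind_eq[of "\<lambda>_. x" 0 "Var 1 \<oplus> Var 0" "Var 0 \<oplus> Var 1" y]
  by (simp add: add_0K add_sucK add_0K' add_sucK')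

lemma add_assocK: "(x + y) + z = x + (y + (z :: kk))"
  using Kind_eq[of "\<lambda>n. if n = 1 then x else y" 0
      "(Var 1 \<oplus> Var 2) \<oplus> Var 0" "Var 1 \<oplus> (Var 2 \<oplus> Var 0)" z]
  by (simp add: add_0K add_sucK)

lemma mul_0K': "0 * x = (0 :: kk)"
  using Kind_eq[of "\<lambda>_. 0" 0 "Zero \<otimes> Var 0" "Zero" x] by (simp add: mul_0K mul_sucK add_0K)

lemma mul_sucK': "sucK x * y = x * y + y"
proof -
  have "sucK x * y + sucK x = (x * y + x) + sucK y" if "sucK x * y = x * y + y" for y
    unfolding that add_sucK by (metis add_assocK add_commK)
  then show ?thesis
  using Kind_eq[of "\<lambda>_. x" 0 "Succ (Var 1) \<otimes> Var 0" "Var 1 \<otimes> Var 0 \<oplus> Var 0" y]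
  by (simp add: mul_0K mul_sucK add_0K)
qed

lemma mul_commK: "x * y = y * (x :: kk)"
  using Kind_eq[of "\<lambda>_. x" 0 "Var 1 \<otimes> Var 0" "Var 0 \<otimes> Var 1" y]
  by (simp add: mul_0K mul_sucK mul_0K' mul_sucK')

lemma distribK: "x * (y + z) = x * y + x * (z :: kk)"
  using Kind_eq[of "\<lambda>n. if n = 1 then x else y" 0
      "Var 1 \<otimes> (Var 2 \<oplus> Var 0)" "Var 1 \<otimes> Var 2 \<oplus> Var 1 \<otimes> Var 0" z]
  by (simp add: mul_0K mul_sucK add_0K add_sucK add_assocK)

lemma mul_assocK: "(x * y) * z = x * (y * (z :: kk))"
  using Kind_eq[of "\<lambda>n. if n = 1 then x else y" 0
      "(Var 1 \<otimes> Var 2) \<otimes> Var 0" "Var 1 \<otimes> (Var 2 \<otimes> Var 0)" z]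
  by (simp add: mul_0K mul_sucK distribK)

lemma add_cancelK: "x + z = y + z \<Longrightarrow> x = (y :: kk)"
  using fm_induct[of "Var 1 \<oplus> Var 0 \<doteq> Var 2 \<oplus> Var 0 \<^bold>\<longrightarrow> Var 1 \<doteq> Var 2"
      "\<lambda>n. if n = 1 then x else y" 0 z]
  by (simp add: add_0K add_sucK) (metis sucK_inj)

lemma casesK: "x = 0 \<or> (\<exists>y. x = sucK y)"
  using fm_induct[of "Var 0 \<doteq> Zero \<^bold>\<or> Ex 1 (Var 0 \<doteq> Succ (Var 1))" "\<lambda>_. 0" 0 x] by auto

lemma add_eq_0K: "x + y = 0 \<Longrightarrow> y = (0 :: kk)"
  using casesK[of y] add_sucK sucK_nonzero by metis

lemma linearK: "(\<exists>z. y = x + z) \<or> (\<exists>z. x = y + (z :: kk))"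
proof -
  have "sata K ((\<lambda>_. y)(0 := x)) (Ex 2 (Var 1 \<doteq> Var 0 \<oplus> Var 2) \<^bold>\<or> Ex 2 (Var 0 \<doteq> Var 1 \<oplus> Var 2))"
  proof (rule fm_induct, goal_cases)
    case 2
    then show ?case by (auto simp: add_0K')
  next
    case (3 u)
    have "sucK u = y + sucK z" if "u = y + z" for z by (simp add: that add_sucK)
    moreover have "(\<exists>w. y = sucK u + w) \<or> sucK u = y + sucK 0" if "y = u + z" for z
      using casesK[of z] that by (auto simp: add_sucK add_sucK' add_0K)
    ultimately show ?case using 3 by simp blast
  qed simp
  then show ?thesis by simp
qed

lemma diffK: "(x + y) - x = (y :: kk)"
proof -
  have "(SOME z. x + y = x + z) = y"
    by (rule some_equality) (auto dest: add_cancelK simp: add_commK[of x])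
  moreover have "x \<le> x + y" by (auto simp: less_eq_kk_def)
  ultimately show ?thesis by (simp add: minus_kk_def)
qed

lemma leK_antisym: "x \<le> y \<Longrightarrow> y \<le> x \<Longrightarrow> x = (y :: kk)"
proof -
  assume "x \<le> y" "y \<le> x"
  then obtain a b where y: "y = x + a" and x: "x = y + b" by (auto simp: less_eq_kk_def)
  then have "0 + x = (a + b) + x" by (metis add_0K' add_assocK add_commK)
  then have "a + b = 0" using add_cancelK by metis
  then have "b = 0" by (rule add_eq_0K)
  then show "x = y" using x by (simp add: add_0K)
qed

lemma not_le_diffK: "\<not> y \<le> x \<Longrightarrow> x - y = (0 :: kk)"
  by (simp add: minus_kk_def)

instance kk :: "{linordered_semidom, ordered_cancel_comm_monoid_diff}"
proof
  fix a b c :: kk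
  show "a + b + c = a + (b + c)" by (rule add_assocK)
  show "a + b = b + a" by (rule add_commK)
  show "0 + a = a" by (rule add_0K')
  show "a * b * c = a * (b * c)" by (rule mul_assocK)
  show "a * b = b * a" by (rule mul_commK)
  show "1 * a = a" using mul_sucK'[of 0 a] by (simp add: sucK_eq add_0K' mul_0K')
  show "(a + b) * c = a * c + b * c" by (metis distribK mul_commK)
  show "(0::kk) \<noteq> 1" using sucK_nonzero[of 0] by (simp add: sucK_eq add_0K')
  show "0 * a = 0" by (rule mul_0K')
  show "a * 0 = 0" by (rule mul_0K)
  show "a * (b + c) = a * b + a * c" by (rule distribK)
  show "a + b - a = b" by (rule diffK)
  show dd: "a - b - c = a - (b + c)" for a b c :: kk
  proof (cases "b \<le> a")
    case True
    then obtain d where d: "a = b + d" by (auto simp: less_eq_kk_def)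
    show ?thesis
    proof (cases "c \<le> d")
      case True
      then show ?thesis using d by (auto simp: less_eq_kk_def diffK add_assocK[symmetric])
    next
      case False
      have "\<not> b + c \<le> a"
      proof
        assume "b + c \<le> a"
        then obtain u where "b + d = b + c + u" using d by (auto simp: less_eq_kk_def)
        then have "d = c + u" by (metis add_assocK diffK)
        then show False using False by (auto simp: less_eq_kk_def)
      qed
      then show ?thesis using d False by (simp add: diffK not_le_diffK)
    qed
  next
    case False
    then have "\<not> b + c \<le> a" by (metis less_eq_kk_def add_assocK)
    moreover have "0 - c = 0"
    proof (cases "c = 0")
      case True
      then show ?thesis using diffK[of 0 0] by (simp add: add_0K)
    next
      case False
      then have "\<not> c \<le> 0" by (metis less_eq_kk_def add_eq_0K add_commK)
      then show ?thesis by (rule not_le_diffK)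
    qed
    ultimately show ?thesis using False by (simp add: not_le_diffK)
  qed
  show z: "0 - a = 0" for a :: kk
  proof (cases "a = 0")
    case True
    then show ?thesis using diffK[of 0 0] by (simp add: add_0K)
  next
    case False
    then have "\<not> a \<le> 0" by (metis less_eq_kk_def add_eq_0K add_commK)
    then show ?thesis by (rule not_le_diffK)
  qed
  show nz: "a \<noteq> 0 \<Longrightarrow> b \<noteq> 0 \<Longrightarrow> a * b \<noteq> 0" for a b :: kk
    using casesK[of a] casesK[of b] sucK_nonzero by (auto simp: mul_sucK add_sucK)
  show "a * (b - c) = a * b - a * c"
  proof (cases "c \<le> b")
    case True
    then show ?thesis by (auto simp: less_eq_kk_def diffK distribK)
  next
    case False
    then obtain d where d: "c = b + d" using linearK[of b c] by (auto simp: less_eq_kk_def)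
    then have "a * b - a * c = (a * b - a * b) - a * d" by (simp add: distribK dd)
    also have "\<dots> = 0" using diffK[of "a * b" 0] by (simp add: add_0K z)
    finally show ?thesis using False by (simp add: not_le_diffK mul_0K)
  qed
  show "a < b \<longleftrightarrow> a \<le> b \<and> \<not> b \<le> a"
    using leK_antisym by (auto simp: less_kk_def)
  show "a \<le> a" by (metis less_eq_kk_def add_0K)
  show "a \<le> b \<Longrightarrow> b \<le> c \<Longrightarrow> a \<le> c" by (metis less_eq_kk_def add_assocK)
  show "a \<le> b \<Longrightarrow> b \<le> a \<Longrightarrow> a = b" by (rule leK_antisym)
  show "a \<le> b \<or> b \<le> a" using linearK by (auto simp: less_eq_kk_def)
  show "a \<le> b \<Longrightarrow> c + a \<le> c + b" by (metis less_eq_kk_def add_assocK)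
  show "a \<le> b \<longleftrightarrow> (\<exists>c. b = a + c)" by (rule less_eq_kk_def)
  show "c + a \<le> c + b \<Longrightarrow> a \<le> b"
    by (metis less_eq_kk_def add_assocK diffK)
  show "(0::kk) < 1" using sucK_nonzero[of 0]
    by (auto simp: less_kk_def less_eq_kk_def sucK_eq add_0K')
  show "b \<le> a \<Longrightarrow> a - b + b = a" by (metis less_eq_kk_def diffK add_commK)
  show "a < b \<Longrightarrow> 0 < c \<Longrightarrow> c * a < c * b"
  proof -
    assume "a < b" "0 < c"
    then obtain d where b: "b = a + d" unfolding less_kk_def less_eq_kk_def by (elim conjE exE)
    have ab: "a \<noteq> b" and c0: "c \<noteq> 0" using \<open>a < b\<close> \<open>0 < c\<close> by (simp_all add: less_kk_def)
    have d0: "d \<noteq> 0" using b ab add_0K[of a] by auto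
    note d = b d0 c0
    have "c * b = c * a + c * d" "c * d \<noteq> 0" using nz d by (auto simp: distribK)
    moreover have "c * a \<noteq> c * a + c * d"
      using \<open>c * d \<noteq> 0\<close> diffK[of "c * a" "c * d"] diffK[of "c * a" 0] by (auto simp: add_0K)
    ultimately show ?thesis by (auto simp: less_kk_def less_eq_kk_def)
  qed
qed

lemma less_iff_add1: "x < y \<longleftrightarrow> x + 1 \<le> (y :: kk)"
proof
  assume "x < y"
  then obtain d where d: "y = x + d" "d \<noteq> 0" by (auto simp: less_kk_def less_eq_kk_def)
  then obtain u where "d = sucK u" using casesK by blast
  then have "y = (x + 1) + u" using d by (simp add: sucK_eq algebra_simps)
  then show "x + 1 \<le> y" by (metis less_eq_kk_def)
next
  assume "x + 1 \<le> y"
  then show "x < y" by (meson less_add_one less_le_trans)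
qed

lemma le_iff_less1: "x \<le> y \<longleftrightarrow> x < y + (1 :: kk)"
  by (simp add: less_iff_add1)

lemma less_add1_iff: "x < y + 1 \<longleftrightarrow> x < y \<or> x = (y :: kk)"
  by (metis le_iff_less1 le_less)

lemma kk_cases: "x = 0 \<or> (\<exists>y. x = y + (1 :: kk))"
  using casesK[of x] by (simp add: sucK_eq)


section \<open>Definable predicates of the model\<close>

definition prk :: "kk \<Rightarrow> kk \<Rightarrow> kk" where "prk x y = (x + y) * (x + y) + x"

lemma tval_pr [simp]: "tval K e (pr s t) = prk (tval K e s) (tval K e t)"
  by (simp add: pr_def prk_def)

text \<open>\<open>prk x y\<close> lies between the square of \<open>x + y\<close> and the next
  square, because the excess \<open>x\<close> is at most \<open>x + y\<close>.\<close>

lemma prk_sum_less: assumes "x + y < u + v" shows "prk x y < prk u v"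
proof -
  have s: "x + y + 1 \<le> u + v" using assms by (simp add: less_iff_add1)
  have "prk x y \<le> (x + y) * (x + y) + (x + y)" by (simp add: prk_def)
  also have "\<dots> < (x + y) * (x + y) + (x + y) + (x + y + 1)"
    using le_less_trans[OF zero_le less_add_one, of "x + y"] by (simp only: less_add_same_cancel1)
  also have "\<dots> = (x + y + 1) * (x + y + 1)" by (simp add: algebra_simps)
  also have "\<dots> \<le> (u + v) * (u + v)" using s by (intro mult_mono) auto
  also have "\<dots> \<le> prk u v" by (simp add: prk_def)
  finally show ?thesis .
qed

lemma prk_inj: assumes "prk x y = prk u v" shows "x = u \<and> y = v"
proof -
  have s: "x + y = u + v"
    using prk_sum_less[of x y u v] prk_sum_less[of u v x y] assms
    by (cases "x + y" "u + v" rule: linorder_cases) auto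
  then have "x = u" using assms by (simp add: prk_def)
  then show ?thesis using s by simp
qed

lemma prk_eq [simp]: "prk x y = prk u v \<longleftrightarrow> x = u \<and> y = v"
  using prk_inj by blast

lemma square_ge: "x \<le> x * (x :: kk)"
proof (cases "x = 0")
  case False
  then have "1 \<le> x" using kk_cases[of x] by auto
  then show ?thesis using mult_left_mono[of 1 x x] by simp
qed simp

lemma le_prk: "x \<le> prk x y" "y \<le> prk x y"
proof -
  show "x \<le> prk x y" by (simp add: prk_def)
  have "y \<le> x + y" by simp
  also have "\<dots> \<le> (x + y) * (x + y)" by (rule square_ge)
  also have "\<dots> \<le> prk x y" by (simp add: prk_def)
  finally show "y \<le> prk x y" .
qed

lemma less_prk: "0 < x \<Longrightarrow> y < prk x y"
  by (rule le_less_trans[OF order_trans[OF _ square_ge[of "x + y"]]]) (simp_all add: prk_def)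

lemma prk_00 [simp]: "prk 0 0 = 0" by (simp add: prk_def)

definition \<pi>1 :: "kk \<Rightarrow> kk" where "\<pi>1 z = (if \<exists>x y. z = prk x y then THE x. \<exists>y. z = prk x y else 0)"
definition \<pi>2 :: "kk \<Rightarrow> kk" where "\<pi>2 z = (if \<exists>x y. z = prk x y then THE y. \<exists>x. z = prk x y else 0)"

lemma proj [simp]: "\<pi>1 (prk x y) = x" "\<pi>2 (prk x y) = y"
  unfolding \<pi>1_def \<pi>2_def by (auto intro!: the_equality)

lemma proj_0 [simp]: "\<pi>1 0 = 0" "\<pi>2 0 = 0"
  using proj[of 0 0] by simp_all

subsection \<open>Closure properties\<close>

text \<open>Definability is with parameters. A predicate with several arguments is treated as a predicate
  of one argument that is a pair: hence quantifiers are introduced by projections.\<close>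

definition D2 :: "(kk \<Rightarrow> kk \<Rightarrow> bool) \<Rightarrow> bool" where
  "D2 R \<longleftrightarrow> (\<exists>A e. arithmetical A \<and> (\<forall>x y. R x y = sata K (e(0 := x, 1 := y)) A))"

definition df :: "(kk \<Rightarrow> bool) \<Rightarrow> bool" where "df P \<longleftrightarrow> D2 (\<lambda>x y. P x)"
definition dt :: "(kk \<Rightarrow> kk) \<Rightarrow> bool" where "dt f \<longleftrightarrow> D2 (\<lambda>x y. y = f x)"

text \<open>The two arguments go to positions \<open>i\<close> and \<open>j\<close> below 4, the
  parameters to positions from 4 on whose parity is \<open>s\<close>. Two formulas with different
  parities can then share an assignment without sharing parameters, and the other positions below 4
  are free for quantified variables.\<close>

definition slot :: "nat \<Rightarrow> nat \<Rightarrow> nat \<Rightarrow> nat \<Rightarrow> nat" where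
  "slot s i j n = (if n = 0 then i else if n = 1 then j else 2 * n + s)"

definition slotted :: "(nat \<Rightarrow> kk) \<Rightarrow> (nat \<Rightarrow> nat \<Rightarrow> fm) \<Rightarrow> (kk \<Rightarrow> kk \<Rightarrow> bool) \<Rightarrow> bool" where
  "slotted e AR R \<longleftrightarrow> (\<forall>i j. arithmetical (AR i j)) \<and>
     (\<forall>e' i j. i \<noteq> j \<longrightarrow> i < 4 \<longrightarrow> j < 4 \<longrightarrow> (\<forall>n\<ge>4. e' n = e n) \<longrightarrow> sata K e' (AR i j) = R (e' i) (e' j))"

lemma slotted_sat: "slotted e AR R \<Longrightarrow> i \<noteq> j \<Longrightarrow> i < 4 \<Longrightarrow> j < 4 \<Longrightarrow> \<forall>n\<ge>4. e' n = e n \<Longrightarrow>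
    sata K e' (AR i j) = R (e' i) (e' j)"
  unfolding slotted_def by blast

lemma slotted_arith: "slotted e AR R \<Longrightarrow> arithmetical (AR i j)"
  unfolding slotted_def by blast

lemma D2_slots:
  assumes "D2 R" "D2 S"
  shows "\<exists>e AR AS. slotted e AR R \<and> slotted e AS S"
proof -
  from assms obtain A eA B eB where A: "arithmetical A" "\<And>x y. R x y = sata K (eA(0 := x, 1 := y)) A"
    and B: "arithmetical B" "\<And>x y. S x y = sata K (eB(0 := x, 1 := y)) B"
    unfolding D2_def by auto
  define e where "e n = (if even n then eA (n div 2) else eB (n div 2))" for n
  have inj: "inj (slot s i j)" if "i \<noteq> j" "i < 4" "j < 4" "s < 2" for s i j
    using that unfolding inj_def slot_def by (auto split: if_splits)
  have A': "e' \<circ> slot 0 i j = eA(0 := e' i, 1 := e' j)"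
    and B': "e' \<circ> slot 1 i j = eB(0 := e' i, 1 := e' j)" if e': "\<forall>n\<ge>4. e' n = e n" for i j e'
  proof -
    have "(e' \<circ> slot 0 i j) n = (eA(0 := e' i, 1 := e' j)) n
        \<and> (e' \<circ> slot 1 i j) n = (eB(0 := e' i, 1 := e' j)) n" for n
    proof -
      consider "n = 0" | "n = 1" | "2 \<le> n" by linarith
      then show ?thesis
      proof cases
        case 3
        then have "e' (2 * n) = e (2 * n)" "e' (2 * n + 1) = e (2 * n + 1)"
          using e' by (metis mult_le_mono2 mult_2 numeral_Bit0 trans_le_add1)+
        then show ?thesis using 3 by (simp add: slot_def e_def)
      qed (simp_all add: slot_def)
    qed
    then show "e' \<circ> slot 0 i j = eA(0 := e' i, 1 := e' j)"
      "e' \<circ> slot 1 i j = eB(0 := e' i, 1 := e' j)" by auto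
  qed
  have "slotted e (\<lambda>i j. rn (slot 0 i j) A) R" "slotted e (\<lambda>i j. rn (slot 1 i j) B) S"
    unfolding slotted_def
  proof (safe)
    fix i j :: nat and e' assume ij: "i \<noteq> j" "i < 4" "j < 4" and e': "\<forall>n\<ge>4. e' n = e n"
    have i0: "inj (slot 0 i j)" and i1: "inj (slot 1 i j)" by (rule inj[OF ij], simp)+
    have 0: "sata K e' (rn (slot 0 i j) A) = R (e' i) (e' j)"
      unfolding sat_rn[OF i0] A'[OF e'] A(2) ..
    then show "sata K e' (rn (slot 0 i j) A) \<Longrightarrow> R (e' i) (e' j)"
      "R (e' i) (e' j) \<Longrightarrow> sata K e' (rn (slot 0 i j) A)" by blast+
    have 1: "sata K e' (rn (slot 1 i j) B) = S (e' i) (e' j)"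
      unfolding sat_rn[OF i1] B'[OF e'] B(2) ..
    then show "sata K e' (rn (slot 1 i j) B) \<Longrightarrow> S (e' i) (e' j)"
      "S (e' i) (e' j) \<Longrightarrow> sata K e' (rn (slot 1 i j) B)" by blast+
  qed (use A B in auto)
  then show ?thesis by blast
qed

lemma D2_I:
  assumes "arithmetical A" "\<And>x y. sata K (e(0 := x, 1 := y)) A = R x y" shows "D2 R"
  unfolding D2_def using assms by blast

lemma D2_not: "D2 R \<Longrightarrow> D2 (\<lambda>x y. \<not> R x y)"
  unfolding D2_def by (metis arithmetical.simps(3) sat.simps(3))

lemma D2_disj: assumes "D2 R" "D2 S" shows "D2 (\<lambda>x y. R x y \<or> S x y)"
proof -
  obtain e AR AS where s: "slotted e AR (R)" "slotted e AS (S)"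
    using D2_slots[OF assms] by blast
  note a = s[THEN slotted_arith] and s = s[THEN slotted_sat]
  show ?thesis by (rule D2_I[of "AR 0 1 \<^bold>\<or> AS 0 1" e]) (simp_all add: a s)
qed

lemma D2_comp: assumes "dt f" "D2 S" shows "D2 (\<lambda>x y. S (f x) y)"
proof -
  obtain e AR AS where s: "slotted e AR (\<lambda>x y. y = f x)" "slotted e AS (S)"
    using D2_slots[OF assms[unfolded dt_def]] by blast
  note a = s[THEN slotted_arith] and s = s[THEN slotted_sat]
  show ?thesis by (rule D2_I[of "Ex 2 (AR 0 2 \<^bold>\<and> AS 2 1)" e]) (simp_all add: a s)
qed

lemma D2_diag: assumes "D2 R" "dt f" shows "df (\<lambda>x. R x (f x))"
proof -
  obtain e AR AS where s: "slotted e AR (R)" "slotted e AS (\<lambda>x y. y = f x)"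
    using D2_slots[OF assms[unfolded dt_def]] by blast
  note a = s[THEN slotted_arith] and s = s[THEN slotted_sat]
  show ?thesis unfolding df_def
    by (rule D2_I[of "Ex 2 (AR 0 2 \<^bold>\<and> AS 0 2)" e]) (auto simp: a s)
qed

lemma D2_op:
  assumes "dt f" "dt g" "\<And>e. tval K e u = h (e 2) (e 3)"
  shows "dt (\<lambda>x. h (f x) (g x))"
proof -
  obtain e AR AS where s: "slotted e AR (\<lambda>x y. y = f x)" "slotted e AS (\<lambda>x y. y = g x)"
    using D2_slots[OF assms(1,2)[unfolded dt_def]] by blast
  note a = s[THEN slotted_arith] and s = s[THEN slotted_sat]
  show ?thesis unfolding dt_def
    by (rule D2_I[of "Ex 2 (Ex 3 ((AR 0 2 \<^bold>\<and> AS 0 3) \<^bold>\<and> Var 1 \<doteq> u))" e]) (simp_all add: a s assms(3))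
qed

named_theorems dfi

lemma dt_id [dfi]: "dt (\<lambda>x. x)"
  unfolding dt_def by (rule D2_I[of "Var 1 \<doteq> Var 0" "\<lambda>_. 0"]) auto

lemma dt_const [dfi]: "dt (\<lambda>x. c)"
  unfolding dt_def by (rule D2_I[of "Var 1 \<doteq> Var 2" "\<lambda>_. c"]) auto

lemma df_const [dfi]: "df (\<lambda>x. c)"
  unfolding df_def
  by (cases c, rule D2_I[of "Zero \<doteq> Zero"], simp, simp, rule D2_I[of "\<^bold>\<not> (Zero \<doteq> Zero)"], simp, simp)

lemma df_not [dfi]: "df P \<Longrightarrow> df (\<lambda>x. \<not> P x)"
  unfolding df_def by (rule D2_not)

lemma df_disj [dfi]: "df P \<Longrightarrow> df Q \<Longrightarrow> df (\<lambda>x. P x \<or> Q x)"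
  unfolding df_def by (rule D2_disj)

lemma df_conj [dfi]: "df P \<Longrightarrow> df Q \<Longrightarrow> df (\<lambda>x. P x \<and> Q x)"
  using df_not[OF df_disj[OF df_not df_not], of P Q] by simp

lemma df_imp [dfi]: "df P \<Longrightarrow> df Q \<Longrightarrow> df (\<lambda>x. P x \<longrightarrow> Q x)"
  unfolding imp_conv_disj by (intro df_disj df_not)

lemma df_iff [dfi]: assumes "df P" "df Q" shows "df (\<lambda>x. P x \<longleftrightarrow> Q x)"
proof -
  have "(\<lambda>x. P x \<longleftrightarrow> Q x) = (\<lambda>x. (P x \<longrightarrow> Q x) \<and> (Q x \<longrightarrow> P x))" by auto
  then show ?thesis using assms by (simp only: df_conj df_imp)
qed

lemma df_comp: "df P \<Longrightarrow> dt f \<Longrightarrow> df (\<lambda>x. P (f x))"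
  unfolding df_def using D2_comp[of f "\<lambda>x y. P x"] .

lemma df_eq [dfi]: "dt f \<Longrightarrow> dt g \<Longrightarrow> df (\<lambda>x. f x = g x)"
  using D2_diag[of "\<lambda>x y. y = g x" f] by (simp add: dt_def)

lemma dt_plus [dfi]: "dt f \<Longrightarrow> dt g \<Longrightarrow> dt (\<lambda>x. f x + g x)"
  by (rule D2_op[of _ _ "Var 2 \<oplus> Var 3"]) auto

lemma dt_times [dfi]: "dt f \<Longrightarrow> dt g \<Longrightarrow> dt (\<lambda>x. f x * g x)"
  by (rule D2_op[of _ _ "Var 2 \<otimes> Var 3"]) auto

lemma dt_prk [dfi]: "dt f \<Longrightarrow> dt g \<Longrightarrow> dt (\<lambda>x. prk (f x) (g x))"
  by (rule D2_op[of _ _ "pr (Var 2) (Var 3)"]) auto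

lemma dt_proj_aux:
  "dt \<pi>1 \<and> dt \<pi>2"
proof -
  let ?N = "\<^bold>\<not> Ex 3 (Ex 4 (Var 0 \<doteq> pr (Var 3) (Var 4))) \<^bold>\<and> Var 1 \<doteq> Zero"
  have ar: "arithmetical (Ex 2 (Var 0 \<doteq> pr (Var 1) (Var 2)) \<^bold>\<or> ?N)"
    "arithmetical (Ex 2 (Var 0 \<doteq> pr (Var 2) (Var 1)) \<^bold>\<or> ?N)" by (simp_all add: pr_def)
  have 1: "sata K ((\<lambda>_. 0)(0 := x, 1 := y)) (Ex 2 (Var 0 \<doteq> pr (Var 1) (Var 2)) \<^bold>\<or> ?N) = (y = \<pi>1 x)"
    for x y
    by (cases "\<exists>u v. x = prk u v") (auto simp: \<pi>1_def)
  have 2: "sata K ((\<lambda>_. 0)(0 := x, 1 := y)) (Ex 2 (Var 0 \<doteq> pr (Var 2) (Var 1)) \<^bold>\<or> ?N) = (y = \<pi>2 x)"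
    for x y
    by (cases "\<exists>u v. x = prk u v") (auto simp: \<pi>2_def)
  show ?thesis unfolding dt_def using D2_I[OF ar(1) 1] D2_I[OF ar(2) 2] by blast
qed

lemma dt_comp: "dt f \<Longrightarrow> dt g \<Longrightarrow> dt (\<lambda>x. f (g x))"
  unfolding dt_def[of f] dt_def[of "\<lambda>x. f (g x)"] by (rule D2_comp)

lemma dt_proj [dfi]: "dt f \<Longrightarrow> dt (\<lambda>x. \<pi>1 (f x))" "dt f \<Longrightarrow> dt (\<lambda>x. \<pi>2 (f x))"
  using dt_comp dt_proj_aux by blast+

lemma df_D2: assumes "df (\<lambda>p. R (\<pi>1 p) (\<pi>2 p))" shows "D2 R"
proof -
  obtain e AR where s: "slotted e AR (\<lambda>x y. R (\<pi>1 x) (\<pi>2 x))"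
    using D2_slots[OF assms[unfolded df_def] assms[unfolded df_def]] by blast
  note a = s[THEN slotted_arith] and s = s[THEN slotted_sat]
  show ?thesis
    by (rule D2_I[of "Ex 2 (Var 2 \<doteq> pr (Var 0) (Var 1) \<^bold>\<and> AR 2 3)" e]) (simp_all add: a s)
qed

lemma df_ex [dfi]: assumes "df (\<lambda>p. P (\<pi>1 p) (\<pi>2 p))" shows "df (\<lambda>x. \<exists>y. P x y)"
proof -
  obtain A e where A: "arithmetical A" "\<And>x y. P x y = sata K (e(0 := x, 1 := y)) A"
    using df_D2[OF assms] unfolding D2_def by auto
  have "sata K (e(0 := x, 1 := z)) (Ex 1 A) = (\<exists>y. P x y)" for x z
    unfolding sat.simps A(2) by simp
  then show ?thesis unfolding df_def by (intro D2_I[of "Ex 1 A" e]) (auto simp: A)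
qed

lemma df_all [dfi]: assumes "df (\<lambda>p. P (\<pi>1 p) (\<pi>2 p))" shows "df (\<lambda>x. \<forall>y. P x y)"
proof -
  have "df (\<lambda>x. \<not> (\<exists>y. \<not> P x y))" by (intro df_not df_ex assms)
  then show ?thesis by simp
qed

lemma dtI: assumes "df (\<lambda>p. \<pi>2 p = f (\<pi>1 p))" shows "dt f"
  unfolding dt_def using assms by (rule df_D2)

lemma df_le [dfi]: assumes "dt f" "dt g" shows "df (\<lambda>x. f x \<le> g x)"
  unfolding less_eq_kk_def
  by (rule df_ex) (intro dfi dt_comp[OF assms(1)] dt_comp[OF assms(2)])

lemma df_less [dfi]: assumes "dt f" "dt g" shows "df (\<lambda>x. f x < g x)"
  unfolding less_kk_def by (intro dfi assms)

lemma df_dvd [dfi]: assumes "dt f" "dt g" shows "df (\<lambda>x. f x dvd g x)"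
  unfolding dvd_def by (intro dfi dt_comp[OF assms(1)] dt_comp[OF assms(2)])

lemma dt_if [dfi]: assumes "df P" "dt f" "dt g" shows "dt (\<lambda>x. if P x then f x else g x)"
proof (rule dtI)
  have "(\<lambda>p. \<pi>2 p = (if P (\<pi>1 p) then f (\<pi>1 p) else g (\<pi>1 p)))
    = (\<lambda>p. (P (\<pi>1 p) \<longrightarrow> \<pi>2 p = f (\<pi>1 p)) \<and> (\<not> P (\<pi>1 p) \<longrightarrow> \<pi>2 p = g (\<pi>1 p)))" by auto
  then show "df (\<lambda>p. \<pi>2 p = (if P (\<pi>1 p) then f (\<pi>1 p) else g (\<pi>1 p)))"
    by (simp only:) (intro dfi df_comp[OF assms(1)] dt_comp[OF assms(2)] dt_comp[OF assms(3)])
qed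

lemma df_if [dfi]: assumes "df P" "df Q" "df R" shows "df (\<lambda>x. if P x then Q x else R x)"
proof -
  have "(\<lambda>x. if P x then Q x else R x) = (\<lambda>x. (P x \<longrightarrow> Q x) \<and> (\<not> P x \<longrightarrow> R x))" by auto
  then show ?thesis by (simp only:) (intro dfi assms)
qed

subsection \<open>Induction\<close>

lemma df_induct:
  assumes "df P" "P 0" "\<And>x. P x \<Longrightarrow> P (x + 1)" shows "P x"
proof -
  obtain A e where A: "arithmetical A" "\<And>x y. P x = sata K (e(0 := x, 1 := y)) A"
    using assms(1) unfolding df_def D2_def by auto
  have "e(0 := x, 1 := e 1) = e(0 := x)" for x by auto
  then have *: "P x = sata K (e(0 := x)) A" for x
    using A(2)[of x "e 1"] by (simp only:)
  show ?thesis unfolding *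
    by (rule fm_induct[OF A(1)]) (use assms(2,3) in \<open>auto simp only: *[symmetric] sucK_eq\<close>)
qed

lemma df_less_induct:
  assumes "df P" "\<And>x. (\<And>y. y < x \<Longrightarrow> P y) \<Longrightarrow> P x" shows "P x"
proof -
  have "\<forall>y<x. P y"
    by (rule df_induct[of "\<lambda>x. \<forall>y<x. P y"], intro dfi df_comp[OF assms(1)])
      (auto simp: less_add1_iff intro: assms(2))
  then show ?thesis using assms(2) by blast
qed

lemma df_least:
  assumes "df P" "P x" obtains y where "P y" "\<And>z. z < y \<Longrightarrow> \<not> P z"
proof -
  have "\<exists>y. P y \<and> (\<forall>z<y. \<not> P z)"
  proof (rule ccontr)
    assume n: "\<not> (\<exists>y. P y \<and> (\<forall>z<y. \<not> P z))"
    have "\<not> P x" by (rule df_less_induct[OF df_not[OF assms(1)]]) (use n in blast)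
    then show False using assms(2) by blast
  qed
  then show ?thesis using that by blast
qed

text \<open>The order of \<open>kk\<close> need not be well-founded, so a least element is certain
  for definable predicates only. The default 0 keeps the operator total and definable.\<close>

definition lst :: "(kk \<Rightarrow> bool) \<Rightarrow> kk" where
  "lst P = (if \<exists>y. P y \<and> (\<forall>z<y. \<not> P z) then THE y. P y \<and> (\<forall>z<y. \<not> P z) else 0)"

lemma lst_eq: assumes "P y" "\<And>z. z < y \<Longrightarrow> \<not> P z" shows "lst P = y"
proof -
  have "(THE y. P y \<and> (\<forall>z<y. \<not> P z)) = y"
    by (rule the_equality) (use assms in \<open>auto intro: linorder_cases\<close>)
  then show ?thesis using assms unfolding lst_def by auto
qed

lemma lst: assumes "df P" "P x" shows "P (lst P)"
  using df_least[OF assms] lst_eq by metis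

lemma dt_lst [dfi]: assumes "df (\<lambda>p. P (\<pi>1 p) (\<pi>2 p))" shows "dt (\<lambda>x. lst (P x))"
proof (rule dtI)
  have *: "y = lst (P x) \<longleftrightarrow> (P x y \<and> (\<forall>z<y. \<not> P x z)) \<or> (\<not> (\<exists>u. P x u \<and> (\<forall>z<u. \<not> P x z)) \<and> y = 0)"
    for x y
  proof (cases "\<exists>u. P x u \<and> (\<forall>z<u. \<not> P x z)")
    case True
    then obtain u where u: "P x u" "\<And>z. z < u \<Longrightarrow> \<not> P x z" by blast
    then show ?thesis using True lst_eq[of "P x" u, OF u] by (auto intro: lst_eq[symmetric])
  next
    case False
    then show ?thesis by (auto simp: lst_def)
  qed
  have c: "df (\<lambda>q. P (f q) (g q))" if "dt f" "dt g" for f g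
    using df_comp[OF assms, of "\<lambda>q. prk (f q) (g q)"] that by (simp add: dfi)
  show "df (\<lambda>p. \<pi>2 p = lst (P (\<pi>1 p)))" unfolding * by (intro dfi c)
qed

lemma df_comp2: "df (\<lambda>p. P (\<pi>1 p) (\<pi>2 p)) \<Longrightarrow> dt f \<Longrightarrow> dt g \<Longrightarrow> df (\<lambda>q. P (f q) (g q))"
  using df_comp[of "\<lambda>p. P (\<pi>1 p) (\<pi>2 p)" "\<lambda>q. prk (f q) (g q)"] by (simp add: dfi)

lemma dt_comp2: "dt (\<lambda>p. F (\<pi>1 p) (\<pi>2 p)) \<Longrightarrow> dt f \<Longrightarrow> dt g \<Longrightarrow> dt (\<lambda>q. F (f q) (g q))"
  using dt_comp[of "\<lambda>p. F (\<pi>1 p) (\<pi>2 p)" "\<lambda>q. prk (f q) (g q)"] by (simp add: dfi)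

text \<open>Collection, derived by induction on an initial segment: the bound for one more point is
  the maximum of the old bound and a value at that point.\<close>

lemma df_bounded:
  assumes "df (\<lambda>p. P (\<pi>1 p) (\<pi>2 p))" "\<And>x. x < n \<Longrightarrow> \<exists>y. P x y"
  obtains m where "\<And>x. x < n \<Longrightarrow> \<exists>y\<le>m. P x y"
proof -
  note [dfi] = df_comp2[OF assms(1)]
  have "n \<le> n \<longrightarrow> (\<exists>m. \<forall>x<n. \<exists>y\<le>m. P x y)"
  proof (rule df_induct[of "\<lambda>k. k \<le> n \<longrightarrow> (\<exists>m. \<forall>x<k. \<exists>y\<le>m. P x y)"], intro dfi, simp, rule impI)
    fix k assume IH: "k \<le> n \<longrightarrow> (\<exists>m. \<forall>x<k. \<exists>y\<le>m. P x y)" and k: "k + 1 \<le> n"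
    then have "k < n" by (simp add: less_iff_add1)
    then obtain m y where m: "\<forall>x<k. \<exists>y\<le>m. P x y" "P k y" using IH assms(2) by (meson less_imp_le)
    have "\<forall>x<k + 1. \<exists>y'\<le>max m y. P x y'"
      using m by (auto simp: less_add1_iff le_max_iff_disj)
    then show "\<exists>m. \<forall>x<k + 1. \<exists>y\<le>m. P x y" by blast
  qed
  then show ?thesis using that by blast
qed


section \<open>Coded sequences\<close>

definition modk :: "kk \<Rightarrow> kk \<Rightarrow> kk" where "modk a m = lst (\<lambda>y. \<exists>q. a = q * m + y)"

lemma dt_modk [dfi]: assumes "dt f" "dt g" shows "dt (\<lambda>x. modk (f x) (g x))"
  unfolding modk_def by (intro dfi dt_comp[OF assms(1)] dt_comp[OF assms(2)])

lemma div_less: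
  assumes "y < m" "q < q'" shows "q * m + y < q' * m + (z :: kk)"
proof -
  have "q * m + y < q * m + m" using assms(1) by simp
  also have "q * m + m = (q + 1) * m" by (simp add: algebra_simps)
  also have "\<dots> \<le> q' * m" using assms(2) by (intro mult_right_mono) (simp_all add: less_iff_add1)
  also have "\<dots> \<le> q' * m + z" by simp
  finally show ?thesis .
qed

lemma div_unique:
  assumes "y < m" "z < m" "q * m + y = q' * m + (z :: kk)" shows "y = z"
proof -
  have "q = q'" using div_less[OF assms(1), of q q' z] div_less[OF assms(2), of q' q y] assms(3)
    by (cases q q' rule: linorder_cases) auto
  then show ?thesis using assms(3) by simp
qed

lemma modk_eq: assumes "y < m" shows "modk (q * m + y) m = y"
  unfolding modk_def
proof (rule lst_eq)
  show "\<exists>q'. q * m + y = q' * m + y" by blast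
  show "\<not> (\<exists>q'. q * m + y = q' * m + z)" if "z < y" for z
    using div_unique[of y m z q] that assms less_trans[OF that assms] by auto
qed

lemma div_exists: assumes "0 < (m :: kk)" shows "\<exists>q y. y < m \<and> a = q * m + y"
proof (rule df_induct[of "\<lambda>a. \<exists>q y. y < m \<and> a = q * m + y"], intro dfi)
  show "\<exists>q y. y < m \<and> 0 = q * m + y" using assms by (intro exI[of _ 0]) simp
  fix a assume "\<exists>q y. y < m \<and> a = q * m + y"
  then obtain q y where y: "y < m" "a = q * m + y" by blast
  show "\<exists>q y. y < m \<and> a + 1 = q * m + y"
  proof (cases "y + 1 < m")
    case True
    then show ?thesis using y by (intro exI[of _ q] exI[of _ "y + 1"]) (simp add: algebra_simps)
  next
    case False
    then have "y + 1 = m" using y(1) by (simp add: less_iff_add1[of y m] not_less antisym)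
    then show ?thesis using y assms
      by (intro exI[of _ "q + 1"] exI[of _ 0]) (auto simp: algebra_simps)
  qed
qed

lemma modk_iff: assumes "0 < m" shows "y = modk a m \<longleftrightarrow> (\<exists>q. q * m + y = a) \<and> y < m"
proof
  assume y: "y = modk a m"
  obtain q z where "z < m" "a = q * m + z" using div_exists[OF assms] by blast
  then show "(\<exists>q. q * m + y = a) \<and> y < m" using y modk_eq by auto
next
  assume "(\<exists>q. q * m + y = a) \<and> y < m"
  then show "y = modk a m" using modk_eq by auto
qed

lemma modk_add: assumes "0 < m" shows "modk (a + m * t) m = modk a m"
proof -
  obtain q y where y: "y < m" "a = q * m + y" using div_exists[OF assms] by blast
  then have "a + m * t = (q + t) * m + y" by (simp add: algebra_simps)
  then show ?thesis using y modk_eq by simp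
qed

text \<open>The total function described by \<open>beta\<close>, with the two parameters combined
  into one code.\<close>

definition dec :: "kk \<Rightarrow> kk \<Rightarrow> kk" where "dec s i = modk (\<pi>1 s) ((i + 1) * \<pi>2 s + 1)"

lemma dt_dec [dfi]: "dt f \<Longrightarrow> dt g \<Longrightarrow> dt (\<lambda>x. dec (f x) (g x))"
  unfolding dec_def by (intro dfi)

lemma dt_upper: assumes "dt f" shows "\<exists>m. \<forall>i<n. f i \<le> m"
proof -
  have "df (\<lambda>p. \<pi>2 p = f (\<pi>1 p))" by (intro dfi dt_comp[OF assms])
  then obtain m where "\<And>x. x < n \<Longrightarrow> \<exists>y\<le>m. y = f x" by (rule df_bounded[of _ n]) auto
  then show ?thesis by blast
qed

text \<open>Replaces the factorial of Goedel's argument, whose definition would already require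
  coded sequences.\<close>

lemma common_multiple: "\<exists>b. 0 < b \<and> (\<forall>d. 0 < d \<longrightarrow> d \<le> n \<longrightarrow> d dvd (b :: kk))"
proof (rule df_induct[of "\<lambda>n. \<exists>b. 0 < b \<and> (\<forall>d. 0 < d \<longrightarrow> d \<le> n \<longrightarrow> d dvd b)"], intro dfi)
  show "\<exists>b. 0 < b \<and> (\<forall>d. 0 < d \<longrightarrow> d \<le> 0 \<longrightarrow> d dvd (b :: kk))" by (intro exI[of _ 1]) auto
  fix n assume "\<exists>b. 0 < b \<and> (\<forall>d. 0 < d \<longrightarrow> d \<le> n \<longrightarrow> d dvd (b :: kk))"
  then obtain b where b: "0 < b" "\<And>d. 0 < d \<Longrightarrow> d \<le> n \<Longrightarrow> d dvd b" by blast
  have "d dvd b * (n + 1)" if "0 < d" "d \<le> n + 1" for d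
  proof (cases "d = n + 1")
    case False
    then have "d < n + 1" using that(2) by (rule le_neq_trans[rotated])
    then have "d \<le> n" by (simp only: le_iff_less1)
    then show ?thesis using b(2) that(1) by (intro dvd_mult2) blast
  qed simp
  moreover have "0 < b * (n + 1)" using b(1) by (intro mult_pos_pos) (auto intro: add_nonneg_pos)
  ultimately show "\<exists>b. 0 < b \<and> (\<forall>d. 0 < d \<longrightarrow> d \<le> n + 1 \<longrightarrow> d dvd (b :: kk))" by blast
qed

lemma pos_ex_add1: "0 < (x :: kk) \<Longrightarrow> \<exists>y. x = y + 1"
  using kk_cases[of x] by auto

text \<open>The difference \<open>d\<close> of the indices divides \<open>b\<close>, say
  \<open>b = d * q\<close>. With \<open>I = i + 1\<close> and \<open>J = j + 1\<close> this makes
  Bezout coefficients explicit: the larger modulus times \<open>I * I * q\<close> exceeds the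
  smaller modulus times \<open>I * J * q - 1\<close> by 1.\<close>

lemma moduli_coprime:
  assumes "i < j" "j \<le> n" "0 < b" and b: "\<And>d. 0 < d \<Longrightarrow> d \<le> n \<Longrightarrow> d dvd (b :: kk)"
  shows "\<exists>x y. ((i + 1) * b + 1) * x = ((j + 1) * b + 1) * y + (1 :: kk)"
proof -
  obtain d where j: "j = i + d" using less_imp_le[OF assms(1)] by (auto simp: le_iff_add)
  then have "0 < d" using assms(1) by simp
  moreover have "d \<le> n" using j assms(2) le_add_same_cancel2[of d i] order_trans by (metis add.commute zero_le)
  ultimately obtain q where q: "b = d * q" using b by (meson dvdE)
  define I J where "I = i + 1" and "J = I + d"
  have J: "j + 1 = J" by (simp add: J_def I_def j algebra_simps)
  have pos: "0 < q" "0 < I" "0 < J" "0 < b"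
    using q assms(3) by (auto simp: I_def J_def zero_less_iff_neq_zero)
  define u where "u = I * I * q"
  obtain v where v: "I * J * q = v + 1" using pos by (metis pos_ex_add1 mult_pos_pos)
  have mj: "(J * b + 1) * u = (I * b + 1) * v + 1"
  proof -
    have "(J * b + 1) * u + I * b = J * b * u + I * q * (I + d)"
      by (simp add: u_def q algebra_simps)
    also have "\<dots> = I * b * (I * J * q) + I * J * q"
      by (simp add: u_def J_def[symmetric] algebra_simps)
    also have "\<dots> = (I * b + 1) * v + 1 + I * b" unfolding v by (simp add: algebra_simps)
    finally show ?thesis by simp
  qed
  \<comment> \<open>\<open>w\<close> is -1 modulo the larger modulus. Multiplying by it moves the
    summand 1 to the side of the larger modulus, without any subtraction.\<close>
  define w where "w = J * b"
  obtain y where y: "u * w = y + 1" using pos unfolding u_def w_def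
    by (metis pos_ex_add1 mult_pos_pos)
  have "(I * b + 1) * (v * w) + w = ((I * b + 1) * v + 1) * w" by (simp add: algebra_simps)
  also have "\<dots> = (w + 1) * (u * w)" unfolding mj[symmetric] w_def by (simp add: algebra_simps)
  also have "\<dots> = (w + 1) * y + 1 + w" unfolding y by (simp add: algebra_simps)
  finally have "(I * b + 1) * (v * w) = (w + 1) * y + 1" by simp
  then show ?thesis unfolding J I_def[symmetric] w_def by blast
qed

lemma sequence_coding: assumes "dt f" shows "\<exists>s. \<forall>i<n. dec s i = f i"
proof -
  obtain M where M: "\<And>i. i < n \<Longrightarrow> f i \<le> M" using dt_upper[OF assms] by blast
  obtain c where c: "0 < c" "\<And>d. 0 < d \<Longrightarrow> d \<le> n \<Longrightarrow> d dvd c" using common_multiple by blast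
  \<comment> \<open>The factor \<open>c\<close> makes the moduli coprime, the factor
    \<open>M + 1\<close> makes them exceed the values of \<open>f\<close>.\<close>
  define b where "b = c * (M + 1)"
  have b: "0 < b" "\<And>d. 0 < d \<Longrightarrow> d \<le> n \<Longrightarrow> d dvd b"
    using c by (auto simp: b_def intro!: mult_pos_pos add_nonneg_pos)
  define m where "m i = (i + 1) * b + 1" for i
  have mpos: "0 < m i" for i by (auto simp: m_def intro: add_nonneg_pos)
  have dtm: "dt (\<lambda>x. m (g x))" if "dt g" for g unfolding m_def by (intro dfi that)
  have fm: "f i < m i" if "i < n" for i
  proof -
    have "f i \<le> 1 * M" using M that by simp
    also have "\<dots> < 1 * (M + 1)" by simp
    also have "\<dots> \<le> c * (M + 1)" using c(1) by (intro mult_right_mono) (auto simp: less_iff_add1)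
    also have "\<dots> \<le> 1 * b" by (simp add: b_def)
    also have "\<dots> \<le> (i + 1) * b" by (intro mult_right_mono) auto
    also have "\<dots> \<le> m i" by (simp add: m_def)
    finally show ?thesis .
  qed
  \<comment> \<open>In place of the product of the first \<open>k\<close> moduli, which could not be
    defined without coding: a common multiple of them that is invertible modulo each later
    modulus.\<close>
  have P: "k \<le> n \<longrightarrow> (\<exists>P. (\<forall>i<k. m i dvd P) \<and> (\<forall>j. k \<le> j \<longrightarrow> j < n \<longrightarrow> (\<exists>x y. P * x = m j * y + 1)))" for k
  proof (rule df_induct[of "\<lambda>k. k \<le> n \<longrightarrow> (\<exists>P. (\<forall>i<k. m i dvd P) \<and> (\<forall>j. k \<le> j \<longrightarrow> j < n \<longrightarrow> (\<exists>x y. P * x = m j * y + 1)))"],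
      intro dfi dtm)
    show "0 \<le> n \<longrightarrow> (\<exists>P. (\<forall>i<0. m i dvd P) \<and> (\<forall>j. 0 \<le> j \<longrightarrow> j < n \<longrightarrow> (\<exists>x y. P * x = m j * y + 1)))"
    proof -
      have "\<exists>x y. 1 * x = m j * y + 1" for j by (intro exI[of _ 1] exI[of _ 0]) simp
      then show ?thesis by (intro impI exI[of _ 1]) simp
    qed
    fix k assume IH: "k \<le> n \<longrightarrow> (\<exists>P. (\<forall>i<k. m i dvd P) \<and> (\<forall>j. k \<le> j \<longrightarrow> j < n \<longrightarrow> (\<exists>x y. P * x = m j * y + 1)))"
    show "k + 1 \<le> n \<longrightarrow> (\<exists>P. (\<forall>i<k + 1. m i dvd P) \<and> (\<forall>j. k + 1 \<le> j \<longrightarrow> j < n \<longrightarrow> (\<exists>x y. P * x = m j * y + 1)))"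
    proof
      assume "k + 1 \<le> n"
      then have "k \<le> n" by (simp add: less_iff_add1[symmetric])
      with IH obtain P where P: "\<And>i. i < k \<Longrightarrow> m i dvd P"
        "\<And>j. k \<le> j \<Longrightarrow> j < n \<Longrightarrow> \<exists>x y. P * x = m j * y + 1" by blast
      have "m i dvd P * m k" if "i < k + 1" for i using that P(1) by (auto simp: less_add1_iff)
      moreover have "\<exists>x y. P * m k * x = m j * y + 1" if j: "k + 1 \<le> j" "j < n" for j
      proof -
        have "k < j" using j by (simp add: less_iff_add1)
        then obtain x y where xy: "P * x = m j * y + 1" using P(2) j by (meson less_imp_le)
        obtain x' y' where xy': "m k * x' = m j * y' + 1"
          using moduli_coprime[OF \<open>k < j\<close> less_imp_le[OF j(2)] b] unfolding m_def by blast
        have "P * m k * (x * x') = (P * x) * (m k * x')" by (simp add: algebra_simps)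
        also have "\<dots> = m j * (y * (m j * y' + 1) + y') + 1" unfolding xy xy' by (simp add: algebra_simps)
        finally show ?thesis by blast
      qed
      ultimately show "\<exists>P. (\<forall>i<k + 1. m i dvd P) \<and> (\<forall>j. k + 1 \<le> j \<longrightarrow> j < n \<longrightarrow> (\<exists>x y. P * x = m j * y + 1))"
        by blast
    qed
  qed
  have "k \<le> n \<longrightarrow> (\<exists>a. \<forall>i<k. modk a (m i) = f i)" for k
  proof (rule df_induct[of "\<lambda>k. k \<le> n \<longrightarrow> (\<exists>a. \<forall>i<k. modk a (m i) = f i)"],
      intro dfi dtm dt_comp[OF assms])
    show "0 \<le> n \<longrightarrow> (\<exists>a. \<forall>i<0. modk a (m i) = f i)" by simp
    fix k assume IH: "k \<le> n \<longrightarrow> (\<exists>a. \<forall>i<k. modk a (m i) = f i)"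
    show "k + 1 \<le> n \<longrightarrow> (\<exists>a. \<forall>i<k + 1. modk a (m i) = f i)"
    proof
      assume "k + 1 \<le> n"
      then have k: "k < n" by (simp add: less_iff_add1)
      with IH obtain a where a: "\<And>i. i < k \<Longrightarrow> modk a (m i) = f i" by (meson less_imp_le)
      obtain P x y where P: "\<And>i. i < k \<Longrightarrow> m i dvd P" "P * x = m k * y + 1"
        using P[of k] k by (meson less_imp_le order_refl)
      obtain u where u: "m k = u + 1" using mpos pos_ex_add1 by blast
      \<comment> \<open>Modulo \<open>m k\<close>, the product \<open>P * x\<close> is 1 and
        \<open>u\<close> is -1. So the added term is \<open>f k - a\<close> modulo
        \<open>m k\<close>, while it vanishes modulo the earlier moduli.\<close>
      define a' where "a' = a + P * (x * (f k + u * a))"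
      have "modk a' (m i) = f i" if "i < k" for i
      proof -
        obtain r where "P = m i * r" using P(1)[OF \<open>i < k\<close>] by (meson dvdE)
        then have "a' = a + m i * (r * (x * (f k + u * a)))" by (simp add: a'_def algebra_simps)
        then show ?thesis using modk_add[OF mpos] a[OF \<open>i < k\<close>] by simp
      qed
      moreover have "modk a' (m k) = f k"
      proof -
        have "a' = a + (P * x) * (f k + u * a)" by (simp add: a'_def algebra_simps)
        also have "\<dots> = (a + u * a) + m k * (y * (f k + u * a)) + f k"
          unfolding P(2) by (simp add: algebra_simps)
        also have "a + u * a = a * m k" unfolding u by (simp add: algebra_simps)
        finally have "a' = (a + y * (f k + u * a)) * m k + f k" by (simp add: algebra_simps)
        then show ?thesis using modk_eq[OF fm[OF k]] by simp
      qed
      ultimately have "\<forall>i<k + 1. modk a' (m i) = f i" by (auto simp: less_add1_iff)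
      then show "\<exists>a. \<forall>i<k + 1. modk a (m i) = f i" by blast
    qed
  qed
  then obtain a where a: "\<And>i. i < n \<Longrightarrow> modk a (m i) = f i" by blast
  have "dec (prk a b) i = modk a (m i)" for i by (simp add: dec_def m_def)
  then show ?thesis using a by (intro exI[of _ "prk a b"]) simp
qed

text \<open>Course-of-values recursion by coded partial solutions, which agree wherever both are
  defined. \<open>H\<close> receives the earlier values as a function, but its definability is
  required for decoded functions only, since quantification over functions is quantification over
  codes.\<close>

lemma recursion:
  assumes dt: "dt (\<lambda>p. H (\<pi>1 p) (dec (\<pi>2 p)))"
    and loc: "\<And>x f g. (\<And>y. y < x \<Longrightarrow> f y = g y) \<Longrightarrow> H x f = H x g"
  obtains F where "dt F" "\<And>x. F x = H x F"
proof -
  define ok where "ok s x \<longleftrightarrow> (\<forall>z<x. dec s z = H z (dec s))" for s x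
  have dH: "dt (\<lambda>x. H (f x) (dec (g x)))" if "dt f" "dt g" for f g
    using dt_comp2[OF dt that] .
  have dok: "df (\<lambda>x. ok (f x) (g x))" if "dt f" "dt g" for f g
    unfolding ok_def by (intro dfi dH dt_comp[OF that(1)] dt_comp[OF that(2)])
  have uniq: "dec s y = dec t y" if "ok s x" "ok t x" "y < x" for s t x y
  proof -
    have "y < x \<longrightarrow> dec s y = dec t y" for y
    proof (rule df_less_induct[of "\<lambda>y. y < x \<longrightarrow> dec s y = dec t y"], intro dfi, rule impI)
      fix y assume IH: "\<And>z. z < y \<Longrightarrow> z < x \<longrightarrow> dec s z = dec t z" and y: "y < x"
      then have "H y (dec s) = H y (dec t)" by (intro loc) (meson less_trans)
      then show "dec s y = dec t y" using that y by (simp add: ok_def)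
    qed
    then show ?thesis using that by blast
  qed
  have ex: "\<exists>s. ok s x" for x
  proof (rule df_induct[of "\<lambda>x. \<exists>s. ok s x"], intro dfi dok)
    show "\<exists>s. ok s 0" by (simp add: ok_def)
    fix x assume "\<exists>s. ok s x"
    then obtain s where s: "ok s x" by blast
    have "dt (\<lambda>z. if z < x then dec s z else H x (dec s))" by (intro dfi)
    then obtain t where t: "\<And>z. z < x + 1 \<Longrightarrow> dec t z = (if z < x then dec s z else H x (dec s))"
      using sequence_coding by blast
    have "dec t z = H z (dec t)" if z: "z < x + 1" for z
    proof -
      have "z \<le> x" using z by (simp add: le_iff_less1)
      then have "H z (dec t) = H z (dec s)"
      proof (intro loc)
        fix y assume "y < z"
        then have "y < x" using \<open>z \<le> x\<close> by (rule less_le_trans)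
        then show "dec t y = dec s y" using t by (simp add: less_add1_iff)
      qed
      then show ?thesis using t[OF z] s z by (auto simp: ok_def less_add1_iff)
    qed
    then show "\<exists>s. ok s (x + 1)" by (auto simp: ok_def)
  qed
  define F where "F x = lst (\<lambda>y. \<exists>s. ok s x \<and> y = H x (dec s))" for x
  have F: "F x = H x (dec s)" if "ok s x" for s x
    unfolding F_def
  proof (rule lst_eq)
    show "\<exists>t. ok t x \<and> H x (dec s) = H x (dec t)" using that by blast
    show "\<not> (\<exists>t. ok t x \<and> z = H x (dec t))" if "z < H x (dec s)" for z
      using that uniq[OF _ \<open>ok s x\<close>] loc[of x] by (metis less_irrefl)
  qed
  have "dt F" unfolding F_def by (intro dfi dok dH)
  moreover have "F x = H x F" for x
  proof -
    obtain s where s: "ok s x" using ex by blast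
    have "F y = dec s y" if "y < x" for y
    proof -
      have "ok s y" using s \<open>y < x\<close> by (auto simp: ok_def dest: less_trans)
      then show ?thesis using F[of s y] s \<open>y < x\<close> by (simp add: ok_def)
    qed
    then have "H x F = H x (dec s)" by (rule loc)
    then show ?thesis using F[OF s] by simp
  qed
  ultimately show ?thesis using that by blast
qed

text \<open>Koenig's lemma inside \<open>K\<close>: the path always takes the least value that
  leaves extensions of every length. Such a value exists by collection: if each of the values up to
  \<open>B\<close> failed at some length, a bound on these lengths would contradict that the path so
  far extends to every length.\<close>

lemma leftmost_path:
  assumes df: "df (\<lambda>p. OK (dec (\<pi>1 p)) (\<pi>2 p))"
    and mono: "\<And>f N N'. OK f N \<Longrightarrow> N' \<le> N \<Longrightarrow> OK f N'"
    and loc: "\<And>f g N. (\<And>i. i < N \<Longrightarrow> f i = g i) \<Longrightarrow> OK f N \<Longrightarrow> OK g N"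
    and bound: "\<And>f N i. OK f N \<Longrightarrow> i < N \<Longrightarrow> f i \<le> B"
    and con: "\<And>N. \<exists>v. OK (dec v) N"
  obtains V where "dt V" "\<And>N. OK V N"
proof -
  note [dfi] = df_comp2[OF df]
  define ext where "ext n f b N \<longleftrightarrow> (\<exists>v. OK (dec v) N \<and> (\<forall>i<n. dec v i = f i) \<and> dec v n = b)" for n f b N
  obtain V where V: "dt V" "\<And>n. V n = lst (\<lambda>b. \<forall>N. ext n V b N)"
  proof (rule recursion[of "\<lambda>n f. lst (\<lambda>b. \<forall>N. ext n f b N)"])
    show "dt (\<lambda>p. lst (\<lambda>b. \<forall>N. ext (\<pi>1 p) (dec (\<pi>2 p)) b N))"
      unfolding ext_def by (intro dfi)
    show "lst (\<lambda>b. \<forall>N. ext x f b N) = lst (\<lambda>b. \<forall>N. ext x g b N)" if "\<And>y. y < x \<Longrightarrow> f y = g y" for x f g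
      using that unfolding ext_def by (simp cong: conj_cong)
  qed blast
  note [dfi] = dt_comp[OF V(1)]
  have C: "\<forall>N. \<exists>v. OK (dec v) N \<and> (\<forall>i<n. dec v i = V i)" for n
  proof (rule df_induct[of "\<lambda>n. \<forall>N. \<exists>v. OK (dec v) N \<and> (\<forall>i<n. dec v i = V i)"], intro dfi)
    show "\<forall>N. \<exists>v. OK (dec v) N \<and> (\<forall>i<0. dec v i = V i)" using con by simp
    fix n assume IH: "\<forall>N. \<exists>v. OK (dec v) N \<and> (\<forall>i<n. dec v i = V i)"
    have "\<exists>b. \<forall>N. ext n V b N"
    proof (rule ccontr)
      assume "\<not> (\<exists>b. \<forall>N. ext n V b N)"
      then have *: "\<And>b. b < B + 1 \<Longrightarrow> \<exists>N. \<not> ext n V b N" by blast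
      have "df (\<lambda>p. \<not> ext n V (\<pi>1 p) (\<pi>2 p))" unfolding ext_def by (intro dfi)
      then obtain m where m: "\<And>b. b < B + 1 \<Longrightarrow> \<exists>N\<le>m. \<not> ext n V b N"
        using df_bounded[of "\<lambda>b N. \<not> ext n V b N" "B + 1"] * by blast
      obtain v where v: "OK (dec v) (max m (n + 1))" "\<forall>i<n. dec v i = V i" using IH by blast
      have "dec v n \<le> B" using bound[OF v(1)] by (simp add: less_max_iff_disj)
      then obtain N where N: "N \<le> m" "\<not> ext n V (dec v n) N" using m by (auto simp: le_iff_less1)
      have "OK (dec v) N" using mono[OF v(1), of N] N(1) by (simp add: le_max_iff_disj)
      then show False using N(2) v(2) unfolding ext_def by blast
    qed
    then obtain b where "\<forall>N. ext n V b N" by blast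
    moreover have "df (\<lambda>b. \<forall>N. ext n V b N)" unfolding ext_def by (intro dfi)
    ultimately have "\<forall>N. ext n V (V n) N" using lst[of "\<lambda>b. \<forall>N. ext n V b N"] V(2)[of n] by simp
    then show "\<forall>N. \<exists>v. OK (dec v) N \<and> (\<forall>i<n + 1. dec v i = V i)"
      unfolding ext_def less_add1_iff by blast
  qed
  have "OK V N" for N
  proof -
    obtain v where "OK (dec v) N" "\<forall>i<N. dec v i = V i" using C by blast
    then show ?thesis using loc[of N "dec v" V] by blast
  qed
  then show ?thesis using that V(1) by blast
qed


section \<open>A truth predicate over a definable elementary extension\<close>

text \<open>Names of the elements of the extension: constants \<open>nK a\<close>, witnesses \<open>nW g p\<close>, and values of
  the base functions \<open>G q\<close>. \<open>nW g p\<close> is to witness the truth of \<open>p\<close> if \<open>p\<close> has the logical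
  skeleton \<open>g\<close>.\<close>

definition nK :: "kk \<Rightarrow> kk" where "nK a = prk 1 a"
definition nW :: "kk \<Rightarrow> kk \<Rightarrow> kk" where "nW g p = prk 2 (prk g p)"
definition nG :: "kk \<Rightarrow> kk \<Rightarrow> kk" where "nG q x = prk 3 (prk q x)"
text \<open>The base functions are unary. A binary one is applied to the name of a pair.\<close>

definition nP :: "kk \<Rightarrow> kk \<Rightarrow> kk" where "nP x y = prk 4 (prk x y)"

lemma names_distinct [simp]:
  "nK a \<noteq> nW g p" "nK a \<noteq> nG q x" "nK a \<noteq> nP x y" "nW g p \<noteq> nK a" "nW g p \<noteq> nG q x" "nW g p \<noteq> nP x y"
  "nG q x \<noteq> nK a" "nG q x \<noteq> nW g p" "nG q x \<noteq> nP u v" "nP u v \<noteq> nK a" "nP u v \<noteq> nW g p" "nP u v \<noteq> nG q x"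
  by (simp_all add: nK_def nW_def nG_def nP_def)

lemma names_inj [simp]:
  "nK a = nK b \<longleftrightarrow> a = b" "nW g p = nW g' p' \<longleftrightarrow> g = g' \<and> p = p'"
  "nG q x = nG q' x' \<longleftrightarrow> q = q' \<and> x = x'" "nP x y = nP x' y' \<longleftrightarrow> x = x' \<and> y = y'"
  by (simp_all add: nK_def nW_def nG_def nP_def)

lemma names_less:
  "g < nW g p" "p < nW g p" "x < nG q x" "q < nG q x" "x < nP x y" "y < nP x y" "a < nK a"
  unfolding nK_def nW_def nG_def nP_def
  using le_less_trans[OF le_prk(1) less_prk] le_less_trans[OF le_prk(2) less_prk] less_prk
  by (simp_all add: zero_less_iff_neq_zero)

lemma dt_names [dfi]:
  assumes "dt f" "dt g" shows "dt (\<lambda>x. nW (f x) (g x))" "dt (\<lambda>x. nG (f x) (g x))" "dt (\<lambda>x. nP (f x) (g x))"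
  unfolding nW_def nG_def nP_def by (intro dfi assms)+

lemma dt_nK [dfi]: "dt f \<Longrightarrow> dt (\<lambda>x. nK (f x))"
  unfolding nK_def by (intro dfi)

lemma dt_max [dfi]: "dt f \<Longrightarrow> dt g \<Longrightarrow> dt (\<lambda>x. max (f x) (g x))"
  unfolding max_def by (intro dfi)

text \<open>The subname of a name at a given position; meaningful only if the tag is right.\<close>

abbreviation "arg1 x \<equiv> \<pi>1 (\<pi>2 x)"
abbreviation "arg2 x \<equiv> \<pi>2 (\<pi>2 x)"

lemma args [simp]:
  "arg1 (nW g p) = g" "arg2 (nW g p) = p" "arg1 (nG q x) = q" "arg2 (nG q x) = x"
  "arg1 (nP x y) = x" "arg2 (nP x y) = y" "\<pi>2 (nK a) = a"
  by (simp_all add: nK_def nW_def nG_def nP_def)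

lemma args_less:
  "x = nW (arg1 x) (arg2 x) \<Longrightarrow> arg1 x < x" "x = nW (arg1 x) (arg2 x) \<Longrightarrow> arg2 x < x"
  "x = nG (arg1 x) (arg2 x) \<Longrightarrow> arg2 x < x"
  "x = nP (arg1 x) (arg2 x) \<Longrightarrow> arg1 x < x" "x = nP (arg1 x) (arg2 x) \<Longrightarrow> arg2 x < x"
  using names_less by metis+

text \<open>Only at a witness does the recursion also see the name itself. It has to do so in order
  to recognize for which skeleton the witness was introduced, or to look up a prescribed value. The
  values at both components are passed on as a pair to keep \<open>w\<close> binary.\<close>

lemma name_recursion:
  assumes "dt a" "dt (\<lambda>p. w (\<pi>1 p) (\<pi>2 p))"
    "dt (\<lambda>p. f (\<pi>1 p) (\<pi>2 p))" "dt (\<lambda>p. g (\<pi>1 p) (\<pi>2 p))" "dt b"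
  obtains F where "dt F" "\<And>c. F (nK c) = a c" "\<And>g p. F (nW g p) = w (nW g p) (prk (F g) (F p))"
    "\<And>q x. F (nG q x) = f q (F x)" "\<And>x y. F (nP x y) = g (F x) (F y)"
    "\<And>x. (\<And>c. x \<noteq> nK c) \<Longrightarrow> (\<And>g p. x \<noteq> nW g p) \<Longrightarrow> (\<And>q y. x \<noteq> nG q y) \<Longrightarrow> (\<And>y z. x \<noteq> nP y z) \<Longrightarrow> F x = b x"
proof -
  define H where "H x F = (if x = nK (\<pi>2 x) then a (\<pi>2 x)
      else if x = nW (arg1 x) (arg2 x) then w x (prk (F (arg1 x)) (F (arg2 x)))
      else if x = nG (arg1 x) (arg2 x) then f (arg1 x) (F (arg2 x))
      else if x = nP (arg1 x) (arg2 x) then g (F (arg1 x)) (F (arg2 x)) else b x)" for x F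
  have dH: "dt (\<lambda>p. H (\<pi>1 p) (dec (\<pi>2 p)))"
    unfolding H_def
    by (intro dfi dt_comp[OF assms(1)] dt_comp2[OF assms(2)] dt_comp2[OF assms(3)]
        dt_comp2[OF assms(4)] dt_comp[OF assms(5)])
  have loc: "H x F = H x F'" if "\<And>y. y < x \<Longrightarrow> F y = F' y" for x F F'
    using args_less[of x] that unfolding H_def by auto
  obtain F where F: "dt F" "\<And>x. F x = H x F" by (rule recursion[OF dH loc]) blast+
  show ?thesis
  proof (rule that[OF F(1)])
    show "F (nK c) = a c" for c by (subst F(2)) (simp add: H_def)
    show "F (nW g p) = w (nW g p) (prk (F g) (F p))" for g p by (subst F(2)) (simp add: H_def)
    show "F (nG q x) = f q (F x)" for q x by (subst F(2)) (simp add: H_def)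
    show "F (nP x y) = g (F x) (F y)" for x y by (subst F(2)) (simp add: H_def)
    show "F x = b x" if "\<And>c. x \<noteq> nK c" "\<And>g p. x \<noteq> nW g p" "\<And>q y. x \<noteq> nG q y" "\<And>y z. x \<noteq> nP y z" for x
      using that by (subst F(2)) (simp add: H_def)
  qed
qed

lemma name_cases:
  obtains c where "x = nK c" | g p where "x = nW g p" | q y where "x = nG q y" | y z where "x = nP y z"
  | "\<And>c. x \<noteq> nK c" "\<And>g p. x \<noteq> nW g p" "\<And>q y. x \<noteq> nG q y" "\<And>y z. x \<noteq> nP y z"
  by metis

text \<open>The stage of a name: the skeleton of \<open>p\<close> has to be available before the witnesses for \<open>p\<close>.\<close>

lemma stage_exists:
  "\<exists>st. dt st \<and> (\<forall>a. st (nK a) = 0) \<and> (\<forall>g p. st (nW g p) = max (st g + 1) (st p))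
    \<and> (\<forall>q x. st (nG q x) = st x) \<and> (\<forall>x y. st (nP x y) = max (st x) (st y)) \<and> (\<forall>x. st x \<le> x)"
proof -
  obtain st where st: "dt st" "\<And>a. st (nK a) = 0" "\<And>g p. st (nW g p) = max (\<pi>1 (prk (st g) (st p)) + 1) (\<pi>2 (prk (st g) (st p)))"
    "\<And>q x. st (nG q x) = st x" "\<And>x y. st (nP x y) = max (st x) (st y)"
    "\<And>x. (\<And>c. x \<noteq> nK c) \<Longrightarrow> (\<And>g p. x \<noteq> nW g p) \<Longrightarrow> (\<And>q y. x \<noteq> nG q y) \<Longrightarrow> (\<And>y z. x \<noteq> nP y z) \<Longrightarrow> st x = 0"
    by (rule name_recursion[of "\<lambda>_. 0" "\<lambda>_ y. max (\<pi>1 y + 1) (\<pi>2 y)" "\<lambda>_ y. y" "\<lambda>x y. max x y" "\<lambda>_. 0"])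
      (intro dfi | blast)+
  have "st x \<le> x" for x
  proof (rule df_less_induct[of "\<lambda>x. st x \<le> x"], intro dfi st(1))
    fix x assume IH: "\<And>y. y < x \<Longrightarrow> st y \<le> y"
    show "st x \<le> x"
    proof (cases x rule: name_cases)
      case (2 g p)
      then have "g < x" "p < x" using names_less by auto
      moreover from this have "st g < x" "st p \<le> x" using IH by (meson le_less_trans less_imp_le order_trans)+
      ultimately show ?thesis using 2 st(3) by (simp add: less_iff_add1)
    next
      case (3 q y)
      then have "y < x" using names_less by auto
      then show ?thesis using IH 3 st(4) by (metis less_imp_le order_trans)
    next
      case (4 y z)
      then have "y < x" "z < x" using names_less by auto
      then have "st y \<le> x" "st z \<le> x" using IH by (meson less_imp_le order_trans)+
      then show ?thesis using 4 st(5) by simp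
    qed (use st in auto)
  qed
  then show ?thesis using st by (intro exI[of _ st]) auto
qed

definition st :: "kk \<Rightarrow> kk" where
  "st = (SOME st. dt st \<and> (\<forall>a. st (nK a) = 0) \<and> (\<forall>g p. st (nW g p) = max (st g + 1) (st p))
    \<and> (\<forall>q x. st (nG q x) = st x) \<and> (\<forall>x y. st (nP x y) = max (st x) (st y)) \<and> (\<forall>x. st x \<le> x))"

lemma dt_st: "dt st" and st_simps [simp]: "st (nK a) = 0" "st (nW g p) = max (st g + 1) (st p)"
    "st (nG q x) = st x" "st (nP x y) = max (st x) (st y)" and st_le: "st x \<le> x"
  using someI_ex[OF stage_exists, folded st_def] by auto

lemmas dt_st' [dfi] = dt_comp[OF dt_st]

subsection \<open>Models\<close>

text \<open>\<open>f x\<close> is a pair of truth values: whether the element named by \<open>x\<close> is \<open>0\<close>, and whether it is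
  a true sentence.\<close>

definition zb :: "(kk \<Rightarrow> kk) \<Rightarrow> kk \<Rightarrow> bool" where "zb f x \<longleftrightarrow> f x = 1 \<or> f x = 3"
definition tb :: "(kk \<Rightarrow> kk) \<Rightarrow> kk \<Rightarrow> bool" where "tb f x \<longleftrightarrow> f x = 2 \<or> f x = 3"

definition code2 :: "bool \<Rightarrow> bool \<Rightarrow> kk" where
  "code2 z t = (if z then (if t then 3 else 1) else (if t then 2 else 0))"

lemma zb_code2: "f x = code2 z t \<Longrightarrow> zb f x \<longleftrightarrow> z" and tb_code2: "f x = code2 z t \<Longrightarrow> tb f x \<longleftrightarrow> t"
  by (auto simp: zb_def tb_def code2_def)

lemma code2_le: "code2 z t \<le> 3" by (simp add: code2_def)

lemma dt_code2: "df P \<Longrightarrow> df Q \<Longrightarrow> dt (\<lambda>x. code2 (P x) (Q x))"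
  unfolding code2_def by (intro dfi)

abbreviation "eqn x y \<equiv> nG 0 (nP x y)"
abbreviation "ltn x y \<equiv> nG 1 (nP x y)"
abbreviation "skn \<equiv> nG 2"
abbreviation "subn p x \<equiv> nG 3 (nP p x)"
abbreviation "hdn \<equiv> nG 4"
abbreviation "ngn \<equiv> nG 5"
abbreviation "atn \<equiv> nG 6"
abbreviation "d1n \<equiv> nG 7"
abbreviation "d2n \<equiv> nG 8"

text \<open>\<open>U\<close> is the set of names to which the clauses apply, and \<open>H\<close> is the set of (names of) skeletons
  for which truth has to be compositional. A sentence \<open>p\<close> is composed of the sentences \<open>sub p x\<close>:
  it is true iff some of them is true, or, if \<open>ng p\<close>, iff some of them is not true.\<close>

definition clauses :: "(kk \<Rightarrow> bool) \<Rightarrow> (kk \<Rightarrow> kk) \<Rightarrow> (kk \<Rightarrow> bool) \<Rightarrow> bool" where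
  "clauses H f U \<longleftrightarrow>
    (\<forall>p p'. U p \<longrightarrow> U p' \<longrightarrow> U (eqn p p') \<longrightarrow> zb f (eqn p p') \<longrightarrow> tb f p \<longrightarrow> tb f p') \<and>
    (\<forall>p. U p \<longrightarrow> U (hdn p) \<longrightarrow> U (atn p) \<longrightarrow> \<not> zb f (hdn p) \<longrightarrow> (tb f p \<longleftrightarrow> zb f (atn p))) \<and>
    (\<forall>g p. H g \<longrightarrow> U g \<longrightarrow> U p \<longrightarrow> U (eqn g (skn p)) \<longrightarrow> U (hdn p) \<longrightarrow> U (ngn p) \<longrightarrow> U (subn p (nW g p)) \<longrightarrow>
       zb f (eqn g (skn p)) \<longrightarrow> zb f (hdn p) \<longrightarrow> tb f p \<longrightarrow> tb f (subn p (nW g p)) \<noteq> zb f (ngn p)) \<and>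
    (\<forall>g p x. H g \<longrightarrow> U g \<longrightarrow> U p \<longrightarrow> U (eqn g (skn p)) \<longrightarrow> U (hdn p) \<longrightarrow> U (ngn p) \<longrightarrow> U (subn p x) \<longrightarrow>
       zb f (eqn g (skn p)) \<longrightarrow> zb f (hdn p) \<longrightarrow> tb f (subn p x) \<noteq> zb f (ngn p) \<longrightarrow> tb f p)"

lemma clauses_mono:
  assumes "clauses H f U" "\<And>g. H' g \<Longrightarrow> U' g \<Longrightarrow> H g" "\<And>x. U' x \<Longrightarrow> U x"
  shows "clauses H' f U'"
  using assms(1) unfolding clauses_def
  by (elim conjE, intro conjI; intro allI impI; meson assms(2,3))

lemma clauses_cong:
  assumes "clauses H f U" "\<And>x. U x \<Longrightarrow> f x = g x" shows "clauses H g U"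
proof -
  have "zb f x = zb g x" "tb f x = tb g x" if "U x" for x
    using assms(2)[OF that] by (simp_all add: zb_def tb_def)
  then show ?thesis using assms(1) unfolding clauses_def
    by (elim conjE, intro conjI; intro allI impI; metis)
qed

text \<open>An instance of a clause involves at most six names, and these have a common upper bound
  in \<open>K\<close>.\<close>

lemma clauses_total:
  assumes "\<And>N. clauses H f (\<lambda>x. x < N)" shows "clauses H f (\<lambda>_. True)"
proof -
  have fin: "clauses H f (\<lambda>x. x \<in> S)" if "finite S" for S
  proof -
    have "x < Max (insert 0 S) + 1" if "x \<in> S" for x
      using \<open>finite S\<close> that by (simp add: le_iff_less1[symmetric])
    then show ?thesis
      by (intro clauses_mono[OF assms[of "Max (insert 0 S) + 1"], of H "\<lambda>x. x \<in> S"])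
  qed
  show ?thesis
    unfolding clauses_def
  proof (intro conjI allI impI)
    fix p p' assume "zb f (eqn p p')" "tb f p"
    then show "tb f p'" using fin[of "{p, p', eqn p p'}"] unfolding clauses_def by blast
  next
    fix p assume "\<not> zb f (hdn p)"
    then show "tb f p \<longleftrightarrow> zb f (atn p)" using fin[of "{p, hdn p, atn p}"] unfolding clauses_def by blast
  next
    fix g p assume "H g" "zb f (eqn g (skn p))" "zb f (hdn p)" "tb f p"
    then show "tb f (subn p (nW g p)) \<noteq> zb f (ngn p)"
      using fin[of "{g, p, eqn g (skn p), hdn p, ngn p, subn p (nW g p)}"]
      unfolding clauses_def by blast
  next
    fix g p x assume "H g" "zb f (eqn g (skn p))" "zb f (hdn p)" "tb f (subn p x) \<noteq> zb f (ngn p)"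
    then show "tb f p" using fin[of "{g, p, eqn g (skn p), hdn p, ngn p, subn p x}"]
      unfolding clauses_def by blast
  qed
qed

text \<open>Base functions double as tests, with 0 for true, so zero tests on names express all
  atomic facts, equality and order included. \<open>G 7\<close> and \<open>G 8\<close> are applied
  to the skeleton alone: however many parts a sentence has, their skeletons have one of two names,
  of the same stage as the given skeleton. That parts have smaller skeletons decides in which order
  truth is redefined.\<close>

locale truth_base =
  fixes G :: "kk \<Rightarrow> kk \<Rightarrow> kk"
  assumes dtG: "dt (\<lambda>p. G (\<pi>1 p) (\<pi>2 p))"
    and G_eq: "G 0 (prk x y) = 0 \<longleftrightarrow> x = y"
    and G_lt: "G 1 (prk x y) = 0 \<longleftrightarrow> x < y"
    and skeleton: "G 4 p = 0 \<Longrightarrow> G 2 (G 3 (prk p x)) = G 7 (G 2 p) \<or> G 2 (G 3 (prk p x)) = G 8 (G 2 p)"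
    and skeleton_less: "G 4 p = 0 \<Longrightarrow> G 2 (G 3 (prk p x)) < G 2 p"
begin

lemmas dtG' [dfi] = dt_comp2[OF dtG]

text \<open>\<open>hom r N\<close>: the assignment \<open>r\<close> of values to the names below \<open>N\<close> respects the base functions.
  The witnesses may have any values.\<close>

definition hom :: "(kk \<Rightarrow> kk) \<Rightarrow> kk \<Rightarrow> bool" where
  "hom r N \<longleftrightarrow> (\<forall>x<N. (\<forall>a. x = nK a \<longrightarrow> r x = a) \<and> (\<forall>q y. x = nG q y \<longrightarrow> r x = G q (r y))
     \<and> (\<forall>y z. x = nP y z \<longrightarrow> r x = prk (r y) (r z)))"

definition thom :: "(kk \<Rightarrow> kk) \<Rightarrow> bool" where
  "thom r \<longleftrightarrow> dt r \<and> (\<forall>a. r (nK a) = a) \<and> (\<forall>q y. r (nG q y) = G q (r y))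
     \<and> (\<forall>y z. r (nP y z) = prk (r y) (r z))"

lemma thomD: "thom r \<Longrightarrow> dt r" "thom r \<Longrightarrow> r (nK a) = a" "thom r \<Longrightarrow> r (nG q y) = G q (r y)"
  "thom r \<Longrightarrow> r (nP y z) = prk (r y) (r z)"
  by (auto simp: thom_def)

lemma thom_hom: "thom r \<Longrightarrow> hom r N"
  unfolding thom_def hom_def by auto

lemma hom_mono: "hom r N \<Longrightarrow> N' \<le> N \<Longrightarrow> hom r N'"
  unfolding hom_def using less_le_trans by blast

lemma hom_cong: assumes "hom r N" "\<And>x. x < N \<Longrightarrow> r x = r' x" shows "hom r' N"
proof -
  have *: "r' x = r x" if "x < N" for x using assms(2) that by simp
  have "r' (nK a) = a" if "nK a < N" for a
    using assms(1) that * unfolding hom_def by metis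
  moreover have "r' (nG q y) = G q (r' y)" if "nG q y < N" for q y
    using assms(1) that * less_trans[OF names_less(3) that] unfolding hom_def by metis
  moreover have "r' (nP y z) = prk (r' y) (r' z)" if "nP y z < N" for y z
    using assms(1) that * less_trans[OF names_less(5) that] less_trans[OF names_less(6) that]
    unfolding hom_def by metis
  ultimately show ?thesis unfolding hom_def by blast
qed

text \<open>The values of witnesses are free and can be read off from \<open>s\<close>, also beyond
  \<open>N\<close>. All other values are forced, and below \<open>N\<close> they agree with
  \<open>s\<close> already.\<close>

lemma thom_extend:
  assumes "hom (dec s) N" obtains r where "thom r" "\<And>x. x < N \<Longrightarrow> r x = dec s x"
proof -
  obtain r where r: "dt r" "\<And>a. r (nK a) = a"
    "\<And>g p. r (nW g p) = dec s (nW g p)"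
    "\<And>q x. r (nG q x) = G q (r x)" "\<And>x y. r (nP x y) = prk (r x) (r y)"
    "\<And>x. (\<And>c. x \<noteq> nK c) \<Longrightarrow> (\<And>g p. x \<noteq> nW g p) \<Longrightarrow> (\<And>q y. x \<noteq> nG q y) \<Longrightarrow> (\<And>y z. x \<noteq> nP y z) \<Longrightarrow> r x = dec s x"
    by (rule name_recursion[of "\<lambda>a. a" "\<lambda>x _. dec s x" G prk "dec s"]) (intro dfi | blast)+
  have "x < N \<longrightarrow> r x = dec s x" for x
  proof (rule df_less_induct[of "\<lambda>x. x < N \<longrightarrow> r x = dec s x"], intro dfi r(1), rule impI)
    fix x assume IH: "\<And>y. y < x \<Longrightarrow> y < N \<longrightarrow> r y = dec s y" and x: "x < N"
    have IH': "r y = dec s y" if "y < x" for y using IH[OF that] that x by simp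
    show "r x = dec s x"
    proof (cases x rule: name_cases)
      case (1 c)
      then show ?thesis using assms x r(2) unfolding hom_def by metis
    next
      case (3 q y)
      then have "y < x" using names_less by auto
      then show ?thesis using assms x r(4) 3 IH' unfolding hom_def by metis
    next
      case (4 y z)
      then have "y < x" "z < x" using names_less by auto
      then show ?thesis using assms x r(5) 4 IH' unfolding hom_def by metis
    qed (use r in auto)
  qed
  moreover have "thom r" using r by (simp add: thom_def)
  ultimately show ?thesis using that by blast
qed

text \<open>All quantifiers over names are bounded by \<open>N\<close>, so the condition can be
  tested on codes. On \<open>A\<close> the zero tests are prescribed by \<open>V0\<close>, whereas
  the truth values may be chosen anew.\<close>

definition okk :: "(kk \<Rightarrow> bool) \<Rightarrow> (kk \<Rightarrow> bool) \<Rightarrow> (kk \<Rightarrow> kk) \<Rightarrow> (kk \<Rightarrow> kk) \<Rightarrow> kk \<Rightarrow> bool" where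
  "okk H A V0 f N \<longleftrightarrow> (\<forall>x<N. f x \<le> 3) \<and> (\<exists>s. hom (dec s) N \<and> (\<forall>x<N. zb f x \<longleftrightarrow> dec s x = 0))
     \<and> (\<forall>x<N. A x \<longrightarrow> (zb f x \<longleftrightarrow> zb V0 x)) \<and> clauses H f (\<lambda>x. x < N)"

text \<open>The existence of a definable model is not a statement inside \<open>K\<close>, but that
  of approximations of every length is. Inductions are therefore carried out on \<open>Con\<close>,
  while models are modified between an application of \<open>Con_model\<close> and one of
  \<open>model_Con\<close>.\<close>

definition Con :: "(kk \<Rightarrow> bool) \<Rightarrow> (kk \<Rightarrow> bool) \<Rightarrow> (kk \<Rightarrow> kk) \<Rightarrow> bool" where
  "Con H A V0 \<longleftrightarrow> (\<forall>N. \<exists>v. okk H A V0 (dec v) N)"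

text \<open>The zero tests below \<open>N\<close> come from an assignment in \<open>K\<close>, but
  the assignment may vary with \<open>N\<close>. This is how the structure described by
  \<open>V\<close> can be larger than \<open>K\<close> and yet resemble it on every finite set of
  names.\<close>

definition model :: "(kk \<Rightarrow> bool) \<Rightarrow> (kk \<Rightarrow> kk) \<Rightarrow> bool" where
  "model H V \<longleftrightarrow> dt V \<and> (\<forall>x. V x \<le> 3) \<and> (\<forall>N. \<exists>r. thom r \<and> (\<forall>x<N. zb V x \<longleftrightarrow> r x = 0))
     \<and> clauses H V (\<lambda>_. True)"

lemma df_okk:
  assumes "df (\<lambda>p. H (\<pi>1 p) (\<pi>2 p))" "df A" "dt V0" "dt i" "dt v" "dt N"
  shows "df (\<lambda>p. okk (H (i p)) A V0 (dec (v p)) (N p))"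
proof -
  note * = assms(4-6)[THEN dt_comp]
  show ?thesis
    unfolding okk_def clauses_def hom_def zb_def tb_def
    by (intro dfi df_comp2[OF assms(1)] df_comp[OF assms(2)] dt_comp[OF assms(3)] *)
qed

lemma Con_model:
  assumes "df H" "df A" "dt V0" "Con H A V0"
  obtains V where "model H V" "\<And>x. A x \<Longrightarrow> zb V x \<longleftrightarrow> zb V0 x"
proof -
  have ok: "\<exists>V. dt V \<and> (\<forall>N. okk H A V0 V N)"
  proof (rule leftmost_path[of "okk H A V0" 3])
    have "df (\<lambda>p. H (\<pi>2 p))" by (intro dfi df_comp[OF assms(1)])
    then show "df (\<lambda>p. okk H A V0 (dec (\<pi>1 p)) (\<pi>2 p))"
      using df_okk[of "\<lambda>_. H" A V0 "\<lambda>_. 0" \<pi>1 \<pi>2] assms(2,3) by (simp add: dfi)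
    show "okk H A V0 f N'" if ok: "okk H A V0 f N" and le: "N' \<le> N" for f N N'
    proof -
      have lt: "x < N" if "x < N'" for x using that le by (rule less_le_trans)
      obtain s where s: "hom (dec s) N" "\<forall>x<N. zb f x \<longleftrightarrow> dec s x = 0" using ok unfolding okk_def by blast
      have "clauses H f (\<lambda>x. x < N)" using ok by (simp add: okk_def)
      then have "clauses H f (\<lambda>x. x < N')" by (rule clauses_mono) (use lt in blast)+
      then show ?thesis using s(2) ok lt hom_mono[OF s(1) le] unfolding okk_def by blast
    qed
    show "okk H A V0 g N" if fg: "\<And>i. i < N \<Longrightarrow> f i = g i" and ok: "okk H A V0 f N" for f g N
    proof -
      have c: "clauses H f (\<lambda>x. x < N)" using ok by (simp add: okk_def)
      have "clauses H g (\<lambda>x. x < N)" by (rule clauses_cong[OF c fg])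
      moreover have "zb f x = zb g x" if "x < N" for x using fg[OF that] by (simp add: zb_def)
      ultimately show ?thesis using ok fg unfolding okk_def by simp
    qed
    show "f i \<le> 3" if "okk H A V0 f N" "i < N" for f N i using that by (simp add: okk_def)
    show "\<exists>v. okk H A V0 (dec v) N" for N using assms(4) by (simp add: Con_def)
  qed blast
  then obtain V where V: "dt V" "\<And>N. okk H A V0 V N" by blast
  have lt: "x < x + 1" for x :: kk by simp
  have "V x \<le> 3" "A x \<Longrightarrow> zb V x \<longleftrightarrow> zb V0 x" for x
    using V(2)[of "x + 1"] lt[of x] unfolding okk_def by blast+
  moreover have "\<exists>r. thom r \<and> (\<forall>x<N. zb V x \<longleftrightarrow> r x = 0)" for N
  proof -
    obtain s where s: "hom (dec s) N" "\<forall>x<N. zb V x \<longleftrightarrow> dec s x = 0" using V(2)[of N] unfolding okk_def by blast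
    obtain r where "thom r" "\<And>x. x < N \<Longrightarrow> r x = dec s x" using thom_extend[OF s(1)] by blast
    then show ?thesis using s(2) by auto
  qed
  moreover have "clauses H V (\<lambda>_. True)" using V(2) clauses_total unfolding okk_def by blast
  ultimately show ?thesis using V(1) that unfolding model_def by blast
qed

lemma model_Con:
  assumes "model H V" "\<And>x. A x \<Longrightarrow> zb V x \<longleftrightarrow> zb V0 x"
  shows "Con H A V0"
  unfolding Con_def
proof
  fix N
  obtain v where v: "\<And>x. x < N \<Longrightarrow> dec v x = V x"
    using sequence_coding assms(1) unfolding model_def by meson
  obtain r where r: "thom r" "\<And>x. x < N \<Longrightarrow> zb V x \<longleftrightarrow> r x = 0" using assms(1) unfolding model_def by meson
  obtain s where s: "\<And>x. x < N \<Longrightarrow> dec s x = r x" using sequence_coding thomD(1)[OF r(1)] by meson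
  have zbv: "zb (dec v) x = zb V x" if "x < N" for x using v[OF that] by (simp add: zb_def)
  have "hom (dec s) N" by (rule hom_cong[OF thom_hom[OF r(1)]]) (simp add: s)
  moreover have "clauses H (dec v) (\<lambda>x. x < N)"
  proof (rule clauses_cong[of H V])
    show "clauses H V (\<lambda>x. x < N)"
      using assms(1) clauses_mono[of H V "\<lambda>_. True" H "\<lambda>x. x < N"] by (simp add: model_def)
  qed (simp add: v)
  moreover have "\<forall>x<N. dec v x \<le> 3" using v assms(1) by (simp add: model_def)
  moreover have "\<forall>x<N. zb (dec v) x \<longleftrightarrow> dec s x = 0" using zbv s r(2) by simp
  moreover have "\<forall>x<N. A x \<longrightarrow> (zb (dec v) x \<longleftrightarrow> zb V0 x)" using zbv assms(2) by simp
  ultimately show "\<exists>v. okk H A V0 (dec v) N" unfolding okk_def by blast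
qed

lemma okk_mono:
  assumes "okk H A V0 f N" "\<And>g. g < N \<Longrightarrow> H' g \<Longrightarrow> H g" "\<And>x. A' x \<Longrightarrow> A x"
  shows "okk H' A' V0 f N"
proof -
  have "clauses H f (\<lambda>x. x < N)" using assms(1) by (simp add: okk_def)
  then have "clauses H' f (\<lambda>x. x < N)" by (rule clauses_mono) (use assms(2) in blast)+
  then show ?thesis using assms(1,3) unfolding okk_def by blast
qed

lemma model_real:
  assumes "model H V" "finite S" obtains r where "thom r" "\<And>x. x \<in> S \<Longrightarrow> zb V x \<longleftrightarrow> r x = 0"
proof -
  obtain r where "thom r" "\<forall>x<Max (insert 0 S) + 1. zb V x \<longleftrightarrow> r x = 0"
    using assms(1) unfolding model_def by meson
  moreover have "x < Max (insert 0 S) + 1" if "x \<in> S" for x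
    using assms(2) that by (simp add: le_iff_less1[symmetric])
  ultimately show ?thesis using that by blast
qed

lemma model_clauses:
  assumes "model H V"
  shows "zb V (eqn p p') \<Longrightarrow> tb V p \<Longrightarrow> tb V p'"
    "\<not> zb V (hdn p) \<Longrightarrow> tb V p \<longleftrightarrow> zb V (atn p)"
    "H g \<Longrightarrow> zb V (eqn g (skn p)) \<Longrightarrow> zb V (hdn p) \<Longrightarrow> tb V p \<Longrightarrow> tb V (subn p (nW g p)) \<noteq> zb V (ngn p)"
    "H g \<Longrightarrow> zb V (eqn g (skn p)) \<Longrightarrow> zb V (hdn p) \<Longrightarrow> tb V (subn p x) \<noteq> zb V (ngn p) \<Longrightarrow> tb V p"
  using assms unfolding model_def clauses_def by blast+

end


subsection \<open>Adding one skeleton\<close>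

context truth_base
begin

lemma model_congs:
  assumes "model H V" "zb V (eqn p p')"
  shows "zb V (hdn p) = zb V (hdn p')" "zb V (ngn p) = zb V (ngn p')"
    "zb V (eqn g (skn p)) = zb V (eqn g (skn p'))" "zb V (eqn (subn p x) (subn p' x))" "zb V (eqn p' p)"
proof -
  define S where "S = {eqn p p', hdn p, hdn p', ngn p, ngn p', eqn g (skn p), eqn g (skn p'),
      eqn (subn p x) (subn p' x), eqn p' p}"
  have "finite S" by (simp add: S_def)
  then obtain r where r: "thom r" "\<And>x. x \<in> S \<Longrightarrow> zb V x \<longleftrightarrow> r x = 0"
    by (rule model_real[OF assms(1)]) blast
  note r = r(1) r(2)[unfolded S_def]
  note rs = thomD(3,4)[OF r(1)]
  have *: "r p = r p'" using assms(2) r(2)[of "eqn p p'"] by (simp add: rs G_eq)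
  show "zb V (hdn p) = zb V (hdn p')" "zb V (ngn p) = zb V (ngn p')"
    "zb V (eqn g (skn p)) = zb V (eqn g (skn p'))" "zb V (eqn (subn p x) (subn p' x))" "zb V (eqn p' p)"
    using r(2) by (simp_all add: rs * G_eq)
qed

lemma model_tb_cong: "model H V \<Longrightarrow> zb V (eqn p p') \<Longrightarrow> tb V p = tb V p'"
  using model_clauses(1) model_congs(5) by blast

lemma thom_comp:
  assumes "thom r" "dt E" "\<And>a. E (nK a) = nK a" "\<And>q y. E (nG q y) = nG q (E y)"
    "\<And>y z. E (nP y z) = nP (E y) (E z)"
  shows "thom (\<lambda>x. r (E x))"
  using assms unfolding thom_def by (auto intro: dt_comp)

text \<open>The step of Enayat and Visser: the truth of the sentences with the skeleton \<open>fs\<close> is redefined from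
  the truth of their parts in \<open>V\<close>, and \<open>E\<close> evaluates the names of the witnesses for them.\<close>

lemma add_skeleton:
  assumes dH: "df H" and dV0: "dt V0" and V: "model H V" and agree: "\<And>x. st x \<le> k \<Longrightarrow> zb V x \<longleftrightarrow> zb V0 x"
    and fs: "st fs = k" and Hk: "\<And>g. H g \<Longrightarrow> st g \<le> k" and Hlt: "\<And>g. st g < k \<Longrightarrow> H g"
    and Hmax: "\<And>g. H g \<Longrightarrow> st g = k \<Longrightarrow> \<not> zb V0 (ltn fs g)"
  shows "\<exists>V'. model (\<lambda>g. H g \<or> g = fs) V' \<and> (\<forall>x. st x \<le> k \<longrightarrow> (zb V' x \<longleftrightarrow> zb V0 x))"
proof -
  have dV [dfi]: "dt f \<Longrightarrow> dt (\<lambda>x. V (f x))" for f using V dt_comp[of V] by (simp add: model_def)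
  have dz [dfi]: "dt f \<Longrightarrow> df (\<lambda>x. zb V (f x))" for f
    unfolding zb_def by (intro df_disj df_eq dV dt_const)
  have dtb [dfi]: "dt f \<Longrightarrow> df (\<lambda>x. tb V (f x))" for f
    unfolding tb_def by (intro df_disj df_eq dV dt_const)
  note cl = model_clauses[OF V]
  define wit where "wit p = lst (\<lambda>y. tb V (subn p y) \<longleftrightarrow> \<not> zb V (ngn p))" for p
  have wit: "tb V (subn p (wit p)) \<noteq> zb V (ngn p)" if "tb V (subn p y) \<noteq> zb V (ngn p)" for p y
  proof -
    have "df (\<lambda>y. tb V (subn p y) \<longleftrightarrow> \<not> zb V (ngn p))" by (intro dfi)
    then have "tb V (subn p (wit p)) \<longleftrightarrow> \<not> zb V (ngn p)"
      unfolding wit_def by (rule lst[of _ y]) (use that in blast)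
    then show ?thesis by blast
  qed
  \<comment> \<open>The test compares the name of the skeleton with \<open>fs\<close> itself, not
    the values of the two: only the witnesses introduced under this name are reinterpreted.\<close>
  obtain E where E: "dt E" "\<And>a. E (nK a) = nK a"
    "\<And>g p. E (nW g p) = (if \<pi>1 (\<pi>2 (nW g p)) = fs then wit (\<pi>2 (prk (E g) (E p)))
        else nW (\<pi>1 (prk (E g) (E p))) (\<pi>2 (prk (E g) (E p))))"
    "\<And>q x. E (nG q x) = nG q (E x)" "\<And>x y. E (nP x y) = nP (E x) (E y)"
    "\<And>x. (\<And>c. x \<noteq> nK c) \<Longrightarrow> (\<And>g p. x \<noteq> nW g p) \<Longrightarrow> (\<And>q y. x \<noteq> nG q y) \<Longrightarrow> (\<And>y z. x \<noteq> nP y z) \<Longrightarrow> E x = x"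
    by (rule name_recursion[of nK "\<lambda>x y. if \<pi>1 (\<pi>2 x) = fs then wit (\<pi>2 y) else nW (\<pi>1 y) (\<pi>2 y)" nG nP "\<lambda>x. x"])
      (unfold wit_def, (intro dfi | blast)+)
  note [dfi] = dt_comp[OF E(1)]
  have EW: "E (nW fs p) = wit (E p)" "g \<noteq> fs \<Longrightarrow> E (nW g p) = nW (E g) (E p)" for g p
    by (simp_all add: E(3))
  \<comment> \<open>A witness named with \<open>fs\<close> has a stage above \<open>k\<close>, so
    none occurs in a name of stage at most \<open>k\<close>.\<close>
  have Est: "E x = x" if "st x \<le> k" for x
  proof -
    have "st x \<le> k \<longrightarrow> E x = x"
    proof (rule df_less_induct[of "\<lambda>x. st x \<le> k \<longrightarrow> E x = x"], intro dfi, rule impI)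
      fix x assume IH: "\<And>y. y < x \<Longrightarrow> st y \<le> k \<longrightarrow> E y = y" and k: "st x \<le> k"
      show "E x = x"
      proof (cases x rule: name_cases)
        case (2 g p)
        then have *: "g < x" "p < x" using names_less by auto
        have "st g + 1 \<le> k" "st p \<le> k" using k 2 by auto
        then have "st g < k" by (simp add: less_iff_add1)
        then have "g \<noteq> fs" "E g = g" "E p = p" using fs IH * \<open>st p \<le> k\<close> by auto
        then show ?thesis using 2 EW by simp
      next
        case (3 q y)
        then have "y < x" "st y \<le> k" using k names_less by auto
        then show ?thesis using 3 IH E(4) by simp
      next
        case (4 y z)
        then have "y < x" "z < x" "st y \<le> k" "st z \<le> k" using k names_less by auto
        then show ?thesis using 4 IH E(5) by simp
      qed (use E in auto)
    qed
    then show ?thesis using that by blast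
  qed
  define Tn where "Tn u \<longleftrightarrow> (if zb V (hdn u) \<and> zb V (eqn fs (skn u))
      then \<exists>y. tb V (subn u y) \<longleftrightarrow> \<not> zb V (ngn u) else tb V u)" for u
  define V' where "V' x = code2 (zb V (E x)) (Tn (E x))" for x
  have zb': "zb V' x \<longleftrightarrow> zb V (E x)" and tb': "tb V' x \<longleftrightarrow> Tn (E x)" for x
    by (rule zb_code2 tb_code2, rule V'_def)+
  \<comment> \<open>For a skeleton in \<open>H\<close> the predicate is compositional already. So
    the redefinition changes nothing, even if \<open>fs\<close> has the same value under another
    name.\<close>
  have A: "Tn u \<longleftrightarrow> tb V u" if "H g" "zb V (eqn g (skn u))" "zb V (hdn u)" for g u
    using cl(3)[OF that] cl(4)[OF that] unfolding Tn_def by meson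
  \<comment> \<open>If the part has the skeleton \<open>fs\<close>, then \<open>g\<close> is larger
    than \<open>fs\<close>, and by \<open>Hmax\<close> its stage is below \<open>k\<close>. Then
    \<open>d1n g\<close> and \<open>d2n g\<close> have that stage too and belong to
    \<open>H\<close>. As one of them names the skeleton of the part, the redefinition does not
    affect the part.\<close>
  have B: "Tn (subn u x) \<longleftrightarrow> tb V (subn u x)"
    if g: "H g \<or> g = fs" and e: "zb V (eqn g (skn u))" and h: "zb V (hdn u)" for g u x
  proof (cases "zb V (hdn (subn u x)) \<and> zb V (eqn fs (skn (subn u x)))")
    case True
    let ?q = "subn u x"
    define S where "S = {eqn g (skn u), hdn u, eqn fs (skn ?q), eqn (d1n g) (skn ?q),
        eqn (d2n g) (skn ?q), ltn fs g}"
    have "finite S" by (simp add: S_def)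
    then obtain r where r: "thom r" "\<And>x. x \<in> S \<Longrightarrow> zb V x \<longleftrightarrow> r x = 0"
      by (rule model_real[OF V]) blast
    note r = r(1) r(2)[unfolded S_def]
    note rs = thomD(3,4)[OF r(1)]
    have 1: "r g = G 2 (r u)" "G 4 (r u) = 0" "r fs = G 2 (G 3 (prk (r u) (r x)))"
      using e h True r(2)[of "eqn g (skn u)"] r(2)[of "hdn u"] r(2)[of "eqn fs (skn ?q)"]
      by (simp_all add: rs G_eq)
    have lt: "r fs < r g" using skeleton_less[OF 1(2)] 1 by simp
    then have "zb V (ltn fs g)" using r(2)[of "ltn fs g"] by (simp add: rs G_lt)
    moreover have "g \<noteq> fs" using lt by auto
    ultimately have "st g \<noteq> k" "H g" using Hmax[of g] agree[of "ltn fs g"] g fs Hk by auto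
    then have k: "st g < k" using Hk by (simp add: less_le)
    have "zb V (eqn (d1n g) (skn ?q)) \<or> zb V (eqn (d2n g) (skn ?q))"
      using skeleton[OF 1(2), of "r x"] r(2)[of "eqn (d1n g) (skn ?q)"] r(2)[of "eqn (d2n g) (skn ?q)"]
      by (auto simp: rs G_eq 1)
    moreover have "H (d1n g)" "H (d2n g)" using Hlt k by simp_all
    ultimately show ?thesis using A True by blast
  next
    case False
    show ?thesis unfolding Tn_def if_not_P[OF False] ..
  qed
  have "model (\<lambda>g. H g \<or> g = fs) V'"
    unfolding model_def
  proof (intro conjI allI)
    show "dt V'" unfolding V'_def Tn_def by (intro dt_code2 dfi)
    show "V' x \<le> 3" for x unfolding V'_def by (rule code2_le)
    fix N
    obtain m where m: "\<And>x. x < N \<Longrightarrow> E x \<le> m" using dt_upper[OF E(1)] by meson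
    obtain r where r: "thom r" "\<And>x. x < m + 1 \<Longrightarrow> zb V x \<longleftrightarrow> r x = 0" using V unfolding model_def by meson
    have "thom (\<lambda>x. r (E x))" by (rule thom_comp[OF r(1) E(1,2,4,5)])
    moreover have "zb V' x \<longleftrightarrow> r (E x) = 0" if "x < N" for x
      using r(2)[of "E x"] m[OF that] zb' by (simp add: le_iff_less1)
    ultimately show "\<exists>r. thom r \<and> (\<forall>x<N. zb V' x \<longleftrightarrow> r x = 0)" by blast
  next
    show "clauses (\<lambda>g. H g \<or> g = fs) V' (\<lambda>_. True)"
      unfolding clauses_def zb' tb' E(4,5)
    proof (intro conjI allI impI)
      fix p p' assume e: "zb V (eqn (E p) (E p'))" and t: "Tn (E p)"
      have "tb V (subn (E p) y) = tb V (subn (E p') y)" for y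
        using model_tb_cong[OF V model_congs(4)[OF V e]] .
      then have "Tn (E p) = Tn (E p')"
        unfolding Tn_def model_congs(1,2,3)[OF V e] model_tb_cong[OF V e] by simp
      then show "Tn (E p')" using t by simp
    next
      fix p assume "\<not> zb V (hdn (E p))"
      then show "Tn (E p) \<longleftrightarrow> zb V (atn (E p))" unfolding Tn_def using cl(2) by simp
    next
      fix g p assume g: "H g \<or> g = fs" and e: "zb V (eqn (E g) (skn (E p)))" and h: "zb V (hdn (E p))"
        and t: "Tn (E p)"
      have Eg: "E g = g" using g Hk fs by (intro Est) auto
      note e = e[unfolded Eg]
      have "tb V (subn (E p) (E (nW g p))) \<noteq> zb V (ngn (E p))"
      proof (cases "g = fs")
        case True
        then obtain y where "tb V (subn (E p) y) \<longleftrightarrow> \<not> zb V (ngn (E p))"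
          using t e h unfolding Tn_def by auto
        then have "tb V (subn (E p) (wit (E p))) \<noteq> zb V (ngn (E p))" by (intro wit) blast
        then show ?thesis using True EW by simp
      next
        case False
        then have "H g" using g by blast
        then show ?thesis using cl(3)[OF _ e h] A[OF _ e h] t False EW Eg by simp
      qed
      then show "Tn (subn (E p) (E (nW g p))) \<noteq> zb V (ngn (E p))" using B[OF g e h] by simp
    next
      fix g p x assume g: "H g \<or> g = fs" and e: "zb V (eqn (E g) (skn (E p)))" and h: "zb V (hdn (E p))"
        and t: "Tn (subn (E p) (E x)) \<noteq> zb V (ngn (E p))"
      have Eg: "E g = g" using g Hk fs by (intro Est) auto
      note e = e[unfolded Eg]
      have t: "tb V (subn (E p) (E x)) \<noteq> zb V (ngn (E p))" using t B[OF g e h] by simp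
      show "Tn (E p)"
      proof (cases "g = fs")
        case True
        then show ?thesis using t e h unfolding Tn_def by auto
      next
        case False
        then have "H g" using g by blast
        then show ?thesis using cl(4)[OF _ e h t] A[OF _ e h] by simp
      qed
    qed
  qed
  moreover have "zb V' x \<longleftrightarrow> zb V0 x" if "st x \<le> k" for x
    using zb' Est[OF that] agree[OF that] by simp
  ultimately show ?thesis by blast
qed

lemma base_model: "\<exists>V. model (\<lambda>_. False) V"
proof -
  have "hom (dec 0) 0" by (simp add: hom_def)
  then obtain r where r: "thom r" using thom_extend by blast
  define V where "V x = code2 (r x = 0) (G 6 (r x) = 0)" for x
  have zb: "zb V x \<longleftrightarrow> r x = 0" and tb: "tb V x \<longleftrightarrow> G 6 (r x) = 0" for x
    by (rule zb_code2 tb_code2, rule V_def)+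
  have "dt V" unfolding V_def by (intro dt_code2 dfi dt_comp[OF thomD(1)[OF r]])
  moreover have "V x \<le> 3" for x unfolding V_def by (rule code2_le)
  moreover have "clauses (\<lambda>_. False) V (\<lambda>_. True)"
    unfolding clauses_def zb tb by (simp add: thomD[OF r] G_eq)
  moreover have "\<exists>r. thom r \<and> (\<forall>x<N. zb V x \<longleftrightarrow> r x = 0)" for N using r zb by blast
  ultimately show ?thesis unfolding model_def by blast
qed

lemma maximal_exists:
  assumes "df P" "dt g" "\<exists>m<n. P m"
  obtains m where "m < n" "P m" "\<And>j. j < n \<Longrightarrow> P j \<Longrightarrow> g j \<le> (g m :: kk)"
proof -
  note [dfi] = df_comp[OF assms(1)] dt_comp[OF assms(2)]
  have "(\<exists>m<n. P m) \<longrightarrow> (\<exists>m<n. P m \<and> (\<forall>j<n. P j \<longrightarrow> g j \<le> g m))"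
  proof (rule df_induct[of "\<lambda>n. (\<exists>m<n. P m) \<longrightarrow> (\<exists>m<n. P m \<and> (\<forall>j<n. P j \<longrightarrow> g j \<le> g m))"], intro dfi)
    show "(\<exists>m<0. P m) \<longrightarrow> (\<exists>m<0. P m \<and> (\<forall>j<0. P j \<longrightarrow> g j \<le> g m))" by simp
    fix n assume IH: "(\<exists>m<n. P m) \<longrightarrow> (\<exists>m<n. P m \<and> (\<forall>j<n. P j \<longrightarrow> g j \<le> g m))"
    show "(\<exists>m<n + 1. P m) \<longrightarrow> (\<exists>m<n + 1. P m \<and> (\<forall>j<n + 1. P j \<longrightarrow> g j \<le> g m))"
    proof
      assume ex: "\<exists>m<n + 1. P m"
      show "\<exists>m<n + 1. P m \<and> (\<forall>j<n + 1. P j \<longrightarrow> g j \<le> g m)"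
      proof (cases "P n \<and> (\<forall>j<n. P j \<longrightarrow> g j \<le> g n)")
        case True
        then show ?thesis by (intro exI[of _ n]) (auto simp: less_add1_iff)
      next
        case False
        then have "\<exists>m<n. P m" using ex by (auto simp: less_add1_iff)
        then obtain m where m: "m < n" "P m" "\<forall>j<n. P j \<longrightarrow> g j \<le> g m" using IH by blast
        have "P n \<Longrightarrow> g n \<le> g m" using False m(3) by (meson less_imp_le linorder_not_le order_trans)
        then show ?thesis using m by (intro exI[of _ m]) (auto simp: less_add1_iff)
      qed
    qed
  qed
  then show ?thesis using assms(3) that by blast
qed

lemma Con_mono:
  assumes "Con H A V0" "\<And>g. H' g \<Longrightarrow> H g" shows "Con H' A V0"
  unfolding Con_def
proof
  fix N
  obtain v where "okk H A V0 (dec v) N" using assms(1) unfolding Con_def by blast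
  then have "okk H' A V0 (dec v) N" by (rule okk_mono) (use assms(2) in blast)+
  then show "\<exists>v. okk H' A V0 (dec v) N" by blast
qed

text \<open>The outer induction is on the stage. The inner one is on the number of skeletons of
  stage \<open>k\<close> that are treated, and these are listed by a coded sequence
  \<open>s\<close>. A model \<open>V0\<close> of the preceding stage fixes the zero tests for names
  of stage at most \<open>k\<close> beforehand, so that the order of the listed skeletons does not
  change while they are added.\<close>

lemma Con_stage: "Con (\<lambda>f. st f < k) (\<lambda>_. False) (\<lambda>_. 0)"
proof (rule df_induct[of "\<lambda>k. Con (\<lambda>f. st f < k) (\<lambda>_. False) (\<lambda>_. 0)"])
  have "df (\<lambda>p. okk (\<lambda>f. st f < \<pi>1 (\<pi>1 p)) (\<lambda>_. False) (\<lambda>_. 0) (dec (\<pi>2 p)) (\<pi>2 (\<pi>1 p)))"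
    by (rule df_okk[of "\<lambda>k f. st f < k" _ _ "\<lambda>p. \<pi>1 (\<pi>1 p)" \<pi>2 "\<lambda>p. \<pi>2 (\<pi>1 p)"]) (intro dfi)+
  then show "df (\<lambda>k. Con (\<lambda>f. st f < k) (\<lambda>_. False) (\<lambda>_. 0))"
    unfolding Con_def by (intro df_all df_ex)
  obtain V where "model (\<lambda>_. False) V" using base_model by blast
  then show "Con (\<lambda>f. st f < 0) (\<lambda>_. False) (\<lambda>_. 0)"
    using model_Con[of "\<lambda>_. False" V "\<lambda>_. False" "\<lambda>_. 0"] by simp
  fix k assume "Con (\<lambda>f. st f < k) (\<lambda>_. False) (\<lambda>_. 0)"
  moreover have "df (\<lambda>f. st f < k)" "df (\<lambda>_. False)" "dt (\<lambda>_. 0)" by (intro dfi)+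
  ultimately obtain V0 where V0: "model (\<lambda>f. st f < k) V0" by (meson Con_model)
  then have dV0: "dt V0" by (simp add: model_def)
  define A where "A x \<longleftrightarrow> st x \<le> k" for x
  define H where "H s i f \<longleftrightarrow> st f < k \<or> (st f = k \<and> (\<exists>j<i. dec s j = f))" for s i f
  have dA: "df A" unfolding A_def by (intro dfi)
  have dH: "df (H s i)" for s i unfolding H_def by (intro dfi)
  have 0: "Con (H s i) A V0" if "\<And>j. j < i \<Longrightarrow> st (dec s j) \<noteq> k" for s i
  proof -
    have "H s i = (\<lambda>f. st f < k)" unfolding H_def using that by auto
    then show ?thesis using model_Con[OF V0] by simp
  qed
  have Con: "\<forall>s. Con (H s i) A V0" for i
  proof (rule df_induct[of "\<lambda>i. \<forall>s. Con (H s i) A V0"])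
    have "df (\<lambda>p. okk (H (\<pi>2 (\<pi>1 (\<pi>1 p))) (\<pi>1 (\<pi>1 (\<pi>1 p)))) A V0 (dec (\<pi>2 p)) (\<pi>2 (\<pi>1 p)))"
      by (rule df_okk[of "\<lambda>i f. H (\<pi>2 i) (\<pi>1 i) f" A V0 "\<lambda>p. \<pi>1 (\<pi>1 p)" \<pi>2 "\<lambda>p. \<pi>2 (\<pi>1 p)"])
        (unfold H_def, (intro dfi dA dV0)+)
    then show "df (\<lambda>i. \<forall>s. Con (H s i) A V0)" unfolding Con_def by (intro df_all df_ex)
    show "\<forall>s. Con (H s 0) A V0" by (intro allI 0) simp
    fix i assume IH: "\<forall>s. Con (H s i) A V0"
    show "\<forall>s. Con (H s (i + 1)) A V0"
    proof
      fix s
      show "Con (H s (i + 1)) A V0"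
      proof (cases "\<exists>j<i + 1. st (dec s j) = k")
        case True
        have "dt (\<lambda>p. ltn (dec s (\<pi>1 p)) (dec s (\<pi>2 p)))" by (intro dfi)
        then have "\<exists>m. \<forall>p<prk (i + 1) (i + 1). ltn (dec s (\<pi>1 p)) (dec s (\<pi>2 p)) \<le> m" by (rule dt_upper)
        then obtain M where M: "ltn (dec s j) (dec s j') \<le> M" if "prk j j' < prk (i + 1) (i + 1)" for j j'
          by (metis proj)
        \<comment> \<open>The names of all comparisons between listed skeletons are below
          \<open>M + 1\<close>, so a single assignment decides all of them.\<close>
        obtain r where r: "thom r" "\<And>x. x < M + 1 \<Longrightarrow> zb V0 x \<longleftrightarrow> r x = 0" using V0 unfolding model_def by meson
        have lt: "zb V0 (ltn (dec s j) (dec s j')) \<longleftrightarrow> r (dec s j) < r (dec s j')"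
          if "j < i + 1" "j' < i + 1" for j j'
        proof -
          have "prk j j' < prk (i + 1) (i + 1)" using that by (intro prk_sum_less add_strict_mono)
          then show ?thesis using r(2)[of "ltn (dec s j) (dec s j')"] M
            by (simp add: le_iff_less1 thomD(3,4)[OF r(1)] G_lt)
        qed
        have "df (\<lambda>j. st (dec s j) = k)" "dt (\<lambda>j. r (dec s j))"
          by (intro dfi dt_comp[OF thomD(1)[OF r(1)]])+
        then obtain m where m: "m < i + 1" "st (dec s m) = k"
          "\<And>j. j < i + 1 \<Longrightarrow> st (dec s j) = k \<Longrightarrow> r (dec s j) \<le> r (dec s m)"
          using maximal_exists[of "\<lambda>j. st (dec s j) = k" "\<lambda>j. r (dec s j)" "i + 1"] True by blast
        \<comment> \<open>The largest skeleton \<open>dec s m\<close> is to be added last, as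
          redefining truth for it could disturb the clauses for larger ones. It is removed from the
          list by moving the last entry to its place.\<close>
        have "dt (\<lambda>j. if j = m then dec s i else dec s j)" by (intro dfi)
        then obtain s' where s': "\<And>j. j < i \<Longrightarrow> dec s' j = (if j = m then dec s i else dec s j)"
          using sequence_coding by blast
        obtain V where V: "model (H s' i) V" "\<And>x. A x \<Longrightarrow> zb V x \<longleftrightarrow> zb V0 x"
          using Con_model[OF dH dA dV0] IH by blast
        have Hk: "st g \<le> k" if "H s' i g" for g using that by (auto simp: H_def)
        have Hlt: "H s' i g" if "st g < k" for g using that by (simp add: H_def)
        have Hmax: "\<not> zb V0 (ltn (dec s m) g)" if Hg: "H s' i g" and sg: "st g = k" for g
        proof -
          obtain j where j: "j < i" "dec s' j = g" using Hg sg by (auto simp: H_def)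
          then obtain j' where j': "j' < i + 1" "dec s j' = g" using s'[OF j(1)]
            by (metis less_add1_iff)
          then show ?thesis using lt[OF m(1) j'(1)] m(3)[OF j'(1)] j'(2) sg by (simp add: not_less)
        qed
        obtain V' where V': "model (\<lambda>g. H s' i g \<or> g = dec s m) V'"
          "\<forall>x. st x \<le> k \<longrightarrow> (zb V' x \<longleftrightarrow> zb V0 x)"
          using add_skeleton[OF dH dV0 V(1) V(2)[unfolded A_def] m(2) Hk Hlt Hmax] by blast
        have "Con (\<lambda>g. H s' i g \<or> g = dec s m) A V0"
          using V'(2) by (intro model_Con[OF V'(1)]) (simp add: A_def)
        moreover have "H s' i g \<or> g = dec s m" if Hg: "H s (i + 1) g" for g
        proof (cases "st g < k \<or> g = dec s m")
          case True
          then show ?thesis by (auto simp: H_def)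
        next
          case False
          then obtain j where j: "j < i + 1" "dec s j = g" "st g = k" using Hg by (auto simp: H_def)
          have "\<exists>j'<i. dec s' j' = g"
          proof (cases "j = i")
            case True
            then have "m < i" using False j m(1) by (auto simp: less_add1_iff)
            then show ?thesis using s'[of m] j True by auto
          next
            case False2: False
            then have "j < i" using j(1) by (simp add: less_add1_iff)
            moreover have "j \<noteq> m" using False j by auto
            ultimately show ?thesis using s'[of j] j(2) by auto
          qed
          then show ?thesis using j(3) by (auto simp: H_def)
        qed
        ultimately show ?thesis by (rule Con_mono)
      next
        case False
        then show ?thesis by (intro 0) blast
      qed
    qed
  qed
  show "Con (\<lambda>f. st f < k + 1) (\<lambda>_. False) (\<lambda>_. 0)"
    unfolding Con_def
  proof
    fix N
    have "dt (\<lambda>j. j)" by (rule dt_id)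
    \<comment> \<open>For an approximation of length \<open>N\<close> only skeletons below
      \<open>N\<close> matter, and the identity sequence lists them all.\<close>
    then obtain s where s: "\<And>j. j < N \<Longrightarrow> dec s j = j" using sequence_coding by blast
    obtain v where v: "okk (H s N) A V0 (dec v) N" using Con unfolding Con_def by blast
    have "okk (\<lambda>f. st f < k + 1) (\<lambda>_. False) V0 (dec v) N"
      by (rule okk_mono[OF v]) (use s in \<open>auto simp: H_def less_add1_iff\<close>)
    then have "okk (\<lambda>f. st f < k + 1) (\<lambda>_. False) (\<lambda>_. 0) (dec v) N" unfolding okk_def by simp
    then show "\<exists>v. okk (\<lambda>f. st f < k + 1) (\<lambda>_. False) (\<lambda>_. 0) (dec v) N" by blast
  qed
qed

text \<open>An approximation of length \<open>N\<close> refers to skeletons below \<open>N\<close>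
  only, and by \<open>st_le\<close> their stages are below \<open>N\<close> as well.\<close>

theorem total_model: "\<exists>V. model (\<lambda>_. True) V"
proof -
  have "Con (\<lambda>_. True) (\<lambda>_. False) (\<lambda>_. 0)"
    unfolding Con_def
  proof
    fix N
    obtain v where v: "okk (\<lambda>f. st f < N) (\<lambda>_. False) (\<lambda>_. 0) (dec v) N"
      using Con_stage[of N] unfolding Con_def by blast
    have "okk (\<lambda>_. True) (\<lambda>_. False) (\<lambda>_. 0) (dec v) N"
      by (rule okk_mono[OF v]) (use st_le le_less_trans in blast)+
    then show "\<exists>v. okk (\<lambda>_. True) (\<lambda>_. False) (\<lambda>_. 0) (dec v) N" by blast
  qed
  moreover have "df (\<lambda>_. True)" "df (\<lambda>_. False)" "dt (\<lambda>_. 0)" by (intro dfi)+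
  ultimately show ?thesis by (meson Con_model)
qed

end


section \<open>The meaning of the arithmetized notions\<close>

subsection \<open>Quantifiers in higher-order abstract syntax\<close>

definition frv :: "(tm \<Rightarrow> fm) \<Rightarrow> nat" where "frv F = Suc (Max (insert 0 (fv (F Zero))))"

lemma frv_neq [simp]: "u \<in> fv (F Zero) \<Longrightarrow> u \<noteq> frv F" "u \<in> fv (F Zero) \<Longrightarrow> frv F \<noteq> u"
proof -
  assume "u \<in> fv (F Zero)"
  then have "u \<le> Max (insert 0 (fv (F Zero)))" by simp
  then show "u \<noteq> frv F" "frv F \<noteq> u" unfolding frv_def by linarith+
qed

lemma frv_fresh [simp]: "(\<And>u. u \<in> tvars s \<Longrightarrow> u \<in> fv (F Zero)) \<Longrightarrow> frv F \<notin> tvars s"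
  using frv_neq(1)[of "frv F" F] by blast

lemma exq_eq: "exq F = Ex (frv F) (F (Var (frv F)))"
  by (simp add: exq_def frv_def Let_def)

lemma sat_exq: "sat I T e (exq F) \<longleftrightarrow> (\<exists>x. sat I T (e(frv F := x)) (F (Var (frv F))))"
  by (simp add: exq_eq)

lemma frv_neg: "frv (\<lambda>x. \<^bold>\<not> F x) = frv F"
  by (simp add: frv_def)

lemma sat_allq: "sat I T e (allq F) \<longleftrightarrow> (\<forall>x. sat I T (e(frv F := x)) (F (Var (frv F))))"
  by (simp add: allq_def exq_eq frv_neg)

lemma fv_exq: "fv (exq F) = fv (F (Var (frv F))) - {frv F}"
  by (simp add: exq_eq)

lemma fv_allq: "fv (allq F) = fv (F (Var (frv F))) - {frv F}"
  by (simp add: allq_def exq_eq frv_neg)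

lemma fv_q:
  assumes "\<And>t. fv (F t) = S \<union> tvars t" shows "fv (exq F) = S" "fv (allq F) = S"
proof -
  have "frv F \<notin> S" using frv_neq(1)[of "frv F" F] assms[of Zero] by auto
  then show "fv (exq F) = S" "fv (allq F) = S" by (auto simp: fv_exq fv_allq assms)
qed

lemma arith_exq [simp]: "arithmetical (exq F) = arithmetical (F (Var (frv F)))"
  by (simp add: exq_eq)

lemma arith_allq [simp]: "arithmetical (allq F) = arithmetical (F (Var (frv F)))"
  by (simp add: allq_def frv_neg)

text \<open>\<open>F\<close> is constrained by its effect on free variables and on satisfaction, for
  all arguments. The former shows that the variable chosen by \<open>exq\<close> is new for
  \<open>S\<close>, the latter that only the value of the argument counts.\<close>

lemma sat_q1:
  assumes "\<And>t. fv (F t) = S \<union> tvars t" "\<And>e t. sat I T e (F t) \<longleftrightarrow> Q e (tval I e t)"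
    "\<And>e v x. v \<notin> S \<Longrightarrow> Q (e(v := x)) = Q e"
  shows "sat I T e (exq F) \<longleftrightarrow> (\<exists>x. Q e x)"
proof -
  have "frv F \<notin> S" using frv_neq(1)[of "frv F" F] assms(1)[of Zero] by auto
  then show ?thesis unfolding sat_exq assms(2) assms(3)[OF \<open>frv F \<notin> S\<close>] by simp
qed

lemma fv_q2:
  assumes "\<And>s t. fv (F s t) = S \<union> tvars s \<union> tvars t" shows "fv (\<^bold>\<exists>s. \<^bold>\<exists>t. F s t) = S"
  by (rule fv_q(1), rule fv_q(1)) (rule assms)

lemma sat_q2:
  assumes "\<And>s t. fv (F s t) = S \<union> tvars s \<union> tvars t"
    "\<And>e s t. sat I T e (F s t) \<longleftrightarrow> Q e (tval I e s) (tval I e t)"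
    "\<And>e v x. v \<notin> S \<Longrightarrow> Q (e(v := x)) = Q e"
  shows "sat I T e (\<^bold>\<exists>s. \<^bold>\<exists>t. F s t) \<longleftrightarrow> (\<exists>x y. Q e x y)"
proof (rule sat_q1)
  show "fv (\<^bold>\<exists>t. F s t) = S \<union> tvars s" for s by (rule fv_q(1)) (rule assms)
  show "sat I T e (\<^bold>\<exists>t. F s t) \<longleftrightarrow> (\<exists>y. Q e (tval I e s) y)" for e s
  proof (rule sat_q1[where S = "S \<union> tvars s" and Q = "\<lambda>e. Q e (tval I e s)"])
    show "Q (e(v := x)) (tval I (e(v := x)) s) = Q e (tval I e s)" if "v \<notin> S \<union> tvars s" for e v x
      using that assms(3) by simp
  qed (rule assms)+
  show "(\<lambda>x. \<exists>y. Q (e(v := z)) x y) = (\<lambda>x. \<exists>y. Q e x y)" if "v \<notin> S" for e v z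
    using assms(3)[OF that] by simp
qed

lemma sat_a1:
  assumes "\<And>t. fv (F t) = S \<union> tvars t" "\<And>e t. sat I T e (F t) \<longleftrightarrow> Q e (tval I e t)"
    "\<And>e v x. v \<notin> S \<Longrightarrow> Q (e(v := x)) = Q e"
  shows "sat I T e (allq F) \<longleftrightarrow> (\<forall>x. Q e x)"
proof -
  have "frv F \<notin> S" using frv_neq(1)[of "frv F" F] assms(1)[of Zero] by auto
  then show ?thesis unfolding sat_allq assms(2) assms(3)[OF \<open>frv F \<notin> S\<close>] by simp
qed

lemma fv_a2:
  assumes "\<And>s t. fv (F s t) = S \<union> tvars s \<union> tvars t" shows "fv (\<^bold>\<forall>s. \<^bold>\<forall>t. F s t) = S"
  by (rule fv_q(2), rule fv_q(2)) (rule assms)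

lemma sat_a2:
  assumes "\<And>s t. fv (F s t) = S \<union> tvars s \<union> tvars t"
    "\<And>e s t. sat I T e (F s t) \<longleftrightarrow> Q e (tval I e s) (tval I e t)"
    "\<And>e v x. v \<notin> S \<Longrightarrow> Q (e(v := x)) = Q e"
  shows "sat I T e (\<^bold>\<forall>s. \<^bold>\<forall>t. F s t) \<longleftrightarrow> (\<forall>x y. Q e x y)"
proof (rule sat_a1)
  show "fv (\<^bold>\<forall>t. F s t) = S \<union> tvars s" for s by (rule fv_q(2)) (rule assms)
  show "sat I T e (\<^bold>\<forall>t. F s t) \<longleftrightarrow> (\<forall>y. Q e (tval I e s) y)" for e s
  proof (rule sat_a1[where S = "S \<union> tvars s" and Q = "\<lambda>e. Q e (tval I e s)"])
    show "Q (e(v := x)) (tval I (e(v := x)) s) = Q e (tval I e s)" if "v \<notin> S \<union> tvars s" for e v x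
      using that assms(3) by simp
  qed (rule assms)+
  show "(\<lambda>x. \<forall>y. Q (e(v := z)) x y) = (\<lambda>x. \<forall>y. Q e x y)" if "v \<notin> S" for e v z
    using assms(3)[OF that] by simp
qed

lemma fv_a3:
  assumes "\<And>s t u. fv (F s t u) = S \<union> tvars s \<union> tvars t \<union> tvars u"
  shows "fv (\<^bold>\<forall>s. \<^bold>\<forall>t. \<^bold>\<forall>u. F s t u) = S"
  by (rule fv_q(2), rule fv_a2) (rule assms)

lemma sat_a3:
  assumes "\<And>s t u. fv (F s t u) = S \<union> tvars s \<union> tvars t \<union> tvars u"
    "\<And>e s t u. sat I T e (F s t u) \<longleftrightarrow> Q e (tval I e s) (tval I e t) (tval I e u)"
    "\<And>e v x. v \<notin> S \<Longrightarrow> Q (e(v := x)) = Q e"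
  shows "sat I T e (\<^bold>\<forall>s. \<^bold>\<forall>t. \<^bold>\<forall>u. F s t u) \<longleftrightarrow> (\<forall>x y z. Q e x y z)"
proof (rule sat_a1)
  show "fv (\<^bold>\<forall>t. \<^bold>\<forall>u. F s t u) = S \<union> tvars s" for s by (rule fv_a2) (rule assms)
  show "sat I T e (\<^bold>\<forall>t. \<^bold>\<forall>u. F s t u) \<longleftrightarrow> (\<forall>y z. Q e (tval I e s) y z)" for e s
  proof (rule sat_a2[where S = "S \<union> tvars s" and Q = "\<lambda>e. Q e (tval I e s)"])
    show "Q (e(v := x)) (tval I (e(v := x)) s) = Q e (tval I e s)" if "v \<notin> S \<union> tvars s" for e v x
      using that assms(3) by simp
  qed (rule assms)+
  show "(\<lambda>x. \<forall>y z. Q (e(v := u)) x y z) = (\<lambda>x. \<forall>y z. Q e x y z)" if "v \<notin> S" for e v u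
    using assms(3)[OF that] by simp
qed

lemma fv_q3:
  assumes "\<And>s t u. fv (F s t u) = S \<union> tvars s \<union> tvars t \<union> tvars u"
  shows "fv (\<^bold>\<exists>s. \<^bold>\<exists>t. \<^bold>\<exists>u. F s t u) = S"
  by (rule fv_q(1), rule fv_q2) (rule assms)

lemma sat_q3:
  assumes "\<And>s t u. fv (F s t u) = S \<union> tvars s \<union> tvars t \<union> tvars u"
    "\<And>e s t u. sat I T e (F s t u) \<longleftrightarrow> Q e (tval I e s) (tval I e t) (tval I e u)"
    "\<And>e v x. v \<notin> S \<Longrightarrow> Q (e(v := x)) = Q e"
  shows "sat I T e (\<^bold>\<exists>s. \<^bold>\<exists>t. \<^bold>\<exists>u. F s t u) \<longleftrightarrow> (\<exists>x y z. Q e x y z)"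
proof (rule sat_q1)
  show "fv (\<^bold>\<exists>t. \<^bold>\<exists>u. F s t u) = S \<union> tvars s" for s by (rule fv_q2) (rule assms)
  show "sat I T e (\<^bold>\<exists>t. \<^bold>\<exists>u. F s t u) \<longleftrightarrow> (\<exists>y z. Q e (tval I e s) y z)" for e s
  proof (rule sat_q2[where S = "S \<union> tvars s" and Q = "\<lambda>e. Q e (tval I e s)"])
    show "Q (e(v := x)) (tval I (e(v := x)) s) = Q e (tval I e s)" if "v \<notin> S \<union> tvars s" for e v x
      using that assms(3) by simp
  qed (rule assms)+
  show "(\<lambda>x. \<exists>y z. Q (e(v := u)) x y z) = (\<lambda>x. \<exists>y z. Q e x y z)" if "v \<notin> S" for e v u
    using assms(3)[OF that] by simp
qed

lemma fv_q4:
  assumes "\<And>s t u v. fv (F s t u v) = S \<union> tvars s \<union> tvars t \<union> tvars u \<union> tvars v"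
  shows "fv (\<^bold>\<exists>s. \<^bold>\<exists>t. \<^bold>\<exists>u. \<^bold>\<exists>v. F s t u v) = S"
  by (rule fv_q2, rule fv_q2) (rule assms)

lemma sat_q4:
  assumes "\<And>s t u v. fv (F s t u v) = S \<union> tvars s \<union> tvars t \<union> tvars u \<union> tvars v"
    "\<And>e s t u v. sat I T e (F s t u v) \<longleftrightarrow> Q e (tval I e s) (tval I e t) (tval I e u) (tval I e v)"
    "\<And>e v x. v \<notin> S \<Longrightarrow> Q (e(v := x)) = Q e"
  shows "sat I T e (\<^bold>\<exists>s. \<^bold>\<exists>t. \<^bold>\<exists>u. \<^bold>\<exists>v. F s t u v) \<longleftrightarrow> (\<exists>x y z w. Q e x y z w)"
proof (rule sat_q2)
  show "fv (\<^bold>\<exists>u. \<^bold>\<exists>v. F s t u v) = S \<union> tvars s \<union> tvars t" for s t by (rule fv_q2) (rule assms)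
  show "sat I T e (\<^bold>\<exists>u. \<^bold>\<exists>v. F s t u v) \<longleftrightarrow> (\<exists>z w. Q e (tval I e s) (tval I e t) z w)" for e s t
  proof (rule sat_q2[where S = "S \<union> tvars s \<union> tvars t" and Q = "\<lambda>e. Q e (tval I e s) (tval I e t)"])
    show "Q (e(v := x)) (tval I (e(v := x)) s) (tval I (e(v := x)) t) = Q e (tval I e s) (tval I e t)"
      if "v \<notin> S \<union> tvars s \<union> tvars t" for e v x
      using that assms(3) by simp
  qed (rule assms)+
  show "(\<lambda>x y. \<exists>z w. Q (e(v := u)) x y z w) = (\<lambda>x y. \<exists>z w. Q e x y z w)" if "v \<notin> S" for e v u
    using assms(3)[OF that] by simp
qed

lemma fv_q5:
  assumes "\<And>r s t u v. fv (F r s t u v) = S \<union> tvars r \<union> tvars s \<union> tvars t \<union> tvars u \<union> tvars v"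
  shows "fv (\<^bold>\<exists>r. \<^bold>\<exists>s. \<^bold>\<exists>t. \<^bold>\<exists>u. \<^bold>\<exists>v. F r s t u v) = S"
  by (rule fv_q(1), rule fv_q4) (rule assms)

lemma sat_q5:
  assumes "\<And>r s t u v. fv (F r s t u v) = S \<union> tvars r \<union> tvars s \<union> tvars t \<union> tvars u \<union> tvars v"
    "\<And>e r s t u v. sat I T e (F r s t u v) \<longleftrightarrow> Q e (tval I e r) (tval I e s) (tval I e t) (tval I e u) (tval I e v)"
    "\<And>e v x. v \<notin> S \<Longrightarrow> Q (e(v := x)) = Q e"
  shows "sat I T e (\<^bold>\<exists>r. \<^bold>\<exists>s. \<^bold>\<exists>t. \<^bold>\<exists>u. \<^bold>\<exists>v. F r s t u v) \<longleftrightarrow> (\<exists>r x y z w. Q e r x y z w)"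
proof (rule sat_q1)
  show "fv (\<^bold>\<exists>s. \<^bold>\<exists>t. \<^bold>\<exists>u. \<^bold>\<exists>v. F r s t u v) = S \<union> tvars r" for r by (rule fv_q4) (rule assms)
  show "sat I T e (\<^bold>\<exists>s. \<^bold>\<exists>t. \<^bold>\<exists>u. \<^bold>\<exists>v. F r s t u v) \<longleftrightarrow> (\<exists>x y z w. Q e (tval I e r) x y z w)" for e r
  proof (rule sat_q4[where S = "S \<union> tvars r" and Q = "\<lambda>e. Q e (tval I e r)"])
    show "Q (e(v := x)) (tval I (e(v := x)) r) = Q e (tval I e r)" if "v \<notin> S \<union> tvars r" for e v x
      using that assms(3) by simp
  qed (rule assms)+
  show "(\<lambda>r. \<exists>x y z w. Q (e(v := u)) r x y z w) = (\<lambda>r. \<exists>x y z w. Q e r x y z w)" if "v \<notin> S" for e v u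
    using assms(3)[OF that] by simp
qed

subsection \<open>Semantic counterparts\<close>

text \<open>The relations that follow copy the formulas of the arithmetized syntax for an arbitrary
  structure, because they are to be compared between \<open>K\<close>, \<open>N\<close>,
  \<open>Ns\<close> and \<open>M\<close>.\<close>

primrec numS :: "'a str \<Rightarrow> nat \<Rightarrow> 'a" where
  "numS I 0 = zer I"
| "numS I (Suc n) = suc I (numS I n)"

definition prS :: "'a str \<Rightarrow> 'a \<Rightarrow> 'a \<Rightarrow> 'a" where
  "prS I x y = plu I (tim I (plu I x y) (plu I x y)) x"

abbreviation tagS :: "'a str \<Rightarrow> nat \<Rightarrow> 'a \<Rightarrow> 'a" where "tagS I n x \<equiv> prS I (numS I n) x"

definition leS where "leS I x y \<longleftrightarrow> (\<exists>z. equ I (plu I x z) y)"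
definition ltS where "ltS I x y \<longleftrightarrow> leS I (suc I x) y"
definition betaS where "betaS I a b i y \<longleftrightarrow>
  (\<exists>q. equ I (plu I (tim I q (suc I (tim I (suc I i) b))) y) a) \<and> ltS I y (suc I (tim I (suc I i) b))"
definition earlierS where "earlierS I a b i z \<longleftrightarrow> (\<exists>j. ltS I j i \<and> betaS I a b j z)"
definition genS where "genS I R x \<longleftrightarrow> (\<exists>a b n. (\<forall>i. leS I i n \<longrightarrow>
  (\<exists>y. betaS I a b i y \<and> R (earlierS I a b i) y)) \<and> betaS I a b n x)"
definition closedS where "closedS I P y \<longleftrightarrow> equ I y (tagS I 1 (zer I)) \<or>
  (\<exists>s. P s \<and> equ I y (tagS I 2 s)) \<or>
  (\<exists>s t. P s \<and> P t \<and> (equ I y (tagS I 3 (prS I s t)) \<or> equ I y (tagS I 4 (prS I s t))))"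
definition is_closed_termS where "is_closed_termS I = genS I (closedS I)"
definition is_termS where
  "is_termS I = genS I (\<lambda>P y. (\<exists>v. equ I y (tagS I 0 v)) \<or> closedS I P y)"
definition is_term_withoutS where "is_term_withoutS I v =
  genS I (\<lambda>P y. (\<exists>u. \<not> equ I u v \<and> equ I y (tagS I 0 u)) \<or> closedS I P y)"
definition is_formulaS where "is_formulaS I = genS I (\<lambda>P y.
    (\<exists>s t. is_termS I s \<and> is_termS I t \<and> equ I y (tagS I 5 (prS I s t)))
    \<or> (\<exists>p. P p \<and> equ I y (tagS I 6 p))
    \<or> (\<exists>p q. P p \<and> P q \<and> equ I y (tagS I 7 (prS I p q)))
    \<or> (\<exists>u p. P p \<and> equ I y (tagS I 8 (prS I u p))))"
definition is_formula_withoutS where "is_formula_withoutS I v = genS I (\<lambda>P y.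
    (\<exists>s t. is_term_withoutS I v s \<and> is_term_withoutS I v t \<and> equ I y (tagS I 5 (prS I s t)))
    \<or> (\<exists>p. P p \<and> equ I y (tagS I 6 p))
    \<or> (\<exists>p q. P p \<and> P q \<and> equ I y (tagS I 7 (prS I p q)))
    \<or> (\<exists>u p. P p \<and> equ I y (tagS I 8 (prS I u p)))
    \<or> (\<exists>p. is_formulaS I p \<and> equ I y (tagS I 8 (prS I v p))))"
definition is_sentenceS where
  "is_sentenceS I x \<longleftrightarrow> is_formulaS I x \<and> (\<forall>v. is_formula_withoutS I v x)"
definition is_formula_inS where "is_formula_inS I v x \<longleftrightarrow>
  is_formulaS I x \<and> (\<forall>u. \<not> equ I u v \<longrightarrow> is_formula_withoutS I u x)"
definition is_valueS where "is_valueS I t y \<longleftrightarrow> genS I (\<lambda>P w.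
     equ I w (prS I (tagS I 1 (zer I)) (zer I))
     \<or> (\<exists>s m. P (prS I s m) \<and> equ I w (prS I (tagS I 2 s) (suc I m)))
     \<or> (\<exists>s m s' m'. P (prS I s m) \<and> P (prS I s' m') \<and>
           (equ I w (prS I (tagS I 3 (prS I s s')) (plu I m m'))
            \<or> equ I w (prS I (tagS I 4 (prS I s s')) (tim I m m'))))) (prS I t y)"
definition is_numeralS where "is_numeralS I x c \<longleftrightarrow> genS I (\<lambda>P w.
     equ I w (prS I (zer I) (tagS I 1 (zer I)))
     \<or> (\<exists>m d. P (prS I m d) \<and> equ I w (prS I (suc I m) (tagS I 2 d)))) (prS I x c)"
definition is_term_substS where "is_term_substS I v c t t' \<longleftrightarrow> genS I (\<lambda>P w.
     equ I w (prS I (tagS I 0 v) c)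
     \<or> (\<exists>u. \<not> equ I u v \<and> equ I w (prS I (tagS I 0 u) (tagS I 0 u)))
     \<or> equ I w (prS I (tagS I 1 (zer I)) (tagS I 1 (zer I)))
     \<or> (\<exists>s s'. P (prS I s s') \<and> equ I w (prS I (tagS I 2 s) (tagS I 2 s')))
     \<or> (\<exists>r r' s s'. P (prS I r r') \<and> P (prS I s s') \<and>
           (equ I w (prS I (tagS I 3 (prS I r s)) (tagS I 3 (prS I r' s')))
            \<or> equ I w (prS I (tagS I 4 (prS I r s)) (tagS I 4 (prS I r' s')))))) (prS I t t')"
definition is_substS where "is_substS I v c p p' \<longleftrightarrow> genS I (\<lambda>P w.
     (\<exists>s s' t t'. is_term_substS I v c s s' \<and> is_term_substS I v c t t' \<and>
        equ I w (prS I (tagS I 5 (prS I s t)) (tagS I 5 (prS I s' t'))))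
     \<or> (\<exists>q q'. P (prS I q q') \<and> equ I w (prS I (tagS I 6 q) (tagS I 6 q')))
     \<or> (\<exists>q q' r r'. P (prS I q q') \<and> P (prS I r r') \<and>
           equ I w (prS I (tagS I 7 (prS I q r)) (tagS I 7 (prS I q' r'))))
     \<or> (\<exists>u q q'. \<not> equ I u v \<and> P (prS I q q') \<and> equ I w (prS I (tagS I 8 (prS I u q)) (tagS I 8 (prS I u q'))))
     \<or> (\<exists>q. is_formulaS I q \<and> equ I w (prS I (tagS I 8 (prS I v q)) (tagS I 8 (prS I v q))))) (prS I p p')"
definition disj_genS where "disj_genS I a b = genS I (\<lambda>P w.
     (\<exists>i e. betaS I a b i e \<and> equ I w (prS I i (prS I (suc I i) e)))
     \<or> (\<exists>i j k e e'. P (prS I i (prS I j e)) \<and> P (prS I j (prS I k e')) \<and>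
           equ I w (prS I i (prS I k (tagS I 7 (prS I e e'))))))"
definition is_disjunctionS where
  "is_disjunctionS I a b m d \<longleftrightarrow> disj_genS I a b (prS I (zer I) (prS I m d))"

definition CTS :: "'a str \<Rightarrow> ('a \<Rightarrow> bool) \<Rightarrow> bool" where
  "CTS I X \<longleftrightarrow> (\<forall>y. X y \<longrightarrow> is_sentenceS I y)
    \<and> (\<forall>s t. is_closed_termS I s \<and> is_closed_termS I t \<longrightarrow>
         (X (tagS I 5 (prS I s t)) \<longleftrightarrow> (\<exists>y. is_valueS I s y \<and> is_valueS I t y)))
    \<and> (\<forall>p. is_sentenceS I p \<longrightarrow> (X (tagS I 6 p) \<longleftrightarrow> \<not> X p))
    \<and> (\<forall>p q. is_sentenceS I p \<and> is_sentenceS I q \<longrightarrow> (X (tagS I 7 (prS I p q)) \<longleftrightarrow> X p \<or> X q))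
    \<and> (\<forall>v p. is_formula_inS I v p \<longrightarrow> (X (tagS I 8 (prS I v p)) \<longleftrightarrow>
         (\<exists>y c q. is_numeralS I y c \<and> is_substS I v c p q \<and> X q)))"

definition DCS :: "'a str \<Rightarrow> ('a \<Rightarrow> bool) \<Rightarrow> 'a \<Rightarrow> bool" where
  "DCS I X m \<longleftrightarrow> (\<forall>a b d. (\<forall>i. ltS I i m \<longrightarrow> (\<exists>p. betaS I a b i p \<and> is_sentenceS I p))
      \<and> is_sentenceS I d \<and> is_disjunctionS I a b m d \<longrightarrow>
      (X d \<longleftrightarrow> (\<exists>i p. ltS I i m \<and> betaS I a b i p \<and> X p)))"

subsection \<open>Correctness of the formulas\<close>

lemma tval_pr' [simp]: "tval I e (pr s t) = prS I (tval I e s) (tval I e t)"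
  by (simp add: pr_def prS_def)

lemma tvars_pr [simp]: "tvars (pr s t) = tvars s \<union> tvars t"
  by (auto simp: pr_def)

lemma tval_numeral [simp]: "tval I e (numeral_tm n) = numS I n"
  by (induction n) auto

lemma tvars_numeral [simp]: "tvars (numeral_tm n) = {}"
  by (induction n) auto

lemma code_simps [simp]:
  "tval I e (varC v) = tagS I 0 (tval I e v)" "tvars (varC v) = tvars v"
  "tval I e zeroC = tagS I 1 (zer I)" "tvars zeroC = {}"
  "tval I e (succC s) = tagS I 2 (tval I e s)" "tvars (succC s) = tvars s"
  "tval I e (addC s t) = tagS I 3 (prS I (tval I e s) (tval I e t))" "tvars (addC s t) = tvars s \<union> tvars t"
  "tval I e (mulC s t) = tagS I 4 (prS I (tval I e s) (tval I e t))" "tvars (mulC s t) = tvars s \<union> tvars t"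
  "tval I e (eqC s t) = tagS I 5 (prS I (tval I e s) (tval I e t))" "tvars (eqC s t) = tvars s \<union> tvars t"
  "tval I e (negC s) = tagS I 6 (tval I e s)" "tvars (negC s) = tvars s"
  "tval I e (orC s t) = tagS I 7 (prS I (tval I e s) (tval I e t))" "tvars (orC s t) = tvars s \<union> tvars t"
  "tval I e (exC s t) = tagS I 8 (prS I (tval I e s) (tval I e t))" "tvars (exC s t) = tvars s \<union> tvars t"
  by (simp_all add: varC_def zeroC_def succC_def addC_def mulC_def eqC_def negC_def orC_def exC_def)

lemmas qsimps = sat_exq sat_allq fv_exq fv_allq

definition earlier :: "tm \<Rightarrow> tm \<Rightarrow> tm \<Rightarrow> tm \<Rightarrow> fm" where
  "earlier a b i z = (\<^bold>\<exists>j. j \<prec> i \<^bold>\<and> beta a b j z)"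

lemma fv_le [simp]: "fv (s \<preceq> t) = tvars s \<union> tvars t"
  unfolding le_def by (rule fv_q) auto

lemma fv_lt [simp]: "fv (s \<prec> t) = tvars s \<union> tvars t"
  unfolding lt_def by simp

lemma fv_beta [simp]: "fv (beta a b i y) = tvars a \<union> tvars b \<union> tvars i \<union> tvars y"
proof -
  have "fv (\<^bold>\<exists>q. q \<otimes> Succ (Succ i \<otimes> b) \<oplus> y \<doteq> a) = tvars i \<union> tvars b \<union> tvars y \<union> tvars a"
    by (rule fv_q) auto
  then show ?thesis unfolding beta_def by auto
qed

lemma fv_earlier [simp]: "fv (earlier a b i z) = tvars a \<union> tvars b \<union> tvars i \<union> tvars z"
  unfolding earlier_def by (rule fv_q) auto

lemma sat_le [simp]: "sat I T e (s \<preceq> t) \<longleftrightarrow> leS I (tval I e s) (tval I e t)"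
  by (simp add: le_def leS_def sat_exq)

lemma sat_lt [simp]: "sat I T e (s \<prec> t) \<longleftrightarrow> ltS I (tval I e s) (tval I e t)"
  by (simp add: lt_def ltS_def)

lemma sat_beta [simp]: "sat I T e (beta a b i y) \<longleftrightarrow>
    betaS I (tval I e a) (tval I e b) (tval I e i) (tval I e y)"
  by (simp add: beta_def betaS_def sat_exq)

lemma sat_earlier [simp]: "sat I T e (earlier a b i z) \<longleftrightarrow>
    earlierS I (tval I e a) (tval I e b) (tval I e i) (tval I e z)"
  by (simp add: earlier_def earlierS_def sat_exq)

lemma generated_eq: "generated R x = (\<^bold>\<exists>a. \<^bold>\<exists>b. \<^bold>\<exists>n.
     (\<^bold>\<forall>i. i \<preceq> n \<^bold>\<longrightarrow> (\<^bold>\<exists>y. beta a b i y \<^bold>\<and> R (earlier a b i) y)) \<^bold>\<and> beta a b n x)"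
  by (simp add: generated_def earlier_def[abs_def])

lemma fv_generated:
  assumes "\<And>a b i y. fv (R (earlier a b i) y) = W \<union> tvars a \<union> tvars b \<union> tvars i \<union> tvars y"
  shows "fv (generated R x) = W \<union> tvars x"
  unfolding generated_eq
proof (intro fv_q, goal_cases)
  case (1 a b n)
  have "fv (\<^bold>\<forall>i. i \<preceq> n \<^bold>\<longrightarrow> (\<^bold>\<exists>y. beta a b i y \<^bold>\<and> R (earlier a b i) y)) = W \<union> tvars a \<union> tvars b \<union> tvars n"
  proof (rule fv_q)
    fix i
    have "fv (\<^bold>\<exists>y. beta a b i y \<^bold>\<and> R (earlier a b i) y) = W \<union> tvars a \<union> tvars b \<union> tvars i"
      by (rule fv_q) (auto simp: assms)
    then show "fv (i \<preceq> n \<^bold>\<longrightarrow> (\<^bold>\<exists>y. beta a b i y \<^bold>\<and> R (earlier a b i) y)) = W \<union> tvars a \<union> tvars b \<union> tvars n \<union> tvars i"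
      by auto
  qed
  then show ?case by auto
qed

lemma sat_generated:
  assumes fv: "\<And>a b i y. fv (R (earlier a b i) y) = W \<union> tvars a \<union> tvars b \<union> tvars i \<union> tvars y"
    and R: "\<And>e a b i y. sat I T e (R (earlier a b i) y)
      \<longleftrightarrow> RS e (earlierS I (tval I e a) (tval I e b) (tval I e i)) (tval I e y)"
    and RS: "\<And>e v x. v \<notin> W \<Longrightarrow> RS (e(v := x)) = RS e"
  shows "sat I T e (generated R x) \<longleftrightarrow> genS I (RS e) (tval I e x)"
proof -
  have fvy: "fv (\<^bold>\<exists>y. beta a b i y \<^bold>\<and> R (earlier a b i) y) = W \<union> tvars a \<union> tvars b \<union> tvars i" for a b i
    by (rule fv_q) (auto simp: fv)
  have fvi: "fv (\<^bold>\<forall>i. i \<preceq> n \<^bold>\<longrightarrow> (\<^bold>\<exists>y. beta a b i y \<^bold>\<and> R (earlier a b i) y)) = W \<union> tvars a \<union> tvars b \<union> tvars n" for a b n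
    by (rule fv_q) (auto simp: fvy)
  have fvn: "fv (\<^bold>\<exists>n. (\<^bold>\<forall>i. i \<preceq> n \<^bold>\<longrightarrow> (\<^bold>\<exists>y. beta a b i y \<^bold>\<and> R (earlier a b i) y)) \<^bold>\<and> beta a b n x) = W \<union> tvars a \<union> tvars b \<union> tvars x" for a b
    by (rule fv_q) (auto simp: fvi)
  have fvb: "fv (\<^bold>\<exists>b. \<^bold>\<exists>n. (\<^bold>\<forall>i. i \<preceq> n \<^bold>\<longrightarrow> (\<^bold>\<exists>y. beta a b i y \<^bold>\<and> R (earlier a b i) y)) \<^bold>\<and> beta a b n x) = W \<union> tvars a \<union> tvars x" for a
    by (rule fv_q) (auto simp: fvn)
  have RSf: "RS (e(frv F := x)) = RS e" if "\<And>u. u \<in> W \<Longrightarrow> u \<in> fv (F Zero)" for e F x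
    by (rule RS) (use frv_neq(1)[of "frv F" F] that in blast)
  have y: "sat I T e (\<^bold>\<exists>y. beta a b i y \<^bold>\<and> R (earlier a b i) y)
    \<longleftrightarrow> (\<exists>y. betaS I (tval I e a) (tval I e b) (tval I e i) y
          \<and> RS e (earlierS I (tval I e a) (tval I e b) (tval I e i)) y)" for e a b i
    by (subst sat_exq) (simp add: R fv RSf)
  have i: "sat I T e (\<^bold>\<forall>i. i \<preceq> n \<^bold>\<longrightarrow> (\<^bold>\<exists>y. beta a b i y \<^bold>\<and> R (earlier a b i) y))
    \<longleftrightarrow> (\<forall>i. leS I i (tval I e n) \<longrightarrow> (\<exists>y. betaS I (tval I e a) (tval I e b) i y
          \<and> RS e (earlierS I (tval I e a) (tval I e b) i) y))" for e a b n
    by (subst sat_allq) (simp add: y fvy RSf)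
  have n: "sat I T e (\<^bold>\<exists>n. (\<^bold>\<forall>i. i \<preceq> n \<^bold>\<longrightarrow> (\<^bold>\<exists>y. beta a b i y \<^bold>\<and> R (earlier a b i) y)) \<^bold>\<and> beta a b n x)
    \<longleftrightarrow> (\<exists>n. (\<forall>i. leS I i n \<longrightarrow> (\<exists>y. betaS I (tval I e a) (tval I e b) i y
          \<and> RS e (earlierS I (tval I e a) (tval I e b) i) y)) \<and> betaS I (tval I e a) (tval I e b) n (tval I e x))" for e a b
    by (subst sat_exq) (simp add: i fvi RSf)
  have b: "sat I T e (\<^bold>\<exists>b. \<^bold>\<exists>n. (\<^bold>\<forall>i. i \<preceq> n \<^bold>\<longrightarrow> (\<^bold>\<exists>y. beta a b i y \<^bold>\<and> R (earlier a b i) y)) \<^bold>\<and> beta a b n x)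
    \<longleftrightarrow> (\<exists>b n. (\<forall>i. leS I i n \<longrightarrow> (\<exists>y. betaS I (tval I e a) b i y
          \<and> RS e (earlierS I (tval I e a) b i) y)) \<and> betaS I (tval I e a) b n (tval I e x))" for e a
    by (subst sat_exq) (simp add: n fvn RSf)
  show ?thesis unfolding generated_eq genS_def
    by (subst sat_exq) (simp add: b fvb RSf)
qed

subsubsection \<open>Terms and formulas\<close>

lemma fv_closed [simp]: "fv (closed_tm_clauses (earlier a b i) y) = tvars a \<union> tvars b \<union> tvars i \<union> tvars y"
  unfolding closed_tm_clauses_def by (auto simp: qsimps)

lemma sat_closed [simp]: "sat I T e (closed_tm_clauses (earlier a b i) y)
    \<longleftrightarrow> closedS I (earlierS I (tval I e a) (tval I e b) (tval I e i)) (tval I e y)"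
  unfolding closed_tm_clauses_def closedS_def by (simp add: qsimps) blast

lemma fv_is_closed_term [simp]: "fv (is_closed_term x) = tvars x"
  unfolding is_closed_term_def by (subst fv_generated[where W = "{}"]) auto

lemma sat_is_closed_term [simp]: "sat I T e (is_closed_term x) \<longleftrightarrow> is_closed_termS I (tval I e x)"
  unfolding is_closed_term_def is_closed_termS_def
  by (rule sat_generated[where W = "{}" and RS = "\<lambda>_. closedS I"]) auto

lemma fv_is_term [simp]: "fv (is_term x) = tvars x"
  unfolding is_term_def by (subst fv_generated[where W = "{}"]) (auto simp: qsimps)

lemma sat_is_term [simp]: "sat I T e (is_term x) \<longleftrightarrow> is_termS I (tval I e x)"
  unfolding is_term_def is_termS_def
  by (rule sat_generated[where W = "{}" and RS = "\<lambda>_ P y. (\<exists>v. equ I y (tagS I 0 v)) \<or> closedS I P y"])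
    (auto simp: qsimps)

lemma fv_is_term_without [simp]: "fv (is_term_without v x) = tvars v \<union> tvars x"
  unfolding is_term_without_def by (subst fv_generated[where W = "tvars v"]) (auto simp: qsimps)

lemma sat_is_term_without [simp]:
  "sat I T e (is_term_without v x) \<longleftrightarrow> is_term_withoutS I (tval I e v) (tval I e x)"
  unfolding is_term_without_def is_term_withoutS_def
  by (rule sat_generated[where W = "tvars v" and RS = "\<lambda>e P y. (\<exists>u. \<not> equ I u (tval I e v) \<and> equ I y (tagS I 0 u)) \<or> closedS I P y"])
    (auto simp: qsimps)

lemma fv_is_formula [simp]: "fv (is_formula x) = tvars x"
  unfolding is_formula_def by (subst fv_generated[where W = "{}"]) (auto simp: qsimps)

lemma sat_is_formula [simp]: "sat I T e (is_formula x) \<longleftrightarrow> is_formulaS I (tval I e x)"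
  unfolding is_formula_def is_formulaS_def
  by (rule sat_generated[where W = "{}" and RS = "\<lambda>_. _"]) (auto simp: qsimps)


lemma fv_is_formula_without [simp]: "fv (is_formula_without v x) = tvars v \<union> tvars x"
  unfolding is_formula_without_def by (subst fv_generated[where W = "tvars v"]) (auto simp: qsimps)

lemma sat_is_formula_without [simp]:
  "sat I T e (is_formula_without v x) \<longleftrightarrow> is_formula_withoutS I (tval I e v) (tval I e x)"
  unfolding is_formula_without_def is_formula_withoutS_def
  by (rule sat_generated[where W = "tvars v" and RS = "\<lambda>e. _ (tval I e v)"]) (auto simp: qsimps)

lemma fv_is_sentence [simp]: "fv (is_sentence x) = tvars x"
  unfolding is_sentence_def by (auto simp: qsimps)

lemma sat_is_sentence [simp]: "sat I T e (is_sentence x) \<longleftrightarrow> is_sentenceS I (tval I e x)"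
  unfolding is_sentence_def is_sentenceS_def by (simp add: qsimps)

lemma fv_is_formula_in [simp]: "fv (is_formula_in v x) = tvars v \<union> tvars x"
  unfolding is_formula_in_def by (auto simp: qsimps)

lemma sat_is_formula_in [simp]:
  "sat I T e (is_formula_in v x) \<longleftrightarrow> is_formula_inS I (tval I e v) (tval I e x)"
  unfolding is_formula_in_def is_formula_inS_def by (simp add: qsimps) blast

context
  fixes I :: "'a str" and T :: "'a \<Rightarrow> 'a \<Rightarrow> bool" and a b i y v c :: tm
begin

abbreviation "Pt \<equiv> earlier a b i"
abbreviation "Pe e \<equiv> earlierS I (tval I e a) (tval I e b) (tval I e i)"

lemma value_op:
  "fv (\<^bold>\<exists>s. \<^bold>\<exists>m. \<^bold>\<exists>s'. \<^bold>\<exists>m'. Pt (pr s m) \<^bold>\<and> Pt (pr s' m') \<^bold>\<and>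
     (y \<doteq> pr (addC s s') (m \<oplus> m') \<^bold>\<or> y \<doteq> pr (mulC s s') (m \<otimes> m'))) = tvars a \<union> tvars b \<union> tvars i \<union> tvars y"
  "sat I T e (\<^bold>\<exists>s. \<^bold>\<exists>m. \<^bold>\<exists>s'. \<^bold>\<exists>m'. Pt (pr s m) \<^bold>\<and> Pt (pr s' m') \<^bold>\<and>
     (y \<doteq> pr (addC s s') (m \<oplus> m') \<^bold>\<or> y \<doteq> pr (mulC s s') (m \<otimes> m')))
   \<longleftrightarrow> (\<exists>s m s' m'. Pe e (prS I s m) \<and> Pe e (prS I s' m') \<and>
     (equ I (tval I e y) (prS I (tagS I 3 (prS I s s')) (plu I m m'))
      \<or> equ I (tval I e y) (prS I (tagS I 4 (prS I s s')) (tim I m m'))))"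
  by ((rule fv_q4, auto)[1])
    (rule sat_q4[where S = "tvars a \<union> tvars b \<union> tvars i \<union> tvars y" and
        Q = "\<lambda>e s m s' m'. Pe e (prS I s m) \<and> Pe e (prS I s' m') \<and>
     (equ I (tval I e y) (prS I (tagS I 3 (prS I s s')) (plu I m m'))
      \<or> equ I (tval I e y) (prS I (tagS I 4 (prS I s s')) (tim I m m')))"]; auto)

lemma term_subst_op:
  "fv (\<^bold>\<exists>r. \<^bold>\<exists>r'. \<^bold>\<exists>s. \<^bold>\<exists>s'. Pt (pr r r') \<^bold>\<and> Pt (pr s s') \<^bold>\<and>
     (y \<doteq> pr (addC r s) (addC r' s') \<^bold>\<or> y \<doteq> pr (mulC r s) (mulC r' s'))) = tvars a \<union> tvars b \<union> tvars i \<union> tvars y"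
  "sat I T e (\<^bold>\<exists>r. \<^bold>\<exists>r'. \<^bold>\<exists>s. \<^bold>\<exists>s'. Pt (pr r r') \<^bold>\<and> Pt (pr s s') \<^bold>\<and>
     (y \<doteq> pr (addC r s) (addC r' s') \<^bold>\<or> y \<doteq> pr (mulC r s) (mulC r' s')))
   \<longleftrightarrow> (\<exists>r r' s s'. Pe e (prS I r r') \<and> Pe e (prS I s s') \<and>
     (equ I (tval I e y) (prS I (tagS I 3 (prS I r s)) (tagS I 3 (prS I r' s')))
      \<or> equ I (tval I e y) (prS I (tagS I 4 (prS I r s)) (tagS I 4 (prS I r' s')))))"
  by ((rule fv_q4, auto)[1])
    (rule sat_q4[where S = "tvars a \<union> tvars b \<union> tvars i \<union> tvars y" and
        Q = "\<lambda>e r r' s s'. Pe e (prS I r r') \<and> Pe e (prS I s s') \<and>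
     (equ I (tval I e y) (prS I (tagS I 3 (prS I r s)) (tagS I 3 (prS I r' s')))
      \<or> equ I (tval I e y) (prS I (tagS I 4 (prS I r s)) (tagS I 4 (prS I r' s'))))"]; auto)

lemma subst_or:
  "fv (\<^bold>\<exists>q. \<^bold>\<exists>q'. \<^bold>\<exists>r. \<^bold>\<exists>r'. Pt (pr q q') \<^bold>\<and> Pt (pr r r') \<^bold>\<and> y \<doteq> pr (orC q r) (orC q' r'))
    = tvars a \<union> tvars b \<union> tvars i \<union> tvars y"
  "sat I T e (\<^bold>\<exists>q. \<^bold>\<exists>q'. \<^bold>\<exists>r. \<^bold>\<exists>r'. Pt (pr q q') \<^bold>\<and> Pt (pr r r') \<^bold>\<and> y \<doteq> pr (orC q r) (orC q' r'))
   \<longleftrightarrow> (\<exists>q q' r r'. Pe e (prS I q q') \<and> Pe e (prS I r r') \<and>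
     equ I (tval I e y) (prS I (tagS I 7 (prS I q r)) (tagS I 7 (prS I q' r'))))"
  by ((rule fv_q4, auto)[1])
    (rule sat_q4[where S = "tvars a \<union> tvars b \<union> tvars i \<union> tvars y" and
        Q = "\<lambda>e q q' r r'. Pe e (prS I q q') \<and> Pe e (prS I r r') \<and>
     equ I (tval I e y) (prS I (tagS I 7 (prS I q r)) (tagS I 7 (prS I q' r')))"]; auto)

lemma subst_eq:
  "fv (\<^bold>\<exists>s. \<^bold>\<exists>s'. \<^bold>\<exists>t. \<^bold>\<exists>t'. is_term_subst v c s s' \<^bold>\<and> is_term_subst v c t t' \<^bold>\<and> y \<doteq> pr (eqC s t) (eqC s' t'))
    = tvars v \<union> tvars c \<union> tvars y" (is ?A)
  "sat I T e (\<^bold>\<exists>s. \<^bold>\<exists>s'. \<^bold>\<exists>t. \<^bold>\<exists>t'. is_term_subst v c s s' \<^bold>\<and> is_term_subst v c t t' \<^bold>\<and> y \<doteq> pr (eqC s t) (eqC s' t'))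
   \<longleftrightarrow> (\<exists>s s' t t'. is_term_substS I (tval I e v) (tval I e c) s s' \<and> is_term_substS I (tval I e v) (tval I e c) t t' \<and>
     equ I (tval I e y) (prS I (tagS I 5 (prS I s t)) (tagS I 5 (prS I s' t'))))" (is ?B)
  if "\<And>t t'. fv (is_term_subst v c t t') = tvars v \<union> tvars c \<union> tvars t \<union> tvars t'"
    "\<And>e t t'. sat I T e (is_term_subst v c t t') \<longleftrightarrow>
      is_term_substS I (tval I e v) (tval I e c) (tval I e t) (tval I e t')"
proof -
  show ?A by (rule fv_q4) (auto simp: that)
  show ?B by (rule sat_q4[where S = "tvars v \<union> tvars c \<union> tvars y" and
        Q = "\<lambda>e s s' t t'. is_term_substS I (tval I e v) (tval I e c) s s' \<and> is_term_substS I (tval I e v) (tval I e c) t t' \<and>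
     equ I (tval I e y) (prS I (tagS I 5 (prS I s t)) (tagS I 5 (prS I s' t')))"]; auto simp: that)
qed

lemma subst_neg:
  "fv (\<^bold>\<exists>q. \<^bold>\<exists>q'. Pt (pr q q') \<^bold>\<and> y \<doteq> pr (negC q) (negC q')) = tvars a \<union> tvars b \<union> tvars i \<union> tvars y"
  "sat I T e (\<^bold>\<exists>q. \<^bold>\<exists>q'. Pt (pr q q') \<^bold>\<and> y \<doteq> pr (negC q) (negC q'))
   \<longleftrightarrow> (\<exists>q q'. Pe e (prS I q q') \<and> equ I (tval I e y) (prS I (tagS I 6 q) (tagS I 6 q')))"
  by ((rule fv_q2, auto)[1])
    (rule sat_q2[where S = "tvars a \<union> tvars b \<union> tvars i \<union> tvars y" and
        Q = "\<lambda>e q q'. Pe e (prS I q q') \<and> equ I (tval I e y) (prS I (tagS I 6 q) (tagS I 6 q'))"]; auto)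

lemma subst_ex:
  "fv (\<^bold>\<exists>u. \<^bold>\<exists>q. \<^bold>\<exists>q'. \<^bold>\<not> u \<doteq> v \<^bold>\<and> Pt (pr q q') \<^bold>\<and> y \<doteq> pr (exC u q) (exC u q'))
    = tvars v \<union> tvars a \<union> tvars b \<union> tvars i \<union> tvars y"
  "sat I T e (\<^bold>\<exists>u. \<^bold>\<exists>q. \<^bold>\<exists>q'. \<^bold>\<not> u \<doteq> v \<^bold>\<and> Pt (pr q q') \<^bold>\<and> y \<doteq> pr (exC u q) (exC u q'))
   \<longleftrightarrow> (\<exists>u q q'. \<not> equ I u (tval I e v) \<and> Pe e (prS I q q') \<and>
     equ I (tval I e y) (prS I (tagS I 8 (prS I u q)) (tagS I 8 (prS I u q'))))"
  by ((rule fv_q3, auto)[1])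
    (rule sat_q3[where S = "tvars v \<union> tvars a \<union> tvars b \<union> tvars i \<union> tvars y" and
        Q = "\<lambda>e u q q'. \<not> equ I u (tval I e v) \<and> Pe e (prS I q q') \<and>
     equ I (tval I e y) (prS I (tagS I 8 (prS I u q)) (tagS I 8 (prS I u q')))"]; auto)

lemma subst_bound:
  "fv (\<^bold>\<exists>q. is_formula q \<^bold>\<and> y \<doteq> pr (exC v q) (exC v q)) = tvars v \<union> tvars y"
  "sat I T e (\<^bold>\<exists>q. is_formula q \<^bold>\<and> y \<doteq> pr (exC v q) (exC v q))
   \<longleftrightarrow> (\<exists>q. is_formulaS I q \<and> equ I (tval I e y) (prS I (tagS I 8 (prS I (tval I e v) q)) (tagS I 8 (prS I (tval I e v) q))))"
  by ((rule fv_q(1), auto)[1])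
    (rule sat_q1[where S = "tvars v \<union> tvars y" and
        Q = "\<lambda>e q. is_formulaS I q \<and> equ I (tval I e y) (prS I (tagS I 8 (prS I (tval I e v) q)) (tagS I 8 (prS I (tval I e v) q)))"]; auto)

lemma disj_single:
  "fv (\<^bold>\<exists>p. \<^bold>\<exists>e. beta v c p e \<^bold>\<and> y \<doteq> pr p (pr (Succ p) e)) = tvars v \<union> tvars c \<union> tvars y"
  "sat I T e (\<^bold>\<exists>p. \<^bold>\<exists>e. beta v c p e \<^bold>\<and> y \<doteq> pr p (pr (Succ p) e))
   \<longleftrightarrow> (\<exists>p d. betaS I (tval I e v) (tval I e c) p d \<and> equ I (tval I e y) (prS I p (prS I (suc I p) d)))"
  by ((rule fv_q2, auto)[1])
    (rule sat_q2[where S = "tvars v \<union> tvars c \<union> tvars y" and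
        Q = "\<lambda>e p d. betaS I (tval I e v) (tval I e c) p d \<and> equ I (tval I e y) (prS I p (prS I (suc I p) d))"]; auto)

lemma disj_or:
  "fv (\<^bold>\<exists>p. \<^bold>\<exists>j. \<^bold>\<exists>k. \<^bold>\<exists>e. \<^bold>\<exists>e'. Pt (pr p (pr j e)) \<^bold>\<and> Pt (pr j (pr k e')) \<^bold>\<and> y \<doteq> pr p (pr k (orC e e')))
    = tvars a \<union> tvars b \<union> tvars i \<union> tvars y"
  "sat I T e (\<^bold>\<exists>p. \<^bold>\<exists>j. \<^bold>\<exists>k. \<^bold>\<exists>e. \<^bold>\<exists>e'. Pt (pr p (pr j e)) \<^bold>\<and> Pt (pr j (pr k e')) \<^bold>\<and> y \<doteq> pr p (pr k (orC e e')))
   \<longleftrightarrow> (\<exists>p j k d d'. Pe e (prS I p (prS I j d)) \<and> Pe e (prS I j (prS I k d')) \<and>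
     equ I (tval I e y) (prS I p (prS I k (tagS I 7 (prS I d d')))))"
  by ((rule fv_q5, auto)[1])
    (rule sat_q5[where S = "tvars a \<union> tvars b \<union> tvars i \<union> tvars y" and
        Q = "\<lambda>e p j k d d'. Pe e (prS I p (prS I j d)) \<and> Pe e (prS I j (prS I k d')) \<and>
     equ I (tval I e y) (prS I p (prS I k (tagS I 7 (prS I d d'))))"]; auto)

end

lemma fv_is_value [simp]: "fv (is_value t y) = tvars t \<union> tvars y"
  unfolding is_value_def by (subst fv_generated[where W = "{}"]) (auto simp: value_op qsimps)

lemma sat_is_value [simp]: "sat I T e (is_value t y) \<longleftrightarrow> is_valueS I (tval I e t) (tval I e y)"
  unfolding is_value_def is_valueS_def
  by (subst sat_generated[where W = "{}" and RS = "\<lambda>_ P w.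
     equ I w (prS I (tagS I 1 (zer I)) (zer I))
     \<or> (\<exists>s m. P (prS I s m) \<and> equ I w (prS I (tagS I 2 s) (suc I m)))
     \<or> (\<exists>s m s' m'. P (prS I s m) \<and> P (prS I s' m') \<and>
           (equ I w (prS I (tagS I 3 (prS I s s')) (plu I m m'))
            \<or> equ I w (prS I (tagS I 4 (prS I s s')) (tim I m m'))))"])
    (auto simp: value_op qsimps)

lemma fv_is_numeral [simp]: "fv (is_numeral t y) = tvars t \<union> tvars y"
  unfolding is_numeral_def by (subst fv_generated[where W = "{}"]) (auto simp: qsimps)

lemma sat_is_numeral [simp]: "sat I T e (is_numeral t y) \<longleftrightarrow> is_numeralS I (tval I e t) (tval I e y)"
  unfolding is_numeral_def is_numeralS_def
  by (subst sat_generated[where W = "{}" and RS = "\<lambda>_. _"]) (auto simp: qsimps)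

lemma fv_is_term_subst [simp]: "fv (is_term_subst v c t t') = tvars v \<union> tvars c \<union> tvars t \<union> tvars t'"
  unfolding is_term_subst_def by (subst fv_generated[where W = "tvars v \<union> tvars c"]) (auto simp: term_subst_op qsimps)

lemma sat_is_term_subst [simp]: "sat I T e (is_term_subst v c t t') \<longleftrightarrow>
    is_term_substS I (tval I e v) (tval I e c) (tval I e t) (tval I e t')"
  unfolding is_term_subst_def is_term_substS_def
  by (subst sat_generated[where W = "tvars v \<union> tvars c" and RS = "\<lambda>e P w.
     equ I w (prS I (tagS I 0 (tval I e v)) (tval I e c))
     \<or> (\<exists>u. \<not> equ I u (tval I e v) \<and> equ I w (prS I (tagS I 0 u) (tagS I 0 u)))
     \<or> equ I w (prS I (tagS I 1 (zer I)) (tagS I 1 (zer I)))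
     \<or> (\<exists>s s'. P (prS I s s') \<and> equ I w (prS I (tagS I 2 s) (tagS I 2 s')))
     \<or> (\<exists>r r' s s'. P (prS I r r') \<and> P (prS I s s') \<and>
           (equ I w (prS I (tagS I 3 (prS I r s)) (tagS I 3 (prS I r' s')))
            \<or> equ I w (prS I (tagS I 4 (prS I r s)) (tagS I 4 (prS I r' s')))))"])
    (auto simp: term_subst_op qsimps)

lemma fv_is_subst [simp]: "fv (is_subst v c t t') = tvars v \<union> tvars c \<union> tvars t \<union> tvars t'"
  unfolding is_subst_def
  by (subst fv_generated[where W = "tvars v \<union> tvars c"]) (auto simp: subst_or subst_eq subst_neg subst_ex subst_bound)

lemma sat_is_subst [simp]: "sat I T e (is_subst v c t t') \<longleftrightarrow>
    is_substS I (tval I e v) (tval I e c) (tval I e t) (tval I e t')"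
  unfolding is_subst_def is_substS_def
  by (subst sat_generated[where W = "tvars v \<union> tvars c" and RS = "\<lambda>e P w.
     (\<exists>s s' t t'. is_term_substS I (tval I e v) (tval I e c) s s' \<and> is_term_substS I (tval I e v) (tval I e c) t t' \<and>
        equ I w (prS I (tagS I 5 (prS I s t)) (tagS I 5 (prS I s' t'))))
     \<or> (\<exists>q q'. P (prS I q q') \<and> equ I w (prS I (tagS I 6 q) (tagS I 6 q')))
     \<or> (\<exists>q q' r r'. P (prS I q q') \<and> P (prS I r r') \<and>
           equ I w (prS I (tagS I 7 (prS I q r)) (tagS I 7 (prS I q' r'))))
     \<or> (\<exists>u q q'. \<not> equ I u (tval I e v) \<and> P (prS I q q') \<and> equ I w (prS I (tagS I 8 (prS I u q)) (tagS I 8 (prS I u q'))))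
     \<or> (\<exists>q. is_formulaS I q \<and> equ I w (prS I (tagS I 8 (prS I (tval I e v) q)) (tagS I 8 (prS I (tval I e v) q))))"])
    (auto simp: subst_or subst_eq subst_neg subst_ex subst_bound)

text \<open>The lower end \<open>i\<close> is a parameter here: the two halves of a disjunction are
  disjunctions of segments that need not start at 0.\<close>

definition disj_fm :: "tm \<Rightarrow> tm \<Rightarrow> tm \<Rightarrow> tm \<Rightarrow> tm \<Rightarrow> fm" where
  "disj_fm a b i k d = generated (\<lambda>P w.
     (\<^bold>\<exists>i. \<^bold>\<exists>e. beta a b i e \<^bold>\<and> w \<doteq> pr i (pr (Succ i) e))
     \<^bold>\<or> (\<^bold>\<exists>i. \<^bold>\<exists>j. \<^bold>\<exists>k. \<^bold>\<exists>e. \<^bold>\<exists>e'. P (pr i (pr j e)) \<^bold>\<and> P (pr j (pr k e')) \<^bold>\<and>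
           w \<doteq> pr i (pr k (orC e e'))))
     (pr i (pr k d))"

lemma is_disjunction_eq: "is_disjunction a b m d = disj_fm a b Zero m d"
  by (simp add: is_disjunction_def disj_fm_def)

lemma fv_disj_fm [simp]: "fv (disj_fm a b i k d) = tvars a \<union> tvars b \<union> tvars i \<union> tvars k \<union> tvars d"
  unfolding disj_fm_def
  by (subst fv_generated[where W = "tvars a \<union> tvars b"]) (auto simp: disj_or disj_single)

lemma sat_disj_fm [simp]: "sat I T e (disj_fm a b i k d) \<longleftrightarrow>
    disj_genS I (tval I e a) (tval I e b) (prS I (tval I e i) (prS I (tval I e k) (tval I e d)))"
  unfolding disj_fm_def disj_genS_def
  by (subst sat_generated[where W = "tvars a \<union> tvars b" and RS = "\<lambda>e P w.
     (\<exists>i p. betaS I (tval I e a) (tval I e b) i p \<and> equ I w (prS I i (prS I (suc I i) p)))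
     \<or> (\<exists>i j k p p'. P (prS I i (prS I j p)) \<and> P (prS I j (prS I k p')) \<and>
           equ I w (prS I i (prS I k (tagS I 7 (prS I p p')))))"])
    (auto simp: disj_or disj_single)

lemma fv_is_disjunction [simp]: "fv (is_disjunction a b m d) = tvars a \<union> tvars b \<union> tvars m \<union> tvars d"
  unfolding is_disjunction_eq by simp

lemma sat_is_disjunction [simp]: "sat I T e (is_disjunction a b m d) \<longleftrightarrow>
    is_disjunctionS I (tval I e a) (tval I e b) (tval I e m) (tval I e d)"
  unfolding is_disjunction_eq is_disjunctionS_def by simp

text \<open>Elementarity of \<open>N\<close> is known only for formulas fixed in advance. That a
  disjunction splits within \<open>N\<close> is transferred from \<open>K\<close> by means of this
  one.\<close>

definition split_fm :: "tm \<Rightarrow> tm \<Rightarrow> tm \<Rightarrow> tm \<Rightarrow> tm \<Rightarrow> fm" where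
  "split_fm a b i k d = (\<^bold>\<exists>j. \<^bold>\<exists>e. \<^bold>\<exists>e'. disj_fm a b i j e \<^bold>\<and> disj_fm a b j k e' \<^bold>\<and> d \<doteq> orC e e')"

lemma sat_split_fm [simp]: "sat I T e (split_fm a b i k d) \<longleftrightarrow>
    (\<exists>j p q. disj_genS I (tval I e a) (tval I e b) (prS I (tval I e i) (prS I j p)) \<and>
      disj_genS I (tval I e a) (tval I e b) (prS I j (prS I (tval I e k) q)) \<and>
      equ I (tval I e d) (tagS I 7 (prS I p q)))"
  unfolding split_fm_def
  by (rule sat_q3[where S = "tvars a \<union> tvars b \<union> tvars i \<union> tvars k \<union> tvars d" and Q = "\<lambda>e j p q.
      disj_genS I (tval I e a) (tval I e b) (prS I (tval I e i) (prS I j p)) \<and>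
      disj_genS I (tval I e a) (tval I e b) (prS I j (prS I (tval I e k) q)) \<and>
      equ I (tval I e d) (tagS I 7 (prS I p q))"]) auto

definition same_value :: "tm \<Rightarrow> tm \<Rightarrow> fm" where
  "same_value s t = (\<^bold>\<exists>y. is_value s y \<^bold>\<and> is_value t y)"

lemma fv_same_value [simp]: "fv (same_value s t) = tvars s \<union> tvars t"
  unfolding same_value_def by (rule fv_q(1)) auto

lemma sat_same_value [simp]: "sat I T e (same_value s t) \<longleftrightarrow>
    (\<exists>y. is_valueS I (tval I e s) y \<and> is_valueS I (tval I e t) y)"
  unfolding same_value_def
  by (rule sat_q1[where S = "tvars s \<union> tvars t" and
      Q = "\<lambda>e y. is_valueS I (tval I e s) y \<and> is_valueS I (tval I e t) y"]) auto

subsubsection \<open>The theory\<close>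

lemma CT_quantifier:
  "fv (\<^bold>\<exists>y. \<^bold>\<exists>c. \<^bold>\<exists>q. is_numeral y c \<^bold>\<and> is_subst v c p q \<^bold>\<and> Tr x q) = tvars v \<union> tvars p \<union> tvars x"
  "sat I T e (\<^bold>\<exists>y. \<^bold>\<exists>c. \<^bold>\<exists>q. is_numeral y c \<^bold>\<and> is_subst v c p q \<^bold>\<and> Tr x q) \<longleftrightarrow>
    (\<exists>y c q. is_numeralS I y c \<and> is_substS I (tval I e v) c (tval I e p) q \<and> T (tval I e x) q)"
  by ((rule fv_q3, auto)[1])
    (rule sat_q3[where S = "tvars v \<union> tvars p \<union> tvars x" and
      Q = "\<lambda>e y c q. is_numeralS I y c \<and> is_substS I (tval I e v) c (tval I e p) q \<and> T (tval I e x) q"]; auto)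

lemma CT_clauses:
  "sat I T e (\<^bold>\<forall>y. Tr x y \<^bold>\<longrightarrow> is_sentence y) \<longleftrightarrow> (\<forall>y. T (tval I e x) y \<longrightarrow> is_sentenceS I y)"
  "sat I T e (\<^bold>\<forall>s. \<^bold>\<forall>t. is_closed_term s \<^bold>\<and> is_closed_term t \<^bold>\<longrightarrow>
     (Tr x (eqC s t) \<^bold>\<longleftrightarrow> (\<^bold>\<exists>y. is_value s y \<^bold>\<and> is_value t y))) \<longleftrightarrow>
   (\<forall>s t. is_closed_termS I s \<and> is_closed_termS I t \<longrightarrow>
     (T (tval I e x) (tagS I 5 (prS I s t)) \<longleftrightarrow> (\<exists>y. is_valueS I s y \<and> is_valueS I t y)))"
  "sat I T e (\<^bold>\<forall>p. is_sentence p \<^bold>\<longrightarrow> (Tr x (negC p) \<^bold>\<longleftrightarrow> \<^bold>\<not> Tr x p)) \<longleftrightarrow>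
   (\<forall>p. is_sentenceS I p \<longrightarrow> (T (tval I e x) (tagS I 6 p) \<longleftrightarrow> \<not> T (tval I e x) p))"
  "sat I T e (\<^bold>\<forall>p. \<^bold>\<forall>q. is_sentence p \<^bold>\<and> is_sentence q \<^bold>\<longrightarrow> (Tr x (orC p q) \<^bold>\<longleftrightarrow> Tr x p \<^bold>\<or> Tr x q)) \<longleftrightarrow>
   (\<forall>p q. is_sentenceS I p \<and> is_sentenceS I q \<longrightarrow>
     (T (tval I e x) (tagS I 7 (prS I p q)) \<longleftrightarrow> T (tval I e x) p \<or> T (tval I e x) q))"
  "sat I T e (\<^bold>\<forall>v. \<^bold>\<forall>p. is_formula_in v p \<^bold>\<longrightarrow> (Tr x (exC v p) \<^bold>\<longleftrightarrow>
     (\<^bold>\<exists>y. \<^bold>\<exists>c. \<^bold>\<exists>q. is_numeral y c \<^bold>\<and> is_subst v c p q \<^bold>\<and> Tr x q))) \<longleftrightarrow>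
   (\<forall>v p. is_formula_inS I v p \<longrightarrow> (T (tval I e x) (tagS I 8 (prS I v p)) \<longleftrightarrow>
     (\<exists>y c q. is_numeralS I y c \<and> is_substS I v c p q \<and> T (tval I e x) q)))"
proof -
  show "sat I T e (\<^bold>\<forall>y. Tr x y \<^bold>\<longrightarrow> is_sentence y) \<longleftrightarrow> (\<forall>y. T (tval I e x) y \<longrightarrow> is_sentenceS I y)"
    by (rule sat_a1[where S = "tvars x" and Q = "\<lambda>e y. T (tval I e x) y \<longrightarrow> is_sentenceS I y"]) auto
  show "sat I T e (\<^bold>\<forall>s. \<^bold>\<forall>t. is_closed_term s \<^bold>\<and> is_closed_term t \<^bold>\<longrightarrow>
     (Tr x (eqC s t) \<^bold>\<longleftrightarrow> (\<^bold>\<exists>y. is_value s y \<^bold>\<and> is_value t y))) \<longleftrightarrow>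
   (\<forall>s t. is_closed_termS I s \<and> is_closed_termS I t \<longrightarrow>
     (T (tval I e x) (tagS I 5 (prS I s t)) \<longleftrightarrow> (\<exists>y. is_valueS I s y \<and> is_valueS I t y)))"
    by (rule sat_a2[where S = "tvars x" and Q = "\<lambda>e s t. is_closed_termS I s \<and> is_closed_termS I t \<longrightarrow>
     (T (tval I e x) (tagS I 5 (prS I s t)) \<longleftrightarrow> (\<exists>y. is_valueS I s y \<and> is_valueS I t y))"])
      (unfold fv.simps sat.simps same_value_def[symmetric] fv_same_value sat_same_value, auto)
  show "sat I T e (\<^bold>\<forall>p. is_sentence p \<^bold>\<longrightarrow> (Tr x (negC p) \<^bold>\<longleftrightarrow> \<^bold>\<not> Tr x p)) \<longleftrightarrow>
   (\<forall>p. is_sentenceS I p \<longrightarrow> (T (tval I e x) (tagS I 6 p) \<longleftrightarrow> \<not> T (tval I e x) p))"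
    by (rule sat_a1[where S = "tvars x" and
        Q = "\<lambda>e p. is_sentenceS I p \<longrightarrow> (T (tval I e x) (tagS I 6 p) \<longleftrightarrow> \<not> T (tval I e x) p)"]) auto
  show "sat I T e (\<^bold>\<forall>p. \<^bold>\<forall>q. is_sentence p \<^bold>\<and> is_sentence q \<^bold>\<longrightarrow> (Tr x (orC p q) \<^bold>\<longleftrightarrow> Tr x p \<^bold>\<or> Tr x q)) \<longleftrightarrow>
   (\<forall>p q. is_sentenceS I p \<and> is_sentenceS I q \<longrightarrow>
     (T (tval I e x) (tagS I 7 (prS I p q)) \<longleftrightarrow> T (tval I e x) p \<or> T (tval I e x) q))"
    by (rule sat_a2[where S = "tvars x" and Q = "\<lambda>e p q. is_sentenceS I p \<and> is_sentenceS I q \<longrightarrow>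
     (T (tval I e x) (tagS I 7 (prS I p q)) \<longleftrightarrow> T (tval I e x) p \<or> T (tval I e x) q)"]) auto
  show "sat I T e (\<^bold>\<forall>v. \<^bold>\<forall>p. is_formula_in v p \<^bold>\<longrightarrow> (Tr x (exC v p) \<^bold>\<longleftrightarrow>
     (\<^bold>\<exists>y. \<^bold>\<exists>c. \<^bold>\<exists>q. is_numeral y c \<^bold>\<and> is_subst v c p q \<^bold>\<and> Tr x q))) \<longleftrightarrow>
   (\<forall>v p. is_formula_inS I v p \<longrightarrow> (T (tval I e x) (tagS I 8 (prS I v p)) \<longleftrightarrow>
     (\<exists>y c q. is_numeralS I y c \<and> is_substS I v c p q \<and> T (tval I e x) q)))"
    by (rule sat_a2[where S = "tvars x" and Q = "\<lambda>e v p. is_formula_inS I v p \<longrightarrow>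
     (T (tval I e x) (tagS I 8 (prS I v p)) \<longleftrightarrow>
     (\<exists>y c q. is_numeralS I y c \<and> is_substS I v c p q \<and> T (tval I e x) q))"])
      (unfold fv.simps sat.simps CT_quantifier, auto)
qed

lemma sat_CT_minus: "sat I T e (CT_minus x) \<longleftrightarrow> CTS I (T (tval I e x))"
  unfolding CT_minus_def CTS_def sat.simps CT_clauses by (simp only: de_Morgan_disj not_not)

lemma fv_CT_minus: "fv (CT_minus x) = tvars x"
proof -
  have "fv (\<^bold>\<forall>y. Tr x y \<^bold>\<longrightarrow> is_sentence y) = tvars x" by (rule fv_q) auto
  moreover have "fv (\<^bold>\<forall>s. \<^bold>\<forall>t. is_closed_term s \<^bold>\<and> is_closed_term t \<^bold>\<longrightarrow>
     (Tr x (eqC s t) \<^bold>\<longleftrightarrow> (\<^bold>\<exists>y. is_value s y \<^bold>\<and> is_value t y))) = tvars x"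
    by (rule fv_a2) (unfold fv.simps same_value_def[symmetric] fv_same_value sat_same_value, auto)
  moreover have "fv (\<^bold>\<forall>p. is_sentence p \<^bold>\<longrightarrow> (Tr x (negC p) \<^bold>\<longleftrightarrow> \<^bold>\<not> Tr x p)) = tvars x"
    by (rule fv_q) auto
  moreover have "fv (\<^bold>\<forall>p. \<^bold>\<forall>q. is_sentence p \<^bold>\<and> is_sentence q \<^bold>\<longrightarrow> (Tr x (orC p q) \<^bold>\<longleftrightarrow> Tr x p \<^bold>\<or> Tr x q)) = tvars x"
    by (rule fv_a2) auto
  moreover have "fv (\<^bold>\<forall>v. \<^bold>\<forall>p. is_formula_in v p \<^bold>\<longrightarrow> (Tr x (exC v p) \<^bold>\<longleftrightarrow>
     (\<^bold>\<exists>y. \<^bold>\<exists>c. \<^bold>\<exists>q. is_numeral y c \<^bold>\<and> is_subst v c p q \<^bold>\<and> Tr x q))) = tvars x"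
    by (rule fv_a2) (unfold fv.simps CT_quantifier, auto)
  ultimately show ?thesis unfolding CT_minus_def fv.simps by (simp only: Un_absorb)
qed

lemma sat_CT_star: "sat I T e CT_star \<longleftrightarrow> (\<forall>x. CTS I (T x))"
  unfolding CT_star_def
  by (rule sat_a1[where S = "{}" and Q = "\<lambda>_ x. CTS I (T x)"]) (simp_all add: sat_CT_minus fv_CT_minus)

lemma DC_premise:
  "fv (\<^bold>\<forall>i. i \<prec> m \<^bold>\<longrightarrow> (\<^bold>\<exists>p. beta a b i p \<^bold>\<and> is_sentence p)) = tvars a \<union> tvars b \<union> tvars m" (is ?A)
  "sat I T e (\<^bold>\<forall>i. i \<prec> m \<^bold>\<longrightarrow> (\<^bold>\<exists>p. beta a b i p \<^bold>\<and> is_sentence p)) \<longleftrightarrow>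
    (\<forall>i. ltS I i (tval I e m) \<longrightarrow> (\<exists>p. betaS I (tval I e a) (tval I e b) i p \<and> is_sentenceS I p))" (is ?B)
proof -
  have 1: "fv (\<^bold>\<exists>p. beta a b i p \<^bold>\<and> is_sentence p) = tvars a \<union> tvars b \<union> tvars i" for i
    by (rule fv_q) auto
  have 2: "sat I T e (\<^bold>\<exists>p. beta a b i p \<^bold>\<and> is_sentence p) \<longleftrightarrow>
    (\<exists>p. betaS I (tval I e a) (tval I e b) (tval I e i) p \<and> is_sentenceS I p)" for i e
    by (rule sat_q1[where S = "tvars a \<union> tvars b \<union> tvars i" and
          Q = "\<lambda>e p. betaS I (tval I e a) (tval I e b) (tval I e i) p \<and> is_sentenceS I p"]) auto
  show ?A by (rule fv_q) (auto simp: 1)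
  show ?B by (rule sat_a1[where S = "tvars a \<union> tvars b \<union> tvars m" and
          Q = "\<lambda>e i. ltS I i (tval I e m) \<longrightarrow> (\<exists>p. betaS I (tval I e a) (tval I e b) i p \<and> is_sentenceS I p)"])
      (auto simp: 1 2)
qed

lemma DC_conclusion:
  "fv (\<^bold>\<exists>i. \<^bold>\<exists>p. i \<prec> m \<^bold>\<and> beta a b i p \<^bold>\<and> Tr x p) = tvars a \<union> tvars b \<union> tvars m \<union> tvars x"
  "sat I T e (\<^bold>\<exists>i. \<^bold>\<exists>p. i \<prec> m \<^bold>\<and> beta a b i p \<^bold>\<and> Tr x p) \<longleftrightarrow>
    (\<exists>i p. ltS I i (tval I e m) \<and> betaS I (tval I e a) (tval I e b) i p \<and> T (tval I e x) p)"
  by ((rule fv_q2, auto)[1])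
    (rule sat_q2[where S = "tvars a \<union> tvars b \<union> tvars m \<union> tvars x" and
      Q = "\<lambda>e i p. ltS I i (tval I e m) \<and> betaS I (tval I e a) (tval I e b) i p \<and> T (tval I e x) p"]; auto)

lemma sat_disjunctively_correct:
  "sat I T e (disjunctively_correct x m) \<longleftrightarrow> DCS I (T (tval I e x)) (tval I e m)"
  unfolding disjunctively_correct_def DCS_def
  by (rule sat_a3[where S = "tvars x \<union> tvars m" and Q = "\<lambda>e a b d.
      (\<forall>i. ltS I i (tval I e m) \<longrightarrow> (\<exists>p. betaS I a b i p \<and> is_sentenceS I p))
      \<and> is_sentenceS I d \<and> is_disjunctionS I a b (tval I e m) d \<longrightarrow>
      (T (tval I e x) d \<longleftrightarrow> (\<exists>i p. ltS I i (tval I e m) \<and> betaS I a b i p \<and> T (tval I e x) p))"])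
    (unfold fv.simps sat.simps DC_premise DC_conclusion, auto)

lemma fv_disjunctively_correct: "fv (disjunctively_correct x m) = tvars x \<union> tvars m"
  unfolding disjunctively_correct_def
  by (rule fv_a3) (unfold fv.simps DC_premise DC_conclusion, auto)

lemma sat_DC_star: "sat I T e DC_star \<longleftrightarrow> (\<forall>x m. leS I m x \<longrightarrow> DCS I (T x) m)"
  unfolding DC_star_def
  by (rule sat_a2[where S = "{}" and Q = "\<lambda>_ x m. leS I m x \<longrightarrow> DCS I (T x) m"])
    (auto simp: sat_disjunctively_correct fv_disjunctively_correct)


section \<open>Arithmetized syntax in the model\<close>

subsection \<open>Definability of formulas\<close>

text \<open>Every element is read as an assignment by iterated projections, and \<open>upd\<close>
  changes one value. So assignments for any fixed formula can be quantified inside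
  \<open>K\<close>.\<close>

primrec env :: "nat \<Rightarrow> kk \<Rightarrow> kk" where
  "env 0 x = \<pi>1 x"
| "env (Suc n) x = env n (\<pi>2 x)"

primrec upd :: "nat \<Rightarrow> kk \<Rightarrow> kk \<Rightarrow> kk" where
  "upd 0 y x = prk y (\<pi>2 x)"
| "upd (Suc n) y x = prk (\<pi>1 x) (upd n y (\<pi>2 x))"

abbreviation ev :: "kk \<Rightarrow> nat \<Rightarrow> kk" where "ev x \<equiv> \<lambda>n. env n x"

lemma ev_upd: "ev (upd v y x) = (ev x)(v := y)"
proof -
  have "env n (upd v y x) = (if n = v then y else env n x)" for n
    by (induction v arbitrary: n x) (case_tac n; simp)+
  then show ?thesis by auto
qed

lemma dt_env [dfi]: "dt f \<Longrightarrow> dt (\<lambda>x. env n (f x))"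
  by (induction n arbitrary: f) (simp_all add: dfi)

lemma dt_upd [dfi]: "dt f \<Longrightarrow> dt g \<Longrightarrow> dt (\<lambda>x. upd n (f x) (g x))"
  by (induction n arbitrary: g) (simp_all add: dfi)

lemma dt_tval_K: "dt f \<Longrightarrow> dt (\<lambda>x. tval K (ev (f x)) t)"
  by (induction t) (simp_all add: dfi sucK_eq)

text \<open>The recursion on \<open>A\<close> takes place outside \<open>K\<close> and yields a
  separate definition for each formula, not a satisfaction predicate.\<close>

lemma df_sat: "arithmetical A \<Longrightarrow> dt f \<Longrightarrow> df (\<lambda>x. sata K (ev (f x)) A)"
proof (induction A arbitrary: f)
  case (Eq s t)
  then show ?case by (simp add: dfi dt_tval_K)
next
  case (Neg A)
  then show ?case by (simp add: dfi)
next
  case (Or A B)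
  then show ?case by (simp add: dfi)
next
  case (Ex v A)
  have "df (\<lambda>p. sata K (ev (upd v (\<pi>2 p) (f (\<pi>1 p)))) A)"
    using Ex by (intro Ex.IH dfi dt_comp[OF Ex.prems(2)]) simp
  then have "df (\<lambda>x. \<exists>y. sata K (ev (upd v y (f x))) A)" by (rule df_ex)
  then show ?case unfolding ev_upd sat.simps .
qed simp

subsection \<open>Inductive definitions\<close>

lemma K_simps [simp]:
  "leS K x y \<longleftrightarrow> x \<le> y" "ltS K x y \<longleftrightarrow> x < y" "prS K x y = prk x y" "numS K n = of_nat n"
  "betaS K a b i y \<longleftrightarrow> y = dec (prk a b) i" "earlierS K a b i z \<longleftrightarrow> (\<exists>j<i. z = dec (prk a b) j)"
proof -
  show le: "leS K x y \<longleftrightarrow> x \<le> y" for x y by (auto simp: leS_def less_eq_kk_def)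
  show lt: "ltS K x y \<longleftrightarrow> x < y" for x y by (simp add: ltS_def le sucK_eq less_iff_add1)
  show "prS K x y = prk x y" by (simp add: prS_def prk_def)
  show "numS K n = of_nat n" by (induction n) (simp_all add: sucK_eq add.commute)
  have pos: "0 < (i + 1) * b + (1 :: kk)" for i b by (simp add: zero_less_iff_neq_zero)
  show b: "betaS K a b i y \<longleftrightarrow> y = dec (prk a b) i" for a b i y
    unfolding dec_def proj modk_iff[OF pos] betaS_def lt by (simp add: sucK_eq)
  show "earlierS K a b i z \<longleftrightarrow> (\<exists>j<i. z = dec (prk a b) j)" by (simp add: earlierS_def lt b)
qed

lemma dec_proj: "dec (prk (\<pi>1 s) (\<pi>2 s)) = dec s"
  by (rule ext) (simp add: dec_def)

abbreviation gk :: "((kk \<Rightarrow> bool) \<Rightarrow> kk \<Rightarrow> bool) \<Rightarrow> kk \<Rightarrow> bool" where "gk \<equiv> genS K"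

lemma gk_iff: "gk R x \<longleftrightarrow> (\<exists>s n. (\<forall>i\<le>n. R (\<lambda>z. \<exists>j<i. z = dec s j) (dec s i)) \<and> x = dec s n)"
proof -
  have e: "earlierS K a b i = (\<lambda>z. \<exists>j<i. z = dec (prk a b) j)" for a b i by (rule ext) simp
  have d: "dec s = dec (prk (\<pi>1 s) (\<pi>2 s))" for s by (simp only: dec_proj)
  show ?thesis
  proof
    assume "gk R x"
    then obtain a b n where "\<forall>i\<le>n. R (\<lambda>z. \<exists>j<i. z = dec (prk a b) j) (dec (prk a b) i)" "x = dec (prk a b) n"
      unfolding genS_def e K_simps by blast
    then show "\<exists>s n. (\<forall>i\<le>n. R (\<lambda>z. \<exists>j<i. z = dec s j) (dec s i)) \<and> x = dec s n" by blast
  next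
    assume "\<exists>s n. (\<forall>i\<le>n. R (\<lambda>z. \<exists>j<i. z = dec s j) (dec s i)) \<and> x = dec s n"
    then obtain s n where s: "\<forall>i\<le>n. R (\<lambda>z. \<exists>j<i. z = dec s j) (dec s i)" "x = dec s n" by blast
    then show "gk R x" unfolding genS_def e K_simps
      by (subst (asm) (1 2) d[of s], subst (asm) d[of s]) blast
  qed
qed

definition monoR :: "((kk \<Rightarrow> bool) \<Rightarrow> kk \<Rightarrow> bool) \<Rightarrow> bool" where
  "monoR R \<longleftrightarrow> (\<forall>P Q y. (\<forall>z. P z \<longrightarrow> Q z) \<longrightarrow> R P y \<longrightarrow> R Q y)"

lemma monoRD: "monoR R \<Longrightarrow> R P y \<Longrightarrow> (\<And>z. P z \<Longrightarrow> Q z) \<Longrightarrow> R Q y"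
  unfolding monoR_def by blast

lemma gk_cases: assumes "monoR R" "gk R x" shows "R (gk R) x"
proof -
  obtain s n where s: "\<forall>i\<le>n. R (\<lambda>z. \<exists>j<i. z = dec s j) (dec s i)" "x = dec s n"
    using assms(2) unfolding gk_iff by blast
  have "gk R (dec s j)" if "j < n" for j
  proof -
    have "\<forall>i\<le>j. R (\<lambda>z. \<exists>j<i. z = dec s j) (dec s i)"
      using s(1) order_trans[OF _ less_imp_le[OF that]] by blast
    then show ?thesis unfolding gk_iff by blast
  qed
  then have q: "\<And>z. \<exists>j<n. z = dec s j \<Longrightarrow> gk R z" by blast
  have "R (\<lambda>z. \<exists>j<n. z = dec s j) (dec s n)" using s(1) by blast
  from monoRD[OF assms(1) this q] show ?thesis unfolding s(2) .
qed

text \<open>A derivation in \<open>K\<close> may have nonstandard length. The induction is therefore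
  one in \<open>K\<close>, on the position within the derivation, and \<open>Q\<close> has to be
  definable.\<close>

lemma gk_induct:
  assumes "monoR R" "gk R x" "df Q" and step: "\<And>y. R (\<lambda>z. gk R z \<and> Q z) y \<Longrightarrow> gk R y \<Longrightarrow> Q y"
  shows "Q x"
proof -
  obtain s n where s: "\<forall>i\<le>n. R (\<lambda>z. \<exists>j<i. z = dec s j) (dec s i)" "x = dec s n"
    using assms(2) unfolding gk_iff by blast
  have g: "gk R (dec s j)" if "j \<le> n" for j
  proof -
    have "\<forall>i\<le>j. R (\<lambda>z. \<exists>j<i. z = dec s j) (dec s i)"
      using s(1) order_trans[OF _ that] by blast
    then show ?thesis unfolding gk_iff by blast
  qed
  have "i \<le> n \<longrightarrow> Q (dec s i)" for i
  proof (rule df_less_induct[of "\<lambda>i. i \<le> n \<longrightarrow> Q (dec s i)"], intro dfi df_comp[OF assms(3)], rule impI)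
    fix i assume IH: "\<And>j. j < i \<Longrightarrow> j \<le> n \<longrightarrow> Q (dec s j)" and i: "i \<le> n"
    have "gk R (dec s j) \<and> Q (dec s j)" if "j < i" for j
    proof -
      have "j \<le> n" using that i by (meson less_imp_le order_trans)
      then show ?thesis using IH[OF that] g by blast
    qed
    then have q: "\<And>z. \<exists>j<i. z = dec s j \<Longrightarrow> gk R z \<and> Q z" by blast
    have "R (\<lambda>z. \<exists>j<i. z = dec s j) (dec s i)" using s(1) i by blast
    from step[OF monoRD[OF assms(1) this q] g[OF i]] show "Q (dec s i)" .
  qed
  then show ?thesis using s(2) by blast
qed

lemma gk_mono: assumes "gk R x" "\<And>P y. R P y \<Longrightarrow> R' P y" shows "gk R' x"
proof -
  obtain s n where "\<forall>i\<le>n. R (\<lambda>z. \<exists>j<i. z = dec s j) (dec s i)" "x = dec s n"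
    using assms(1) unfolding gk_iff by blast
  then have "(\<forall>i\<le>n. R' (\<lambda>z. \<exists>j<i. z = dec s j) (dec s i)) \<and> x = dec s n"
    using assms(2) by simp
  then show ?thesis unfolding gk_iff by (intro exI)
qed

lemma gk_intro0: assumes "R (\<lambda>_. False) y" shows "gk R y"
proof -
  obtain s where s: "\<And>i. i < 1 \<Longrightarrow> dec s i = y" using sequence_coding[of "\<lambda>_. y" 1] by (auto simp: dfi)
  then have "dec s 0 = y" by simp
  then show ?thesis using assms unfolding gk_iff by (intro exI[of _ s] exI[of _ 0]) simp
qed

lemma dt_minus [dfi]: assumes "dt f" "dt g" shows "dt (\<lambda>x. f x - g x)"
proof -
  have "(f x - g x) = (if g x \<le> f x then lst (\<lambda>z. g x + z = f x) else 0)" for x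
  proof (cases "g x \<le> f x")
    case True
    have "lst (\<lambda>z. g x + z = f x) = f x - g x"
    proof (rule lst_eq)
      show "g x + (f x - g x) = f x" using True by simp
    next
      fix z assume "z < f x - g x"
      then show "\<not> g x + z = f x" by (metis add_diff_cancel_left' less_irrefl)
    qed
    then show ?thesis using True by simp
  next
    case False
    then obtain z where "g x = f x + z" using le_iff_add[of "f x" "g x"] by auto
    then have "f x - g x = 0" by (simp add: diff_diff_add[symmetric])
    then show ?thesis using False by simp
  qed
  moreover have "dt (\<lambda>x. if g x \<le> f x then lst (\<lambda>z. g x + z = f x) else 0)"
    by (intro dfi assms dt_comp[OF assms(1)] dt_comp[OF assms(2)])
  ultimately show ?thesis by simp
qed

lemma gk_intro2:
  assumes m: "monoR R" and R: "R (\<lambda>z. z = z1 \<or> z = z2) y" and g: "gk R z1" "gk R z2" shows "gk R y"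
proof -
  obtain s1 n1 where s1: "\<forall>i\<le>n1. R (\<lambda>z. \<exists>j<i. z = dec s1 j) (dec s1 i)" "z1 = dec s1 n1"
    using g(1) unfolding gk_iff by blast
  obtain s2 n2 where s2: "\<forall>i\<le>n2. R (\<lambda>z. \<exists>j<i. z = dec s2 j) (dec s2 i)" "z2 = dec s2 n2"
    using g(2) unfolding gk_iff by blast
  \<comment> \<open>The derivations have \<open>n1 + 1\<close> and \<open>n2 + 1\<close> entries, so
    \<open>M\<close> is the position of the new last entry \<open>y\<close>.\<close>
  define M where "M = n1 + 1 + n2 + 1"
  define f where "f i = (if i \<le> n1 then dec s1 i else if i < M then dec s2 (i - (n1 + 1)) else y)" for i
  have "dt f" unfolding f_def by (intro dfi)
  then obtain s where s: "\<And>i. i < M + 1 \<Longrightarrow> dec s i = f i" using sequence_coding by blast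
  have lt1: "n1 < M" "n1 + 1 + n2 < M" unfolding M_def by (simp_all add: add.assoc less_iff_add1)
  have f1: "f i = dec s1 i" if "i \<le> n1" for i using that by (simp add: f_def)
  have f2: "f (n1 + 1 + i) = dec s2 i" if "i \<le> n2" for i
  proof -
    have "n1 + 1 + i < M" using le_less_trans[OF add_left_mono[OF that] lt1(2)] .
    moreover have "\<not> n1 + 1 + i \<le> n1" by (simp add: not_le add.assoc add_pos_nonneg)
    ultimately show ?thesis by (simp add: f_def add.assoc)
  qed
  have lt2: "n1 + 1 + i < M + 1" if "i \<le> n2" for i
    using le_less_trans[OF add_left_mono[OF that] lt1(2)] by (rule less_trans) (simp add: less_iff_add1)
  have "\<not> M \<le> n1" using lt1(1) by (simp only: not_le)
  then have f3: "f M = y" by (simp add: f_def)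
  have all: "R (\<lambda>z. \<exists>j<i. z = dec s j) (dec s i)" if i: "i \<le> M" for i
  proof -
    have iM: "i < M + 1" using i by (simp add: le_iff_less1)
    have si: "dec s j = f j" if "j \<le> i" for j using s[of j] that iM by (meson le_less_trans)
    consider "i \<le> n1" | u where "i = n1 + 1 + u" "u \<le> n2" | "i = M"
    proof -
      assume a: "i \<le> n1 \<Longrightarrow> thesis" "\<And>u. i = n1 + 1 + u \<Longrightarrow> u \<le> n2 \<Longrightarrow> thesis" "i = M \<Longrightarrow> thesis"
      show thesis
      proof (cases "i \<le> n1 \<or> i = M")
        case False
        then have "n1 + 1 \<le> i" by (simp only: de_Morgan_disj not_le less_iff_add1[symmetric])
        have "i < M" using False i by (simp only: de_Morgan_disj less_le) blast
        obtain u where "i = n1 + 1 + u" using \<open>n1 + 1 \<le> i\<close> unfolding le_iff_add by blast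
        moreover from this have "u \<le> n2" using \<open>i < M\<close> unfolding M_def by (simp add: add.assoc le_iff_less1)
        ultimately show ?thesis using a(2) by blast
      qed (use a in blast)
    qed
    then show ?thesis
    proof cases
      case 1
      have "R (\<lambda>z. \<exists>j<i. z = dec s1 j) (dec s1 i)" using s1(1) 1 by blast
      then have "R (\<lambda>z. \<exists>j<i. z = dec s j) (dec s1 i)"
        by (rule monoRD[OF m]) (use si f1 1 in \<open>metis less_imp_le order_trans\<close>)
      then show ?thesis using si[of i] f1[OF 1] by simp
    next
      case (2 u)
      have "R (\<lambda>z. \<exists>j<u. z = dec s2 j) (dec s2 u)" using s2(1) 2 by blast
      then have "R (\<lambda>z. \<exists>j<i. z = dec s j) (dec s2 u)"
      proof (rule monoRD[OF m])
        fix z assume "\<exists>j<u. z = dec s2 j"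
        then obtain j where j: "j < u" "z = dec s2 j" by blast
        then have "n1 + 1 + j < i" "j \<le> n2" using 2 by (auto intro: less_imp_le order_trans)
        then show "\<exists>j<i. z = dec s j" using si[of "n1 + 1 + j"] f2[of j] j(2) by (metis less_imp_le)
      qed
      then show ?thesis using si[of i] f2[of u] 2 by simp
    next
      case 3
      have "dec s n1 = z1" using si[of n1] f1[of n1] lt1(1) 3 s1(2) by simp
      moreover have "dec s (n1 + 1 + n2) = z2" using si[of "n1 + 1 + n2"] f2[of n2] lt1(2) 3 s2(2) by simp
      ultimately have "R (\<lambda>z. \<exists>j<i. z = dec s j) y"
        using lt1 3 by (intro monoRD[OF m R]) metis
      then show ?thesis using si[of i] f3 3 by simp
    qed
  qed
  have "dec s M = y" using s[of M] f3 by simp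
  then show ?thesis unfolding gk_iff using all by metis
qed


subsection \<open>Fixed-point equations\<close>

text \<open>Two derivations can be concatenated. So it is enough that each clause uses at most two earlier
  entries.\<close>

definition finR :: "((kk \<Rightarrow> bool) \<Rightarrow> kk \<Rightarrow> bool) \<Rightarrow> bool" where
  "finR R \<longleftrightarrow> monoR R \<and> (\<forall>P y. R P y \<longrightarrow> (\<exists>z1 z2. P z1 \<and> P z2 \<and> R (\<lambda>z. z = z1 \<or> z = z2) y) \<or> R (\<lambda>_. False) y)"

lemma finR_const: "finR (\<lambda>P. C)"
  unfolding finR_def monoR_def by simp

lemma finR_ex: assumes "\<And>x. finR (A x)" shows "finR (\<lambda>P y. \<exists>x. A x P y)"
  unfolding finR_def
proof (intro conjI allI impI)
  show "monoR (\<lambda>P y. \<exists>x. A x P y)" using assms unfolding finR_def monoR_def by meson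
  fix P y assume "\<exists>x. A x P y"
  then obtain x where "A x P y" by blast
  then have "(\<exists>z1 z2. P z1 \<and> P z2 \<and> A x (\<lambda>z. z = z1 \<or> z = z2) y) \<or> A x (\<lambda>_. False) y"
    using assms[of x] unfolding finR_def by blast
  then show "(\<exists>z1 z2. P z1 \<and> P z2 \<and> (\<exists>x. A x (\<lambda>z. z = z1 \<or> z = z2) y)) \<or> (\<exists>x. A x (\<lambda>_. False) y)"
    by blast
qed

text \<open>A disjunction is an existential quantification over truth values, so
  \<open>finR_ex\<close> covers it.\<close>

lemma finR_disj: assumes "finR A" "finR B" shows "finR (\<lambda>P y. A P y \<or> B P y)"
proof -
  have "finR (\<lambda>P y. \<exists>b. (if b then A else B) P y)"
    by (rule finR_ex) (simp add: assms)
  moreover have "(\<lambda>P y. \<exists>b. (if b then A else B) P y) = (\<lambda>P y. A P y \<or> B P y)"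
    by (intro ext) (auto split: if_splits)
  ultimately show ?thesis by simp
qed

lemma finR_conj1: "finR (\<lambda>P y. P (f y) \<and> C y)"
  unfolding finR_def monoR_def by blast

lemma finR_conj2: "finR (\<lambda>P y. P (f y) \<and> P (g y) \<and> C y)"
  unfolding finR_def monoR_def by blast

lemma finR_conj3: "finR (\<lambda>P y. C y \<and> P (f y) \<and> D y)"
  unfolding finR_def monoR_def by blast

lemmas finR_rules = finR_const finR_ex finR_disj finR_conj3 finR_conj2 finR_conj1

lemma finR_mono: "finR R \<Longrightarrow> monoR R"
  by (simp add: finR_def)

lemma gk_fix: assumes "finR R" shows "gk R x \<longleftrightarrow> R (gk R) x"
proof
  show "gk R x \<Longrightarrow> R (gk R) x" by (rule gk_cases[OF finR_mono[OF assms]])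
  assume "R (gk R) x"
  then consider z1 z2 where "gk R z1" "gk R z2" "R (\<lambda>z. z = z1 \<or> z = z2) x" | "R (\<lambda>_. False) x"
    using assms unfolding finR_def by blast
  then show "gk R x"
  proof cases
    case 1
    then show ?thesis using gk_intro2[OF finR_mono[OF assms]] by blast
  qed (rule gk_intro0)
qed

lemma gk_induct':
  assumes "finR R" "gk R x" "df Q" and "\<And>y. R (\<lambda>z. gk R z \<and> Q z) y \<Longrightarrow> Q y"
  shows "Q x"
  using assms(2,3,4) by (rule gk_induct[OF finR_mono[OF assms(1)]])

lemma gk_induct2:
  assumes "finR R" "gk R (prk x c)" "df (\<lambda>p. Q (\<pi>1 p) (\<pi>2 p))"
    and "\<And>y. R (\<lambda>z. gk R z \<and> Q (\<pi>1 z) (\<pi>2 z)) y \<Longrightarrow> Q (\<pi>1 y) (\<pi>2 y)"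
  shows "Q x c"
  using gk_induct'[OF assms(1,2,3)] assms(4) by simp

subsection \<open>Definability of the notions\<close>

lemma arith_q: "(\<And>t. arithmetical (F t)) \<Longrightarrow> arithmetical (exq F)" "(\<And>t. arithmetical (F t)) \<Longrightarrow> arithmetical (allq F)"
  by simp_all

lemma arith_le: "arithmetical (s \<preceq> t)" "arithmetical (s \<prec> t)"
  unfolding lt_def le_def by simp_all

lemma arith_beta: "arithmetical (beta a b i y)"
  unfolding beta_def by (simp add: arith_le)

lemma arith_generated:
  assumes "\<And>P y. (\<And>z. arithmetical (P z)) \<Longrightarrow> arithmetical (R P y)" shows "arithmetical (generated R x)"
proof -
  have P: "arithmetical (R (\<lambda>z. \<^bold>\<exists>j. j \<prec> i \<^bold>\<and> beta a b j z) y)" for a b i y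
    by (rule assms) (simp add: arith_le arith_beta)
  show ?thesis
    unfolding generated_def arithmetical.simps
    by (intro arith_q, unfold arithmetical.simps, intro conjI arith_q, unfold arithmetical.simps, intro conjI arith_q)
      (simp_all add: arith_le arith_beta P)
qed

lemma arith_closed: "(\<And>z. arithmetical (P z)) \<Longrightarrow> arithmetical (closed_tm_clauses P y)"
  unfolding closed_tm_clauses_def by (intro arith_q | unfold arithmetical.simps, intro conjI arith_q | simp)+

lemma arith_terms:
  "arithmetical (is_closed_term t)" "arithmetical (is_term t)" "arithmetical (is_term_without v t)"
proof -
  show "arithmetical (is_closed_term t)"
    unfolding is_closed_term_def by (rule arith_generated) (rule arith_closed)
  show "arithmetical (is_term t)" "arithmetical (is_term_without v t)"
    unfolding is_term_def is_term_without_def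
    by (rule arith_generated, unfold arithmetical.simps, (intro conjI arith_q arith_closed | simp)+)+
qed

lemma arith_formulas:
  "arithmetical (is_formula t)" "arithmetical (is_formula_without v t)"
proof -
  show f: "arithmetical (is_formula t)" for t
    unfolding is_formula_def
    by (rule arith_generated, unfold arithmetical.simps, (intro conjI arith_q | simp add: arith_terms)+)
  show "arithmetical (is_formula_without v t)"
    unfolding is_formula_without_def
    by (rule arith_generated, unfold arithmetical.simps, (intro conjI arith_q | simp add: arith_terms f)+)
qed

lemma arith_sentence: "arithmetical (is_sentence t)" "arithmetical (is_formula_in v t)"
  unfolding is_sentence_def is_formula_in_def by (simp_all add: arith_formulas)

lemma arith_relations:
  "arithmetical (is_value s t)" "arithmetical (is_numeral s t)" "arithmetical (is_term_subst v c s t)"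
  "arithmetical (is_subst v c s t)" "arithmetical (disj_fm a b i k d)"
proof -
  show "arithmetical (is_value s t)"
    unfolding is_value_def by (rule arith_generated, unfold arithmetical.simps, (intro conjI arith_q | simp)+)
  show "arithmetical (is_numeral s t)"
    unfolding is_numeral_def by (rule arith_generated, unfold arithmetical.simps, (intro conjI arith_q | simp)+)
  show ts: "arithmetical (is_term_subst v c s t)" for v c s t
    unfolding is_term_subst_def by (rule arith_generated, unfold arithmetical.simps, (intro conjI arith_q | simp)+)
  show "arithmetical (is_subst v c s t)"
    unfolding is_subst_def
    by (rule arith_generated, unfold arithmetical.simps, (intro conjI arith_q | simp add: ts arith_formulas)+)
  show "arithmetical (disj_fm a b i k d)"
    unfolding disj_fm_def
    by (rule arith_generated, unfold arithmetical.simps, (intro conjI arith_q | simp add: arith_beta)+)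
qed

lemma df_syntax1:
  assumes "dt f"
  shows "df (\<lambda>x. is_termS K (f x))" "df (\<lambda>x. is_formulaS K (f x))" "df (\<lambda>x. is_sentenceS K (f x))"
    "df (\<lambda>x. is_closed_termS K (f x))"
  using df_sat[OF arith_terms(2)[of "Var 0"] dt_prk[OF assms dt_const[of 0]]]
    df_sat[OF arith_formulas(1)[of "Var 0"] dt_prk[OF assms dt_const[of 0]]]
    df_sat[OF arith_sentence(1)[of "Var 0"] dt_prk[OF assms dt_const[of 0]]]
    df_sat[OF arith_terms(1)[of "Var 0"] dt_prk[OF assms dt_const[of 0]]]
  by simp_all

lemma df_syntax2:
  assumes "dt f" "dt g"
  shows "df (\<lambda>x. is_term_withoutS K (f x) (g x))" "df (\<lambda>x. is_formula_withoutS K (f x) (g x))"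
    "df (\<lambda>x. is_formula_inS K (f x) (g x))" "df (\<lambda>x. is_valueS K (f x) (g x))"
    "df (\<lambda>x. is_numeralS K (f x) (g x))"
proof -
  note d = dt_prk[OF assms(1) dt_prk[OF assms(2) dt_const[of 0]]]
  show "df (\<lambda>x. is_term_withoutS K (f x) (g x))" using df_sat[OF arith_terms(3)[of "Var 0" "Var 1"] d] by simp
  show "df (\<lambda>x. is_formula_withoutS K (f x) (g x))" using df_sat[OF arith_formulas(2)[of "Var 0" "Var 1"] d] by simp
  show "df (\<lambda>x. is_formula_inS K (f x) (g x))" using df_sat[OF arith_sentence(2)[of "Var 0" "Var 1"] d] by simp
  show "df (\<lambda>x. is_valueS K (f x) (g x))" using df_sat[OF arith_relations(1)[of "Var 0" "Var 1"] d] by simp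
  show "df (\<lambda>x. is_numeralS K (f x) (g x))" using df_sat[OF arith_relations(2)[of "Var 0" "Var 1"] d] by simp
qed

lemma df_syntax4:
  assumes "dt f" "dt g" "dt h" "dt k"
  shows "df (\<lambda>x. is_term_substS K (f x) (g x) (h x) (k x))" "df (\<lambda>x. is_substS K (f x) (g x) (h x) (k x))"
proof -
  note d = dt_prk[OF assms(1) dt_prk[OF assms(2) dt_prk[OF assms(3) dt_prk[OF assms(4) dt_const[of 0]]]]]
  show "df (\<lambda>x. is_term_substS K (f x) (g x) (h x) (k x))"
    using df_sat[OF arith_relations(3)[of "Var 0" "Var 1" "Var 2" "Var 3"] d] by (simp add: eval_nat_numeral)
  show "df (\<lambda>x. is_substS K (f x) (g x) (h x) (k x))"
    using df_sat[OF arith_relations(4)[of "Var 0" "Var 1" "Var 2" "Var 3"] d] by (simp add: eval_nat_numeral)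
qed

lemmas [dfi] = df_syntax1 df_syntax2 df_syntax4

subsection \<open>Terms and formulas\<close>

declare numS.simps [simp del]

definition termR :: "(kk \<Rightarrow> bool) \<Rightarrow> (kk \<Rightarrow> bool) \<Rightarrow> kk \<Rightarrow> bool" where
  "termR C P y \<longleftrightarrow> C y \<or> y = prk 1 0 \<or> (\<exists>s. P s \<and> y = prk 2 s)
     \<or> (\<exists>s t. P s \<and> P t \<and> y = prk 3 (prk s t)) \<or> (\<exists>s t. P s \<and> P t \<and> y = prk 4 (prk s t))"

lemma fin_termR: "finR (termR C)"
  unfolding termR_def[abs_def]
  by (intro finR_rules)

lemma closedS_K: "closedS K P y \<longleftrightarrow> termR (\<lambda>_. False) P y"
  unfolding closedS_def termR_def by simp blast

lemma terms_K:
  "is_closed_termS K = gk (termR (\<lambda>_. False))" "is_termS K = gk (termR (\<lambda>y. \<exists>v. y = prk 0 v))"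
  "is_term_withoutS K v = gk (termR (\<lambda>y. \<exists>u. u \<noteq> v \<and> y = prk 0 u))"
  unfolding is_closed_termS_def is_termS_def is_term_withoutS_def closedS_K[abs_def] termR_def[abs_def] by simp_all

lemma is_term_K [simp]:
  "is_termS K (prk 0 v)" "is_termS K (prk 1 0)" "is_termS K (prk 2 s) \<longleftrightarrow> is_termS K s"
  "is_termS K (prk 3 (prk s t)) \<longleftrightarrow> is_termS K s \<and> is_termS K t"
  "is_termS K (prk 4 (prk s t)) \<longleftrightarrow> is_termS K s \<and> is_termS K t"
  unfolding terms_K by (subst gk_fix[OF fin_termR], simp add: termR_def)+

lemma is_term_without_K [simp]:
  "is_term_withoutS K v (prk 0 u) \<longleftrightarrow> u \<noteq> v" "is_term_withoutS K v (prk 1 0)"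
  "is_term_withoutS K v (prk 2 s) \<longleftrightarrow> is_term_withoutS K v s"
  "is_term_withoutS K v (prk 3 (prk s t)) \<longleftrightarrow> is_term_withoutS K v s \<and> is_term_withoutS K v t"
  "is_term_withoutS K v (prk 4 (prk s t)) \<longleftrightarrow> is_term_withoutS K v s \<and> is_term_withoutS K v t"
  unfolding terms_K by (subst gk_fix[OF fin_termR], simp add: termR_def)+

lemma is_closed_term_K [simp]:
  "is_closed_termS K (prk 1 0)" "is_closed_termS K (prk 2 s) \<longleftrightarrow> is_closed_termS K s"
  unfolding terms_K by (subst gk_fix[OF fin_termR], simp add: termR_def)+

lemma closed_term: assumes "is_closed_termS K t" shows "is_termS K t \<and> is_term_withoutS K v t"
  using assms unfolding terms_K by (auto elim!: gk_mono simp: termR_def)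

lemma term_induct [consumes 1]:
  assumes "is_termS K t" "df Q" "\<And>v. Q (prk 0 v)" "Q (prk 1 0)" "\<And>s. Q s \<Longrightarrow> Q (prk 2 s)"
    "\<And>s t. Q s \<Longrightarrow> Q t \<Longrightarrow> Q (prk 3 (prk s t))" "\<And>s t. Q s \<Longrightarrow> Q t \<Longrightarrow> Q (prk 4 (prk s t))"
  shows "Q t"
  by (rule gk_induct'[OF fin_termR assms(1)[unfolded terms_K] assms(2)])
    (auto simp: termR_def intro: assms(3-))

definition formR :: "(kk \<Rightarrow> bool) \<Rightarrow> (kk \<Rightarrow> bool) \<Rightarrow> (kk \<Rightarrow> bool) \<Rightarrow> kk \<Rightarrow> bool" where
  "formR C D P y \<longleftrightarrow> (\<exists>s t. C s \<and> C t \<and> y = prk 5 (prk s t)) \<or> (\<exists>p. P p \<and> y = prk 6 p)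
     \<or> (\<exists>p q. P p \<and> P q \<and> y = prk 7 (prk p q)) \<or> (\<exists>u p. P p \<and> y = prk 8 (prk u p)) \<or> D y"

lemma fin_formR: "finR (formR C D)"
  unfolding formR_def[abs_def]
  by (intro finR_rules)

lemma formulas_K:
  "is_formulaS K = gk (formR (is_termS K) (\<lambda>_. False))"
  "is_formula_withoutS K v = gk (formR (is_term_withoutS K v) (\<lambda>y. \<exists>p. is_formulaS K p \<and> y = prk 8 (prk v p)))"
  unfolding is_formulaS_def is_formula_withoutS_def formR_def[abs_def] by simp_all

lemma is_formula_K [simp]:
  "is_formulaS K (prk 5 (prk s t)) \<longleftrightarrow> is_termS K s \<and> is_termS K t"
  "is_formulaS K (prk 6 p) \<longleftrightarrow> is_formulaS K p"
  "is_formulaS K (prk 7 (prk p q)) \<longleftrightarrow> is_formulaS K p \<and> is_formulaS K q"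
  "is_formulaS K (prk 8 (prk u p)) \<longleftrightarrow> is_formulaS K p"
  unfolding formulas_K(1) by (subst gk_fix[OF fin_formR], simp add: formR_def)+

lemma is_formula_without_K [simp]:
  "is_formula_withoutS K v (prk 5 (prk s t)) \<longleftrightarrow> is_term_withoutS K v s \<and> is_term_withoutS K v t"
  "is_formula_withoutS K v (prk 6 p) \<longleftrightarrow> is_formula_withoutS K v p"
  "is_formula_withoutS K v (prk 7 (prk p q)) \<longleftrightarrow> is_formula_withoutS K v p \<and> is_formula_withoutS K v q"
  "is_formula_withoutS K v (prk 8 (prk u p)) \<longleftrightarrow> is_formula_withoutS K v p \<or> (u = v \<and> is_formulaS K p)"
proof -
  have fix1: "is_formula_withoutS K v y \<longleftrightarrow> formR (is_term_withoutS K v)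
    (\<lambda>y. \<exists>p. is_formulaS K p \<and> y = prk 8 (prk v p)) (is_formula_withoutS K v) y" for v y
    unfolding formulas_K(2) by (rule gk_fix[OF fin_formR])
  note fix1 = fix1[unfolded formR_def]
  show "is_formula_withoutS K v (prk 5 (prk s t)) \<longleftrightarrow> is_term_withoutS K v s \<and> is_term_withoutS K v t"
    unfolding fix1[of v "prk 5 (prk s t)"] by simp
  show "is_formula_withoutS K v (prk 6 p) \<longleftrightarrow> is_formula_withoutS K v p"
    unfolding fix1[of v "prk 6 p"] by simp
  show "is_formula_withoutS K v (prk 7 (prk p q)) \<longleftrightarrow> is_formula_withoutS K v p \<and> is_formula_withoutS K v q"
    unfolding fix1[of v "prk 7 (prk p q)"] by simp
  show "is_formula_withoutS K v (prk 8 (prk u p)) \<longleftrightarrow> is_formula_withoutS K v p \<or> (u = v \<and> is_formulaS K p)"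
    unfolding fix1[of v "prk 8 (prk u p)"] by auto
qed

lemma formula_induct [consumes 1]:
  assumes "is_formulaS K p" "df Q" "\<And>s t. is_termS K s \<Longrightarrow> is_termS K t \<Longrightarrow> Q (prk 5 (prk s t))"
    "\<And>p. Q p \<Longrightarrow> Q (prk 6 p)" "\<And>p q. Q p \<Longrightarrow> Q q \<Longrightarrow> Q (prk 7 (prk p q))"
    "\<And>u p. is_formulaS K p \<Longrightarrow> Q p \<Longrightarrow> Q (prk 8 (prk u p))"
  shows "Q p"
  by (rule gk_induct'[OF fin_formR assms(1)[unfolded formulas_K(1)] assms(2)])
    (auto simp: formR_def formulas_K(1)[symmetric] intro: assms(3-))

lemma sentence_closure:
  "is_closed_termS K s \<Longrightarrow> is_closed_termS K t \<Longrightarrow> is_sentenceS K (prk 5 (prk s t))"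
  "is_sentenceS K p \<Longrightarrow> is_sentenceS K (prk 6 p)"
  "is_sentenceS K p \<Longrightarrow> is_sentenceS K q \<Longrightarrow> is_sentenceS K (prk 7 (prk p q))"
  "is_formula_inS K v p \<Longrightarrow> is_sentenceS K (prk 8 (prk v p))"
  unfolding is_sentenceS_def is_formula_inS_def by (auto dest: closed_term)

subsection \<open>Numerals and substitution\<close>

definition numR :: "(kk \<Rightarrow> bool) \<Rightarrow> kk \<Rightarrow> bool" where
  "numR P w \<longleftrightarrow> w = prk 0 (prk 1 0) \<or> (\<exists>m d. P (prk m d) \<and> w = prk (m + 1) (prk 2 d))"

lemma fin_numR: "finR numR"
  unfolding numR_def[abs_def] by (intro finR_rules)

lemma is_numeral_gk: "is_numeralS K x c \<longleftrightarrow> gk numR (prk x c)"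
  unfolding is_numeralS_def numR_def[abs_def] by (simp add: sucK_eq)

lemma is_numeral_fix: "is_numeralS K x c \<longleftrightarrow>
    (x = 0 \<and> c = prk 1 0) \<or> (\<exists>m d. is_numeralS K m d \<and> x = m + 1 \<and> c = prk 2 d)"
  unfolding is_numeral_gk gk_fix[OF fin_numR, of "prk x c"] numR_def by simp

lemma is_numeral_K [simp]:
  "is_numeralS K 0 c \<longleftrightarrow> c = prk 1 0" "is_numeralS K (x + 1) c \<longleftrightarrow> (\<exists>d. is_numeralS K x d \<and> c = prk 2 d)"
  unfolding is_numeral_fix[of 0] is_numeral_fix[of "x + 1"] by (auto simp: eq_commute[of 0])

lemma ex1_numeral: "\<exists>!c. is_numeralS K y c"
proof -
  have "df (\<lambda>y. \<exists>c. is_numeralS K y c \<and> (\<forall>d. is_numeralS K y d \<longrightarrow> d = c))" by (intro dfi)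
  then have "\<exists>c. is_numeralS K y c \<and> (\<forall>d. is_numeralS K y d \<longrightarrow> d = c)"
    by (rule df_induct) auto
  then show ?thesis by blast
qed

lemma closed_numeral: "is_numeralS K y c \<Longrightarrow> is_closed_termS K c"
proof -
  have "df (\<lambda>y. \<forall>c. is_numeralS K y c \<longrightarrow> is_closed_termS K c)" by (intro dfi)
  then have "\<forall>c. is_numeralS K y c \<longrightarrow> is_closed_termS K c"
    by (rule df_induct) auto
  then show "is_numeralS K y c \<Longrightarrow> is_closed_termS K c" by blast
qed

definition tsR :: "kk \<Rightarrow> kk \<Rightarrow> (kk \<Rightarrow> bool) \<Rightarrow> kk \<Rightarrow> bool" where
  "tsR v c P w \<longleftrightarrow> (w = prk (prk 0 v) c \<or> (\<exists>u. u \<noteq> v \<and> w = prk (prk 0 u) (prk 0 u)) \<or> w = prk (prk 1 0) (prk 1 0))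
     \<or> (\<exists>s s'. P (prk s s') \<and> w = prk (prk 2 s) (prk 2 s'))
     \<or> (\<exists>r r' s s'. P (prk r r') \<and> P (prk s s') \<and>
          (w = prk (prk 3 (prk r s)) (prk 3 (prk r' s')) \<or> w = prk (prk 4 (prk r s)) (prk 4 (prk r' s'))))"

lemma fin_tsR: "finR (tsR v c)"
  unfolding tsR_def[abs_def] by (intro finR_rules)

lemma is_term_subst_gk: "is_term_substS K v c t t' \<longleftrightarrow> gk (tsR v c) (prk t t')"
  unfolding is_term_substS_def tsR_def[abs_def] by (simp add: disj_assoc)

lemma is_term_subst_fix: "is_term_substS K v c t t' \<longleftrightarrow> tsR v c (\<lambda>z. is_term_substS K v c (\<pi>1 z) (\<pi>2 z)) (prk t t')"
proof -
  have "gk (tsR v c) (prk t t') \<longleftrightarrow> tsR v c (gk (tsR v c)) (prk t t')" by (rule gk_fix[OF fin_tsR])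
  then show ?thesis unfolding tsR_def is_term_subst_gk by simp
qed

lemma is_term_subst_K [simp]:
  "is_term_substS K v c (prk 0 u) t' \<longleftrightarrow> t' = (if u = v then c else prk 0 u)"
  "is_term_substS K v c (prk 1 0) t' \<longleftrightarrow> t' = prk 1 0"
  "is_term_substS K v c (prk 2 s) t' \<longleftrightarrow> (\<exists>s'. is_term_substS K v c s s' \<and> t' = prk 2 s')"
  "is_term_substS K v c (prk 3 (prk r s)) t' \<longleftrightarrow>
    (\<exists>r' s'. is_term_substS K v c r r' \<and> is_term_substS K v c s s' \<and> t' = prk 3 (prk r' s'))"
  "is_term_substS K v c (prk 4 (prk r s)) t' \<longleftrightarrow>
    (\<exists>r' s'. is_term_substS K v c r r' \<and> is_term_substS K v c s s' \<and> t' = prk 4 (prk r' s'))"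
  unfolding is_term_subst_fix[of v c "prk 0 u"] is_term_subst_fix[of v c "prk 1 0"]
    is_term_subst_fix[of v c "prk 2 s"] is_term_subst_fix[of v c "prk 3 (prk r s)"]
    is_term_subst_fix[of v c "prk 4 (prk r s)"] tsR_def
  by auto

lemma term_subst_induct:
  assumes "is_term_substS K v c t t'" "df (\<lambda>p. Q (\<pi>1 p) (\<pi>2 p))"
    "Q (prk 0 v) c" "\<And>u. u \<noteq> v \<Longrightarrow> Q (prk 0 u) (prk 0 u)" "Q (prk 1 0) (prk 1 0)"
    "\<And>s s'. Q s s' \<Longrightarrow> Q (prk 2 s) (prk 2 s')"
    "\<And>r r' s s'. Q r r' \<Longrightarrow> Q s s' \<Longrightarrow> Q (prk 3 (prk r s)) (prk 3 (prk r' s'))"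
    "\<And>r r' s s'. Q r r' \<Longrightarrow> Q s s' \<Longrightarrow> Q (prk 4 (prk r s)) (prk 4 (prk r' s'))"
  shows "Q t t'"
  by (rule gk_induct2[OF fin_tsR assms(1)[unfolded is_term_subst_gk] assms(2)])
    (auto simp: tsR_def intro: assms(3-))

lemma term_subst_total: assumes "is_termS K t" shows "\<exists>t'. is_term_substS K v c t t'"
proof -
  have "df (\<lambda>t. \<exists>t'. is_term_substS K v c t t')" by (intro dfi)
  with assms show ?thesis by (rule term_induct) auto
qed

lemma term_subst_unique: assumes "is_term_substS K v c t t'" shows "\<forall>t''. is_term_substS K v c t t'' \<longrightarrow> t'' = t'"
  by (rule term_subst_induct[OF assms]) (intro dfi | simp | blast)+

lemma term_subst_term: assumes "is_term_substS K v c t t'" "is_closed_termS K c" shows "is_termS K t'"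
  by (rule term_subst_induct[OF assms(1)]) (intro dfi | simp add: closed_term[OF assms(2)])+

lemma term_subst_without: assumes "is_term_substS K v c t t'" "is_closed_termS K c" shows "is_term_withoutS K v t'"
  by (rule term_subst_induct[OF assms(1)]) (intro dfi | simp add: closed_term[OF assms(2)])+

lemma term_subst_preserves:
  assumes "is_term_substS K v c t t'" "is_closed_termS K c" shows "is_term_withoutS K u t \<longrightarrow> is_term_withoutS K u t'"
  by (rule term_subst_induct[OF assms(1)]) (intro dfi | simp add: closed_term[OF assms(2)])+

definition sbR :: "kk \<Rightarrow> kk \<Rightarrow> (kk \<Rightarrow> bool) \<Rightarrow> kk \<Rightarrow> bool" where
  "sbR v c P w \<longleftrightarrow>
     (\<exists>s s' t t'. is_term_substS K v c s s' \<and> is_term_substS K v c t t' \<and> w = prk (prk 5 (prk s t)) (prk 5 (prk s' t')))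
     \<or> (\<exists>q q'. P (prk q q') \<and> w = prk (prk 6 q) (prk 6 q'))
     \<or> (\<exists>q q' r r'. P (prk q q') \<and> P (prk r r') \<and> w = prk (prk 7 (prk q r)) (prk 7 (prk q' r')))
     \<or> (\<exists>u q q'. u \<noteq> v \<and> P (prk q q') \<and> w = prk (prk 8 (prk u q)) (prk 8 (prk u q')))
     \<or> (\<exists>q. is_formulaS K q \<and> w = prk (prk 8 (prk v q)) (prk 8 (prk v q)))"

lemma fin_sbR: "finR (sbR v c)"
  unfolding sbR_def[abs_def] by (intro finR_rules)

lemma is_subst_gk: "is_substS K v c t t' \<longleftrightarrow> gk (sbR v c) (prk t t')"
  unfolding is_substS_def sbR_def[abs_def] by simp

lemma is_subst_fix: "is_substS K v c t t' \<longleftrightarrow> sbR v c (\<lambda>z. is_substS K v c (\<pi>1 z) (\<pi>2 z)) (prk t t')"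
proof -
  have "gk (sbR v c) (prk t t') \<longleftrightarrow> sbR v c (gk (sbR v c)) (prk t t')" by (rule gk_fix[OF fin_sbR])
  then show ?thesis unfolding sbR_def is_subst_gk by simp
qed

lemma is_subst_K [simp]:
  "is_substS K v c (prk 5 (prk s t)) p' \<longleftrightarrow>
    (\<exists>s' t'. is_term_substS K v c s s' \<and> is_term_substS K v c t t' \<and> p' = prk 5 (prk s' t'))"
  "is_substS K v c (prk 6 q) p' \<longleftrightarrow> (\<exists>q'. is_substS K v c q q' \<and> p' = prk 6 q')"
  "is_substS K v c (prk 7 (prk q r)) p' \<longleftrightarrow>
    (\<exists>q' r'. is_substS K v c q q' \<and> is_substS K v c r r' \<and> p' = prk 7 (prk q' r'))"
  "is_substS K v c (prk 8 (prk u q)) p' \<longleftrightarrow>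
    (if u = v then is_formulaS K q \<and> p' = prk 8 (prk u q) else \<exists>q'. is_substS K v c q q' \<and> p' = prk 8 (prk u q'))"
  unfolding is_subst_fix[of v c "prk 5 (prk s t)"] is_subst_fix[of v c "prk 6 q"]
    is_subst_fix[of v c "prk 7 (prk q r)"] is_subst_fix[of v c "prk 8 (prk u q)"] sbR_def
  by auto

lemma subst_induct:
  assumes "is_substS K v c p p'" "df (\<lambda>p. Q (\<pi>1 p) (\<pi>2 p))"
    "\<And>s s' t t'. is_term_substS K v c s s' \<Longrightarrow> is_term_substS K v c t t' \<Longrightarrow> Q (prk 5 (prk s t)) (prk 5 (prk s' t'))"
    "\<And>q q'. Q q q' \<Longrightarrow> Q (prk 6 q) (prk 6 q')"
    "\<And>q q' r r'. Q q q' \<Longrightarrow> Q r r' \<Longrightarrow> Q (prk 7 (prk q r)) (prk 7 (prk q' r'))"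
    "\<And>u q q'. u \<noteq> v \<Longrightarrow> is_substS K v c q q' \<Longrightarrow> Q q q' \<Longrightarrow> Q (prk 8 (prk u q)) (prk 8 (prk u q'))"
    "\<And>q. is_formulaS K q \<Longrightarrow> Q (prk 8 (prk v q)) (prk 8 (prk v q))"
  shows "Q p p'"
  by (rule gk_induct2[OF fin_sbR assms(1)[unfolded is_subst_gk] assms(2)])
    (auto simp: sbR_def is_subst_gk[symmetric] intro: assms(3-))

lemma subst_total: assumes "is_formulaS K p" shows "\<exists>q. is_substS K v c p q"
proof -
  have "df (\<lambda>p. \<exists>q. is_substS K v c p q)" by (intro dfi)
  with assms show ?thesis
  proof (rule formula_induct)
    fix s t assume "is_termS K s" "is_termS K t"
    then obtain s' t' where "is_term_substS K v c s s'" "is_term_substS K v c t t'"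
      using term_subst_total by blast
    then show "\<exists>q. is_substS K v c (prk 5 (prk s t)) q" by auto
  qed auto
qed

lemma subst_unique: assumes "is_substS K v c p q" shows "\<forall>q'. is_substS K v c p q' \<longrightarrow> q' = q"
proof (rule subst_induct[OF assms, of "\<lambda>p q. \<forall>q'. is_substS K v c p q' \<longrightarrow> q' = q"])
  show "df (\<lambda>p. \<forall>q'. is_substS K v c (\<pi>1 p) q' \<longrightarrow> q' = \<pi>2 p)" by (intro dfi)
next
  fix s s' t t' assume "is_term_substS K v c s s'" "is_term_substS K v c t t'"
  then show "\<forall>q'. is_substS K v c (prk 5 (prk s t)) q' \<longrightarrow> q' = prk 5 (prk s' t')"
    unfolding is_subst_K using term_subst_unique[of v c s s'] term_subst_unique[of v c t t'] by blast
next
  fix q q' assume "\<forall>x. is_substS K v c q x \<longrightarrow> x = q'"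
  then show "\<forall>x. is_substS K v c (prk 6 q) x \<longrightarrow> x = prk 6 q'"
    unfolding is_subst_K by blast
next
  fix q q' r r' assume "\<forall>x. is_substS K v c q x \<longrightarrow> x = q'" "\<forall>x. is_substS K v c r x \<longrightarrow> x = r'"
  then show "\<forall>x. is_substS K v c (prk 7 (prk q r)) x \<longrightarrow> x = prk 7 (prk q' r')"
    unfolding is_subst_K by blast
next
  fix u q q' assume "u \<noteq> v" "\<forall>x. is_substS K v c q x \<longrightarrow> x = q'"
  then show "\<forall>x. is_substS K v c (prk 8 (prk u q)) x \<longrightarrow> x = prk 8 (prk u q')"
    unfolding is_subst_K if_not_P[OF \<open>u \<noteq> v\<close>] by blast
next
  fix q
  show "\<forall>x. is_substS K v c (prk 8 (prk v q)) x \<longrightarrow> x = prk 8 (prk v q)"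
    unfolding is_subst_K if_P[OF refl] by blast
qed

lemma subst_formula: assumes "is_substS K v c p q" "is_closed_termS K c" shows "is_formulaS K q"
  by (rule subst_induct[OF assms(1)]) (intro dfi | simp add: term_subst_term[OF _ assms(2)])+

lemma subst_without: assumes "is_substS K v c p q" "is_closed_termS K c" shows "is_formula_withoutS K v q"
  by (rule subst_induct[OF assms(1)]) (intro dfi | simp add: term_subst_without[OF _ assms(2)])+

lemma subst_preserves:
  assumes "is_substS K v c p q" "is_closed_termS K c" shows "is_formula_withoutS K u p \<longrightarrow> is_formula_withoutS K u q"
proof (rule subst_induct[OF assms(1)])
  show "is_formula_withoutS K u (prk 8 (prk w q)) \<longrightarrow> is_formula_withoutS K u (prk 8 (prk w q'))"
    if "is_substS K v c q q'" "is_formula_withoutS K u q \<longrightarrow> is_formula_withoutS K u q'" for w q q'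
    using that subst_formula[OF that(1) assms(2)] by auto
qed (intro dfi | simp add: term_subst_preserves[OF _ assms(2)])+

lemma sentence_instance:
  assumes "is_formula_inS K v p" "is_numeralS K y c" "is_substS K v c p q" shows "is_sentenceS K q"
proof -
  have c: "is_closed_termS K c" using closed_numeral[OF assms(2)] .
  have "is_formula_withoutS K u q" for u
    using subst_without[OF assms(3) c] subst_preserves[OF assms(3) c, of u] assms(1)
    unfolding is_formula_inS_def by (cases "u = v") auto
  then show ?thesis unfolding is_sentenceS_def using subst_formula[OF assms(3) c] by blast
qed

subsection \<open>Disjunctions\<close>

definition djR :: "kk \<Rightarrow> kk \<Rightarrow> (kk \<Rightarrow> bool) \<Rightarrow> kk \<Rightarrow> bool" where
  "djR a b P w \<longleftrightarrow> (\<exists>i. w = prk i (prk (i + 1) (dec (prk a b) i)))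
     \<or> (\<exists>i j k e e'. P (prk i (prk j e)) \<and> P (prk j (prk k e')) \<and> w = prk i (prk k (prk 7 (prk e e'))))"

lemma fin_djR: "finR (djR a b)"
  unfolding djR_def[abs_def] by (intro finR_rules)

lemma disj_gk: "disj_genS K a b = gk (djR a b)"
  unfolding disj_genS_def djR_def[abs_def] by (simp add: sucK_eq)

lemma disj_fix: "disj_genS K a b (prk i (prk k d)) \<longleftrightarrow> (k = i + 1 \<and> d = dec (prk a b) i)
   \<or> (\<exists>j e e'. disj_genS K a b (prk i (prk j e)) \<and> disj_genS K a b (prk j (prk k e')) \<and> d = prk 7 (prk e e'))"
  unfolding disj_gk gk_fix[OF fin_djR, of a b "prk i (prk k d)"] djR_def[of a b _ "prk i (prk k d)"] prk_eq by blast

lemma disj_less: assumes "disj_genS K a b (prk i (prk k d))" shows "i < k"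
proof -
  have "df (\<lambda>w. \<pi>1 w < \<pi>1 (\<pi>2 w))" by (intro dfi)
  then have "\<pi>1 (prk i (prk k d)) < \<pi>1 (\<pi>2 (prk i (prk k d)))"
    by (rule gk_induct'[OF fin_djR assms[unfolded disj_gk]]) (auto simp: djR_def intro: less_trans)
  then show ?thesis by simp
qed


subsection \<open>The base functions\<close>

text \<open>A skeleton forgets the terms and the bound variables. So all numeral instances of a
  formula have the same skeleton, and the parts of a sentence have at most two skeletons between
  them, although an existential sentence has a part for every element of the model.\<close>

lemma skeleton_exists:
  "\<exists>sk. dt sk \<and> (\<forall>p. sk (prk 6 p) = prk 6 (sk p)) \<and> (\<forall>p q. sk (prk 7 (prk p q)) = prk 7 (prk (sk p) (sk q)))
    \<and> (\<forall>u p. sk (prk 8 (prk u p)) = prk 8 (sk p)) \<and> (\<forall>x. sk (prk 5 x) = 0)"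
proof -
  define H where "H x F = (if x = prk 6 (\<pi>2 x) then prk 6 (F (\<pi>2 x))
      else if x = prk 7 (prk (arg1 x) (arg2 x)) then prk 7 (prk (F (arg1 x)) (F (arg2 x)))
      else if x = prk 8 (prk (arg1 x) (arg2 x)) then prk 8 (F (arg2 x)) else 0)" for x :: kk and F
  have less6: "p < prk 6 p" for p by (rule less_prk) simp
  have less7: "p < prk 7 (prk p q)" "q < prk 7 (prk p q)" for p q
    by (rule le_less_trans[OF le_prk(1)], rule less_prk, simp) (rule le_less_trans[OF le_prk(2)], rule less_prk, simp)
  have less8: "q < prk 8 (prk p q)" for p q
    by (rule le_less_trans[OF le_prk(2)], rule less_prk) simp
  have "dt (\<lambda>p. H (\<pi>1 p) (dec (\<pi>2 p)))" unfolding H_def by (intro dfi)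
  moreover have "H x f = H x g" if "\<And>y. y < x \<Longrightarrow> f y = g y" for x f g
  proof -
    have "x = prk 6 (\<pi>2 x) \<Longrightarrow> \<pi>2 x < x" using less6[of "\<pi>2 x"] by simp
    moreover have "x = prk 7 (prk (arg1 x) (arg2 x)) \<Longrightarrow> arg1 x < x" "x = prk 7 (prk (arg1 x) (arg2 x)) \<Longrightarrow> arg2 x < x"
      by (metis less7(1)) (metis less7(2))
    moreover have "x = prk 8 (prk (arg1 x) (arg2 x)) \<Longrightarrow> arg2 x < x" using less8[of "arg2 x" "arg1 x"] by simp
    ultimately show ?thesis unfolding H_def using that by (auto cong: if_cong)
  qed
  ultimately obtain F where F: "dt F" "\<And>x. F x = H x F" using recursion by blast
  have "F (prk 6 p) = prk 6 (F p)" "F (prk 7 (prk p q)) = prk 7 (prk (F p) (F q))"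
    "F (prk 8 (prk u p)) = prk 8 (F p)" "F (prk 5 x) = 0" for p q u x
    by (subst F(2), simp add: H_def)+
  then show ?thesis using F(1) by blast
qed

definition skel :: "kk \<Rightarrow> kk" where
  "skel = (SOME sk. dt sk \<and> (\<forall>p. sk (prk 6 p) = prk 6 (sk p)) \<and> (\<forall>p q. sk (prk 7 (prk p q)) = prk 7 (prk (sk p) (sk q)))
    \<and> (\<forall>u p. sk (prk 8 (prk u p)) = prk 8 (sk p)) \<and> (\<forall>x. sk (prk 5 x) = 0))"

lemma dt_skel: "dt skel" and skel [simp]: "skel (prk 6 p) = prk 6 (skel p)"
    "skel (prk 7 (prk p q)) = prk 7 (prk (skel p) (skel q))" "skel (prk 8 (prk u p)) = prk 8 (skel p)" "skel (prk 5 x) = 0"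
  using someI_ex[OF skeleton_exists, folded skel_def] by auto

lemmas dt_skel' [dfi] = dt_comp[OF dt_skel]

lemma skel_subst: assumes "is_substS K v c p q" shows "skel q = skel p"
  by (rule subst_induct[OF assms, of "\<lambda>p q. skel q = skel p"]) (intro dfi | simp)+

definition headed :: "kk \<Rightarrow> bool" where
  "headed x \<longleftrightarrow> x = prk 6 (\<pi>2 x) \<or> x = prk 7 (prk (arg1 x) (arg2 x)) \<or> x = prk 8 (prk (arg1 x) (arg2 x))"

definition atomic_true :: "kk \<Rightarrow> bool" where
  "atomic_true x \<longleftrightarrow> (\<exists>y. is_valueS K (arg1 x) y \<and> is_valueS K (arg2 x) y)"

text \<open>Being total in the index, it allows one clause to treat all connectives as an infinite
  disjunction. Where there is no instance the default is \<open>arg2 x\<close>, because its skeleton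
  is that of an instance.\<close>

definition part :: "kk \<Rightarrow> kk \<Rightarrow> kk" where
  "part x y = (if \<pi>1 x = 6 then \<pi>2 x else if \<pi>1 x = 7 then (if y = 0 then arg1 x else arg2 x)
     else if \<exists>q c. is_numeralS K y c \<and> is_substS K (arg1 x) c (arg2 x) q
     then lst (\<lambda>q. \<exists>c. is_numeralS K y c \<and> is_substS K (arg1 x) c (arg2 x) q) else arg2 x)"

lemma dt_part: "dt f \<Longrightarrow> dt g \<Longrightarrow> dt (\<lambda>x. part (f x) (g x))"
proof -
  have "dt (\<lambda>x. lst (\<lambda>q. \<exists>c. is_numeralS K (g x) c \<and> is_substS K (arg1 (f x)) c (arg2 (f x)) q))"
    if "dt f" "dt g" for f g
    by (intro dfi dt_comp[OF that(1)] dt_comp[OF that(2)])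
  then show "dt f \<Longrightarrow> dt g \<Longrightarrow> dt (\<lambda>x. part (f x) (g x))"
    unfolding part_def by (intro dt_if dfi) (assumption | rule dfi dt_comp[of f] dt_comp[of g])+
qed

lemma part_8:
  assumes "is_numeralS K y c" "is_substS K v c p q" shows "part (prk 8 (prk v p)) y = q"
proof -
  have eq: "q' = q" if "is_numeralS K y c'" "is_substS K v c' p q'" for c' q'
    using that assms ex1_numeral[of y] subst_unique[OF assms(2)] by blast
  have "lst (\<lambda>q. \<exists>c. is_numeralS K y c \<and> is_substS K v c p q) = q"
    by (rule lst_eq) (use assms eq in \<open>blast+\<close>)
  moreover have "\<exists>q c. is_numeralS K y c \<and> is_substS K v c p q" using assms by blast
  ultimately show ?thesis by (simp add: part_def)
qed

lemma part_simps [simp]: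
  "part (prk 6 p) y = p" "part (prk 7 (prk p q)) y = (if y = 0 then p else q)"
  by (simp_all add: part_def)

lemma skel_part_8: "skel (part (prk 8 (prk v p)) y) = skel p"
proof (cases "\<exists>q c. is_numeralS K y c \<and> is_substS K v c p q")
  case True
  then obtain q c where "is_numeralS K y c" "is_substS K v c p q" by blast
  then show ?thesis using part_8[of y c v p q] skel_subst by simp
next
  case False
  then have "part (prk 8 (prk v p)) y = p" by (auto simp: part_def)
  then show ?thesis by simp
qed

definition holds_at :: "fm \<Rightarrow> kk \<Rightarrow> kk" where
  "holds_at A s = (if sata K (ev s) A then 0 else 1)"

fun witness_at :: "fm \<Rightarrow> kk \<Rightarrow> kk" where
  "witness_at (Ex v A) s = lst (\<lambda>y. sata K (ev (upd v y s)) A)"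
| "witness_at _ s = 0"

lemma dt_holds_at: "arithmetical A \<Longrightarrow> dt (holds_at A)"
  unfolding holds_at_def[abs_def] by (intro dfi df_sat)

lemma dt_witness_at: "arithmetical A \<Longrightarrow> dt (witness_at A)"
proof (cases A)
  case (Ex v B)
  assume "arithmetical A"
  then have B: "arithmetical B" using Ex by simp
  have "dt (\<lambda>s. lst (\<lambda>y. sata K (ev (upd v y s)) B))" by (intro dfi df_sat[OF B])
  then show ?thesis unfolding Ex witness_at.simps[abs_def] .
qed (simp_all add: witness_at.simps[abs_def] dfi)

text \<open>The symbols below 12 are taken. From there on the even ones are tests and the odd ones
  Skolem functions, which makes the formula recoverable from the symbol.\<close>

definition holds_sym :: "fm \<Rightarrow> nat" where "holds_sym A = 12 + 2 * to_nat A"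
definition witness_sym :: "fm \<Rightarrow> nat" where "witness_sym A = 13 + 2 * to_nat A"

text \<open>Tests have the value 0 when they succeed. Symbols 0 to 8 are those of
  \<open>truth_base\<close>: equality, order, skeleton, part, head, negation, atomic truth and the
  two possible skeletons of parts. Symbols 9 to 11 are the operations of arithmetic.\<close>

definition base :: "nat \<Rightarrow> kk \<Rightarrow> kk" where
  "base n x = (if n = 0 then (if \<pi>1 x = \<pi>2 x then 0 else 1)
     else if n = 1 then (if \<pi>1 x < \<pi>2 x then 0 else 1)
     else if n = 2 then skel x
     else if n = 3 then part (\<pi>1 x) (\<pi>2 x)
     else if n = 4 then (if headed x then 0 else 1)
     else if n = 5 then (if \<pi>1 x = 6 then 0 else 1)
     else if n = 6 then (if atomic_true x then 0 else 1)
     else if n = 7 then (if \<pi>1 x = 7 then arg1 x else \<pi>2 x)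
     else if n = 8 then arg2 x
     else if n = 9 then x + 1
     else if n = 10 then \<pi>1 x + \<pi>2 x
     else if n = 11 then \<pi>1 x * \<pi>2 x
     else if arithmetical (from_nat ((n - 12) div 2)) then
       (if even n then holds_at (from_nat ((n - 12) div 2)) x else witness_at (from_nat ((n - 12) div 2)) x)
     else 0)"

lemma dt_base: "dt (base n)"
proof (cases "n < 12")
  case True
  then have "n = 0 \<or> n = 1 \<or> n = 2 \<or> n = 3 \<or> n = 4 \<or> n = 5 \<or> n = 6 \<or> n = 7 \<or> n = 8 \<or> n = 9 \<or> n = 10 \<or> n = 11" by presburger
  then show ?thesis
    unfolding base_def[abs_def] headed_def atomic_true_def
    by (elim disjE) (simp_all only: simp_thms if_True if_False numeral_eq_iff num.distinct num.inject one_neq_zero zero_neq_numeral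
        zero_neq_one one_eq_numeral_iff numeral_eq_one_iff zero_neq_numeral[symmetric] refl, (intro dfi dt_part | simp)+)
next
  case False
  let ?A = "from_nat ((n - 12) div 2) :: fm"
  have "base n = (\<lambda>x. if arithmetical ?A then (if even n then holds_at ?A x else witness_at ?A x) else 0)"
    using False by (intro ext) (simp add: base_def)
  moreover have "dt (\<lambda>x. if arithmetical ?A then (if even n then holds_at ?A x else witness_at ?A x) else 0)"
    using dt_holds_at[of ?A] dt_witness_at[of ?A] by (cases "arithmetical ?A"; cases "even n") (simp_all add: dfi)
  ultimately show ?thesis by simp
qed

lemma base_sym:
  "arithmetical A \<Longrightarrow> base (holds_sym A) = holds_at A" "arithmetical A \<Longrightarrow> base (witness_sym A) = witness_at A"
  by (intro ext; simp add: base_def holds_sym_def witness_sym_def)+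

text \<open>All the functions \<open>base n\<close> together would define truth in \<open>K\<close>,
  so they are not uniformly definable. Finitely many of them are, by a distinction of cases.\<close>

primrec app :: "nat \<Rightarrow> kk \<Rightarrow> kk \<Rightarrow> kk" where
  "app 0 g x = 0"
| "app (Suc n) g x = (if g = of_nat n then base n x else app n g x)"

lemma app_eq: "n < L \<Longrightarrow> app L (of_nat n) = base n"
  by (induction L) (auto simp: less_Suc_eq)

lemma dt_app: "dt (\<lambda>p. app L (\<pi>1 p) (\<pi>2 p))"
  by (induction L) (simp_all add: dfi dt_comp[OF dt_base])

lemma app_numeral:
  assumes "12 \<le> L"
  shows "app L 0 = base 0" "app L 1 = base 1" "numeral k < (12 :: nat) \<Longrightarrow> app L (numeral k) = base (numeral k)"
proof -
  show "app L 0 = base 0" using app_eq[of 0 L] assms by simp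
  show "app L 1 = base 1" using app_eq[of 1 L] assms by simp
  show "numeral k < (12 :: nat) \<Longrightarrow> app L (numeral k) = base (numeral k)"
    using app_eq[OF less_le_trans[OF _ assms], of "numeral k"] by (simp only: of_nat_numeral)
qed

lemma truth_base_app: assumes "12 \<le> L" shows "truth_base (app L)"
proof
  have H: "P" if "headed p" "\<And>q. p = prk 6 q \<Longrightarrow> P" "\<And>q r. p = prk 7 (prk q r) \<Longrightarrow> P" "\<And>u q. p = prk 8 (prk u q) \<Longrightarrow> P" for p P
    using that unfolding headed_def by blast
  have h: "app L 4 p = 0 \<longleftrightarrow> headed p" for p
    using app_numeral[OF assms] by (simp add: base_def)
  show "dt (\<lambda>p. app L (\<pi>1 p) (\<pi>2 p))" by (rule dt_app)
  show "app L 0 (prk x y) = 0 \<longleftrightarrow> x = y" "app L 1 (prk x y) = 0 \<longleftrightarrow> x < y" for x y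
    using app_numeral[OF assms] by (simp_all add: base_def)
  show "app L 2 (app L 3 (prk p x)) = app L 7 (app L 2 p) \<or> app L 2 (app L 3 (prk p x)) = app L 8 (app L 2 p)"
    if "app L 4 p = 0" for p x
    using that[unfolded h] by (rule H) (simp_all add: app_numeral[OF assms] base_def skel_part_8)
  show "app L 2 (app L 3 (prk p x)) < app L 2 p" if "app L 4 p = 0" for p x
  proof -
    have l: "a < prk 7 (prk a b)" "a < prk 7 (prk b a)" "a < prk 8 a" "a < prk 6 a" for a b
      by (rule le_less_trans[OF le_prk(1)], rule less_prk, simp)
        (rule le_less_trans[OF le_prk(2)], rule less_prk, simp, rule less_prk, simp, rule less_prk, simp)
    show ?thesis
      using that[unfolded h] by (rule H) (simp_all add: app_numeral[OF assms] base_def skel_part_8 l)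
  qed
qed


section \<open>Approximations with a disjunctively correct truth predicate\<close>

primrec subfms :: "fm \<Rightarrow> fm set" where
  "subfms (s \<doteq> t) = {s \<doteq> t}"
| "subfms (Tr s t) = {Tr s t}"
| "subfms (\<^bold>\<not> A) = insert (\<^bold>\<not> A) (subfms A)"
| "subfms (A \<^bold>\<or> B) = insert (A \<^bold>\<or> B) (subfms A \<union> subfms B)"
| "subfms (Ex v A) = insert (Ex v A) (subfms A)"

lemma finite_subfms: "finite (subfms A)"
  by (induction A) auto

lemma subfms_self: "A \<in> subfms A"
  by (cases A) auto

lemma subfms_trans: "B \<in> subfms A \<Longrightarrow> subfms B \<subseteq> subfms A"
  by (induction A) auto

lemma subfms_arith: "arithmetical A \<Longrightarrow> B \<in> subfms A \<Longrightarrow> arithmetical B"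
  by (induction A) auto

text \<open>A numeral is needed as an element of \<open>N\<close>, where a realization of finitely
  many names yields only its value in \<open>K\<close>. Its existence is therefore transferred as a
  formula; \<open>has_instance\<close> does the same for substitution.\<close>

definition has_numeral :: "tm \<Rightarrow> fm" where
  "has_numeral y = (\<^bold>\<exists>c. is_numeral y c)"

definition has_instance :: "tm \<Rightarrow> tm \<Rightarrow> tm \<Rightarrow> fm" where
  "has_instance v c p = (\<^bold>\<exists>q. is_subst v c p q)"

lemma sat_has_numeral [simp]: "sat I T e (has_numeral y) \<longleftrightarrow> (\<exists>c. is_numeralS I (tval I e y) c)"
  unfolding has_numeral_def
  by (rule sat_q1[where S = "tvars y" and Q = "\<lambda>e c. is_numeralS I (tval I e y) c"]) auto

lemma sat_has_instance [simp]:
  "sat I T e (has_instance v c p) \<longleftrightarrow> (\<exists>q. is_substS I (tval I e v) (tval I e c) (tval I e p) q)"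
  unfolding has_instance_def
  by (rule sat_q1[where S = "tvars v \<union> tvars c \<union> tvars p" and
        Q = "\<lambda>e q. is_substS I (tval I e v) (tval I e c) (tval I e p) q"]) auto

definition syntax_fms :: "fm set" where
  "syntax_fms = {is_sentence (Var 0), is_formula_in (Var 0) (Var 1), is_closed_term (Var 0),
     has_numeral (Var 0), has_instance (Var 0) (Var 1) (Var 2),
     is_numeral (Var 0) (Var 1), is_subst (Var 0) (Var 1) (Var 2) (Var 3), same_value (Var 0) (Var 1),
     Var 0 \<preceq> Var 1, Var 0 \<prec> Var 1, beta (Var 0) (Var 1) (Var 2) (Var 3),
     disj_fm (Var 0) (Var 1) (Var 2) (Var 3) (Var 4), split_fm (Var 0) (Var 1) (Var 2) (Var 3) (Var 4)}"

lemma syntax_fms_arith: "A \<in> syntax_fms \<Longrightarrow> arithmetical A"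
  unfolding syntax_fms_def same_value_def split_fm_def has_numeral_def has_instance_def
  by (auto simp: arith_sentence arith_terms arith_relations arith_le arith_beta)

primrec tup :: "nat \<Rightarrow> (nat \<Rightarrow> kk) \<Rightarrow> kk" where
  "tup 0 e = nK 0"
| "tup (Suc n) e = nP (e 0) (tup n (\<lambda>v. e (Suc v)))"

lemma finite_tup: "finite A \<Longrightarrow> finite {tup n e |e. range e \<subseteq> A}"
proof (induction n)
  case (Suc n)
  have "{tup (Suc n) e |e. range e \<subseteq> A} \<subseteq> (\<lambda>(x, y). nP x y) ` (A \<times> {tup n e |e. range e \<subseteq> A})"
    by fastforce
  then show ?case using Suc by (meson finite_SigmaI finite_imageI finite_subset)
qed simp

lemma dt_tup: "(\<And>v. dt (\<lambda>x. E x v)) \<Longrightarrow> dt (\<lambda>x. tup n (E x))"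
  by (induction n arbitrary: E) (simp_all add: dfi)

text \<open>Closure of \<open>Fm\<close> under subformulas allows induction on formulas. The bound
  on \<open>witness_sym A\<close> puts the test for \<open>A\<close> and its Skolem function among
  the base functions.\<close>

locale approximation =
  fixes L n :: nat and Fm :: "fm set" and V :: "kk \<Rightarrow> kk"
  assumes L: "12 \<le> L" "A \<in> Fm \<Longrightarrow> witness_sym A < L"
    and fin_Fm: "finite Fm" and arith_Fm: "A \<in> Fm \<Longrightarrow> arithmetical A"
    and sub_Fm: "A \<in> Fm \<Longrightarrow> subfms A \<subseteq> Fm"
    and fv_Fm: "A \<in> Fm \<Longrightarrow> fv A \<subseteq> {..<n}"
    and syntax_Fm: "syntax_fms \<subseteq> Fm"
    and V: "truth_base.model (app L) (\<lambda>_. True) V"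
begin

interpretation truth_base "app L" by (rule truth_base_app[OF L(1)])

definition N :: "kk str" where
  "N = \<lparr>zer = nK 0, suc = nG 9, plu = \<lambda>x y. nG 10 (nP x y), tim = \<lambda>x y. nG 11 (nP x y), equ = \<lambda>x y. zb V (eqn x y)\<rparr>"

lemma N_simps [simp]:
  "zer N = nK 0" "suc N x = nG 9 x" "plu N x y = nG 10 (nP x y)" "tim N x y = nG 11 (nP x y)" "equ N x y = zb V (eqn x y)"
  by (simp_all add: N_def)

lemma r_base: "thom r \<Longrightarrow> numeral k < (12 :: nat) \<Longrightarrow> r (nG (numeral k) x) = base (numeral k) (r x)"
  using thomD(3) app_numeral(3)[OF L(1)] by metis

lemma r_eqn: "thom r \<Longrightarrow> r (eqn x y) = 0 \<longleftrightarrow> r x = r y"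
  by (simp add: thomD G_eq)

lemma r_ops: assumes "thom r"
  shows "r (nK a) = a" "r (zer N) = 0" "r (suc N x) = r x + 1" "r (plu N x y) = r x + r y" "r (tim N x y) = r x * r y"
    "r (prS N x y) = prk (r x) (r y)" "r (numS N k) = of_nat k"
proof -
  show z: "r (nK a) = a" "r (zer N) = 0" using thomD(2)[OF assms] by simp_all
  show s: "r (suc N x) = r x + 1" for x using r_base[OF assms, of "num.Bit1 (num.Bit0 (num.Bit0 num.One))"]
    by (simp add: base_def)
  show p: "r (plu N x y) = r x + r y" for x y
    using r_base[OF assms, of "num.Bit0 (num.Bit1 (num.Bit0 num.One))"] by (simp add: base_def thomD(4)[OF assms])
  show t: "r (tim N x y) = r x * r y" for x y
    using r_base[OF assms, of "num.Bit1 (num.Bit1 (num.Bit0 num.One))"] by (simp add: base_def thomD(4)[OF assms])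
  show "r (prS N x y) = prk (r x) (r y)" unfolding prS_def prk_def p t ..
  show "r (numS N k) = of_nat k" by (induction k) (simp_all only: numS.simps z s of_nat_0 of_nat_Suc add.commute)
qed

lemma r_tval: "thom r \<Longrightarrow> r (tval N e t) = tval K (\<lambda>v. r (e v)) t"
  by (induction t) (simp_all add: r_ops[simplified] sucK_eq)

lemma r_tup: "thom r \<Longrightarrow> v < n' \<Longrightarrow> env v (r (tup n' e)) = r (e v)"
proof (induction n' arbitrary: v e)
  case (Suc n')
  then show ?case by (cases v) (simp_all add: thomD(4))
qed simp

definition hn :: "fm \<Rightarrow> (nat \<Rightarrow> kk) \<Rightarrow> kk" where "hn A e = nG (of_nat (holds_sym A)) (tup n e)"

lemma sat_env: "A \<in> Fm \<Longrightarrow> thom r \<Longrightarrow> sata K (ev (r (tup n e))) A = sata K (\<lambda>v. r (e v)) A"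
  using fv_Fm[of A] by (intro sat_cong r_tup) auto

lemma r_hn: assumes "A \<in> Fm" "thom r" shows "r (hn A e) = 0 \<longleftrightarrow> sata K (\<lambda>v. r (e v)) A"
proof -
  have "holds_sym A < L" using L(2)[OF assms(1)] by (simp add: holds_sym_def witness_sym_def)
  then have "app L (of_nat (holds_sym A)) = holds_at A" using app_eq base_sym(1)[OF arith_Fm[OF assms(1)]] by simp
  then show ?thesis unfolding hn_def thomD(3)[OF assms(2)] by (simp add: holds_at_def sat_env[OF assms])
qed

lemma sub_cases: assumes "A \<in> Fm"
  shows "A = \<^bold>\<not> B \<Longrightarrow> B \<in> Fm" "A = B \<^bold>\<or> C \<Longrightarrow> B \<in> Fm" "A = B \<^bold>\<or> C \<Longrightarrow> C \<in> Fm" "A = Ex v B \<Longrightarrow> B \<in> Fm"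
  using sub_Fm[OF assms] subfms_self by auto

lemma r_upd: "(\<lambda>v. r ((e(u := x)) v)) = (\<lambda>v. r (e v))(u := r x)"
  by auto

lemma real3: obtains r where "thom r" "\<forall>x\<in>{a, b, c}. zb V x \<longleftrightarrow> r x = 0"
proof -
  have "finite {a, b, c}" by simp
  then obtain r where "thom r" "\<And>x. x \<in> {a, b, c} \<Longrightarrow> zb V x \<longleftrightarrow> r x = 0"
    by (rule model_real[OF V]) blast
  then show ?thesis using that by blast
qed

text \<open>An analogue of the theorem of Los: in each step the finitely many names involved have a
  common realization, and there the claim is one about \<open>K\<close>. An existential formula has
  a witness with a name because its Skolem function is a base function.\<close>

lemma sat_N: "A \<in> Fm \<Longrightarrow> sata N e A \<longleftrightarrow> zb V (hn A e)"
proof (induction A arbitrary: e)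
  case (Eq s t)
  obtain r where r: "thom r" "\<forall>x\<in>{eqn (tval N e s) (tval N e t), hn (s \<doteq> t) e, hn (s \<doteq> t) e}. zb V x \<longleftrightarrow> r x = 0"
    by (rule real3)
  have "zb V (eqn (tval N e s) (tval N e t)) \<longleftrightarrow> r (tval N e s) = r (tval N e t)"
    using r(2) r_eqn[OF r(1)] by blast
  moreover have "zb V (hn (s \<doteq> t) e) \<longleftrightarrow> sata K (\<lambda>v. r (e v)) (s \<doteq> t)"
    using r(2) r_hn[OF Eq r(1)] by blast
  ultimately show ?case unfolding sat.simps N_simps r_tval[OF r(1)] by simp
next
  case (Tr s t)
  then show ?case using arith_Fm by fastforce
next
  case (Neg A)
  have A: "A \<in> Fm" using sub_cases[OF Neg.prems] by blast
  obtain r where r: "thom r" "\<forall>x\<in>{hn A e, hn (\<^bold>\<not> A) e, hn (\<^bold>\<not> A) e}. zb V x \<longleftrightarrow> r x = 0"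
    by (rule real3)
  have "zb V (hn A e) \<longleftrightarrow> sata K (\<lambda>v. r (e v)) A" using r(2) r_hn[OF A r(1)] by blast
  moreover have "zb V (hn (\<^bold>\<not> A) e) \<longleftrightarrow> sata K (\<lambda>v. r (e v)) (\<^bold>\<not> A)" using r(2) r_hn[OF Neg.prems r(1)] by blast
  ultimately show ?case using Neg.IH[OF A] unfolding sat.simps by blast
next
  case (Or A B)
  have A: "A \<in> Fm" "B \<in> Fm" using sub_cases[OF Or.prems] by blast+
  obtain r where r: "thom r" "\<forall>x\<in>{hn A e, hn B e, hn (A \<^bold>\<or> B) e}. zb V x \<longleftrightarrow> r x = 0"
    by (rule real3)
  have "zb V (hn A e) \<longleftrightarrow> sata K (\<lambda>v. r (e v)) A" "zb V (hn B e) \<longleftrightarrow> sata K (\<lambda>v. r (e v)) B"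
    using r(2) r_hn[OF A(1) r(1)] r_hn[OF A(2) r(1)] by blast+
  moreover have "zb V (hn (A \<^bold>\<or> B) e) \<longleftrightarrow> sata K (\<lambda>v. r (e v)) (A \<^bold>\<or> B)" using r(2) r_hn[OF Or.prems r(1)] by blast
  ultimately show ?case using Or.IH(1)[OF A(1)] Or.IH(2)[OF A(2)] unfolding sat.simps by blast
next
  case (Ex v A)
  have A: "A \<in> Fm" using sub_cases[OF Ex.prems] by blast
  have IH: "sata N (e(v := x)) A \<longleftrightarrow> zb V (hn A (e(v := x)))" for x by (rule Ex.IH[OF A])
  show ?case
  proof
    assume "sata N e (Ex v A)"
    then obtain x where x: "sata N (e(v := x)) A" unfolding sat.simps by blast
    obtain r where r: "thom r" "\<forall>x\<in>{hn A (e(v := x)), hn (Ex v A) e, hn (Ex v A) e}. zb V x \<longleftrightarrow> r x = 0"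
      by (rule real3)
    have "sata K (\<lambda>u. r ((e(v := x)) u)) A" using x IH r(2) r_hn[OF A r(1)] by blast
    then have "sata K (\<lambda>u. r (e u)) (Ex v A)" unfolding sat.simps r_upd by blast
    then show "zb V (hn (Ex v A) e)" using r(2) r_hn[OF Ex.prems r(1)] by blast
  next
    assume a: "zb V (hn (Ex v A) e)"
    define x where "x = nG (of_nat (witness_sym (Ex v A))) (tup n e)"
    obtain r where r: "thom r" "\<forall>x\<in>{hn A (e(v := x)), hn (Ex v A) e, hn (Ex v A) e}. zb V x \<longleftrightarrow> r x = 0"
      by (rule real3)
    have "app L (of_nat (witness_sym (Ex v A))) = witness_at (Ex v A)"
      using app_eq[OF L(2)[OF Ex.prems]] base_sym(2)[OF arith_Fm[OF Ex.prems]] by simp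
    then have rx: "r x = lst (\<lambda>y. sata K (ev (upd v y (r (tup n e)))) A)"
      unfolding x_def thomD(3)[OF r(1)] by simp
    have "sata K (\<lambda>u. r (e u)) (Ex v A)" using a r(2) r_hn[OF Ex.prems r(1)] by blast
    then have "sata K (ev (r (tup n e))) (Ex v A)" using sat_env[OF Ex.prems r(1)] by blast
    then obtain y where y: "sata K (ev (upd v y (r (tup n e)))) A" unfolding sat.simps ev_upd by blast
    have d: "df (\<lambda>y. sata K (ev (upd v y (r (tup n e)))) A)" using arith_Fm[OF A] by (intro df_sat dfi)
    have "sata K (ev (upd v (r x) (r (tup n e)))) A" unfolding rx by (rule lst[OF d y])
    then have "sata K ((ev (r (tup n e)))(v := r x)) A" unfolding ev_upd .
    moreover have "sata K ((ev (r (tup n e)))(v := r x)) A = sata K (\<lambda>u. r ((e(v := x)) u)) A"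
      unfolding r_upd by (rule sat_cong) (use fv_Fm[OF A] r_tup[OF r(1)] in auto)
    ultimately have "zb V (hn A (e(v := x)))" using r(2) r_hn[OF A r(1)] by blast
    then show "sata N e (Ex v A)" using IH unfolding sat.simps by blast
  qed
qed

text \<open>A realization evaluates the names in \<open>S\<close> in \<open>K\<close>, in agreement with \<open>N\<close>.\<close>

definition real :: "(kk \<Rightarrow> kk) \<Rightarrow> kk set \<Rightarrow> bool" where
  "real r S \<longleftrightarrow> thom r \<and> (\<forall>x\<in>S. \<forall>y\<in>S. equ N x y \<longleftrightarrow> r x = r y)
    \<and> (\<forall>A\<in>Fm. \<forall>e. range e \<subseteq> S \<longrightarrow> (sata N e A \<longleftrightarrow> sata K (\<lambda>v. r (e v)) A))"

text \<open>There are infinitely many assignments into \<open>S\<close>, but they give rise to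
  finitely many names \<open>hn A e\<close>, as \<open>tup\<close> looks at the first
  \<open>n\<close> values only. So one realization covers them along with the names in
  \<open>Z\<close>.\<close>

lemma realization:
  assumes "finite S" "finite Z" obtains r where "real r S" "\<And>x. x \<in> Z \<Longrightarrow> zb V x \<longleftrightarrow> r x = 0"
proof -
  define X where "X = Z \<union> (\<lambda>(x, y). eqn x y) ` (S \<times> S) \<union> (\<Union>A\<in>Fm. nG (of_nat (holds_sym A)) ` {tup n e |e. range e \<subseteq> S})"
  have "finite X" unfolding X_def using assms fin_Fm finite_tup[OF assms(1), of n] by simp
  then obtain r where r: "thom r" "\<And>x. x \<in> X \<Longrightarrow> zb V x \<longleftrightarrow> r x = 0"
    by (rule model_real[OF V]) blast
  have "equ N x y \<longleftrightarrow> r x = r y" if "x \<in> S" "y \<in> S" for x y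
  proof -
    have "eqn x y \<in> X" using that unfolding X_def by auto
    then show ?thesis using r r_eqn[OF r(1)] by (simp only: N_simps)
  qed
  moreover have "sata N e A \<longleftrightarrow> sata K (\<lambda>v. r (e v)) A" if "A \<in> Fm" "range e \<subseteq> S" for A e
  proof -
    have "hn A e \<in> X" using that unfolding X_def hn_def by blast
    then show ?thesis using r(2) r_hn[OF that(1) r(1)] sat_N[OF that(1)] by blast
  qed
  moreover have "zb V x \<longleftrightarrow> r x = 0" if "x \<in> Z" for x using r(2) that unfolding X_def by blast
  ultimately show ?thesis using that r(1) unfolding real_def by blast
qed

lemma real_thom: "real r S \<Longrightarrow> thom r"
  and real_equ: "real r S \<Longrightarrow> x \<in> S \<Longrightarrow> y \<in> S \<Longrightarrow> equ N x y \<longleftrightarrow> r x = r y"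
  and real_sat: "real r S \<Longrightarrow> A \<in> Fm \<Longrightarrow> range e \<subseteq> S \<Longrightarrow> sata N e A \<longleftrightarrow> sata K (\<lambda>v. r (e v)) A"
  unfolding real_def by blast+

lemma real_syntax_aux:
  assumes "real r S" "x \<in> S" "y \<in> S" "z \<in> S" "u \<in> S" "w \<in> S"
  shows "is_sentenceS N x \<longleftrightarrow> is_sentenceS K (r x)" "is_formula_inS N x y \<longleftrightarrow> is_formula_inS K (r x) (r y)"
    "is_closed_termS N x \<longleftrightarrow> is_closed_termS K (r x)" "is_numeralS N x y \<longleftrightarrow> is_numeralS K (r x) (r y)"
    "is_substS N x y z u \<longleftrightarrow> is_substS K (r x) (r y) (r z) (r u)"
    "(\<exists>v. is_valueS N x v \<and> is_valueS N y v) \<longleftrightarrow> (\<exists>v. is_valueS K (r x) v \<and> is_valueS K (r y) v)"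
    "(\<exists>c. is_numeralS N x c) \<longleftrightarrow> (\<exists>c. is_numeralS K (r x) c)"
    "(\<exists>q. is_substS N x y z q) \<longleftrightarrow> (\<exists>q. is_substS K (r x) (r y) (r z) q)"
    "leS N x y \<longleftrightarrow> r x \<le> r y" "ltS N x y \<longleftrightarrow> r x < r y" "betaS N x y z u \<longleftrightarrow> r u = dec (prk (r x) (r y)) (r z)"
    "disj_genS N x y (prS N z (prS N u w)) \<longleftrightarrow> disj_genS K (r x) (r y) (prk (r z) (prk (r u) (r w)))"
    "(\<exists>j p q. disj_genS N x y (prS N z (prS N j p)) \<and> disj_genS N x y (prS N j (prS N u q)) \<and> equ N w (tagS N 7 (prS N p q)))
     \<longleftrightarrow> (\<exists>j p q. disj_genS K (r x) (r y) (prk (r z) (prk j p)) \<and> disj_genS K (r x) (r y) (prk j (prk (r u) q)) \<and> r w = prk 7 (prk p q))"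
proof -
  define e :: "nat \<Rightarrow> kk" where "e v = (if v = 0 then x else if v = 1 then y else if v = 2 then z else if v = 3 then u else w)" for v
  have "range e \<subseteq> S" using assms unfolding e_def by auto
  then have T: "A \<in> syntax_fms \<Longrightarrow> sata N e A \<longleftrightarrow> sata K (\<lambda>v. r (e v)) A" for A
    using real_sat[OF assms(1)] syntax_Fm by blast
  have e: "e 0 = x" "e (Suc 0) = y" "e 1 = y" "e 2 = z" "e 3 = u" "e 4 = w" by (simp_all add: e_def)
  note T = T[unfolded syntax_fms_def, simplified insert_iff]
  show "is_sentenceS N x \<longleftrightarrow> is_sentenceS K (r x)" using T[of "is_sentence (Var 0)"] by (simp del: N_simps add: e)
  show "is_formula_inS N x y \<longleftrightarrow> is_formula_inS K (r x) (r y)"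
    using T[of "is_formula_in (Var 0) (Var 1)"] by (simp del: N_simps add: e)
  show "is_closed_termS N x \<longleftrightarrow> is_closed_termS K (r x)" using T[of "is_closed_term (Var 0)"] by (simp del: N_simps add: e)
  show "is_numeralS N x y \<longleftrightarrow> is_numeralS K (r x) (r y)" using T[of "is_numeral (Var 0) (Var 1)"] by (simp del: N_simps add: e)
  show "is_substS N x y z u \<longleftrightarrow> is_substS K (r x) (r y) (r z) (r u)"
    using T[of "is_subst (Var 0) (Var 1) (Var 2) (Var 3)"] by (simp del: N_simps add: e)
  show "(\<exists>v. is_valueS N x v \<and> is_valueS N y v) \<longleftrightarrow> (\<exists>v. is_valueS K (r x) v \<and> is_valueS K (r y) v)"
    using T[of "same_value (Var 0) (Var 1)"] by (simp del: N_simps add: e)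
  show "(\<exists>c. is_numeralS N x c) \<longleftrightarrow> (\<exists>c. is_numeralS K (r x) c)"
    using T[of "has_numeral (Var 0)"] by (simp del: N_simps add: e)
  show "(\<exists>q. is_substS N x y z q) \<longleftrightarrow> (\<exists>q. is_substS K (r x) (r y) (r z) q)"
    using T[of "has_instance (Var 0) (Var 1) (Var 2)"] by (simp del: N_simps add: e)
  show "leS N x y \<longleftrightarrow> r x \<le> r y" using T[of "Var 0 \<preceq> Var 1"] by (simp del: N_simps add: e)
  show "ltS N x y \<longleftrightarrow> r x < r y" using T[of "Var 0 \<prec> Var 1"] by (simp del: N_simps add: e)
  show "betaS N x y z u \<longleftrightarrow> r u = dec (prk (r x) (r y)) (r z)"
    using T[of "beta (Var 0) (Var 1) (Var 2) (Var 3)"] by (simp del: N_simps add: e)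
  show "disj_genS N x y (prS N z (prS N u w)) \<longleftrightarrow> disj_genS K (r x) (r y) (prk (r z) (prk (r u) (r w)))"
    using T[of "disj_fm (Var 0) (Var 1) (Var 2) (Var 3) (Var 4)"] by (simp del: N_simps add: e)
  show "(\<exists>j p q. disj_genS N x y (prS N z (prS N j p)) \<and> disj_genS N x y (prS N j (prS N u q)) \<and> equ N w (tagS N 7 (prS N p q)))
     \<longleftrightarrow> (\<exists>j p q. disj_genS K (r x) (r y) (prk (r z) (prk j p)) \<and> disj_genS K (r x) (r y) (prk j (prk (r u) q)) \<and> r w = prk 7 (prk p q))"
    using T[of "split_fm (Var 0) (Var 1) (Var 2) (Var 3) (Var 4)"] by (simp del: N_simps add: e)
qed

lemma real_syntax:
  assumes "real r S"
  shows "x \<in> S \<Longrightarrow> is_sentenceS N x \<longleftrightarrow> is_sentenceS K (r x)"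
    "x \<in> S \<Longrightarrow> y \<in> S \<Longrightarrow> is_formula_inS N x y \<longleftrightarrow> is_formula_inS K (r x) (r y)"
    "x \<in> S \<Longrightarrow> is_closed_termS N x \<longleftrightarrow> is_closed_termS K (r x)"
    "x \<in> S \<Longrightarrow> y \<in> S \<Longrightarrow> is_numeralS N x y \<longleftrightarrow> is_numeralS K (r x) (r y)"
    "x \<in> S \<Longrightarrow> y \<in> S \<Longrightarrow> z \<in> S \<Longrightarrow> u \<in> S \<Longrightarrow> is_substS N x y z u \<longleftrightarrow> is_substS K (r x) (r y) (r z) (r u)"
    "x \<in> S \<Longrightarrow> y \<in> S \<Longrightarrow> (\<exists>v. is_valueS N x v \<and> is_valueS N y v) \<longleftrightarrow> (\<exists>v. is_valueS K (r x) v \<and> is_valueS K (r y) v)"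
    "x \<in> S \<Longrightarrow> (\<exists>c. is_numeralS N x c) \<longleftrightarrow> (\<exists>c. is_numeralS K (r x) c)"
    "x \<in> S \<Longrightarrow> y \<in> S \<Longrightarrow> z \<in> S \<Longrightarrow> (\<exists>q. is_substS N x y z q) \<longleftrightarrow> (\<exists>q. is_substS K (r x) (r y) (r z) q)"
    "x \<in> S \<Longrightarrow> y \<in> S \<Longrightarrow> leS N x y \<longleftrightarrow> r x \<le> r y"
    "x \<in> S \<Longrightarrow> y \<in> S \<Longrightarrow> ltS N x y \<longleftrightarrow> r x < r y"
    "x \<in> S \<Longrightarrow> y \<in> S \<Longrightarrow> z \<in> S \<Longrightarrow> u \<in> S \<Longrightarrow> betaS N x y z u \<longleftrightarrow> r u = dec (prk (r x) (r y)) (r z)"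
  by (rule real_syntax_aux[OF assms]; assumption)+

lemmas real_disj = real_syntax_aux(12,13)

end


context approximation
begin

interpretation truth_base "app L" by (rule truth_base_app[OF L(1)])

lemma realize: assumes "\<And>r. real r S \<Longrightarrow> thom r \<Longrightarrow> thesis" "finite S" shows thesis
  using realization[OF assms(2) finite.emptyI] real_thom assms(1) by metis

lemma congS_N: "congS N"
  unfolding congS_def
proof (intro conjI allI impI)
  fix x
  obtain r where r: "real r {x}" "thom r" by (rule realize, assumption) simp
  show "equ N x x" using real_equ[OF r(1)] by simp
next
  fix x y assume a: "equ N x y"
  obtain r where r: "real r {x, y}" "thom r" by (rule realize, assumption) simp
  show "equ N y x" using a real_equ[OF r(1)] by simp
next
  fix x y z assume a: "equ N x y" "equ N y z"
  obtain r where r: "real r {x, y, z}" "thom r" by (rule realize, assumption) simp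
  have "r x = r y" "r y = r z" using a real_equ[OF r(1)] by blast+
  then show "equ N x z" using real_equ[OF r(1)] by simp
next
  fix x y assume a: "equ N x y"
  obtain r where r: "real r {x, y, suc N x, suc N y}" "thom r" by (rule realize, assumption) simp
  have "r x = r y" using a real_equ[OF r(1)] by blast
  then have "r (suc N x) = r (suc N y)" by (simp only: r_ops[OF r(2)])
  then show "equ N (suc N x) (suc N y)" using real_equ[OF r(1)] by blast
next
  fix x y x' y' assume a: "equ N x y" "equ N x' y'"
  obtain r where r: "real r {x, y, x', y', plu N x x', plu N y y'}" "thom r" by (rule realize, assumption) simp
  have "r x = r y" "r x' = r y'" using a real_equ[OF r(1)] by blast+
  then have "r (plu N x x') = r (plu N y y')" by (simp only: r_ops[OF r(2)])
  then show "equ N (plu N x x') (plu N y y')" using real_equ[OF r(1)] by blast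
next
  fix x y x' y' assume a: "equ N x y" "equ N x' y'"
  obtain r where r: "real r {x, y, x', y', tim N x x', tim N y y'}" "thom r" by (rule realize, assumption) simp
  have "r x = r y" "r x' = r y'" using a real_equ[OF r(1)] by blast+
  then have "r (tim N x x') = r (tim N y y')" by (simp only: r_ops[OF r(2)])
  then show "equ N (tim N x x') (tim N y y')" using real_equ[OF r(1)] by blast
qed

lemma tb_cong: "equ N x y \<Longrightarrow> tb V x = tb V y"
  using model_tb_cong[OF V] by simp

text \<open>\<open>tb V\<close> may hold of elements of \<open>N\<close> that code no sentence. The
  restriction secures the first axiom of \<open>CT_minus\<close>.\<close>

definition Tn :: "kk \<Rightarrow> bool" where "Tn y \<longleftrightarrow> tb V y \<and> is_sentenceS N y"

lemma sentence_cong: assumes "equ N x y" shows "is_sentenceS N x = is_sentenceS N y"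
proof -
  obtain r where r: "real r {x, y}" "thom r" by (rule realize, assumption) simp
  have "r x = r y" using assms real_equ[OF r(1)] by blast
  then show ?thesis using real_syntax(1)[OF r(1)] by simp
qed

lemma Tn_cong: "equ N x y \<Longrightarrow> Tn x = Tn y"
  unfolding Tn_def using tb_cong sentence_cong by blast

lemma tag_N: "thom r \<Longrightarrow> r (tagS N k x) = prk (of_nat k) (r x)"
  by (simp only: r_ops)

lemma part_N: "thom r \<Longrightarrow> r (subn p x) = part (r p) (r x)"
  using r_base[of r "num.Bit1 num.One"] by (simp add: base_def thomD(4))

lemma head_N:
  assumes "thom r" "zb V (hdn p) \<longleftrightarrow> r (hdn p) = 0" "zb V (ngn p) \<longleftrightarrow> r (ngn p) = 0" "zb V (atn p) \<longleftrightarrow> r (atn p) = 0"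
  shows "zb V (hdn p) \<longleftrightarrow> headed (r p)" "zb V (ngn p) \<longleftrightarrow> \<pi>1 (r p) = 6" "zb V (atn p) \<longleftrightarrow> atomic_true (r p)"
  unfolding assms(2-4)
  using r_base[OF assms(1), of "num.Bit0 (num.Bit0 num.One)"] r_base[OF assms(1), of "num.Bit1 (num.Bit0 num.One)"]
    r_base[OF assms(1), of "num.Bit0 (num.Bit1 num.One)"]
  by (simp_all add: base_def)

lemma realize_head:
  assumes "finite S" obtains r where "real r S" "thom r" "zb V (hdn p) \<longleftrightarrow> headed (r p)" "zb V (ngn p) \<longleftrightarrow> \<pi>1 (r p) = 6"
    "zb V (atn p) \<longleftrightarrow> atomic_true (r p)"
proof -
  have "finite {hdn p, ngn p, atn p}" by simp
  then obtain r where r: "real r S" "\<And>x. x \<in> {hdn p, ngn p, atn p} \<Longrightarrow> zb V x \<longleftrightarrow> r x = 0"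
    by (rule realization[OF assms]) blast
  show thesis
    by (rule that[OF r(1) real_thom[OF r(1)]]; rule head_N[OF real_thom[OF r(1)]]; rule r(2); simp)
qed

lemma tb_headed: assumes "zb V (hdn p)" shows "tb V p \<longleftrightarrow> (\<exists>x. tb V (subn p x) \<noteq> zb V (ngn p))"
proof -
  \<comment> \<open>All skeletons have been treated, in particular the one named
    \<open>skn p\<close>, so its clauses apply to \<open>p\<close>.\<close>
  have "zb V (eqn (skn p) (skn p))" using congS_N unfolding congS_def N_simps by blast
  then show ?thesis using model_clauses(3,4)[OF V _ _ assms] by blast
qed

lemma tb_neg: "tb V (tagS N 6 p) \<longleftrightarrow> \<not> tb V p"
proof -
  let ?P = "tagS N 6 p"
  have *: "zb V (hdn ?P) \<and> zb V (ngn ?P) \<and> equ N (subn ?P x) p" for x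
  proof -
    have "finite {p, ?P, x, subn ?P x}" by simp
    then obtain r where r: "real r {p, ?P, x, subn ?P x}" "thom r" "zb V (hdn ?P) \<longleftrightarrow> headed (r ?P)" "zb V (ngn ?P) \<longleftrightarrow> \<pi>1 (r ?P) = 6"
      by (rule realize_head[where p = "?P"]) blast
    have P: "r ?P = prk 6 (r p)" using tag_N[OF r(2), of 6] by simp
    then have "r (subn ?P x) = r p" unfolding part_N[OF r(2)] by simp
    then have "equ N (subn ?P x) p" using real_equ[OF r(1)] by blast
    then show ?thesis using r(3,4) P by (simp add: headed_def)
  qed
  then show ?thesis using tb_headed[of ?P] tb_cong by blast
qed

lemma tb_or: "tb V (tagS N 7 (prS N p q)) \<longleftrightarrow> tb V p \<or> tb V q"
proof -
  let ?P = "tagS N 7 (prS N p q)"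
  have *: "zb V (hdn ?P) \<and> \<not> zb V (ngn ?P) \<and> (equ N (subn ?P x) p \<or> equ N (subn ?P x) q)
     \<and> equ N (subn ?P (nK 0)) p \<and> equ N (subn ?P (nK 1)) q" for x
  proof -
    have "finite {p, q, ?P, x, subn ?P x, subn ?P (nK 0), subn ?P (nK 1)}" by simp
    then obtain r where r: "real r {p, q, ?P, x, subn ?P x, subn ?P (nK 0), subn ?P (nK 1)}" "thom r"
        "zb V (hdn ?P) \<longleftrightarrow> headed (r ?P)" "zb V (ngn ?P) \<longleftrightarrow> \<pi>1 (r ?P) = 6"
      by (rule realize_head[where p = "?P"]) blast
    have P: "r ?P = prk 7 (prk (r p) (r q))" using tag_N[OF r(2), of 7] r_ops[OF r(2)] by simp
    then have "r (subn ?P x) = r p \<or> r (subn ?P x) = r q" "r (subn ?P (nK 0)) = r p" "r (subn ?P (nK 1)) = r q"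
      unfolding part_N[OF r(2)] by (simp_all add: r_ops(1)[OF r(2)])
    then have "equ N (subn ?P x) p \<or> equ N (subn ?P x) q" "equ N (subn ?P (nK 0)) p" "equ N (subn ?P (nK 1)) q"
      using real_equ[OF r(1)] by blast+
    then show ?thesis using r(3,4) P by (simp add: headed_def)
  qed
  then show ?thesis using tb_headed[of ?P] tb_cong by blast
qed

lemma tb_ex:
  assumes "is_formula_inS N v p"
  shows "tb V (tagS N 8 (prS N v p)) \<longleftrightarrow> (\<exists>y c q. is_numeralS N y c \<and> is_substS N v c p q \<and> tb V q)"
proof -
  let ?P = "tagS N 8 (prS N v p)"
  have h: "zb V (hdn ?P)" "\<not> zb V (ngn ?P)"
  proof -
    have "finite {v, p, ?P}" by simp
    then obtain r where r: "real r {v, p, ?P}" "thom r"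
        "zb V (hdn ?P) \<longleftrightarrow> headed (r ?P)" "zb V (ngn ?P) \<longleftrightarrow> \<pi>1 (r ?P) = 6"
      by (rule realize_head[where p = "?P"]) blast
    have P: "r ?P = prk 8 (prk (r v) (r p))" using tag_N[OF r(2), of 8] r_ops[OF r(2)] by simp
    then show "zb V (hdn ?P)" "\<not> zb V (ngn ?P)" using r(3,4) by (simp_all add: headed_def)
  qed
  have 1: "equ N (subn ?P y) q" if "is_numeralS N y c" "is_substS N v c p q" for y c q
  proof -
    obtain r where r: "real r {v, p, y, c, q, ?P, subn ?P y}" "thom r" by (rule realize, assumption) simp
    have P: "r ?P = prk 8 (prk (r v) (r p))" using tag_N[OF r(2), of 8] r_ops[OF r(2)] by simp
    have "is_numeralS K (r y) (r c)" using real_syntax(4)[OF r(1)] that(1) by blast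
    moreover have "is_substS K (r v) (r c) (r p) (r q)" using real_syntax(5)[OF r(1)] that(2) by blast
    ultimately have "r (subn ?P y) = r q" unfolding part_N[OF r(2)] P by (rule part_8)
    then show ?thesis using real_equ[OF r(1)] by blast
  qed
  have 2: "\<exists>c q. is_numeralS N y c \<and> is_substS N v c p q" for y
  proof -
    obtain r where r: "real r {y}" "thom r" by (rule realize, assumption) simp
    have "\<exists>c. is_numeralS K (r y) c" using ex1_numeral by blast
    then obtain c where c: "is_numeralS N y c" using real_syntax(7)[OF r(1)] by blast
    obtain r where r: "real r {v, c, p}" "thom r" by (rule realize, assumption) simp
    have "is_formula_inS K (r v) (r p)" using real_syntax(2)[OF r(1)] assms by blast
    then have "\<exists>q. is_substS K (r v) (r c) (r p) q" unfolding is_formula_inS_def using subst_total by blast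
    then obtain q where "is_substS N v c p q" using real_syntax(8)[OF r(1)] by blast
    then show ?thesis using c by blast
  qed
  have "tb V ?P \<longleftrightarrow> (\<exists>y. tb V (subn ?P y))" using tb_headed[OF h(1)] h(2) by blast
  also have "\<dots> \<longleftrightarrow> (\<exists>y c q. is_numeralS N y c \<and> is_substS N v c p q \<and> tb V q)"
    using 1 2 tb_cong by blast
  finally show ?thesis .
qed

lemma tb_eq: "tb V (tagS N 5 (prS N s t)) \<longleftrightarrow> (\<exists>y. is_valueS N s y \<and> is_valueS N t y)"
proof -
  let ?P = "tagS N 5 (prS N s t)"
  have "finite {s, t, ?P}" by simp
  then obtain r where r: "real r {s, t, ?P}" "thom r" "zb V (hdn ?P) \<longleftrightarrow> headed (r ?P)" "zb V (atn ?P) \<longleftrightarrow> atomic_true (r ?P)"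
    by (rule realize_head[where p = "?P"]) blast
  have P: "r ?P = prk 5 (prk (r s) (r t))" using tag_N[OF r(2), of 5] r_ops[OF r(2)] by simp
  have "\<not> zb V (hdn ?P)" unfolding r(3) P headed_def by simp
  then have "tb V ?P \<longleftrightarrow> atomic_true (r ?P)" using model_clauses(2)[OF V] r(4) by blast
  also have "\<dots> \<longleftrightarrow> (\<exists>y. is_valueS K (r s) y \<and> is_valueS K (r t) y)" unfolding P atomic_true_def by simp
  also have "\<dots> \<longleftrightarrow> (\<exists>y. is_valueS N s y \<and> is_valueS N t y)" using real_syntax(6)[OF r(1)] by blast
  finally show ?thesis .
qed

lemma sentences_N:
  "is_closed_termS N s \<Longrightarrow> is_closed_termS N t \<Longrightarrow> is_sentenceS N (tagS N 5 (prS N s t))"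
  "is_sentenceS N p \<Longrightarrow> is_sentenceS N (tagS N 6 p)"
  "is_sentenceS N p \<Longrightarrow> is_sentenceS N q \<Longrightarrow> is_sentenceS N (tagS N 7 (prS N p q))"
  "is_formula_inS N v p \<Longrightarrow> is_sentenceS N (tagS N 8 (prS N v p))"
  "is_formula_inS N v p \<Longrightarrow> is_numeralS N y c \<Longrightarrow> is_substS N v c p q \<Longrightarrow> is_sentenceS N q"
proof -
  assume a: "is_closed_termS N s" "is_closed_termS N t"
  let ?P = "tagS N 5 (prS N s t)"
  obtain r where r: "real r {s, t, ?P}" "thom r" by (rule realize, assumption) simp
  have "r ?P = prk 5 (prk (r s) (r t))" using tag_N[OF r(2), of 5] r_ops[OF r(2)] by simp
  moreover have "is_closed_termS K (r s)" "is_closed_termS K (r t)" using a real_syntax(3)[OF r(1)] by blast+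
  ultimately have "is_sentenceS K (r ?P)" by (simp only: sentence_closure(1))
  then show "is_sentenceS N ?P" using real_syntax(1)[OF r(1)] by blast
next
  assume a: "is_sentenceS N p"
  let ?P = "tagS N 6 p"
  obtain r where r: "real r {p, ?P}" "thom r" by (rule realize, assumption) simp
  have "r ?P = prk 6 (r p)" using tag_N[OF r(2), of 6] r_ops[OF r(2)] by simp
  moreover have "is_sentenceS K (r p)" using a real_syntax(1)[OF r(1)] by blast
  ultimately have "is_sentenceS K (r ?P)" by (simp only: sentence_closure(2))
  then show "is_sentenceS N ?P" using real_syntax(1)[OF r(1)] by blast
next
  assume a: "is_sentenceS N p" "is_sentenceS N q"
  let ?P = "tagS N 7 (prS N p q)"
  obtain r where r: "real r {p, q, ?P}" "thom r" by (rule realize, assumption) simp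
  have "r ?P = prk 7 (prk (r p) (r q))" using tag_N[OF r(2), of 7] r_ops[OF r(2)] by simp
  moreover have "is_sentenceS K (r p)" "is_sentenceS K (r q)" using a real_syntax(1)[OF r(1)] by blast+
  ultimately have "is_sentenceS K (r ?P)" by (simp only: sentence_closure(3))
  then show "is_sentenceS N ?P" using real_syntax(1)[OF r(1)] by blast
next
  assume a: "is_formula_inS N v p"
  let ?P = "tagS N 8 (prS N v p)"
  obtain r where r: "real r {v, p, ?P}" "thom r" by (rule realize, assumption) simp
  have "r ?P = prk 8 (prk (r v) (r p))" using tag_N[OF r(2), of 8] r_ops[OF r(2)] by simp
  moreover have "is_formula_inS K (r v) (r p)" using a real_syntax(2)[OF r(1)] by blast
  ultimately have "is_sentenceS K (r ?P)" by (simp only: sentence_closure(4))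
  then show "is_sentenceS N ?P" using real_syntax(1)[OF r(1)] by blast
next
  assume a: "is_formula_inS N v p" "is_numeralS N y c" "is_substS N v c p q"
  obtain r where r: "real r {v, p, y, c, q}" "thom r" by (rule realize, assumption) simp
  have "is_formula_inS K (r v) (r p)" using a real_syntax(2)[OF r(1)] by blast
  moreover have "is_numeralS K (r y) (r c)" using a real_syntax(4)[OF r(1)] by blast
  moreover have "is_substS K (r v) (r c) (r p) (r q)" using a real_syntax(5)[OF r(1)] by blast
  ultimately have "is_sentenceS K (r q)" by (rule sentence_instance)
  then show "is_sentenceS N q" using real_syntax(1)[OF r(1)] by blast
qed

lemma CTS_N: "CTS N Tn"
  unfolding CTS_def Tn_def
  by (intro conjI allI impI)
    (simp_all only: tb_eq tb_neg tb_or sentences_N simp_thms, use tb_ex sentences_N(4,5) in blast)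

text \<open>The names \<open>eqn x (nK m)\<close> for \<open>m \<le> c\<close> are bounded in \<open>K\<close>. So they have a common realization, which
  evaluates \<open>x\<close> to some \<open>m \<le> c\<close>.\<close>

lemma standard_below: assumes "leS N x (nK c)" shows "\<exists>m\<le>c. equ N x (nK m)"
proof -
  obtain B where B: "\<And>m. m < c + 1 \<Longrightarrow> eqn x (nK m) \<le> B"
    using dt_upper[of "\<lambda>m. eqn x (nK m)" "c + 1"] by (auto simp: dfi)
  define e where "e v = (if v = 0 then x else nK c)" for v :: nat
  have A: "Var 0 \<preceq> Var 1 \<in> Fm" using syntax_Fm unfolding syntax_fms_def by blast
  define h where "h = hn (Var 0 \<preceq> Var 1) e"
  obtain r where r: "thom r" "\<forall>y<max B h + 1. zb V y \<longleftrightarrow> r y = 0" using V unfolding model_def by blast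
  have "sata N e (Var 0 \<preceq> Var 1)" using assms by (simp add: e_def)
  then have "zb V h" unfolding h_def sat_N[OF A] .
  moreover have "h < max B h + 1" by (simp add: le_iff_less1[symmetric])
  ultimately have "r h = 0" using r(2) by blast
  then have "sata K (\<lambda>v. r (e v)) (Var 0 \<preceq> Var 1)" unfolding h_def r_hn[OF A r(1)] .
  then have le: "r x \<le> c" by (simp add: e_def r_ops(1)[OF r(1)])
  then have "eqn x (nK (r x)) \<le> B" using B by (simp add: le_iff_less1)
  then have "eqn x (nK (r x)) < max B h + 1" by (simp add: le_iff_less1[symmetric] le_max_iff_disj)
  moreover have "r (eqn x (nK (r x))) = 0" using r_eqn[OF r(1)] r_ops(1)[OF r(1)] by simp
  ultimately have "equ N x (nK (r x))" using r(2) by simp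
  then show ?thesis using le by blast
qed

text \<open>\<open>sat_N\<close> reduces satisfaction in \<open>N\<close> to a zero test of
  \<open>V\<close>, and \<open>V\<close> is definable.\<close>

lemma df_sat_N: assumes "A \<in> Fm" "\<And>v. dt (\<lambda>x. E x v)" shows "df (\<lambda>x. sata N (E x) A)"
proof -
  have "dt V" using V unfolding model_def by blast
  moreover have "dt (\<lambda>x. hn A (E x))" unfolding hn_def by (intro dfi dt_tup assms(2))
  ultimately have "dt (\<lambda>x. V (hn A (E x)))" by (rule dt_comp)
  then show ?thesis unfolding sat_N[OF assms(1)] zb_def by (intro dfi)
qed

lemma df_beta_N: assumes "dt f" "dt g" shows "df (\<lambda>x. betaS N a b (f x) (g x))"
proof -
  have A: "beta (Var 0) (Var 1) (Var 2) (Var 3) \<in> Fm" using syntax_Fm unfolding syntax_fms_def by blast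
  have "dt (\<lambda>x. if v = 0 then a else if v = 1 then b else if v = 2 then f x else g x)" for v :: nat
    by (intro dfi assms)
  from df_sat_N[OF A, of "\<lambda>x v. if v = 0 then a else if v = 1 then b else if v = 2 then f x else g x", OF this]
  show ?thesis by simp
qed

lemma df_disj_N: assumes "dt f" "dt g" "dt h" shows "df (\<lambda>x. disj_genS N a b (prS N (f x) (prS N (g x) (h x))))"
proof -
  have A: "disj_fm (Var 0) (Var 1) (Var 2) (Var 3) (Var 4) \<in> Fm" using syntax_Fm unfolding syntax_fms_def by blast
  have "dt (\<lambda>x. if v = 0 then a else if v = 1 then b else if v = 2 then f x else if v = 3 then g x else h x)" for v :: nat
    by (intro dfi assms)
  from df_sat_N[OF A, of "\<lambda>x v. if v = 0 then a else if v = 1 then b else if v = 2 then f x else if v = 3 then g x else h x", OF this]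
  show ?thesis by simp
qed

lemma df_tb: assumes "dt f" shows "df (\<lambda>x. tb V (f x))"
proof -
  have "dt V" using V unfolding model_def by blast
  then have "dt (\<lambda>x. V (f x))" by (rule dt_comp[OF _ assms])
  then show ?thesis unfolding tb_def by (intro dfi)
qed

text \<open>Induction in \<open>K\<close> on the length of the disjunction; it is available as \<open>V\<close> is definable.\<close>

lemma disjunction_N:
  "disj_genS N a b (prS N (nK i) (prS N (nK k) d)) \<Longrightarrow>
    tb V d \<longleftrightarrow> (\<exists>l y. i \<le> l \<and> l < k \<and> betaS N a b (nK l) y \<and> tb V y)"
proof -
  \<comment> \<open>Segments and disjunctions are quantified inside the induction, because the two
    halves of a disjunction have other ends and are other elements of \<open>N\<close>.\<close>
  define Q where "Q len \<longleftrightarrow> (\<forall>i k d. k \<le> i + len \<longrightarrow> disj_genS N a b (prS N (nK i) (prS N (nK k) d)) \<longrightarrow>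
    (tb V d \<longleftrightarrow> (\<exists>l y. i \<le> l \<and> l < k \<and> betaS N a b (nK l) y \<and> tb V y)))" for len
  have "Q len" for len
  proof (rule df_less_induct[of Q])
    show "df Q" unfolding Q_def by (intro dfi df_beta_N df_disj_N df_tb)
  next
    fix len assume IH: "\<And>len'. len' < len \<Longrightarrow> Q len'"
    have "tb V d \<longleftrightarrow> (\<exists>l y. i \<le> l \<and> l < k \<and> betaS N a b (nK l) y \<and> tb V y)"
      if k: "k \<le> i + len" and D: "disj_genS N a b (prS N (nK i) (prS N (nK k) d))" for i k d
    proof -
      obtain r where r: "real r {a, b, nK i, nK k, d}" "thom r" by (rule realize, assumption) simp
      have "disj_genS K (r a) (r b) (prk i (prk k (r d)))"
        using D real_disj(1)[OF r(1), of a b "nK i" "nK k" d] by (simp add: r_ops(1)[OF r(2)])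
      then consider (1) "k = i + 1" "r d = dec (prk (r a) (r b)) i"
        | (2) "\<exists>j p q. disj_genS K (r a) (r b) (prk i (prk j p)) \<and> disj_genS K (r a) (r b) (prk j (prk k q)) \<and> r d = prk 7 (prk p q)"
        using disj_fix by blast
      then show ?thesis
      proof cases
        case 1
        have bd: "betaS N a b (nK i) d" using 1(2) real_syntax(11)[OF r(1), of a b "nK i" d] by (simp add: r_ops(1)[OF r(2)])
        have uniq: "tb V y = tb V d" if y: "betaS N a b (nK i) y" for y
        proof -
          obtain r where r: "real r {a, b, nK i, d, y}" "thom r" by (rule realize, assumption) simp
          have "r y = r d" using bd y real_syntax(11)[OF r(1), of a b "nK i"] by simp
          then show ?thesis using real_equ[OF r(1)] tb_cong by blast
        qed
        have "l = i" if "i \<le> l" "l < k" for l using that 1(1) by (simp add: le_iff_less1[symmetric])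
        moreover have "i < k" using 1(1) by (simp add: less_iff_add1)
        ultimately show ?thesis using bd uniq by blast
      next
        case 2
        then obtain j p q where j: "disj_genS N a b (prS N (nK i) (prS N j p))" "disj_genS N a b (prS N j (prS N (nK k) q))"
            "equ N d (tagS N 7 (prS N p q))"
          using real_disj(2)[OF r(1), of a b "nK i" "nK k" d] by (simp add: r_ops(1)[OF r(2)]) blast
        obtain r where r: "real r {a, b, nK i, nK k, j, p, q}" "thom r" by (rule realize, assumption) simp
        have "disj_genS K (r a) (r b) (prk (r j) (prk k (r q)))"
          using j(2) real_disj(1)[OF r(1), of a b j "nK k" q] by (simp add: r_ops(1)[OF r(2)])
        then have "r j \<le> k" using disj_less less_imp_le by blast
        then have "leS N j (nK k)" using real_syntax(9)[OF r(1), of j "nK k"] by (simp add: r_ops(1)[OF r(2)])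
        \<comment> \<open>The disjunction splits at an element \<open>j\<close> of \<open>N\<close>.
          As it is at most \<open>k\<close>, it equals an element of \<open>K\<close>, so the
          lengths of both halves are in \<open>K\<close> and the induction hypothesis
          applies.\<close>
        then obtain m where m: "equ N j (nK m)" using standard_below by blast
        obtain r where r: "real r {a, b, nK i, nK k, j, p, q, nK m}" "thom r" by (rule realize, assumption) simp
        have rj: "r j = m" using m real_equ[OF r(1), of j "nK m"] by (simp add: r_ops(1)[OF r(2)])
        have D1: "disj_genS K (r a) (r b) (prk i (prk m (r p)))"
          using j(1) real_disj(1)[OF r(1), of a b "nK i" j p] by (simp add: r_ops(1)[OF r(2)] rj)
        have D2: "disj_genS K (r a) (r b) (prk m (prk k (r q)))"
          using j(2) real_disj(1)[OF r(1), of a b j "nK k" q] by (simp add: r_ops(1)[OF r(2)] rj)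
        have E1: "disj_genS N a b (prS N (nK i) (prS N (nK m) p))"
          using D1 real_disj(1)[OF r(1), of a b "nK i" "nK m" p] by (simp add: r_ops(1)[OF r(2)])
        have E2: "disj_genS N a b (prS N (nK m) (prS N (nK k) q))"
          using D2 real_disj(1)[OF r(1), of a b "nK m" "nK k" q] by (simp add: r_ops(1)[OF r(2)])
        have lt: "i < m" "m < k" using disj_less[OF D1] disj_less[OF D2] .
        obtain l1 where l1: "m = i + l1" using less_imp_le[OF lt(1)] unfolding le_iff_add by blast
        obtain l2 where l2: "k = m + l2" using less_imp_le[OF lt(2)] unfolding le_iff_add by blast
        have "i + l1 < i + len" using lt(2) k unfolding l1[symmetric] by (rule less_le_trans)
        then have 1: "Q l1" using IH by simp
        have "m + l2 < m + len"
          using k lt(1) unfolding l2[symmetric] by (rule le_less_trans[OF _ add_strict_right_mono])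
        then have 2: "Q l2" using IH by simp
        have "tb V p \<longleftrightarrow> (\<exists>l y. i \<le> l \<and> l < m \<and> betaS N a b (nK l) y \<and> tb V y)"
          using 1 E1 order_refl unfolding Q_def l1 by blast
        moreover have "tb V q \<longleftrightarrow> (\<exists>l y. m \<le> l \<and> l < k \<and> betaS N a b (nK l) y \<and> tb V y)"
          using 2 E2 order_refl unfolding Q_def l2 by blast
        moreover have "tb V d \<longleftrightarrow> tb V p \<or> tb V q" using tb_cong[OF j(3)] tb_or by blast
        moreover have "i \<le> l \<and> l < k \<longleftrightarrow> (i \<le> l \<and> l < m) \<or> (m \<le> l \<and> l < k)" for l
          using lt by (meson leI le_less_trans less_imp_le less_le_trans order_trans)
        ultimately show ?thesis by blast
      qed
    qed
    then show "Q len" unfolding Q_def by blast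
  qed
  note Q = this
  assume D: "disj_genS N a b (prS N (nK i) (prS N (nK k) d))"
  have "k \<le> i + k" by (simp add: add_increasing)
  then show ?thesis using Q[of k] D unfolding Q_def by blast
qed

lemma DCS_N: assumes "leS N x (nK c)" shows "DCS N Tn x"
proof -
  obtain m where m: "equ N x (nK m)" using standard_below[OF assms] by blast
  show ?thesis unfolding DCS_def
  proof (intro allI impI)
    fix a b d
    assume a: "(\<forall>i. ltS N i x \<longrightarrow> (\<exists>p. betaS N a b i p \<and> is_sentenceS N p)) \<and> is_sentenceS N d \<and> is_disjunctionS N a b x d"
    obtain r where r: "real r {a, b, nK 0, nK m, x, d}" "thom r" by (rule realize, assumption) simp
    have rx: "r x = m" using m real_equ[OF r(1), of x "nK m"] by (simp add: r_ops(1)[OF r(2)])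
    have "disj_genS N a b (prS N (nK 0) (prS N x d))" using a unfolding is_disjunctionS_def by simp
    then have "disj_genS N a b (prS N (nK 0) (prS N (nK m) d))"
      using real_disj(1)[OF r(1), of a b "nK 0" _ d] by (simp add: r_ops(1)[OF r(2)] rx)
    then have tb: "tb V d \<longleftrightarrow> (\<exists>l y. 0 \<le> l \<and> l < m \<and> betaS N a b (nK l) y \<and> tb V y)" by (rule disjunction_N)
    have below: "ltS N (nK l) x \<longleftrightarrow> l < m" for l
    proof -
      obtain r where r: "real r {nK l, x, nK m}" "thom r" by (rule realize, assumption) simp
      have "r x = m" using m real_equ[OF r(1), of x "nK m"] by (simp add: r_ops(1)[OF r(2)])
      then show ?thesis using real_syntax(10)[OF r(1), of "nK l" x] by (simp add: r_ops(1)[OF r(2)])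
    qed
    show "Tn d \<longleftrightarrow> (\<exists>i p. ltS N i x \<and> betaS N a b i p \<and> Tn p)"
    proof
      assume "Tn d"
      then obtain l y where l: "l < m" "betaS N a b (nK l) y" "tb V y" using tb unfolding Tn_def by blast
      then have lx: "ltS N (nK l) x" using below by blast
      \<comment> \<open>\<open>Tn\<close> demands that the true entry \<open>y\<close> be a
        sentence. It is one because \<open>beta\<close> is single-valued and some value at this
        index is known to be a sentence.\<close>
      then obtain p where p: "betaS N a b (nK l) p" "is_sentenceS N p" using a by blast
      obtain r where r: "real r {a, b, nK l, y, p}" "thom r" by (rule realize, assumption) simp
      have "r y = r p" using l(2) p(1) real_syntax(11)[OF r(1), of a b "nK l"] by simp
      then have "is_sentenceS N y" using p(2) real_equ[OF r(1)] sentence_cong by blast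
      then show "\<exists>i p. ltS N i x \<and> betaS N a b i p \<and> Tn p" using l lx unfolding Tn_def by blast
    next
      assume "\<exists>i p. ltS N i x \<and> betaS N a b i p \<and> Tn p"
      then obtain i p where i: "ltS N i x" "betaS N a b i p" "tb V p" unfolding Tn_def by blast
      obtain r where r: "real r {i, x, nK m}" "thom r" by (rule realize, assumption) simp
      have "r x = m" using m real_equ[OF r(1), of x "nK m"] by (simp add: r_ops(1)[OF r(2)])
      then have "leS N i (nK m)" using i(1) real_syntax(9)[OF r(1), of i "nK m"] real_syntax(10)[OF r(1), of i x]
        by (simp add: r_ops(1)[OF r(2)])
      then obtain l where l: "equ N i (nK l)" using standard_below by blast
      obtain r where r: "real r {i, x, nK l, nK m, a, b, p}" "thom r" by (rule realize, assumption) simp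
      have ri: "r i = l" "r x = m" using l m real_equ[OF r(1), of i "nK l"] real_equ[OF r(1), of x "nK m"]
        by (simp_all add: r_ops(1)[OF r(2)])
      have "l < m" using i(1) real_syntax(10)[OF r(1), of i x] by (simp add: ri)
      moreover have "betaS N a b (nK l) p"
        using i(2) real_syntax(11)[OF r(1), of a b _ p] by (simp add: r_ops(1)[OF r(2)] ri)
      ultimately have "tb V d" using i(3) tb zero_le[of l] by blast
      then show "Tn d" using a unfolding Tn_def by blast
    qed
  qed
qed

lemma elementary_N: assumes "A \<in> Fm" shows "sata N (\<lambda>v. nK (e v)) A \<longleftrightarrow> sata K e A"
proof -
  obtain r where r: "thom r" "\<forall>x\<in>{hn A (\<lambda>v. nK (e v)), 0, 0}. zb V x \<longleftrightarrow> r x = 0" by (rule real3)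
  have "zb V (hn A (\<lambda>v. nK (e v))) \<longleftrightarrow> sata K e A" using r(2) r_hn[OF assms r(1)] by (simp add: r_ops(1)[OF r(1)])
  then show ?thesis unfolding sat_N[OF assms] .
qed

end

theorem approximation_exists:
  assumes "finite \<Phi>" "\<And>A. A \<in> \<Phi> \<Longrightarrow> arithmetical A"
  shows "\<exists>(N :: kk str) X \<kappa>. congS N \<and> (\<forall>x y. equ N x y \<longrightarrow> X x \<longrightarrow> X y)
    \<and> (\<forall>A\<in>\<Phi>. \<forall>e. sata N (\<lambda>v. \<kappa> (e v)) A \<longleftrightarrow> sata K e A)
    \<and> CTS N X \<and> (\<forall>c x. leS N x (\<kappa> c) \<longrightarrow> DCS N X x)"
proof -
  define Fm where "Fm = \<Union> (subfms ` (\<Phi> \<union> syntax_fms))"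
  have fin: "finite Fm" unfolding Fm_def using assms(1) finite_subfms by (simp add: syntax_fms_def)
  have arith: "arithmetical A" if "A \<in> Fm" for A
    using that assms(2) syntax_fms_arith subfms_arith unfolding Fm_def by blast
  have sub: "subfms A \<subseteq> Fm" if "A \<in> Fm" for A using that subfms_trans unfolding Fm_def by blast
  have synt: "\<Phi> \<union> syntax_fms \<subseteq> Fm" using subfms_self unfolding Fm_def by blast
  obtain n where n: "\<And>v. v \<in> \<Union> (fv ` Fm) \<Longrightarrow> v < n"
    using finite_nat_set_iff_bounded[of "\<Union> (fv ` Fm)"] fin finite_fv by auto
  obtain L' where L': "\<And>A. A \<in> witness_sym ` Fm \<Longrightarrow> A < L'"
    using finite_nat_set_iff_bounded[of "witness_sym ` Fm"] fin by auto
  define L where "L = L' + 12"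
  have L: "12 \<le> L" "\<And>A. A \<in> Fm \<Longrightarrow> witness_sym A < L" unfolding L_def by simp (rule trans_less_add1, rule L', rule imageI)
  obtain V where V: "truth_base.model (app L) (\<lambda>_. True) V"
    using truth_base.total_model[OF truth_base_app[OF L(1)]] by blast
  have fvn: "fv A \<subseteq> {..<n}" if "A \<in> Fm" for A using n that by blast
  interpret approximation L n Fm V
    using L fin arith sub fvn synt V by unfold_locales blast+
  show ?thesis
  proof (intro exI conjI)
    show "congS N" by (rule congS_N)
    show "\<forall>x y. equ N x y \<longrightarrow> Tn x \<longrightarrow> Tn y" using Tn_cong by blast
    show "\<forall>A\<in>\<Phi>. \<forall>e. sata N (\<lambda>v. nK (e v)) A \<longleftrightarrow> sata K e A" using elementary_N synt by blast
    show "CTS N Tn" by (rule CTS_N)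
    show "\<forall>c x. leS N x (nK c) \<longrightarrow> DCS N Tn x" using DCS_N by blast
  qed
qed


section \<open>Ultraproducts\<close>

definition uf :: "nat filter" where
  "uf = (SOME U. U \<le> sequentially \<and> U \<noteq> bot \<and> (\<forall>P. eventually P U \<or> eventually (\<lambda>i. \<not> P i) U))"

text \<open>In the order of filters, a minimal proper filter is an ultrafilter: unless it contains
  the complement of a given set, its infimum with the principal filter of the set is still proper,
  and so equal to it. Lying below \<open>sequentially\<close> makes all final segments large, which
  saturation relies on.\<close>

lemma uf: "uf \<le> sequentially" "uf \<noteq> bot" "eventually P uf \<or> eventually (\<lambda>i. \<not> P i) uf"
proof -
  define A where "A = {U :: nat filter. U \<le> sequentially \<and> U \<noteq> bot}"
  have "\<exists>m\<in>A. \<forall>a\<in>A. a \<le> m \<longrightarrow> a = m"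
  proof (rule predicate_Zorn)
    show "partial_order_on A (relation_of (\<lambda>x y. y \<le> x) A)"
      by (rule partial_order_on_relation_ofI) auto
  next
    fix C assume C: "C \<in> Chains (relation_of (\<lambda>x y. y \<le> x) A)"
    then have CA: "C \<subseteq> A" and lin: "\<And>a b. a \<in> C \<Longrightarrow> b \<in> C \<Longrightarrow> b \<le> a \<or> a \<le> b"
      unfolding Chains_def relation_of_def by blast+
    have fin: "X \<subseteq> C \<Longrightarrow> X \<noteq> {} \<Longrightarrow> \<exists>a\<in>C. \<forall>x\<in>X. a \<le> x" if "finite X" for X
      using that
    proof (induction X)
      case (insert x X)
      show ?case
      proof (cases "X = {}")
        case False
        then obtain a where a: "a \<in> C" "\<forall>y\<in>X. a \<le> y" using insert by blast
        have "x \<in> C" using insert by blast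
        from lin[OF a(1) this] show ?thesis
        proof
          assume "x \<le> a"
          then have "\<forall>y\<in>insert x X. x \<le> y" using a(2) order_trans[OF \<open>x \<le> a\<close>] by simp
          then show ?thesis using \<open>x \<in> C\<close> by (rule bexI)
        next
          assume "a \<le> x"
          then have "\<forall>y\<in>insert x X. a \<le> y" using a(2) by simp
          then show ?thesis using a(1) by (rule bexI)
        qed
      qed (use insert in auto)
    qed simp
    show "\<exists>u\<in>A. \<forall>a\<in>C. u \<le> a"
    proof (cases "C = {}")
      case True
      have "sequentially \<in> A" unfolding A_def by simp
      then show ?thesis using True by blast
    next
      case False
      have "Inf C \<noteq> bot"
      proof (rule Inf_filter_not_bot)
        fix X assume X: "X \<subseteq> C" "finite X"
        show "Inf X \<noteq> bot"
        proof (cases "X = {}")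
          case False
          then obtain a where a: "a \<in> C" "\<forall>x\<in>X. a \<le> x" using fin[OF X(2,1) False] by (elim bexE)
          then have "a \<le> Inf X" by (simp add: Inf_greatest)
          moreover have "a \<noteq> bot" using a(1) CA unfolding A_def by blast
          ultimately show ?thesis by (metis bot.extremum_uniqueI)
        qed (simp add: trivial_limit_def)
      qed
      moreover obtain a where a: "a \<in> C" using False by blast
      then have "a \<le> sequentially" using CA unfolding A_def by blast
      then have "Inf C \<le> sequentially" by (rule order_trans[OF Inf_lower[OF a]])
      ultimately have "Inf C \<in> A" unfolding A_def by blast
      then show ?thesis using Inf_lower by blast
    qed
  qed
  then obtain U where U: "U \<in> A" "\<And>a. a \<in> A \<Longrightarrow> a \<le> U \<Longrightarrow> a = U" by blast
  have "eventually P U \<or> eventually (\<lambda>i. \<not> P i) U" for P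
  proof (rule disjCI)
    assume n: "\<not> eventually (\<lambda>i. \<not> P i) U"
    define F where "F = inf U (principal {i. P i})"
    have "F \<noteq> bot" using n unfolding F_def trivial_limit_def eventually_inf_principal by simp
    then have "F \<in> A" using U(1) unfolding A_def F_def by (auto intro: le_infI1)
    then have "F = U" by (rule U(2)) (simp add: F_def)
    moreover have "eventually P F" unfolding F_def eventually_inf_principal by simp
    ultimately show "eventually P U" by simp
  qed
  then have "\<exists>U :: nat filter. U \<le> sequentially \<and> U \<noteq> bot \<and> (\<forall>P. eventually P U \<or> eventually (\<lambda>i. \<not> P i) U)"
    using U(1) unfolding A_def by blast
  from someI_ex[OF this, folded uf_def]
  show "uf \<le> sequentially" "uf \<noteq> bot" "eventually P uf \<or> eventually (\<lambda>i. \<not> P i) uf" by blast+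
qed

lemma uf_not: "eventually (\<lambda>i. \<not> P i) uf \<longleftrightarrow> \<not> eventually P uf"
proof
  assume a: "eventually (\<lambda>i. \<not> P i) uf"
  show "\<not> eventually P uf"
  proof
    assume "eventually P uf"
    with a have "eventually (\<lambda>i. False) uf" by eventually_elim simp
    then show False using uf(2) unfolding trivial_limit_def[symmetric] by simp
  qed
qed (use uf(3) in blast)

lemma uf_disj: "eventually (\<lambda>i. P i \<or> Q i) uf \<longleftrightarrow> eventually P uf \<or> eventually Q uf"
proof -
  have "eventually (\<lambda>i. \<not> (\<not> P i \<and> \<not> Q i)) uf \<longleftrightarrow> eventually P uf \<or> eventually Q uf"
    unfolding uf_not eventually_conj_iff by blast
  then show ?thesis by simp
qed

lemma uf_large: "eventually (\<lambda>i. n \<le> i) uf"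
  using uf(1) eventually_ge_at_top[of n] by (rule filter_leD)

definition uprod :: "(nat \<Rightarrow> 'a str) \<Rightarrow> (nat \<Rightarrow> 'a) str" where
  "uprod I = \<lparr>zer = \<lambda>i. zer (I i), suc = \<lambda>f i. suc (I i) (f i), plu = \<lambda>f g i. plu (I i) (f i) (g i),
     tim = \<lambda>f g i. tim (I i) (f i) (g i), equ = \<lambda>f g. eventually (\<lambda>i. equ (I i) (f i) (g i)) uf\<rparr>"

lemma uprod_simps [simp]:
  "zer (uprod I) = (\<lambda>i. zer (I i))" "suc (uprod I) f = (\<lambda>i. suc (I i) (f i))"
  "plu (uprod I) f g = (\<lambda>i. plu (I i) (f i) (g i))" "tim (uprod I) f g = (\<lambda>i. tim (I i) (f i) (g i))"
  "equ (uprod I) f g \<longleftrightarrow> eventually (\<lambda>i. equ (I i) (f i) (g i)) uf"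
  by (simp_all add: uprod_def)

lemma tval_uprod: "tval (uprod I) e t = (\<lambda>i. tval (I i) (\<lambda>v. e v i) t)"
  by (induction t) auto

lemma upd_at: "(\<lambda>u. (e(v := x)) u i) = (\<lambda>u. e u i)(v := x i)"
  by auto

lemma los: "sat (uprod I) (\<lambda>x y. eventually (\<lambda>i. T i (x i) (y i)) uf) e A
    \<longleftrightarrow> eventually (\<lambda>i. sat (I i) (T i) (\<lambda>v. e v i) A) uf"
proof (induction A arbitrary: e)
  case (Eq s t)
  show ?case unfolding sat.simps tval_uprod uprod_simps ..
next
  case (Tr s t)
  show ?case unfolding sat.simps tval_uprod ..
next
  case (Neg A)
  show ?case unfolding sat.simps Neg uf_not ..
next
  case (Or A B)
  show ?case unfolding sat.simps Or uf_disj ..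
next
  case (Ex v A)
  have IH: "sat (uprod I) (\<lambda>x y. eventually (\<lambda>i. T i (x i) (y i)) uf) (e(v := x)) A
    \<longleftrightarrow> eventually (\<lambda>i. sat (I i) (T i) ((\<lambda>u. e u i)(v := x i)) A) uf" for x
    unfolding Ex upd_at ..
  show ?case unfolding sat.simps IH
  proof
    assume "\<exists>x. eventually (\<lambda>i. sat (I i) (T i) ((\<lambda>u. e u i)(v := x i)) A) uf"
    then obtain x where "eventually (\<lambda>i. sat (I i) (T i) ((\<lambda>u. e u i)(v := x i)) A) uf" by blast
    then show "eventually (\<lambda>i. \<exists>x. sat (I i) (T i) ((\<lambda>u. e u i)(v := x)) A) uf"
      by (rule eventually_mono) blast
  next
    assume a: "eventually (\<lambda>i. \<exists>x. sat (I i) (T i) ((\<lambda>u. e u i)(v := x)) A) uf"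
    define x where "x i = (SOME x. sat (I i) (T i) ((\<lambda>u. e u i)(v := x)) A)" for i
    have "eventually (\<lambda>i. sat (I i) (T i) ((\<lambda>u. e u i)(v := x i)) A) uf"
      using a by (rule eventually_mono) (unfold x_def, rule someI_ex)
    then show "\<exists>x. eventually (\<lambda>i. sat (I i) (T i) ((\<lambda>u. e u i)(v := x i)) A) uf" by blast
  qed
qed

lemma los_arith: "sata (uprod I) e A \<longleftrightarrow> eventually (\<lambda>i. sata (I i) (\<lambda>v. e v i) A) uf"
proof -
  have "eventually (\<lambda>i. False) uf = False" using uf(2) unfolding trivial_limit_def by blast
  then show ?thesis using los[of I "\<lambda>_ _ _. False" e A] by (simp only:)
qed

lemma congS_uprod: assumes "\<And>i. congS (I i)" shows "congS (uprod I)"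
  unfolding congS_def uprod_simps
proof (intro conjI allI impI)
  show "eventually (\<lambda>i. equ (I i) (x i) (x i)) uf" for x using equ_refl[OF assms] by simp
  show "eventually (\<lambda>i. equ (I i) (y i) (x i)) uf" if "eventually (\<lambda>i. equ (I i) (x i) (y i)) uf" for x y
    using that by (rule eventually_mono) (rule equ_sym[OF assms])
  show "eventually (\<lambda>i. equ (I i) (x i) (z i)) uf"
    if "eventually (\<lambda>i. equ (I i) (x i) (y i)) uf" "eventually (\<lambda>i. equ (I i) (y i) (z i)) uf" for x y z
    using that by eventually_elim (rule equ_trans[OF assms])
  show "eventually (\<lambda>i. equ (I i) (suc (I i) (x i)) (suc (I i) (y i))) uf" if "eventually (\<lambda>i. equ (I i) (x i) (y i)) uf" for x y
    using that by (rule eventually_mono) (rule equ_suc[OF assms])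
  show "eventually (\<lambda>i. equ (I i) (plu (I i) (x i) (x' i)) (plu (I i) (y i) (y' i))) uf"
    if "eventually (\<lambda>i. equ (I i) (x i) (y i)) uf" "eventually (\<lambda>i. equ (I i) (x' i) (y' i)) uf" for x y x' y'
    using that by eventually_elim (rule equ_plu[OF assms])
  show "eventually (\<lambda>i. equ (I i) (tim (I i) (x i) (x' i)) (tim (I i) (y i) (y' i))) uf"
    if "eventually (\<lambda>i. equ (I i) (x i) (y i)) uf" "eventually (\<lambda>i. equ (I i) (x' i) (y' i)) uf" for x y x' y'
    using that by eventually_elim (rule equ_tim[OF assms])
qed

text \<open>A diagonal argument over the countably many formulas: in the factor \<open>i\<close> one
  satisfies those members of \<open>S\<close> whose codes are below a number \<open>mm i\<close>,
  chosen as large as possible but at most \<open>i\<close>. Any finite part of \<open>S\<close> is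
  satisfiable in almost all factors, and almost all \<open>i\<close> exceed its codes, so every
  member of \<open>S\<close> is satisfied almost everywhere.\<close>

lemma saturation:
  assumes "\<And>F. finite F \<Longrightarrow> F \<subseteq> S \<Longrightarrow> \<exists>x. \<forall>A\<in>F. sata (uprod I) (e(v := x)) A"
  shows "\<exists>x. \<forall>A\<in>S. sata (uprod I) (e(v := x)) A"
proof -
  define P where "P m i \<longleftrightarrow> (\<exists>x. \<forall>A\<in>S. to_nat A < m \<longrightarrow> sata (I i) ((\<lambda>u. e u i)(v := x)) A)" for m i
  define mm where "mm i = Max {m. m \<le> i \<and> P m i}" for i
  define x where "x i = (SOME x. \<forall>A\<in>S. to_nat A < mm i \<longrightarrow> sata (I i) ((\<lambda>u. e u i)(v := x)) A)" for i
  have fin: "finite {m. m \<le> i \<and> P m i}" for i by (rule finite_subset[of _ "{..i}"]) auto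
  have "0 \<in> {m. m \<le> i \<and> P m i}" for i unfolding P_def by simp
  then have "mm i \<in> {m. m \<le> i \<and> P m i}" for i unfolding mm_def using Max_in[OF fin] by blast
  then have "P (mm i) i" for i by blast
  then have x: "\<forall>A\<in>S. to_nat A < mm i \<longrightarrow> sata (I i) ((\<lambda>u. e u i)(v := x i)) A" for i
    unfolding P_def x_def by (rule someI_ex)
  have "sata (uprod I) (e(v := x)) A" if A: "A \<in> S" for A
  proof -
    define m where "m = Suc (to_nat A)"
    define F where "F = {B \<in> S. to_nat B < m}"
    have "finite (to_nat -` {..<m} :: fm set)" by (rule finite_vimageI) auto
    moreover have "F \<subseteq> to_nat -` {..<m}" unfolding F_def by auto
    ultimately have "finite F" by (rule finite_subset[rotated])
    moreover have "F \<subseteq> S" unfolding F_def by blast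
    ultimately obtain y where y: "\<forall>B\<in>F. sata (uprod I) (e(v := y)) B" using assms by blast
    have "eventually (\<lambda>i. \<forall>B\<in>F. sata (I i) ((\<lambda>u. e u i)(v := y i)) B) uf"
      using y unfolding los_arith upd_at by (intro eventually_ball_finite \<open>finite F\<close>) blast
    then have "eventually (\<lambda>i. P m i) uf"
      by (rule eventually_mono) (unfold P_def F_def, blast)
    then have "eventually (\<lambda>i. sata (I i) ((\<lambda>u. e u i)(v := x i)) A) uf"
      using uf_large[of m]
    proof eventually_elim
      case (elim i)
      then have "m \<le> mm i" unfolding mm_def by (intro Max_ge[OF fin]) blast
      then have "to_nat A < mm i" unfolding m_def by simp
      then show ?case using x A by blast
    qed
    then show ?thesis unfolding los_arith upd_at .
  qed
  then show ?thesis by blast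
qed

section \<open>Types and their extension\<close>

primrec conj :: "fm list \<Rightarrow> fm" where
  "conj [] = \<^bold>\<not> Zero \<doteq> Zero \<^bold>\<or> Zero \<doteq> Zero"
| "conj (A # As) = A \<^bold>\<and> conj As"

lemma sat_conj: "sat I T e (conj As) \<longleftrightarrow> (\<forall>A\<in>set As. sat I T e A)"
  by (induction As) auto

lemma fv_conj: "fv (conj As) = \<Union> (fv ` set As)"
  by (induction As) auto

lemma arithmetical_conj: "arithmetical (conj As) \<longleftrightarrow> (\<forall>A\<in>set As. arithmetical A)"
  by (induction As) auto

definition same_type :: "nat \<Rightarrow> 'a str \<Rightarrow> (nat \<Rightarrow> 'a) \<Rightarrow> 'b str \<Rightarrow> (nat \<Rightarrow> 'b) \<Rightarrow> bool" where
  "same_type k I e J e' \<longleftrightarrow> (\<forall>A. arithmetical A \<longrightarrow> fv A \<subseteq> {..<k} \<longrightarrow> (sata I e A \<longleftrightarrow> sata J e' A))"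

lemma same_typeD: "same_type k I e J e' \<Longrightarrow> arithmetical A \<Longrightarrow> fv A \<subseteq> {..<k} \<Longrightarrow> sata I e A \<longleftrightarrow> sata J e' A"
  unfolding same_type_def by blast

lemma same_type_sym: "same_type k I e J e' \<Longrightarrow> same_type k J e' I e"
  unfolding same_type_def by blast

lemma same_type_cong:
  assumes "same_type k I e J e'" "\<And>v. v < k \<Longrightarrow> e v = d v" "\<And>v. v < k \<Longrightarrow> e' v = d' v"
  shows "same_type k I d J d'"
  unfolding same_type_def
proof (intro allI impI)
  fix A assume A: "arithmetical A" "fv A \<subseteq> {..<k}"
  have "sata I d A = sata I e A" "sata J d' A = sata J e' A" using A(2) assms(2,3) by (auto intro!: sat_cong)
  then show "sata I d A \<longleftrightarrow> sata J d' A" using same_typeD[OF assms(1) A] by blast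
qed

text \<open>The type of \<open>b\<close> over \<open>e'\<close> is carried over to \<open>e\<close>.
  It is finitely satisfiable there, since a conjunction of finitely many members, existentially
  quantified, is a formula in the old variables. Saturation then realizes it.\<close>

lemma extension:
  assumes st: "same_type k (uprod I) e J e'"
  shows "\<exists>a. same_type (Suc k) (uprod I) (e(k := a)) J (e'(k := b))"
proof -
  define S where "S = {A. arithmetical A \<and> fv A \<subseteq> {..<Suc k} \<and> sata J (e'(k := b)) A}"
  have "\<exists>x. \<forall>A\<in>S. sata (uprod I) (e(k := x)) A"
  proof (rule saturation)
    fix F assume F: "finite F" "F \<subseteq> S"
    obtain As where As: "set As = F" using finite_list[OF F(1)] by blast
    have "sata J (e'(k := b)) (conj As)" unfolding sat_conj As using F(2) unfolding S_def by blast
    then have "sata J e' (Ex k (conj As))" unfolding sat.simps by blast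
    moreover have "arithmetical (Ex k (conj As))"
      using F(2) unfolding arithmetical.simps arithmetical_conj As S_def by blast
    moreover have "fv (Ex k (conj As)) \<subseteq> {..<k}"
      using F(2) unfolding fv.simps fv_conj As S_def by (fastforce simp: less_Suc_eq)
    ultimately have "sata (uprod I) e (Ex k (conj As))" using same_typeD[OF st] by blast
    then show "\<exists>x. \<forall>A\<in>F. sata (uprod I) (e(k := x)) A" unfolding sat.simps sat_conj As .
  qed
  then obtain a where a: "\<And>A. A \<in> S \<Longrightarrow> sata (uprod I) (e(k := a)) A" by blast
  have "sata (uprod I) (e(k := a)) A \<longleftrightarrow> sata J (e'(k := b)) A" if A: "arithmetical A" "fv A \<subseteq> {..<Suc k}" for A
  proof (cases "sata J (e'(k := b)) A")
    case True
    then have "A \<in> S" using A unfolding S_def by blast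
    then show ?thesis using a True by blast
  next
    case False
    then have "\<^bold>\<not> A \<in> S" using A unfolding S_def by simp
    from a[OF this] show ?thesis using False unfolding sat.simps by blast
  qed
  then show ?thesis unfolding same_type_def by blast
qed


section \<open>A model of the theory\<close>

subsection \<open>The ultraproduct of the approximations\<close>

definition approx :: "nat \<Rightarrow> kk str \<Rightarrow> (kk \<Rightarrow> bool) \<Rightarrow> (kk \<Rightarrow> kk) \<Rightarrow> bool" where
  "approx n N X \<kappa> \<longleftrightarrow> congS N \<and> (\<forall>x y. equ N x y \<longrightarrow> X x \<longrightarrow> X y)
    \<and> (\<forall>A. arithmetical A \<longrightarrow> to_nat A < n \<longrightarrow> (\<forall>e. sata N (\<lambda>v. \<kappa> (e v)) A \<longleftrightarrow> sata K e A))
    \<and> CTS N X \<and> (\<forall>c x. leS N x (\<kappa> c) \<longrightarrow> DCS N X x)"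

lemma ex_approx: "\<exists>p. approx n (fst p) (fst (snd p)) (snd (snd p))"
proof -
  have "finite (to_nat -` {..<n} :: fm set)" by (rule finite_vimageI) auto
  then have fin: "finite {A. arithmetical A \<and> to_nat A < n}" by (rule finite_subset[rotated]) auto
  obtain N :: "kk str" and X \<kappa> where a: "congS N" "\<forall>x y. equ N x y \<longrightarrow> X x \<longrightarrow> X y"
      "\<forall>A\<in>{A. arithmetical A \<and> to_nat A < n}. \<forall>e. sata N (\<lambda>v. \<kappa> (e v)) A \<longleftrightarrow> sata K e A"
      "CTS N X" "\<forall>c x. leS N x (\<kappa> c) \<longrightarrow> DCS N X x"
    using approximation_exists[OF fin] by blast
  have "approx n N X \<kappa>" unfolding approx_def using a by blast
  then have "approx n (fst (N, X, \<kappa>)) (fst (snd (N, X, \<kappa>))) (snd (snd (N, X, \<kappa>)))" by simp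
  then show ?thesis by (rule exI)
qed

definition apx :: "nat \<Rightarrow> kk str \<times> (kk \<Rightarrow> bool) \<times> (kk \<Rightarrow> kk)" where
  "apx n = (SOME p. approx n (fst p) (fst (snd p)) (snd (snd p)))"

lemma apx: "approx n (fst (apx n)) (fst (snd (apx n))) (snd (snd (apx n)))"
  unfolding apx_def by (rule someI_ex[OF ex_approx])

definition Ns :: "(nat \<Rightarrow> kk) str" where "Ns = uprod (\<lambda>n. fst (apx n))"
definition Ks :: "(nat \<Rightarrow> kk) str" where "Ks = uprod (\<lambda>_. K)"
definition TT :: "(nat \<Rightarrow> kk) \<Rightarrow> bool" where "TT x \<longleftrightarrow> eventually (\<lambda>n. fst (snd (apx n)) (x n)) uf"
definition kap :: "(nat \<Rightarrow> kk) \<Rightarrow> nat \<Rightarrow> kk" where "kap x = (\<lambda>n. snd (snd (apx n)) (x n))"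

lemma congS_Ks: "congS Ks" and congS_Ns: "congS Ns"
  unfolding Ks_def Ns_def by (rule congS_uprod, rule congS_K) (rule congS_uprod, use apx in \<open>unfold approx_def, blast\<close>)

lemma TT_cong: assumes "equ Ns x y" shows "TT x = TT y"
proof -
  have "TT y" if "equ Ns x y" "TT x" for x y
    using that unfolding Ns_def TT_def uprod_simps
    by eventually_elim (use apx in \<open>unfold approx_def, blast\<close>)
  then show ?thesis using assms equ_sym[OF congS_Ns] by blast
qed

text \<open>Each single formula is preserved by all but finitely many of the approximations.\<close>

lemma sat_kap: assumes "arithmetical A" shows "sata Ns (\<lambda>v. kap (e v)) A \<longleftrightarrow> sata Ks e A"
proof -
  have "eventually (\<lambda>n. sata (fst (apx n)) (\<lambda>v. kap (e v) n) A = sata K (\<lambda>v. e v n) A) uf"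
    using uf_large[of "Suc (to_nat A)"]
  proof eventually_elim
    case (elim n)
    then have n: "to_nat A < n" by simp
    from apx[of n] have "\<forall>e. sata (fst (apx n)) (\<lambda>v. snd (snd (apx n)) (e v)) A \<longleftrightarrow> sata K e A"
      unfolding approx_def using assms n by blast
    then show ?case unfolding kap_def by (rule allE)
  qed
  then show ?thesis unfolding Ns_def Ks_def los_arith by (rule eventually_subst)
qed

lemma los_Ns: "sat Ns (\<lambda>_. TT) e A \<longleftrightarrow>
    eventually (\<lambda>n. sat (fst (apx n)) (\<lambda>_. fst (snd (apx n))) (\<lambda>v. e v n) A) uf"
proof -
  have "(\<lambda>(x :: nat \<Rightarrow> kk) y. eventually (\<lambda>i. fst (snd (apx i)) (y i)) uf) = (\<lambda>_. TT)"
    by (intro ext) (simp add: TT_def)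
  then show ?thesis
    using los[of "\<lambda>n. fst (apx n)" "\<lambda>n _. fst (snd (apx n))" e A] unfolding Ns_def[symmetric] by (simp only:)
qed

text \<open>The theorem of Los applies because the truth axioms form a single formula. Its free
  variable is the index, on which this interpretation of \<open>Tr\<close> does not depend.\<close>

lemma CTS_Ns: "CTS Ns TT"
proof -
  have "eventually (\<lambda>n. sat (fst (apx n)) (\<lambda>_. fst (snd (apx n))) (\<lambda>v. 0) (CT_minus (Var 0))) uf"
    unfolding sat_CT_minus using apx unfolding approx_def by simp
  then show ?thesis using los_Ns[of "\<lambda>_ _. 0" "CT_minus (Var 0)"] unfolding sat_CT_minus by blast
qed

lemma DCS_Ns: assumes "leS Ns x (kap c)" shows "DCS Ns TT x"
proof -
  define e where "e v = (if v = 0 then x else kap c)" for v :: nat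
  let ?A = "Var 0 \<preceq> Var 1 \<^bold>\<longrightarrow> disjunctively_correct (Var 2) (Var 0)"
  have "eventually (\<lambda>n. sat (fst (apx n)) (\<lambda>_. fst (snd (apx n))) (\<lambda>v. e v n) ?A) uf"
    unfolding sat.simps sat_disjunctively_correct sat_le tval.simps e_def kap_def
    using apx unfolding approx_def by simp
  then have "sat Ns (\<lambda>_. TT) e ?A" unfolding los_Ns .
  then show ?thesis using assms unfolding sat.simps sat_disjunctively_correct sat_le tval.simps e_def by simp
qed

subsection \<open>A countable elementary submodel\<close>

definition lenv :: "(nat \<Rightarrow> kk) list \<Rightarrow> nat \<Rightarrow> nat \<Rightarrow> kk" where
  "lenv xs v = (if v < length xs then xs ! v else (\<lambda>_. 0))"

text \<open>Some elements \<open>e'\<close> of \<open>Ns\<close> have the same type as \<open>xs\<close> and the truth values \<open>ts\<close>. The image of the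
  first entry of \<open>xs\<close> is prescribed: it is to bound the lengths of disjunctions.\<close>

definition matched :: "(nat \<Rightarrow> kk) list \<Rightarrow> bool list \<Rightarrow> bool" where
  "matched xs ts \<longleftrightarrow> xs \<noteq> [] \<and> length ts = length xs \<and>
     (\<exists>e'. same_type (length xs) Ks (lenv xs) Ns e' \<and> equ Ns (e' 0) (kap (xs ! 0)) \<and> (\<forall>i<length xs. TT (e' i) = ts ! i))"

lemma lenv_snoc: "v < Suc (length xs) \<Longrightarrow> ((lenv xs)(length xs := a)) v = lenv (xs @ [a]) v"
  by (auto simp: lenv_def nth_append less_Suc_eq)

lemma matched_single: "matched [x] [TT (kap x)]"
proof -
  have "same_type 1 Ks (lenv [x]) Ns (\<lambda>v. kap (lenv [x] v))" unfolding same_type_def using sat_kap by blast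
  moreover have "lenv [x] 0 = x" by (simp add: lenv_def)
  ultimately show ?thesis unfolding matched_def using equ_refl[OF congS_Ns]
    by (auto intro!: exI[of _ "\<lambda>v. kap (lenv [x] v)"])
qed

lemma matched_extend:
  assumes "xs \<noteq> []" "length ts = length xs" "equ Ns (e' 0) (kap (xs ! 0))" "\<forall>i<length xs. TT (e' i) = ts ! i"
    "same_type (Suc (length xs)) Ks ((lenv xs)(length xs := a)) Ns (e'(length xs := b))"
  shows "matched (xs @ [a]) (ts @ [TT b])"
  unfolding matched_def
proof (intro conjI exI)
  show "same_type (length (xs @ [a])) Ks (lenv (xs @ [a])) Ns (e'(length xs := b))"
    using same_type_cong[OF assms(5) lenv_snoc] by simp
  show "equ Ns ((e'(length xs := b)) 0) (kap ((xs @ [a]) ! 0))"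
    using assms(1,3) by (simp add: nth_append)
  show "\<forall>i<length (xs @ [a]). TT ((e'(length xs := b)) i) = (ts @ [TT b]) ! i"
    using assms(2,4) by (auto simp: nth_append less_Suc_eq)
qed (use assms in auto)

lemma matched_forth: assumes "matched xs ts" shows "\<exists>t. matched (xs @ [a]) (ts @ [t])"
proof -
  obtain e' where e': "xs \<noteq> []" "length ts = length xs" "same_type (length xs) Ks (lenv xs) Ns e'"
      "equ Ns (e' 0) (kap (xs ! 0))" "\<forall>i<length xs. TT (e' i) = ts ! i"
    using assms unfolding matched_def by blast
  obtain b where "same_type (Suc (length xs)) Ns (e'(length xs := b)) Ks ((lenv xs)(length xs := a))"
    using extension[OF same_type_sym[OF e'(3), unfolded Ns_def]] unfolding Ns_def by blast
  from matched_extend[OF e'(1,2,4,5) same_type_sym[OF this]] show ?thesis by blast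
qed

text \<open>The type of the extended sequence speaks about the new value at position
  \<open>k\<close>. This formula lets that value act as the value of \<open>w\<close>.\<close>

lemma sat_transport:
  assumes "congS I" "w \<noteq> k" "k \<notin> fv A"
  shows "sata I (e(k := a)) (Ex w (Var w \<doteq> Var k \<^bold>\<and> A)) \<longleftrightarrow> sata I (e(w := a)) A"
proof -
  have cT: "congT I (\<lambda>_ _. False)" unfolding congT_def by blast
  have 1: "sata I ((e(k := a))(w := x)) A \<longleftrightarrow> sata I (e(w := x)) A" for x
    by (rule sat_cong) (use assms(3) in auto)
  have 2: "sata I (e(w := x)) A \<longleftrightarrow> sata I (e(w := a)) A" if "equ I x a" for x
    by (rule sat_equ[OF assms(1) cT]) (use that equ_refl[OF assms(1)] in auto)
  have "sata I (e(k := a)) (Ex w (Var w \<doteq> Var k \<^bold>\<and> A)) \<longleftrightarrow> (\<exists>x. equ I x a \<and> sata I (e(w := x)) A)"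
    unfolding sat.simps 1 using assms(2) by simp
  then show ?thesis using 2 equ_refl[OF assms(1)] by blast
qed

text \<open>The counterpart of \<open>matched_forth\<close>: the new element is chosen in
  \<open>Ns\<close>, where truth is given, and is then matched in \<open>Ks\<close>.\<close>

lemma matched_back:
  assumes "xs \<noteq> []" "length ts = length xs" "equ Ns (e' 0) (kap (xs ! 0))" "\<forall>i<length xs. TT (e' i) = ts ! i"
    and st: "same_type (length xs) Ks (lenv xs) Ns e'"
    and A: "arithmetical A" "fv A \<subseteq> {..<length xs}" "w < length xs" and b: "sata Ns (e'(w := b)) A" "TT b"
  shows "\<exists>a. matched (xs @ [a]) (ts @ [True]) \<and> sata Ks ((lenv xs)(w := a)) A"
proof -
  obtain a where a: "same_type (Suc (length xs)) Ks ((lenv xs)(length xs := a)) Ns (e'(length xs := b))"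
    using extension[OF st[unfolded Ks_def]] unfolding Ks_def by blast
  let ?A = "Ex w (Var w \<doteq> Var (length xs) \<^bold>\<and> A)"
  have w: "w \<noteq> length xs" "length xs \<notin> fv A" using A by auto
  have "arithmetical ?A" "fv ?A \<subseteq> {..<Suc (length xs)}" using A by auto
  then have "sata Ks ((lenv xs)(length xs := a)) ?A \<longleftrightarrow> sata Ns (e'(length xs := b)) ?A" by (rule same_typeD[OF a])
  then have "sata Ks ((lenv xs)(w := a)) A"
    unfolding sat_transport[OF congS_Ks w] sat_transport[OF congS_Ns w] using b by blast
  moreover have "matched (xs @ [a]) (ts @ [True])" using matched_extend[OF assms(1-4) a] b(2) by simp
  ultimately show ?thesis by blast
qed

text \<open>\<open>Sk w A xs\<close> names a value of \<open>w\<close> that satisfies \<open>A\<close>, and \<open>Wt w A xs ts\<close> one that can be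
  declared true, provided that \<open>xs\<close> have the truth values \<open>ts\<close>.\<close>

datatype nm = Sk nat fm "nm list" | Wt nat fm "nm list" "bool list"

instance nm :: countable by countable_datatype

primrec den :: "nm \<Rightarrow> nat \<Rightarrow> kk" where
  "den (Sk w A xs) = (SOME a. sata Ks ((lenv (map den xs))(w := a)) A)"
| "den (Wt w A xs ts) = (SOME a. matched (map den xs @ [a]) (ts @ [True]) \<and> sata Ks ((lenv (map den xs))(w := a)) A)"

definition M :: "nm str" where
  "M = \<lparr>zer = Sk 0 (Var 0 \<doteq> Zero) [], suc = \<lambda>x. Sk 1 (Var 1 \<doteq> Succ (Var 0)) [x],
     plu = \<lambda>x y. Sk 2 (Var 2 \<doteq> Var 0 \<oplus> Var 1) [x, y], tim = \<lambda>x y. Sk 2 (Var 2 \<doteq> Var 0 \<otimes> Var 1) [x, y],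
     equ = \<lambda>x y. equ Ks (den x) (den y)\<rparr>"

lemma den_Sk: "sata Ks ((lenv (map den xs))(w := a)) A \<Longrightarrow> sata Ks ((lenv (map den xs))(w := den (Sk w A xs))) A"
  unfolding den.simps by (rule someI[of "\<lambda>a. sata Ks ((lenv (map den xs))(w := a)) A"])

lemma equ_M: "equ M x y \<longleftrightarrow> equ Ks (den x) (den y)"
  by (simp add: M_def)

lemma den_ops:
  "equ Ks (den (zer M)) (zer Ks)" "equ Ks (den (suc M x)) (suc Ks (den x))"
  "equ Ks (den (plu M x y)) (plu Ks (den x) (den y))" "equ Ks (den (tim M x y)) (tim Ks (den x) (den y))"
proof -
  note r = equ_refl[OF congS_Ks]
  show "equ Ks (den (zer M)) (zer Ks)"
    using den_Sk[of "[]" 0 "zer Ks" "Var 0 \<doteq> Zero"] r by (simp add: M_def del: den.simps)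
  show "equ Ks (den (suc M x)) (suc Ks (den x))"
    using den_Sk[of "[x]" 1 "suc Ks (den x)" "Var 1 \<doteq> Succ (Var 0)"] r by (simp add: M_def lenv_def del: den.simps)
  show "equ Ks (den (plu M x y)) (plu Ks (den x) (den y))"
    using den_Sk[of "[x, y]" 2 "plu Ks (den x) (den y)" "Var 2 \<doteq> Var 0 \<oplus> Var 1"] r
    by (simp add: M_def lenv_def del: den.simps)
  show "equ Ks (den (tim M x y)) (tim Ks (den x) (den y))"
    using den_Sk[of "[x, y]" 2 "tim Ks (den x) (den y)" "Var 2 \<doteq> Var 0 \<otimes> Var 1"] r
    by (simp add: M_def lenv_def del: den.simps)
qed

lemma congS_M: "congS M"
proof -
  note t = equ_trans[OF congS_Ks] and s = equ_sym[OF congS_Ks]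
  show ?thesis
    unfolding congS_def equ_M
  proof (intro conjI allI impI)
    show "equ Ks (den x) (den x)" for x by (rule equ_refl[OF congS_Ks])
    show "equ Ks (den y) (den x)" if "equ Ks (den x) (den y)" for x y using that by (rule s)
    show "equ Ks (den x) (den z)" if "equ Ks (den x) (den y)" "equ Ks (den y) (den z)" for x y z using that by (rule t)
    show "equ Ks (den (suc M x)) (den (suc M y))" if "equ Ks (den x) (den y)" for x y
      by (rule t[OF den_ops(2) t[OF equ_suc[OF congS_Ks that] s[OF den_ops(2)]]])
    show "equ Ks (den (plu M x x')) (den (plu M y y'))" if "equ Ks (den x) (den y)" "equ Ks (den x') (den y')" for x y x' y'
      by (rule t[OF den_ops(3) t[OF equ_plu[OF congS_Ks that] s[OF den_ops(3)]]])
    show "equ Ks (den (tim M x x')) (den (tim M y y'))" if "equ Ks (den x) (den y)" "equ Ks (den x') (den y')" for x y x' y'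
      by (rule t[OF den_ops(4) t[OF equ_tim[OF congS_Ks that] s[OF den_ops(4)]]])
  qed
qed

lemma den_tval: "equ Ks (den (tval M e t)) (tval Ks (\<lambda>v. den (e v)) t)"
proof (induction t)
  case (Var v)
  show ?case by (simp only: tval.simps equ_refl[OF congS_Ks])
next
  case (Succ t)
  show ?case unfolding tval.simps by (rule equ_trans[OF congS_Ks den_ops(2) equ_suc[OF congS_Ks Succ]])
next
  case (Add s t)
  show ?case unfolding tval.simps by (rule equ_trans[OF congS_Ks den_ops(3) equ_plu[OF congS_Ks Add]])
next
  case (Mul s t)
  show ?case unfolding tval.simps by (rule equ_trans[OF congS_Ks den_ops(4) equ_tim[OF congS_Ks Mul]])
qed (simp only: tval.simps den_ops)

text \<open>The Tarski-Vaught test: the names \<open>Sk\<close> supply witnesses for existential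
  formulas. As finitely many variables occur in a formula, the relevant part of the assignment is a
  list and can be built into such a name.\<close>

lemma sat_M: "arithmetical A \<Longrightarrow> sata M e A \<longleftrightarrow> sata Ks (\<lambda>v. den (e v)) A"
proof (induction A arbitrary: e)
  case (Eq s t)
  show ?case unfolding sat.simps equ_M
    using den_tval[of e s] den_tval[of e t] equ_trans[OF congS_Ks] equ_sym[OF congS_Ks] by meson
next
  case (Ex v A)
  have IH: "sata M (e(v := x)) A \<longleftrightarrow> sata Ks ((\<lambda>u. den (e u))(v := den x)) A" for x
  proof -
    have "(\<lambda>u. den ((e(v := x)) u)) = (\<lambda>u. den (e u))(v := den x)" by auto
    then show ?thesis using Ex.IH[of "e(v := x)"] Ex.prems by (simp only: arithmetical.simps)
  qed
  have "\<exists>x. sata Ks ((\<lambda>u. den (e u))(v := den x)) A" if a: "sata Ks ((\<lambda>u. den (e u))(v := a)) A" for a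
  proof -
    obtain n where n: "\<And>u. u \<in> fv A \<Longrightarrow> u < n" using finite_nat_set_iff_bounded[of "fv A"] by auto
    define xs where "xs = map e [0..<n]"
    have "sata Ks ((lenv (map den xs))(v := b)) A = sata Ks ((\<lambda>u. den (e u))(v := b)) A" for b
      by (rule sat_cong) (use n in \<open>auto simp: lenv_def xs_def\<close>)
    then show ?thesis using den_Sk[of xs v a A] a by blast
  qed
  then show ?case unfolding sat.simps IH by blast
next
  case (Neg A)
  then show ?case by (simp only: sat.simps arithmetical.simps)
next
  case (Or A B)
  then show ?case by (simp only: sat.simps arithmetical.simps)
qed simp


subsection \<open>Truth classes by a Henkin construction\<close>

abbreviation "dens S \<equiv> map (\<lambda>p. den (fst p)) S"

definition good :: "(nm \<times> bool) list \<Rightarrow> bool" where "good S \<longleftrightarrow> matched (dens S) (map snd S)"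

definition pad :: "(nm \<times> bool) list \<Rightarrow> nm \<Rightarrow> nm \<times> bool" where
  "pad S x = (x, SOME t. good (S @ [(x, t)]))"

text \<open>Each task recurs infinitely often: either to list an element \<open>x\<close>, or to find a true sentence that
  satisfies \<open>A\<close> as the value of \<open>w\<close>.\<close>

definition nxt :: "nm \<Rightarrow> (nm \<times> bool) list \<Rightarrow> nm \<times> bool" where
  "nxt c S = (case from_nat (fst (prod_decode (length S))) :: nm + nat \<times> fm of
     Inl x \<Rightarrow> pad S x
   | Inr (w, A) \<Rightarrow> let q = Wt w A (map fst S) (map snd S) in
       if good (S @ [(q, True)]) \<and> sata Ks ((lenv (dens S))(w := den q)) A then (q, True) else pad S c)"

primrec hist :: "nm \<Rightarrow> nat \<Rightarrow> (nm \<times> bool) list" where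
  "hist c 0 = [(c, TT (kap (den c)))]"
| "hist c (Suc n) = hist c n @ [nxt c (hist c n)]"

definition elt :: "nm \<Rightarrow> nat \<Rightarrow> nm" where "elt c n = fst (last (hist c n))"
definition val :: "nm \<Rightarrow> nat \<Rightarrow> bool" where "val c n = snd (last (hist c n))"

definition Tc :: "nm \<Rightarrow> nm \<Rightarrow> bool" where "Tc c y \<longleftrightarrow> (\<exists>n. elt c n = y \<and> val c n)"

lemma good_pad: "good S \<Longrightarrow> good (S @ [pad S x])"
proof -
  assume "good S"
  then have "\<exists>t. good (S @ [(x, t)])" unfolding good_def using matched_forth[of "dens S" "map snd S" "den x"] by simp
  then show ?thesis unfolding pad_def by (rule someI_ex)
qed

lemma good_nxt: "good S \<Longrightarrow> good (S @ [nxt c S])"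
  unfolding nxt_def Let_def by (auto split: sum.split intro: good_pad)

lemma good_hist: "good (hist c n)"
  by (induction n) (auto simp: good_nxt, simp add: good_def matched_single)

lemma hist_eq: "hist c n = map (\<lambda>i. (elt c i, val c i)) [0..<Suc n]"
proof (induction n)
  case (Suc n)
  have "hist c (Suc n) = hist c n @ [last (hist c (Suc n))]" by simp
  also have "last (hist c (Suc n)) = (elt c (Suc n), val c (Suc n))" by (simp only: elt_def val_def prod.collapse)
  finally show ?case using Suc by simp
qed (simp add: elt_def val_def)

lemma length_hist: "length (hist c n) = Suc n"
  by (induction n) auto

lemma elt_0: "elt c 0 = c"
  by (simp add: elt_def)

lemma types:
  obtains e' where "same_type (Suc n) Ks (lenv (dens (hist c n))) Ns e'" "equ Ns (e' 0) (kap (den c))"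
    "\<And>i. i \<le> n \<Longrightarrow> TT (e' i) = val c i"
proof -
  obtain e' where e': "same_type (Suc n) Ks (lenv (dens (hist c n))) Ns e'" "equ Ns (e' 0) (kap (dens (hist c n) ! 0))"
     "\<forall>i<Suc n. TT (e' i) = map snd (hist c n) ! i"
    using good_hist[of c n] unfolding good_def matched_def length_map length_hist by blast
  have "dens (hist c n) ! 0 = den c" unfolding hist_eq by (simp add: elt_0 del: upt_Suc)
  moreover have "map snd (hist c n) ! i = val c i" if "i \<le> n" for i
    unfolding hist_eq using that by (simp del: upt_Suc)
  ultimately show ?thesis using e' that by simp
qed

lemma lenv_hist: "i \<le> n \<Longrightarrow> lenv (dens (hist c n)) i = den (elt c i)"
  unfolding hist_eq by (simp add: lenv_def del: upt_Suc)

lemma types_M: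
  assumes "same_type (Suc n) Ks (lenv (dens (hist c n))) Ns e'" "arithmetical A" "fv A \<subseteq> {..n}"
  shows "sata M (elt c) A \<longleftrightarrow> sata Ns e' A"
proof -
  have "sata M (elt c) A \<longleftrightarrow> sata Ks (\<lambda>v. den (elt c v)) A" by (rule sat_M[OF assms(2)])
  also have "\<dots> \<longleftrightarrow> sata Ks (lenv (dens (hist c n))) A"
    by (rule sat_cong) (use assms(3) lenv_hist in auto)
  also have "\<dots> \<longleftrightarrow> sata Ns e' A"
    by (rule same_typeD[OF assms(1,2)]) (use assms(3) in auto)
  finally show ?thesis .
qed

text \<open>Both elements belong to a common history, whose counterpart \<open>e'\<close> in
  \<open>Ns\<close> satisfies the same equations, and \<open>TT\<close> respects equality in
  \<open>Ns\<close>.\<close>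

lemma val_cong: assumes "equ M (elt c i) (elt c j)" shows "val c i = val c j"
proof -
  obtain e' where e': "same_type (Suc (max i j)) Ks (lenv (dens (hist c (max i j)))) Ns e'"
      "\<And>l. l \<le> max i j \<Longrightarrow> TT (e' l) = val c l" using types[of "max i j" c] by metis
  have "sata M (elt c) (Var i \<doteq> Var j) \<longleftrightarrow> sata Ns e' (Var i \<doteq> Var j)"
    by (rule types_M[OF e'(1)]) auto
  then have "equ Ns (e' i) (e' j)" using assms by simp
  then have "TT (e' i) = TT (e' j)" by (rule TT_cong)
  then show ?thesis using e'(2) by simp
qed

text \<open>A name may be listed many times, and \<open>Tc\<close> asks for a single positive
  decision. By \<open>val_cong\<close> all decisions about it agree.\<close>

lemma Tc_elt: "Tc c (elt c i) = val c i"
  unfolding Tc_def using val_cong equ_refl[OF congS_M] by metis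

lemma stage: "\<exists>m\<ge>n. nxt c (hist c m) = (case t :: nm + nat \<times> fm of
     Inl x \<Rightarrow> pad (hist c m) x
   | Inr (w, A) \<Rightarrow> let q = Wt w A (map fst (hist c m)) (map snd (hist c m)) in
       if good (hist c m @ [(q, True)]) \<and> sata Ks ((lenv (dens (hist c m)))(w := den q)) A then (q, True) else pad (hist c m) c)"
proof -
  \<comment> \<open>The second component carries no task; it pushes the stage beyond
    \<open>n\<close>. It is a successor because the history at stage \<open>m\<close> has length
    \<open>Suc m\<close>.\<close>
  have "Suc n \<le> prod_encode (to_nat t, Suc n)" by (rule le_prod_encode_2)
  then obtain m where m: "prod_encode (to_nat t, Suc n) = Suc m" "n \<le> m" by (cases "prod_encode (to_nat t, Suc n)") auto
  have "(from_nat (fst (prod_decode (length (hist c m)))) :: nm + nat \<times> fm) = t"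
    unfolding length_hist m(1)[symmetric] by simp
  then show ?thesis using m(2) unfolding nxt_def by blast
qed

lemma elt_surj: "\<exists>n. elt c n = y"
proof -
  obtain m where "nxt c (hist c m) = pad (hist c m) y" using stage[of 0 c "Inl y"] by auto
  then have "elt c (Suc m) = y" by (simp add: elt_def pad_def)
  then show ?thesis by blast
qed

lemma Tc_cong: assumes "equ M x y" shows "Tc c x = Tc c y"
proof -
  obtain i j where "elt c i = x" "elt c j = y" using elt_surj by blast
  then show ?thesis using val_cong[of c i j] Tc_elt assms by metis
qed

lemma transfer:
  obtains e' where "\<And>A. arithmetical A \<Longrightarrow> fv A \<subseteq> {..n} \<Longrightarrow> sata M (elt c) A \<longleftrightarrow> sata Ns e' A"
    "equ Ns (e' 0) (kap (den c))" "\<And>i. i \<le> n \<Longrightarrow> TT (e' i) = Tc c (elt c i)"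
  using types[of n c] types_M[of n c] unfolding Tc_elt by metis

text \<open>The counterpart of the history in \<open>Ns\<close> may change from stage to stage, so
  hypothesis \<open>b\<close> speaks of every possible counterpart. It is applied to one that exists
  when the task for \<open>w\<close> and \<open>A\<close> comes up. \<open>matched_back\<close> then
  brings the true element to \<open>Ks\<close>, where a name \<open>Wt\<close> denotes it, and this
  name is declared true.\<close>

lemma witness:
  assumes A: "arithmetical A" "fv A \<subseteq> {..n}" "w \<le> n"
    and b: "\<And>e'. (\<And>A. arithmetical A \<Longrightarrow> fv A \<subseteq> {..n} \<Longrightarrow> sata M (elt c) A \<longleftrightarrow> sata Ns e' A) \<Longrightarrow>
       equ Ns (e' 0) (kap (den c)) \<Longrightarrow> (\<And>i. i \<le> n \<Longrightarrow> TT (e' i) = Tc c (elt c i)) \<Longrightarrow>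
       \<exists>b. sata Ns (e'(w := b)) A \<and> TT b"
  shows "\<exists>q. sata M ((elt c)(w := q)) A \<and> Tc c q"
proof -
  obtain m where m: "n \<le> m" "nxt c (hist c m) = (let q = Wt w A (map fst (hist c m)) (map snd (hist c m)) in
       if good (hist c m @ [(q, True)]) \<and> sata Ks ((lenv (dens (hist c m)))(w := den q)) A then (q, True) else pad (hist c m) c)"
    using stage[of n c "Inr (w, A)"] by auto
  let ?S = "hist c m"
  define q where "q = Wt w A (map fst ?S) (map snd ?S)"
  obtain e' where e': "dens ?S \<noteq> []" "length (map snd ?S) = length (dens ?S)"
      "same_type (length (dens ?S)) Ks (lenv (dens ?S)) Ns e'"
      "equ Ns (e' 0) (kap (dens ?S ! 0))" "\<forall>i<length (dens ?S). TT (e' i) = map snd ?S ! i"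
    using good_hist[of c m] unfolding good_def matched_def by blast
  have len: "length (dens ?S) = Suc m" by (simp add: length_hist)
  have "\<exists>b. sata Ns (e'(w := b)) A \<and> TT b"
  proof (rule b)
    fix B assume "arithmetical B" "fv B \<subseteq> {..n}"
    then show "sata M (elt c) B \<longleftrightarrow> sata Ns e' B"
      using types_M[OF e'(3)[unfolded len], of B] m(1) by (meson atMost_subset_iff order_trans)
  next
    have "dens ?S ! 0 = den c" unfolding hist_eq by (simp add: elt_0 del: upt_Suc)
    then show "equ Ns (e' 0) (kap (den c))" using e'(4) by simp
  next
    fix i assume "i \<le> n"
    then have "i \<le> m" using m(1) by simp
    moreover from this have "map snd ?S ! i = val c i" unfolding hist_eq by (simp del: upt_Suc)
    ultimately show "TT (e' i) = Tc c (elt c i)" using e'(5) unfolding len Tc_elt by auto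
  qed
  then obtain b where b: "sata Ns (e'(w := b)) A" "TT b" by blast
  have "fv A \<subseteq> {..<length (dens ?S)}" "w < length (dens ?S)" unfolding len using A m(1) by auto
  from matched_back[OF e'(1,2,4,5,3) A(1) this b]
  have ex: "\<exists>a. matched (dens ?S @ [a]) (map snd ?S @ [True]) \<and> sata Ks ((lenv (dens ?S))(w := a)) A" .
  have "den q = (SOME a. matched (dens ?S @ [a]) (map snd ?S @ [True]) \<and> sata Ks ((lenv (dens ?S))(w := a)) A)"
    unfolding q_def den.simps map_map comp_def ..
  then have q: "matched (dens ?S @ [den q]) (map snd ?S @ [True])" "sata Ks ((lenv (dens ?S))(w := den q)) A"
    using someI_ex[OF ex] by simp_all
  have "good (?S @ [(q, True)])" unfolding good_def using q(1) by simp
  then have "nxt c ?S = (q, True)" using m(2) q(2) unfolding q_def[symmetric] Let_def by simp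
  then have "elt c (Suc m) = q" "val c (Suc m)" by (simp_all add: elt_def val_def)
  then have T: "Tc c q" unfolding Tc_def by blast
  have d: "(\<lambda>u. den (((elt c)(w := q)) u)) = (\<lambda>u. den (elt c u))(w := den q)" by auto
  have "sata M ((elt c)(w := q)) A \<longleftrightarrow> sata Ks ((\<lambda>u. den (elt c u))(w := den q)) A"
    unfolding sat_M[OF A(1)] d ..
  also have "\<dots> \<longleftrightarrow> sata Ks ((lenv (dens ?S))(w := den q)) A"
    by (rule sat_cong) (use A(2) m(1) lenv_hist[of _ m c] in auto)
  finally show ?thesis using q(2) T by blast
qed


text \<open>The existential axiom and disjunctive correctness both ask for a true sentence with an
  arithmetical property. The property is isolated by this formula and by \<open>entry_fm\<close>, as
  \<open>witness\<close> requires.\<close>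

definition instance_fm :: "tm \<Rightarrow> tm \<Rightarrow> tm \<Rightarrow> fm" where
  "instance_fm v p q = (\<^bold>\<exists>y. \<^bold>\<exists>c. is_numeral y c \<^bold>\<and> is_subst v c p q)"

definition entry_fm :: "tm \<Rightarrow> tm \<Rightarrow> tm \<Rightarrow> tm \<Rightarrow> fm" where
  "entry_fm a b m p = (\<^bold>\<exists>i. i \<prec> m \<^bold>\<and> beta a b i p)"

definition sentences_fm :: "tm \<Rightarrow> tm \<Rightarrow> tm \<Rightarrow> fm" where
  "sentences_fm a b m = (\<^bold>\<forall>i. i \<prec> m \<^bold>\<longrightarrow> (\<^bold>\<exists>p. beta a b i p \<^bold>\<and> is_sentence p))"

lemma instance_fm [simp]:
  "fv (instance_fm v p q) = tvars v \<union> tvars p \<union> tvars q"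
  "sat I T e (instance_fm v p q) \<longleftrightarrow>
     (\<exists>y c. is_numeralS I y c \<and> is_substS I (tval I e v) c (tval I e p) (tval I e q))"
  "arithmetical (instance_fm v p q)"
  unfolding instance_fm_def
proof -
  show "fv (\<^bold>\<exists>y. \<^bold>\<exists>c. is_numeral y c \<^bold>\<and> is_subst v c p q) = tvars v \<union> tvars p \<union> tvars q"
    by (rule fv_q2) auto
  show "sat I T e (\<^bold>\<exists>y. \<^bold>\<exists>c. is_numeral y c \<^bold>\<and> is_subst v c p q) \<longleftrightarrow>
     (\<exists>y c. is_numeralS I y c \<and> is_substS I (tval I e v) c (tval I e p) (tval I e q))"
    by (rule sat_q2[where S = "tvars v \<union> tvars p \<union> tvars q" and
      Q = "\<lambda>e y c. is_numeralS I y c \<and> is_substS I (tval I e v) c (tval I e p) (tval I e q)"]) auto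
qed (simp add: arith_relations)

lemma entry_fm [simp]:
  "fv (entry_fm a b m p) = tvars a \<union> tvars b \<union> tvars m \<union> tvars p"
  "sat I T e (entry_fm a b m p) \<longleftrightarrow>
     (\<exists>i. ltS I i (tval I e m) \<and> betaS I (tval I e a) (tval I e b) i (tval I e p))"
  "arithmetical (entry_fm a b m p)"
  unfolding entry_fm_def
proof -
  show "fv (\<^bold>\<exists>i. i \<prec> m \<^bold>\<and> beta a b i p) = tvars a \<union> tvars b \<union> tvars m \<union> tvars p"
    by (rule fv_q(1)) auto
  show "sat I T e (\<^bold>\<exists>i. i \<prec> m \<^bold>\<and> beta a b i p) \<longleftrightarrow>
     (\<exists>i. ltS I i (tval I e m) \<and> betaS I (tval I e a) (tval I e b) i (tval I e p))"
    by (rule sat_q1[where S = "tvars a \<union> tvars b \<union> tvars m \<union> tvars p" and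
      Q = "\<lambda>e i. ltS I i (tval I e m) \<and> betaS I (tval I e a) (tval I e b) i (tval I e p)"]) auto
qed (simp add: arith_le arith_beta)

lemma sentences_fm [simp]:
  "fv (sentences_fm a b m) = tvars a \<union> tvars b \<union> tvars m"
  "sat I T e (sentences_fm a b m) \<longleftrightarrow>
    (\<forall>i. ltS I i (tval I e m) \<longrightarrow> (\<exists>p. betaS I (tval I e a) (tval I e b) i p \<and> is_sentenceS I p))"
  "arithmetical (sentences_fm a b m)"
  unfolding sentences_fm_def DC_premise by (simp_all add: arith_le arith_beta arith_sentence)

lemma arith_same_value: "arithmetical (same_value s t)"
  unfolding same_value_def by (simp add: arith_relations)

lemmas arith = arith_sentence arith_terms arith_relations arith_le arith_beta arith_same_value instance_fm(3)
  entry_fm(3) sentences_fm(3)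

lemma disj_zero: "disj_genS I a b (prS I (zer I) (prS I m d)) \<longleftrightarrow> is_disjunctionS I a b m d"
  by (simp add: is_disjunctionS_def)

lemma Tc_sentence: assumes "Tc c y" shows "is_sentenceS M y"
proof -
  obtain i where i: "elt c i = y" using elt_surj by blast
  obtain e' where e': "\<And>A. arithmetical A \<Longrightarrow> fv A \<subseteq> {..i} \<Longrightarrow> sata M (elt c) A \<longleftrightarrow> sata Ns e' A"
    "\<And>j. j \<le> i \<Longrightarrow> TT (e' j) = Tc c (elt c j)" by (rule transfer[of i c]) blast
  have "TT (e' i)" using e'(2) assms i by simp
  then have "is_sentenceS Ns (e' i)" using CTS_Ns unfolding CTS_def by blast
  then show ?thesis using e'(1)[of "is_sentence (Var i)"] i by (simp add: arith)
qed

text \<open>All elements concerned are listed by some stage. There \<open>transfer\<close> replaces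
  them by elements of \<open>Ns\<close> with the same type and the same truth values, for which the
  axiom is known. The compound sentence has an index \<open>k\<close> of its own, because truth
  values are compared for listed elements only.\<close>

lemma Tc_eq:
  assumes "is_closed_termS M s" "is_closed_termS M t"
  shows "Tc c (tagS M 5 (prS M s t)) \<longleftrightarrow> (\<exists>y. is_valueS M s y \<and> is_valueS M t y)"
proof -
  obtain i j k where ij: "elt c i = s" "elt c j = t" "elt c k = tagS M 5 (prS M s t)" using elt_surj by metis
  obtain e' where e': "\<And>A. arithmetical A \<Longrightarrow> fv A \<subseteq> {..i + j + k} \<Longrightarrow> sata M (elt c) A \<longleftrightarrow> sata Ns e' A"
    "\<And>l. l \<le> i + j + k \<Longrightarrow> TT (e' l) = Tc c (elt c l)" by (rule transfer[of "i + j + k" c]) blast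
  have "equ Ns (e' k) (tagS Ns 5 (prS Ns (e' i) (e' j)))"
    using e'(1)[of "Var k \<doteq> eqC (Var i) (Var j)"] equ_refl[OF congS_M] by (simp add: ij)
  then have "Tc c (tagS M 5 (prS M s t)) \<longleftrightarrow> TT (tagS Ns 5 (prS Ns (e' i) (e' j)))"
    using TT_cong e'(2)[of k] ij by simp
  moreover have "is_closed_termS Ns (e' i)" "is_closed_termS Ns (e' j)"
    using assms e'(1)[of "is_closed_term (Var i)"] e'(1)[of "is_closed_term (Var j)"] by (simp_all add: ij arith)
  ultimately have "Tc c (tagS M 5 (prS M s t)) \<longleftrightarrow> (\<exists>y. is_valueS Ns (e' i) y \<and> is_valueS Ns (e' j) y)"
    using CTS_Ns unfolding CTS_def by blast
  then show ?thesis using e'(1)[of "same_value (Var i) (Var j)"] by (simp add: ij arith)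
qed

lemma Tc_neg: assumes "is_sentenceS M p" shows "Tc c (tagS M 6 p) \<longleftrightarrow> \<not> Tc c p"
proof -
  obtain i k where ij: "elt c i = p" "elt c k = tagS M 6 p" using elt_surj by metis
  obtain e' where e': "\<And>A. arithmetical A \<Longrightarrow> fv A \<subseteq> {..i + k} \<Longrightarrow> sata M (elt c) A \<longleftrightarrow> sata Ns e' A"
    "\<And>l. l \<le> i + k \<Longrightarrow> TT (e' l) = Tc c (elt c l)" by (rule transfer[of "i + k" c]) blast
  have "equ Ns (e' k) (tagS Ns 6 (e' i))"
    using e'(1)[of "Var k \<doteq> negC (Var i)"] equ_refl[OF congS_M] by (simp add: ij)
  then have "Tc c (tagS M 6 p) \<longleftrightarrow> TT (tagS Ns 6 (e' i))" using TT_cong e'(2)[of k] ij by simp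
  moreover have "is_sentenceS Ns (e' i)" using assms e'(1)[of "is_sentence (Var i)"] by (simp add: ij arith)
  ultimately have "Tc c (tagS M 6 p) \<longleftrightarrow> \<not> TT (e' i)" using CTS_Ns unfolding CTS_def by blast
  then show ?thesis using e'(2)[of i] ij by simp
qed

lemma Tc_or:
  assumes "is_sentenceS M p" "is_sentenceS M q" shows "Tc c (tagS M 7 (prS M p q)) \<longleftrightarrow> Tc c p \<or> Tc c q"
proof -
  obtain i j k where ij: "elt c i = p" "elt c j = q" "elt c k = tagS M 7 (prS M p q)" using elt_surj by metis
  obtain e' where e': "\<And>A. arithmetical A \<Longrightarrow> fv A \<subseteq> {..i + j + k} \<Longrightarrow> sata M (elt c) A \<longleftrightarrow> sata Ns e' A"
    "\<And>l. l \<le> i + j + k \<Longrightarrow> TT (e' l) = Tc c (elt c l)" by (rule transfer[of "i + j + k" c]) blast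
  have "equ Ns (e' k) (tagS Ns 7 (prS Ns (e' i) (e' j)))"
    using e'(1)[of "Var k \<doteq> orC (Var i) (Var j)"] equ_refl[OF congS_M] by (simp add: ij)
  then have "Tc c (tagS M 7 (prS M p q)) \<longleftrightarrow> TT (tagS Ns 7 (prS Ns (e' i) (e' j)))"
    using TT_cong e'(2)[of k] ij by simp
  moreover have "is_sentenceS Ns (e' i)" "is_sentenceS Ns (e' j)"
    using assms e'(1)[of "is_sentence (Var i)"] e'(1)[of "is_sentence (Var j)"] by (simp_all add: ij arith)
  ultimately have "Tc c (tagS M 7 (prS M p q)) \<longleftrightarrow> TT (e' i) \<or> TT (e' j)" using CTS_Ns unfolding CTS_def by blast
  then show ?thesis using e'(2)[of i] e'(2)[of j] ij by simp
qed

lemma CTS_Ns_ex: "is_formula_inS Ns v p \<Longrightarrow> TT (tagS Ns 8 (prS Ns v p)) \<longleftrightarrow>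
    (\<exists>y c q. is_numeralS Ns y c \<and> is_substS Ns v c p q \<and> TT q)"
  using CTS_Ns unfolding CTS_def by blast

lemma Tc_ex:
  assumes "is_formula_inS M v p"
  shows "Tc c (tagS M 8 (prS M v p)) \<longleftrightarrow> (\<exists>y d q. is_numeralS M y d \<and> is_substS M v d p q \<and> Tc c q)"
proof
  obtain i j k where ij: "elt c i = v" "elt c j = p" "elt c k = tagS M 8 (prS M v p)" using elt_surj by metis
  {
    fix n e' assume n: "i + j + k \<le> n"
      and e': "\<And>A. arithmetical A \<Longrightarrow> fv A \<subseteq> {..n} \<Longrightarrow> sata M (elt c) A \<longleftrightarrow> sata Ns e' A"
        "\<And>l. l \<le> n \<Longrightarrow> TT (e' l) = Tc c (elt c l)"
    have "equ Ns (e' k) (tagS Ns 8 (prS Ns (e' i) (e' j)))"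
      using e'(1)[of "Var k \<doteq> exC (Var i) (Var j)"] equ_refl[OF congS_M] n by (simp add: ij)
    then have "Tc c (tagS M 8 (prS M v p)) \<longleftrightarrow> TT (tagS Ns 8 (prS Ns (e' i) (e' j)))"
      using TT_cong e'(2)[of k] ij n by simp
    moreover have "is_formula_inS Ns (e' i) (e' j)"
      using assms e'(1)[of "is_formula_in (Var i) (Var j)"] n by (simp add: ij arith)
    ultimately have "Tc c (tagS M 8 (prS M v p)) \<longleftrightarrow>
        (\<exists>y d q. is_numeralS Ns y d \<and> is_substS Ns (e' i) d (e' j) q \<and> TT q)"
      using CTS_Ns_ex by simp
  } note * = this
  {
    assume T: "Tc c (tagS M 8 (prS M v p))"
    define w where "w = Suc (i + j + k)"
    let ?A = "instance_fm (Var i) (Var j) (Var w)"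
    have w: "w \<noteq> i" "w \<noteq> j" "i + j + k \<le> w" unfolding w_def by simp_all
    have "\<exists>q. sata M ((elt c)(w := q)) ?A \<and> Tc c q"
    proof (rule witness)
      fix e' assume e': "\<And>A. arithmetical A \<Longrightarrow> fv A \<subseteq> {..w} \<Longrightarrow> sata M (elt c) A \<longleftrightarrow> sata Ns e' A"
        "\<And>l. l \<le> w \<Longrightarrow> TT (e' l) = Tc c (elt c l)"
      show "\<exists>b. sata Ns (e'(w := b)) ?A \<and> TT b"
        using *[OF w(3) e'] T w(1,2) by (auto simp: instance_fm(2))
    qed (use w in \<open>auto simp: w_def\<close>)
    then show "\<exists>y d q. is_numeralS M y d \<and> is_substS M v d p q \<and> Tc c q" using w(1,2) by (auto simp: ij)
  next
    assume "\<exists>y d q. is_numeralS M y d \<and> is_substS M v d p q \<and> Tc c q"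
    then obtain y d q where q: "is_numeralS M y d" "is_substS M v d p q" "Tc c q" by blast
    obtain l where l: "elt c l = q" using elt_surj by blast
    obtain e' where e': "\<And>A. arithmetical A \<Longrightarrow> fv A \<subseteq> {..i + j + k + l} \<Longrightarrow> sata M (elt c) A \<longleftrightarrow> sata Ns e' A"
      "\<And>l'. l' \<le> i + j + k + l \<Longrightarrow> TT (e' l') = Tc c (elt c l')" by (rule transfer[of "i + j + k + l" c]) blast
    have "sata M (elt c) (instance_fm (Var i) (Var j) (Var l))" using q by (auto simp: ij l)
    then have "sata Ns e' (instance_fm (Var i) (Var j) (Var l))"
      using e'(1)[of "instance_fm (Var i) (Var j) (Var l)"] by simp
    moreover have "TT (e' l)" using e'(2)[of l] q(3) l by simp
    ultimately show "Tc c (tagS M 8 (prS M v p))" using *[OF le_add1 e'] by auto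
  }
qed

lemma CTS_M: "CTS M (Tc c)"
  unfolding CTS_def using Tc_sentence Tc_eq Tc_neg Tc_or Tc_ex by blast

lemma leS_equ: assumes "congS I" "leS I x y" "equ I y z" shows "leS I x z"
  using assms(2,3) equ_trans[OF assms(1)] unfolding leS_def by blast

lemma DCS_M: assumes "leS M m c" shows "DCS M (Tc c) m"
  unfolding DCS_def
proof (intro allI impI)
  fix a b d
  assume pre: "(\<forall>i. ltS M i m \<longrightarrow> (\<exists>p. betaS M a b i p \<and> is_sentenceS M p)) \<and> is_sentenceS M d \<and> is_disjunctionS M a b m d"
  obtain i j k l where ij: "elt c i = a" "elt c j = b" "elt c k = d" "elt c l = m" using elt_surj by metis
  have *: "Tc c d \<longleftrightarrow> (\<exists>p. sata Ns (e'(w := p)) (entry_fm (Var i) (Var j) (Var l) (Var w)) \<and> TT p)"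
    if n: "i + j + k + l \<le> n" and e': "\<And>A. arithmetical A \<Longrightarrow> fv A \<subseteq> {..n} \<Longrightarrow> sata M (elt c) A \<longleftrightarrow> sata Ns e' A"
        "equ Ns (e' 0) (kap (den c))" "\<And>l. l \<le> n \<Longrightarrow> TT (e' l) = Tc c (elt c l)" and w: "w \<notin> {i, j, l}" for n e' w
  proof -
    \<comment> \<open>The bound \<open>c\<close> is listed first and its counterpart equals
      \<open>kap (den c)\<close>. So the length \<open>m\<close> has a counterpart below this image,
      where \<open>DCS_Ns\<close> holds.\<close>
    have "leS Ns (e' l) (e' 0)"
      using assms e'(1)[of "Var l \<preceq> Var 0"] n by (simp add: ij arith elt_0)
    then have "DCS Ns TT (e' l)" using DCS_Ns leS_equ[OF congS_Ns _ e'(2)] by blast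
    moreover have "\<forall>u. ltS Ns u (e' l) \<longrightarrow> (\<exists>p. betaS Ns (e' i) (e' j) u p \<and> is_sentenceS Ns p)"
      using pre e'(1)[of "sentences_fm (Var i) (Var j) (Var l)"] n by (simp add: ij)
    moreover have "is_sentenceS Ns (e' k)" using pre e'(1)[of "is_sentence (Var k)"] n by (simp add: ij arith)
    moreover have "is_disjunctionS Ns (e' i) (e' j) (e' l) (e' k)"
      using pre e'(1)[of "is_disjunction (Var i) (Var j) (Var l) (Var k)"] n by (simp add: ij arith is_disjunction_eq disj_zero)
    ultimately have "TT (e' k) \<longleftrightarrow> (\<exists>u p. ltS Ns u (e' l) \<and> betaS Ns (e' i) (e' j) u p \<and> TT p)"
      unfolding DCS_def by blast
    then show ?thesis using e'(3)[of k] n w ij by auto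
  qed
  show "Tc c d \<longleftrightarrow> (\<exists>u p. ltS M u m \<and> betaS M a b u p \<and> Tc c p)"
  proof
    assume T: "Tc c d"
    define w where "w = Suc (i + j + k + l)"
    have w: "w \<notin> {i, j, l}" "i + j + k + l \<le> w" unfolding w_def by simp_all
    have "\<exists>q. sata M ((elt c)(w := q)) (entry_fm (Var i) (Var j) (Var l) (Var w)) \<and> Tc c q"
      by (rule witness[of _ w]) (use w *[OF w(2) _ _ _ w(1)] T in \<open>auto simp: w_def\<close>)
    then show "\<exists>u p. ltS M u m \<and> betaS M a b u p \<and> Tc c p" using w(1) by (auto simp: ij)
  next
    assume "\<exists>u p. ltS M u m \<and> betaS M a b u p \<and> Tc c p"
    then obtain u p where p: "ltS M u m" "betaS M a b u p" "Tc c p" by blast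
    obtain h where h: "elt c h = p" using elt_surj by blast
    define w where "w = Suc (i + j + k + l + h)"
    have w: "w \<notin> {i, j, l}" "i + j + k + l \<le> w" "h \<le> w" unfolding w_def by simp_all
    obtain e' where e': "\<And>A. arithmetical A \<Longrightarrow> fv A \<subseteq> {..w} \<Longrightarrow> sata M (elt c) A \<longleftrightarrow> sata Ns e' A"
      "equ Ns (e' 0) (kap (den c))" "\<And>l. l \<le> w \<Longrightarrow> TT (e' l) = Tc c (elt c l)" by (rule transfer[of w c]) blast
    have "sata M (elt c) (entry_fm (Var i) (Var j) (Var l) (Var h))" using p by (auto simp: ij h)
    then have "sata Ns e' (entry_fm (Var i) (Var j) (Var l) (Var h))"
      using e'(1)[of "entry_fm (Var i) (Var j) (Var l) (Var h)"] w by simp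
    then have "sata Ns (e'(w := e' h)) (entry_fm (Var i) (Var j) (Var l) (Var w))" using w(1) by simp
    moreover have "TT (e' h)" using e'(3)[of h] w(3) p(3) h by simp
    ultimately show "Tc c d" using *[OF w(2) e' w(1)] by blast
  qed
qed

subsection \<open>Conservativity\<close>

text \<open>The enumeration behind \<open>Tc c\<close> depends on the name \<open>c\<close>, not
  only on its denotation. Passing to a chosen representative makes the family of truth predicates
  respect equality in the index.\<close>

definition repr :: "nm \<Rightarrow> nm" where "repr x = (SOME y. equ M y x)"

lemma equ_repr: "equ M (repr x) x"
  unfolding repr_def by (rule someI[of "\<lambda>y. equ M y x"]) (rule equ_refl[OF congS_M])

lemma repr_cong: assumes "equ M x y" shows "repr x = repr y"
proof -
  have "(\<lambda>z. equ M z x) = (\<lambda>z. equ M z y)"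
    using assms equ_sym[OF congS_M] equ_trans[OF congS_M] by blast
  then show ?thesis by (simp add: repr_def)
qed

lemma not_bad: "\<not> bad A"
proof
  assume "bad A"
  note b = bad_K[OF this]
  define T where "T x = Tc (repr x)" for x
  have "congT M T" unfolding congT_def T_def using repr_cong Tc_cong by metis
  moreover have "sat M T e C" if "C \<in> PA \<union> {CT_star, DC_star}" for C e
    using that
  proof (elim UnE insertE emptyE)
    assume C: "C \<in> PA"
    have "sata M e C" unfolding sat_M[OF PA_arith[OF C]] Ks_def los_arith using PA_K[OF C] by simp
    then show ?thesis using sat_arith[OF PA_arith[OF C]] by blast
  next
    assume "C = CT_star"
    then show ?thesis unfolding T_def using CTS_M by (simp add: sat_CT_star)
  next
    have "DCS M (Tc (repr x)) m" if "leS M m x" for x m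
      using DCS_M leS_equ[OF congS_M that equ_sym[OF congS_M equ_repr]] by blast
    moreover assume "C = DC_star"
    ultimately show ?thesis unfolding T_def by (simp add: sat_DC_star)
  qed
  moreover have "provable L_PAT (PA \<union> {CT_star, DC_star}) bad_fm" "arithmetical bad_fm"
    using b(1) by (simp_all add: bad_def L_PA_iff)
  ultimately have "sat M T e bad_fm" for e using soundness[OF _ congS_M] by blast
  then have "sata M (\<lambda>_. zer M) bad_fm" using sat_arith[OF \<open>arithmetical bad_fm\<close>] by blast
  then have "eventually (\<lambda>i. False) uf"
    unfolding sat_M[OF \<open>arithmetical bad_fm\<close>] Ks_def los_arith using b(2) by simp
  then show False using uf(2) unfolding trivial_limit_def by blast
qed

theorem mainTheorem4:
  fixes A :: fm
  assumes "A \<in> L_PA" and "fv A = {}"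
    and "provable L_PAT (PA \<union> {CT_star, DC_star}) A"
  shows "provable L_PA PA A"
  using not_bad[of A] assms unfolding bad_def by blast

end
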